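(* Consider the system $$\frac{dx}{dt}=xy,\qquad \frac{dy}{dt}=-\frac{y^2}{2}+4x+2 .$$ After a series of blowing-ups in $\mathbb{P}^2$ one obtains a rational surface of type $E_7^{(1)}$. The phase space $\mathcal{X}$ of the system can be obtained by gluing three copies $U_j\times\mathbb{C}=\mathbb{C}^2\times\mathbb{C}\ni(x_j,y_j,t)$, $j=0,1,2$, via the birational and symplectic transformations $$\begin{aligned} 0)\;& x_0=x,\quad y_0=y,\\ 1)\;& x_1=-\Bigl(x-\frac{y^2}{4}+1\Bigr)y^2,\quad y_1=\frac1y,\\ 2)\;& x_2=-xy^2,\quad y_2=\frac1y . \end{aligned}$$
   Context: Symplectic means $dx_j\wedge dy_j=dx\wedge dy$ for fixed $t$. Gluing: points of different charts with the same $t$ are identified through the given birational relations wherever these are biregular. Phase space: the resulting complex manifold $\mathcal{X}$, fibred over the $t$-line $B$ (here $B=\mathbb{C}$), is the phase space (space of initial conditions) of the system if (i) rewritten in the coordinates $(x_j,y_j)$ of every chart, the system has right-hand sides that are polynomials in $(x_j,y_j)$ with coefficients holomorphic in $t$; and (ii) every solution $(x(t),y(t))$ that is meromorphic near a point $t_0\in B$ extends holomorphically across $t_0$ as a map into $\mathcal{X}$. Type: a rational surface of type $R$ (an affine Dynkin diagram) here means a smooth projective rational surface $S$ (obtained by successively blowing up $\mathbb{P}^2\supset\mathbb{C}^2\ni(x,y)$) containing the fibre $\mathcal{X}_t$ as an open subset such that $S\setminus\mathcal{X}_t$ is a union of smooth rational curves of self-intersection $-2$ whose dual intersection graph is the diagram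 $R$. *)

theory Defs
  imports "HOL-Complex_Analysis.Complex_Analysis"
begin

section \<open>Holomorphic maps between finite-dimensional complex spaces\<close>

class complex_space = euclidean_space +
  fixes cscale :: "complex \<Rightarrow> 'a \<Rightarrow> 'a"
  assumes cscale_add_right: "cscale c (u + v) = cscale c u + cscale c v"
    and cscale_add_left: "cscale (c + d) u = cscale c u + cscale d u"
    and cscale_cscale: "cscale c (cscale d u) = cscale (c * d) u"
    and cscale_of_real: "cscale (complex_of_real r) u = r *\<^sub>R u"

instantiation complex :: complex_space
begin
definition cscale_complex :: "complex \<Rightarrow> complex \<Rightarrow> complex" where
  "cscale_complex c z = c * z"
instance
  by standard (simp_all add: cscale_complex_def algebra_simps scaleR_conv_of_real)
end

instantiation prod :: (complex_space, complex_space) complex_space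
begin
definition cscale_prod :: "complex \<Rightarrow> 'a \<times> 'b \<Rightarrow> 'a \<times> 'b" where
  "cscale_prod c p = (cscale c (fst p), cscale c (snd p))"
instance
  by standard (simp_all add: cscale_prod_def prod_eq_iff cscale_add_right cscale_add_left
      cscale_cscale cscale_of_real)
end

definition has_complex_derivative ::
  "('a::complex_space \<Rightarrow> 'b::complex_space) \<Rightarrow> ('a \<Rightarrow> 'b) \<Rightarrow> 'a \<Rightarrow> bool" where
  "has_complex_derivative f L p \<longleftrightarrow>
     (f has_derivative L) (at p) \<and> (\<forall>c v. L (cscale c v) = cscale c (L v))"

definition holo_on :: "('a::complex_space \<Rightarrow> 'b::complex_space) \<Rightarrow> 'a set \<Rightarrow> bool" where
  "holo_on f U \<longleftrightarrow> open U \<and> (\<forall>p\<in>U. \<exists>L. has_complex_derivative f L p)"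

section \<open>Complex manifolds\<close>

text \<open>The points are the elements of \<open>pts\<close>; an atlas is a set of pairs (domain, coordinate map).\<close>

record ('a, 'm) cmfd =
  pts :: "'a set"
  atlas :: "('a set \<times> ('a \<Rightarrow> 'm)) set"

definition mtop :: "('a, 'm::complex_space) cmfd \<Rightarrow> 'a topology" where
  "mtop M = topology (\<lambda>W. W \<subseteq> pts M \<and> (\<forall>(U, \<phi>)\<in>atlas M. open (\<phi> ` (W \<inter> U))))"

definition complex_manifold :: "('a, 'm::complex_space) cmfd \<Rightarrow> bool" where
  "complex_manifold M \<longleftrightarrow>
     (\<forall>(U, \<phi>)\<in>atlas M. U \<subseteq> pts M \<and> inj_on \<phi> U \<and> open (\<phi> ` U)) \<and>
     (\<Union>(U, \<phi>)\<in>atlas M. U) = pts M \<and>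
     (\<forall>(U, \<phi>)\<in>atlas M. \<forall>(V, \<psi>)\<in>atlas M. holo_on (\<psi> \<circ> inv_into U \<phi>) (\<phi> ` (U \<inter> V))) \<and>
     Hausdorff_space (mtop M) \<and> second_countable (mtop M)"

definition holomorphic_map ::
  "('a, 'm::complex_space) cmfd \<Rightarrow> ('b, 'n::complex_space) cmfd \<Rightarrow> ('a \<Rightarrow> 'b) \<Rightarrow> bool" where
  "holomorphic_map M N F \<longleftrightarrow>
     F ` pts M \<subseteq> pts N \<and>
     (\<forall>p\<in>pts M. \<exists>(U, \<phi>)\<in>atlas M. \<exists>(V, \<psi>)\<in>atlas N. \<exists>W. W \<subseteq> \<phi> ` U \<and>
        p \<in> U \<and> \<phi> p \<in> W \<and> F ` inv_into U \<phi> ` W \<subseteq> V \<and> holo_on (\<psi> \<circ> F \<circ> inv_into U \<phi>) W)"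

definition biholomorphic ::
  "('a, 'm::complex_space) cmfd \<Rightarrow> ('b, 'n::complex_space) cmfd \<Rightarrow> ('a \<Rightarrow> 'b) \<Rightarrow> bool" where
  "biholomorphic M N F \<longleftrightarrow> bij_betw F (pts M) (pts N) \<and> holomorphic_map M N F \<and>
     holomorphic_map N M (inv_into (pts M) F)"

text \<open>The open submanifold on \<open>pts M \<inter> W\<close>, for \<open>pts M \<inter> W\<close> open.\<close>

definition restrict_mfd ::
  "('a, 'm) cmfd \<Rightarrow> 'a set \<Rightarrow> ('a, 'm) cmfd" where
  "restrict_mfd M W = \<lparr>pts = pts M \<inter> W, atlas = (\<lambda>(U, \<phi>). (U \<inter> W, \<phi>)) ` atlas M\<rparr>"

definition open_mfd :: "'m set \<Rightarrow> ('m, 'm) cmfd" where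
  "open_mfd V = \<lparr>pts = V, atlas = {(V, \<lambda>v. v)}\<rparr>"

text \<open>Membership in the maximal atlas.\<close>

definition coord_chart ::
  "('a, 'm::complex_space) cmfd \<Rightarrow> 'a set \<Rightarrow> ('a \<Rightarrow> 'm) \<Rightarrow> bool" where
  "coord_chart M W \<kappa> \<longleftrightarrow> openin (mtop M) W \<and> open (\<kappa> ` W) \<and>
     biholomorphic (restrict_mfd M W) (open_mfd (\<kappa> ` W)) \<kappa>"

section \<open>Projective spaces and blowing-up\<close>

text \<open>A point of a projective space is a line through the origin, as a set of vectors.\<close>

definition line :: "'m::complex_space \<Rightarrow> 'm set" where
  "line v = range (\<lambda>c. cscale c v)"

definition P1 :: "((complex \<times> complex) set, complex) cmfd" where
  "P1 = \<lparr>pts = {line v |v. v \<noteq> 0},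
         atlas = {({line (1, z) |z. True}, \<lambda>l. THE z. (1, z) \<in> l),
                  ({line (z, 1) |z. True}, \<lambda>l. THE z. (z, 1) \<in> l)}\<rparr>"

definition P2 :: "((complex \<times> complex \<times> complex) set, complex \<times> complex) cmfd" where
  "P2 = \<lparr>pts = {line v |v. v \<noteq> 0},
         atlas = {({line (1, a, b) |a b. True}, \<lambda>l. THE (a, b). (1, a, b) \<in> l),
                  ({line (a, 1, b) |a b. True}, \<lambda>l. THE (a, b). (a, 1, b) \<in> l),
                  ({line (a, b, 1) |a b. True}, \<lambda>l. THE (a, b). (a, b, 1) \<in> l)}\<rparr>"

text \<open>The blow-up of \<open>\<complex>\<^sup>2\<close> at the origin: pairs of a line and a point on it.\<close>

definition Bl0 ::
  "((complex \<times> complex) \<times> (complex \<times> complex) set, complex \<times> complex) cmfd" where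
  "Bl0 = \<lparr>pts = {(v, l). l \<in> pts P1 \<and> v \<in> l},
          atlas = {({(v, l). (\<exists>z. l = line (1, z)) \<and> v \<in> l},
                      \<lambda>(v, l). (fst v, THE z. (1, z) \<in> l)),
                   ({(v, l). (\<exists>z. l = line (z, 1)) \<and> v \<in> l},
                      \<lambda>(v, l). (snd v, THE z. (z, 1) \<in> l))}\<rparr>"

definition is_blowup ::
  "('a, complex \<times> complex) cmfd \<Rightarrow> ('b, complex \<times> complex) cmfd \<Rightarrow> 'b \<Rightarrow> ('a \<Rightarrow> 'b) \<Rightarrow> bool" where
  "is_blowup S' S p \<beta> \<longleftrightarrow>
     complex_manifold S' \<and> complex_manifold S \<and> p \<in> pts S \<and> holomorphic_map S' S \<beta> \<and>
     biholomorphic (restrict_mfd S' {q. \<beta> q \<noteq> p}) (restrict_mfd S (- {p})) \<beta> \<and>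
     (\<exists>W \<kappa> h. coord_chart S W \<kappa> \<and> p \<in> W \<and> \<kappa> p = 0 \<and>
        biholomorphic (restrict_mfd S' {q. \<beta> q \<in> W}) (restrict_mfd Bl0 {(v, l). v \<in> \<kappa> ` W}) h \<and>
        (\<forall>q\<in>pts S'. \<beta> q \<in> W \<longrightarrow> fst (h q) = \<kappa> (\<beta> q)))"

text \<open>\<open>iterated_blowup S \<pi>\<close>: the surface \<open>S\<close> arises from the projective plane by finitely many
  successive point blow-ups, with composite morphism \<open>\<pi>\<close>. In particular \<open>S\<close> is a smooth
  projective rational surface. All stages have points in the same type \<open>'a\<close>; this is no restriction
  as soon as \<open>'a\<close> has at least the cardinality of the continuum.\<close>

inductive iterated_blowup ::
  "('a, complex \<times> complex) cmfd \<Rightarrow> ('a \<Rightarrow> (complex \<times> complex \<times> complex) set) \<Rightarrow> bool" where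
  plane: "complex_manifold S \<Longrightarrow> biholomorphic S P2 \<pi> \<Longrightarrow> iterated_blowup S \<pi>"
| blowup: "iterated_blowup S \<pi> \<Longrightarrow> is_blowup S' S p \<beta> \<Longrightarrow> iterated_blowup S' (\<pi> \<circ> \<beta>)"

section \<open>Curves on surfaces and intersection numbers\<close>

text \<open>Local coordinates \<open>\<kappa> = (z, w)\<close> in which the curve \<open>C\<close> is \<open>w = 0\<close>, so that \<open>z\<close> is a local
  coordinate of \<open>C\<close> and \<open>w\<close> a local equation of \<open>C\<close>.\<close>

definition adapted_chart ::
  "('a, complex \<times> complex) cmfd \<Rightarrow> 'a set \<Rightarrow> 'a set \<Rightarrow> ('a \<Rightarrow> complex \<times> complex) \<Rightarrow> bool" where
  "adapted_chart S C W \<kappa> \<longleftrightarrow> coord_chart S W \<kappa> \<and> \<kappa> ` (C \<inter> W) = {q \<in> \<kappa> ` W. snd q = 0}"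

definition smooth_curve :: "('a, complex \<times> complex) cmfd \<Rightarrow> 'a set \<Rightarrow> bool" where
  "smooth_curve S C \<longleftrightarrow> closedin (mtop S) C \<and> (\<forall>p\<in>C. \<exists>W \<kappa>. p \<in> W \<and> adapted_chart S C W \<kappa>)"

definition curve_mfd :: "('a, complex \<times> complex) cmfd \<Rightarrow> 'a set \<Rightarrow> ('a, complex) cmfd" where
  "curve_mfd S C = \<lparr>pts = C, atlas = {(C \<inter> W, fst \<circ> \<kappa>) |W \<kappa>. adapted_chart S C W \<kappa>}\<rparr>"

definition smooth_rational_curve :: "('a, complex \<times> complex) cmfd \<Rightarrow> 'a set \<Rightarrow> bool" where
  "smooth_rational_curve S C \<longleftrightarrow>
     smooth_curve S C \<and> (\<exists>\<gamma>. biholomorphic P1 (curve_mfd S C) \<gamma>)"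

text \<open>\<open>C \<cdot> C = n\<close>, as the degree of the normal bundle of the compact curve \<open>C\<close>: the number of
  zeros minus poles of a meromorphic section. On an adapted chart \<open>(z, w)\<close> the normal bundle is
  framed by the class of \<open>\<partial>/\<partial>w\<close>; the component \<open>s\<close> of a section in this frame and the component
  \<open>s'\<close> in the frame of \<open>(z', w')\<close> are related by \<open>s = (\<partial>w/\<partial>w') s'\<close> along \<open>C\<close>. The section is
  given by its components on a family \<open>K\<close> of adapted charts covering \<open>C\<close>; as any two nonzero
  meromorphic sections have the same degree, one section determines \<open>n\<close>.\<close>

definition self_intersection ::
  "('a, complex \<times> complex) cmfd \<Rightarrow> 'a set \<Rightarrow> int \<Rightarrow> bool" where
  "self_intersection S C n \<longleftrightarrow>
     (\<exists>K (s :: 'a set \<times> ('a \<Rightarrow> complex \<times> complex) \<Rightarrow> 'a \<Rightarrow> complex) (ord :: 'a \<Rightarrow> int).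
        (\<forall>(W, \<kappa>)\<in>K. adapted_chart S C W \<kappa>) \<and> C \<subseteq> (\<Union>(W, \<kappa>)\<in>K. W) \<and>
        (\<forall>(W, \<kappa>)\<in>K. \<forall>p\<in>C \<inter> W.
           let z0 = fst (\<kappa> p); g = (\<lambda>z. s (W, \<kappa>) (inv_into W \<kappa> (z, 0)))
           in g meromorphic_on {z0} \<and> (\<forall>\<^sub>F z in at z0. g z \<noteq> 0) \<and> ord p = zorder g z0) \<and>
        (\<forall>(W, \<kappa>)\<in>K. \<forall>(W', \<kappa>')\<in>K. \<forall>p\<in>C \<inter> W \<inter> W'.
           s (W, \<kappa>) p =
             deriv (\<lambda>w'. snd (\<kappa> (inv_into W' \<kappa>' (fst (\<kappa>' p), w')))) 0 * s (W', \<kappa>') p) \<and>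
        finite {p \<in> C. ord p \<noteq> 0} \<and>
        n = (\<Sum>p | p \<in> C \<and> ord p \<noteq> 0. ord p))"

text \<open>The local intersection multiplicity of \<open>C\<close> and \<open>D\<close> is the vanishing order along \<open>C\<close> of a
  local equation of \<open>D\<close>.\<close>

definition local_intersection ::
  "('a, complex \<times> complex) cmfd \<Rightarrow> 'a set \<Rightarrow> 'a set \<Rightarrow> 'a \<Rightarrow> int \<Rightarrow> bool" where
  "local_intersection S C D p m \<longleftrightarrow>
     (\<exists>W \<kappa> W' \<kappa>'. adapted_chart S C W \<kappa> \<and> adapted_chart S D W' \<kappa>' \<and> p \<in> W \<and> p \<in> W' \<and>
        m = zorder (\<lambda>z. snd (\<kappa>' (inv_into W \<kappa> (z, 0)))) (fst (\<kappa> p)))"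

text \<open>\<open>C \<cdot> D = n\<close> for smooth curves without common component.\<close>

definition intersection_number ::
  "('a, complex \<times> complex) cmfd \<Rightarrow> 'a set \<Rightarrow> 'a set \<Rightarrow> int \<Rightarrow> bool" where
  "intersection_number S C D n \<longleftrightarrow> finite (C \<inter> D) \<and>
     (\<exists>m. (\<forall>p\<in>C \<inter> D. local_intersection S C D p (m p)) \<and> n = (\<Sum>p\<in>C \<inter> D. m p))"

section \<open>Birational and symplectic transformations of the plane\<close>

definition eval2 :: "complex poly poly \<Rightarrow> complex \<times> complex \<Rightarrow> complex" where
  "eval2 P = (\<lambda>(x, y). poly (poly P [:y:]) x)"

text \<open>A rational map from \<open>\<complex>\<^sup>2\<close> to \<open>\<complex>\<^sup>2\<close>, as a pair of fractions (numerator, denominator).\<close>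

type_synonym ratmap =
  "(complex poly poly \<times> complex poly poly) \<times> (complex poly poly \<times> complex poly poly)"

definition rat_dom :: "ratmap \<Rightarrow> (complex \<times> complex) set" where
  "rat_dom F = {p. eval2 (snd (fst F)) p \<noteq> 0 \<and> eval2 (snd (snd F)) p \<noteq> 0}"

definition rat_eval :: "ratmap \<Rightarrow> complex \<times> complex \<Rightarrow> complex \<times> complex" where
  "rat_eval F p = (eval2 (fst (fst F)) p / eval2 (snd (fst F)) p,
                   eval2 (fst (snd F)) p / eval2 (snd (snd F)) p)"

text \<open>\<open>f\<close>, defined on the principal Zariski-open set \<open>D\<close>, is a birational map.\<close>

definition birational_on ::
  "(complex \<times> complex) set \<Rightarrow> (complex \<times> complex \<Rightarrow> complex \<times> complex) \<Rightarrow> bool" where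
  "birational_on D f \<longleftrightarrow>
     (\<exists>h. h \<noteq> 0 \<and> D = {p. eval2 h p \<noteq> 0}) \<and>
     (\<exists>F. D \<subseteq> rat_dom F \<and> (\<forall>p\<in>D. f p = rat_eval F p)) \<and>
     (\<exists>G h k. h \<noteq> 0 \<and> k \<noteq> 0 \<and>
        (\<forall>p\<in>D. eval2 h p \<noteq> 0 \<longrightarrow> f p \<in> rat_dom G \<and> rat_eval G (f p) = p) \<and>
        (\<forall>q. eval2 k q \<noteq> 0 \<longrightarrow> q \<in> rat_dom G \<and> rat_eval G q \<in> D \<and> f (rat_eval G q) = q))"

text \<open>\<open>f\<close> pulls back the 2-form \<open>dx \<and> dy\<close> to itself.\<close>

definition symplectic_on ::
  "(complex \<times> complex) set \<Rightarrow> (complex \<times> complex \<Rightarrow> complex \<times> complex) \<Rightarrow> bool" where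
  "symplectic_on D f \<longleftrightarrow>
     (let \<omega> = (\<lambda>u v. fst u * snd v - snd u * fst v) in
      \<forall>p\<in>D. \<exists>L. has_complex_derivative f L p \<and> (\<forall>u v. \<omega> (L u) (L v) = \<omega> u v))"

text \<open>For birational \<open>f\<close> on \<open>D\<close> and \<open>f'\<close> on \<open>D'\<close>: the birational map \<open>f' \<circ> f\<^sup>-\<^sup>1\<close> is biregular at
  \<open>q\<close> and maps \<open>q\<close> to \<open>q'\<close>. The rational maps \<open>F\<close> and \<open>G\<close> represent \<open>f' \<circ> f\<^sup>-\<^sup>1\<close> and its inverse.\<close>

definition biregular_at ::
  "(complex \<times> complex) set \<Rightarrow> (complex \<times> complex \<Rightarrow> complex \<times> complex) \<Rightarrow>
   (complex \<times> complex) set \<Rightarrow> (complex \<times> complex \<Rightarrow> complex \<times> complex) \<Rightarrow>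
   complex \<times> complex \<Rightarrow> complex \<times> complex \<Rightarrow> bool" where
  "biregular_at D f D' f' q q' \<longleftrightarrow>
     (\<exists>F G. (\<forall>p\<in>D \<inter> D'. f p \<in> rat_dom F \<longrightarrow> rat_eval F (f p) = f' p) \<and>
            (\<forall>p\<in>D \<inter> D'. f' p \<in> rat_dom G \<longrightarrow> rat_eval G (f' p) = f p) \<and>
            q \<in> rat_dom F \<and> rat_eval F q = q' \<and> q' \<in> rat_dom G \<and> rat_eval G q' = q)"

section \<open>Gluing and phase spaces\<close>

text \<open>Copies \<open>U\<^sub>j \<times> \<complex>\<close>, \<open>j \<in> I\<close>, of \<open>\<complex>\<^sup>2 \<times> \<complex>\<close>; \<open>(j, x, y, t)\<close> is the point of the \<open>j\<close>-th copy with
  coordinates \<open>x\<^sub>j = x\<close>, \<open>y\<^sub>j = y\<close> at time \<open>t\<close>. The coordinates of the \<open>j\<close>-th copy are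
  \<open>T j t (x, y)\<close> for \<open>(x, y) \<in> D j t\<close>, where \<open>(x, y)\<close> are the coordinates of the copy \<open>0\<close>.\<close>

type_synonym plane_dom = "nat \<Rightarrow> complex \<Rightarrow> (complex \<times> complex) set"
type_synonym plane_trafo = "nat \<Rightarrow> complex \<Rightarrow> complex \<times> complex \<Rightarrow> complex \<times> complex"
type_synonym copy_point = "nat \<times> complex \<times> complex \<times> complex"

definition glue_rel :: "nat set \<Rightarrow> plane_dom \<Rightarrow> plane_trafo \<Rightarrow> (copy_point \<times> copy_point) set" where
  "glue_rel I D T =
     {((j, x, y, t), (k, x', y', t)) |j x y k x' y' t. j \<in> I \<and> k \<in> I \<and>
        biregular_at (D j t) (T j t) (D k t) (T k t) (x, y) (x', y')}"

definition glued ::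
  "nat set \<Rightarrow> plane_dom \<Rightarrow> plane_trafo \<Rightarrow>
   (copy_point set, complex \<times> complex \<times> complex) cmfd" where
  "glued I D T =
     \<lparr>pts = (I \<times> UNIV) // glue_rel I D T,
      atlas = {({glue_rel I D T `` {(j, p)} |p. True}, \<lambda>c. THE p. (j, p) \<in> c) |j. j \<in> I}\<rparr>"

definition time_of :: "copy_point set \<Rightarrow> complex" where
  "time_of c = (THE t. \<exists>j x y. (j, x, y, t) \<in> c)"

definition fibre ::
  "(copy_point set, complex \<times> complex \<times> complex) cmfd \<Rightarrow> complex \<Rightarrow>
   (copy_point set, complex \<times> complex) cmfd" where
  "fibre X t =
     \<lparr>pts = {c \<in> pts X. time_of c = t},
      atlas = (\<lambda>(U, \<phi>). ({c \<in> U. time_of c = t}, \<lambda>c. case \<phi> c of (x, y, _) \<Rightarrow> (x, y))) ` atlas X\<rparr>"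

text \<open>Polynomial in \<open>(x, y)\<close> with coefficients holomorphic in \<open>t\<close>.\<close>

definition poly_holo_coeffs :: "(complex \<Rightarrow> complex \<times> complex \<Rightarrow> complex) \<Rightarrow> bool" where
  "poly_holo_coeffs g \<longleftrightarrow>
     (\<exists>n c. (\<forall>i k. c i k holomorphic_on UNIV) \<and>
        (\<forall>t x y. g t (x, y) = (\<Sum>i\<le>n. \<Sum>k\<le>n. c i k t * x ^ i * y ^ k)))"

text \<open>\<open>g\<close> is the right-hand side of the system \<open>(x, y)' = f t (x, y)\<close> rewritten in the coordinates
  \<open>\<tau> t (x, y)\<close>, by the chain rule.\<close>

definition rewritten_system ::
  "(complex \<Rightarrow> complex \<times> complex \<Rightarrow> complex \<times> complex) \<Rightarrow>
   (complex \<Rightarrow> (complex \<times> complex) set) \<Rightarrow>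
   (complex \<Rightarrow> complex \<times> complex \<Rightarrow> complex \<times> complex) \<Rightarrow>
   (complex \<Rightarrow> complex \<times> complex \<Rightarrow> complex \<times> complex) \<Rightarrow> bool" where
  "rewritten_system f D \<tau> g \<longleftrightarrow>
     (\<forall>t. \<forall>p\<in>D t. \<exists>L. has_complex_derivative (\<lambda>(s, q). \<tau> s q) L (t, p) \<and>
        L (1, f t p) = g t (\<tau> t p))"

definition meromorphic_solution_near ::
  "(complex \<Rightarrow> complex \<times> complex \<Rightarrow> complex \<times> complex) \<Rightarrow>
   complex \<Rightarrow> (complex \<Rightarrow> complex) \<Rightarrow> (complex \<Rightarrow> complex) \<Rightarrow> bool" where
  "meromorphic_solution_near f t0 x y \<longleftrightarrow>
     x meromorphic_on {t0} \<and> y meromorphic_on {t0} \<and>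
     (\<forall>\<^sub>F t in at t0. (x has_field_derivative fst (f t (x t, y t))) (at t) \<and>
                     (y has_field_derivative snd (f t (x t, y t))) (at t))"

text \<open>The result of the gluing is the phase space, over the \<open>t\<close>-line \<open>\<complex>\<close>, of the system
  \<open>(x, y)' = f t (x, y)\<close>. That the identifications form an equivalence relation and that the
  result is a (Hausdorff) complex manifold fibred over the \<open>t\<close>-line is part of the claim.\<close>

definition phase_space_by_gluing ::
  "(complex \<Rightarrow> complex \<times> complex \<Rightarrow> complex \<times> complex) \<Rightarrow>
   nat set \<Rightarrow> plane_dom \<Rightarrow> plane_trafo \<Rightarrow> bool" where
  "phase_space_by_gluing f I D T \<longleftrightarrow>
     0 \<in> I \<and> (\<forall>t. D 0 t = UNIV \<and> (\<forall>p. T 0 t p = p)) \<and>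
     equiv (I \<times> UNIV) (glue_rel I D T) \<and>
     complex_manifold (glued I D T) \<and>
     holomorphic_map (glued I D T) (open_mfd UNIV) time_of \<and>
     (\<forall>j\<in>I. \<exists>g. poly_holo_coeffs (\<lambda>t p. fst (g t p)) \<and> poly_holo_coeffs (\<lambda>t p. snd (g t p)) \<and>
        rewritten_system f (D j) (T j) g) \<and>
     (\<forall>t0 x y. meromorphic_solution_near f t0 x y \<longrightarrow>
        (\<exists>r>0. \<exists>\<Phi>. holomorphic_map (open_mfd (ball t0 r)) (glued I D T) \<Phi> \<and>
           (\<forall>t\<in>ball t0 r - {t0}. (0, x t, y t, t) \<in> \<Phi> t)))"

section \<open>Surfaces of a given type\<close>

text \<open>A diagram is given by its set of vertices and the number of edges between any two vertices.\<close>

type_synonym diagram = "nat set \<times> (nat \<Rightarrow> nat \<Rightarrow> nat)"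

text \<open>\<open>E\<^sub>7\<^sup>(\<^sup>1\<^sup>)\<close>: the chain of the vertices 0, ..., 6, with 7 attached to the middle vertex 3.\<close>

definition E7_affine :: diagram where
  "E7_affine =
     ({0..7}, \<lambda>i j. if {i, j} \<in> {{0,1}, {1,2}, {2,3}, {3,4}, {4,5}, {5,6}, {3,7}} then 1 else 0)"

text \<open>\<open>S\<close> is a rational surface of type \<open>R\<close> containing the fibre of \<open>X\<close> over \<open>t\<close> as the open subset
  \<open>\<iota> (fibre X t)\<close>. The last condition on \<open>\<iota>\<close> says that \<open>S\<close> is obtained from the compactification
  \<open>(x, y) \<mapsto> [1 : x : y]\<close> of the \<open>(x, y)\<close>-plane, that is, of the copy \<open>0\<close>.\<close>

definition rational_surface_of_type ::
  "diagram \<Rightarrow> (copy_point set, complex \<times> complex \<times> complex) cmfd \<Rightarrow> complex \<Rightarrow>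
   ('a, complex \<times> complex) cmfd \<Rightarrow> bool" where
  "rational_surface_of_type R X t S \<longleftrightarrow>
     (\<exists>\<pi> \<iota> C. iterated_blowup S \<pi> \<and>
        biholomorphic (fibre X t) (restrict_mfd S (- (\<Union>i\<in>fst R. C i))) \<iota> \<and>
        (\<forall>c\<in>pts (fibre X t). \<forall>x y. (0, x, y, t) \<in> c \<longrightarrow> \<pi> (\<iota> c) = line (1, x, y)) \<and>
        inj_on C (fst R) \<and>
        (\<forall>i\<in>fst R. smooth_rational_curve S (C i) \<and> self_intersection S (C i) (-2)) \<and>
        (\<forall>i\<in>fst R. \<forall>j\<in>fst R. i \<noteq> j \<longrightarrow>
           intersection_number S (C i) (C j) (int (snd R i j))))"

section \<open>The system and the coordinate transformations\<close>

definition rhs :: "complex \<Rightarrow> complex \<times> complex \<Rightarrow> complex \<times> complex" where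
  "rhs = (\<lambda>t (x, y). (x * y, - (y\<^sup>2 / 2) + 4 * x + 2))"

definition trafo_dom :: plane_dom where
  "trafo_dom = (\<lambda>j t. if j = 0 then UNIV else {(x, y). y \<noteq> 0})"

definition trafo :: plane_trafo where
  "trafo = (\<lambda>j t (x, y).
     if j = 0 then (x, y)
     else if j = 1 then (- (x - y\<^sup>2 / 4 + 1) * y\<^sup>2, 1 / y)
     else (- x * y\<^sup>2, 1 / y))"

end

(*
  The boundary curves arise as follows. In the affine charts (1/y, x/y) and (1/x, y/x) of the
  projective plane, the curves x2 = const and x1 = const pass through the points [0:0:1] and
  [0:1:0] at infinity. Blowing up three times over the first point (v = 1/y: x/v, x/v^2 = -x2
  become coordinates) and six times over the second (xi = x/y^2, then r/v with r = 1/4 - xi, then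
  r/v^2, then m/v with m = r/v^2 - 1, and finally m/v^2 = x1) separates them. The last exceptional
  curves, without the point on the preceding one, are the lines y2 = 0 and y1 = 0 of the phase
  space; the seven other exceptional curves and the line at infinity form the diagram. Each of
  these eight curves has two charts related by (z, w) -> (1/z, z^2 w), hence self-intersection -2.

  Two points of the copies of C^2 are glued iff they have the same image in the surface, so the
  Hausdorff property of the phase space is inherited from the surface; that the transformations are
  not biregular elsewhere follows by comparing limits. Meromorphic solutions extend because
  x (x - y^2/4 + 1) is a first integral: at a pole of y exactly one of the factors tends to zero,
  and it does so like a multiple of 1/y^2.
*)
theory Submission
  imports Defs
begin

section \<open>Complex differentiability\<close>

text \<open>Write u = x - y^2/4 + 1. Since x' = x y and u' = - y u, the line x = 0 and the conic u =
  0 are invariant, and the curves x u = c form a pencil of plane cubics whose member c = infinity is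
  the line at infinity counted three times. The nine centres are the base points of this pencil: x =
  0 meets the line at infinity once and u = 0 is tangent to it, which gives three points over
  [0:0:1] and six over [0:1:0]. The constants come from u as well: on the conic xi = 1/4 - v^2,
  hence the centres xi = 1/4 and r/v^2 = 1, and m = -u. The eight boundary curves make up the member
  c = infinity of the resulting fibration. The number -2 can be predicted by counting: the line at
  infinity contains three centres (1 - 3), every other boundary curve one (-1 - 1). All surfaces
  share one type of points, and a blow-up only renames the centre. Each chart of the tower is
  therefore an explicit function into singletons, and questions about curves and gluing become
  equations between such singletons.\<close>

definition cdiff :: "('a::complex_space \<Rightarrow> 'b::complex_space) \<Rightarrow> 'a \<Rightarrow> bool" where
  "cdiff f p \<longleftrightarrow> (\<exists>L. has_complex_derivative f L p)"

lemma holo_on_iff_cdiff: "holo_on f U \<longleftrightarrow> open U \<and> (\<forall>p\<in>U. cdiff f p)"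
  by (simp add: holo_on_def cdiff_def)

lemma cscale_fst: "fst (cscale c p) = cscale c (fst p)"
  and cscale_snd: "snd (cscale c p) = cscale c (snd p)"
  by (simp_all add: cscale_prod_def)

lemma cscale_zero [simp]: "cscale c 0 = 0"
  using cscale_add_right[of c 0 0] by simp

lemma cscale_Pair: "cscale c (u, v) = (cscale c u, cscale c v)"
  by (simp add: cscale_prod_def)

lemma has_complex_derivative_const: "has_complex_derivative (\<lambda>x. c) (\<lambda>_. 0) p"
  by (simp add: has_complex_derivative_def)

lemma has_complex_derivative_ident: "has_complex_derivative (\<lambda>x. x) (\<lambda>v. v) p"
  by (simp add: has_complex_derivative_def)

lemma has_complex_derivative_fst:
  "has_complex_derivative f L p \<Longrightarrow> has_complex_derivative (\<lambda>x. fst (f x)) (\<lambda>v. fst (L v)) p"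
  by (auto simp: has_complex_derivative_def cscale_fst intro!: derivative_intros)

lemma has_complex_derivative_snd:
  "has_complex_derivative f L p \<Longrightarrow> has_complex_derivative (\<lambda>x. snd (f x)) (\<lambda>v. snd (L v)) p"
  by (auto simp: has_complex_derivative_def cscale_snd intro!: derivative_intros)

lemma has_complex_derivative_Pair:
  "has_complex_derivative f L p \<Longrightarrow> has_complex_derivative g M p \<Longrightarrow>
   has_complex_derivative (\<lambda>x. (f x, g x)) (\<lambda>v. (L v, M v)) p"
  by (auto simp: has_complex_derivative_def cscale_Pair intro!: derivative_intros)

lemma has_complex_derivative_add:
  fixes f g :: "'a::complex_space \<Rightarrow> complex"
  shows "has_complex_derivative f L p \<Longrightarrow> has_complex_derivative g M p \<Longrightarrow>
   has_complex_derivative (\<lambda>x. f x + g x) (\<lambda>v. L v + M v) p"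
  by (auto simp: has_complex_derivative_def cscale_add_right intro!: derivative_intros)

lemma has_complex_derivative_minus:
  fixes f :: "'a::complex_space \<Rightarrow> complex"
  shows "has_complex_derivative f L p \<Longrightarrow>
   has_complex_derivative (\<lambda>x. - f x) (\<lambda>v. - L v) p"
  by (auto simp: has_complex_derivative_def cscale_complex_def intro!: derivative_intros)

lemma has_complex_derivative_diff:
  fixes f g :: "'a::complex_space \<Rightarrow> complex"
  shows "has_complex_derivative f L p \<Longrightarrow> has_complex_derivative g M p \<Longrightarrow>
   has_complex_derivative (\<lambda>x. f x - g x) (\<lambda>v. L v - M v) p"
  by (auto simp: has_complex_derivative_def cscale_complex_def algebra_simps intro!: derivative_intros)

lemma has_complex_derivative_mult:
  fixes f g :: "'a::complex_space \<Rightarrow> complex"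
  shows "has_complex_derivative f L p \<Longrightarrow> has_complex_derivative g M p \<Longrightarrow>
   has_complex_derivative (\<lambda>x. f x * g x) (\<lambda>v. f p * M v + L v * g p) p"
  unfolding has_complex_derivative_def
  by (intro conjI allI has_derivative_mult) (auto simp: cscale_complex_def algebra_simps)

lemma has_complex_derivative_inverse:
  fixes g :: "'a::complex_space \<Rightarrow> complex"
  shows "has_complex_derivative g M p \<Longrightarrow> g p \<noteq> 0 \<Longrightarrow>
   has_complex_derivative (\<lambda>x. inverse (g x)) (\<lambda>v. - (inverse (g p) * M v * inverse (g p))) p"
  unfolding has_complex_derivative_def
  by (intro conjI allI Deriv.has_derivative_inverse) (auto simp: cscale_complex_def)

lemma has_complex_derivative_compose:
  assumes "has_complex_derivative f L p" "has_complex_derivative g M (f p)"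
  shows "has_complex_derivative (\<lambda>x. g (f x)) (\<lambda>v. M (L v)) p"
  using assms has_derivative_compose[of f L p UNIV g M]
  by (simp add: has_complex_derivative_def)

lemma has_complex_derivative_transform:
  assumes "has_complex_derivative f L p" "open N" "p \<in> N" "\<And>x. x \<in> N \<Longrightarrow> g x = f x"
  shows "has_complex_derivative g L p"
proof -
  have "(g has_derivative L) (at p)"
    using assms by (intro has_derivative_transform_within_open[of f L p UNIV N g])
      (auto simp: has_complex_derivative_def)
  then show ?thesis using assms(1) by (simp add: has_complex_derivative_def)
qed

lemma cdiff_transform:
  "cdiff f p \<Longrightarrow> open N \<Longrightarrow> p \<in> N \<Longrightarrow> (\<And>x. x \<in> N \<Longrightarrow> g x = f x) \<Longrightarrow> cdiff g p"
  unfolding cdiff_def by (meson has_complex_derivative_transform)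

named_theorems cdiff_intros

lemma cdiff_const [cdiff_intros]: "cdiff (\<lambda>x. c) p"
  using has_complex_derivative_const by (auto simp: cdiff_def)

lemma cdiff_ident [cdiff_intros]: "cdiff (\<lambda>x. x) p"
  using has_complex_derivative_ident by (auto simp: cdiff_def)

lemma cdiff_fst [cdiff_intros]: "cdiff f p \<Longrightarrow> cdiff (\<lambda>x. fst (f x)) p"
  using has_complex_derivative_fst by (fastforce simp: cdiff_def)

lemma cdiff_snd [cdiff_intros]: "cdiff f p \<Longrightarrow> cdiff (\<lambda>x. snd (f x)) p"
  using has_complex_derivative_snd by (fastforce simp: cdiff_def)

lemma cdiff_Pair [cdiff_intros]: "cdiff f p \<Longrightarrow> cdiff g p \<Longrightarrow> cdiff (\<lambda>x. (f x, g x)) p"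
  using has_complex_derivative_Pair by (fastforce simp: cdiff_def)

lemma cdiff_add [cdiff_intros]:
  fixes f g :: "'a::complex_space \<Rightarrow> complex"
  shows "cdiff f p \<Longrightarrow> cdiff g p \<Longrightarrow> cdiff (\<lambda>x. f x + g x) p"
  using has_complex_derivative_add by (fastforce simp: cdiff_def)

lemma cdiff_minus [cdiff_intros]:
  fixes f :: "'a::complex_space \<Rightarrow> complex"
  shows "cdiff f p \<Longrightarrow> cdiff (\<lambda>x. - f x) p"
  using has_complex_derivative_minus by (fastforce simp: cdiff_def)

lemma cdiff_diff [cdiff_intros]:
  fixes f g :: "'a::complex_space \<Rightarrow> complex"
  shows "cdiff f p \<Longrightarrow> cdiff g p \<Longrightarrow> cdiff (\<lambda>x. f x - g x) p"
  using has_complex_derivative_diff by (fastforce simp: cdiff_def)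

lemma cdiff_mult [cdiff_intros]:
  fixes f g :: "'a::complex_space \<Rightarrow> complex"
  shows "cdiff f p \<Longrightarrow> cdiff g p \<Longrightarrow> cdiff (\<lambda>x. f x * g x) p"
  using has_complex_derivative_mult by (fastforce simp: cdiff_def)

lemma cdiff_power [cdiff_intros]:
  fixes f :: "'a::complex_space \<Rightarrow> complex"
  shows "cdiff f p \<Longrightarrow> cdiff (\<lambda>x. f x ^ n) p"
  by (induction n) (auto intro: cdiff_intros)

lemma cdiff_divide [cdiff_intros]:
  fixes f g :: "'a::complex_space \<Rightarrow> complex"
  assumes "cdiff f p" "cdiff g p" "g p \<noteq> 0"
  shows "cdiff (\<lambda>x. f x / g x) p"
proof -
  have "cdiff (\<lambda>x. inverse (g x)) p"
    using assms has_complex_derivative_inverse by (fastforce simp: cdiff_def)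
  then show ?thesis
    unfolding divide_inverse by (intro cdiff_mult assms)
qed

lemma cdiff_case_prod [cdiff_intros]:
  "cdiff (\<lambda>x. f (fst (g x)) (snd (g x)) x) p \<Longrightarrow> cdiff (\<lambda>x. case g x of (a, b) \<Rightarrow> f a b x) p"
  by (simp add: case_prod_beta)

lemma cdiff_compose: "cdiff f p \<Longrightarrow> cdiff g (f p) \<Longrightarrow> cdiff (\<lambda>x. g (f x)) p"
  using has_complex_derivative_compose by (fastforce simp: cdiff_def)

lemma cdiff_isCont: "cdiff f p \<Longrightarrow> isCont f p"
  by (auto simp: cdiff_def has_complex_derivative_def intro: has_derivative_continuous)

lemma holo_on_continuous: "holo_on f U \<Longrightarrow> continuous_on U f"
  by (auto simp: holo_on_iff_cdiff intro!: continuous_at_imp_continuous_on cdiff_isCont)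

lemma holo_on_open: "holo_on f U \<Longrightarrow> open U"
  by (simp add: holo_on_def)

lemma holo_on_subset: "holo_on f U \<Longrightarrow> open V \<Longrightarrow> V \<subseteq> U \<Longrightarrow> holo_on f V"
  by (auto simp: holo_on_def)

lemma holo_on_preimage:
  assumes "holo_on f U" "open V"
  shows "open {x\<in>U. f x \<in> V}"
proof -
  have "open (f -` V \<inter> U)"
    using continuous_open_preimage[OF holo_on_continuous[OF assms(1)] holo_on_open[OF assms(1)] assms(2)]
    by (simp add: Int_commute)
  moreover have "f -` V \<inter> U = {x\<in>U. f x \<in> V}" by auto
  ultimately show ?thesis by simp
qed

lemma holo_on_compose:
  assumes "holo_on f U" "holo_on g V"
  shows "holo_on (\<lambda>x. g (f x)) {x\<in>U. f x \<in> V}"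
  using assms holo_on_preimage[OF assms(1) holo_on_open[OF assms(2)]]
  by (auto simp: holo_on_iff_cdiff intro: cdiff_compose)

text \<open>Each N is open as part of \<open>holo_on\<close>, so openness of U need not be known
  beforehand. This is what allows transitions of charts to be described point by point.\<close>

lemma holo_on_local:
  fixes f :: "'a::complex_space \<Rightarrow> 'b::complex_space"
  assumes "\<And>x. x \<in> U \<Longrightarrow> \<exists>N g. x \<in> N \<and> N \<subseteq> U \<and> holo_on g N \<and> (\<forall>u\<in>N. f u = g u)"
  shows "holo_on f U"
proof -
  have "open U"
  proof (rule Topological_Spaces.openI)
    fix x assume "x \<in> U"
    then obtain N and g :: "'a \<Rightarrow> 'b" where "x \<in> N" "N \<subseteq> U" "holo_on g N" using assms[of x] by blast
    then show "\<exists>T. open T \<and> x \<in> T \<and> T \<subseteq> U" using holo_on_open[of g N] by blast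
  qed
  moreover have "cdiff f x" if x: "x \<in> U" for x
  proof -
    obtain N g where N: "x \<in> N" "holo_on g N" "\<forall>u\<in>N. f u = g u" using assms[OF x] by blast
    have "cdiff g x" "open N" using N by (simp_all add: holo_on_iff_cdiff)
    then show ?thesis by (rule cdiff_transform[OF _ _ N(1)]) (use N(3) in blast)
  qed
  ultimately show ?thesis by (simp add: holo_on_iff_cdiff)
qed

lemma holo_on_cong:
  assumes "holo_on g U" "\<And>x. x \<in> U \<Longrightarrow> f x = g x"
  shows "holo_on f U"
proof (rule holo_on_local)
  fix x assume "x \<in> U"
  then show "\<exists>N h. x \<in> N \<and> N \<subseteq> U \<and> holo_on h N \<and> (\<forall>u\<in>N. f u = h u)"
    using assms by (intro exI[of _ U] exI[of _ g]) simp
qed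

lemma holo_on_id: "open U \<Longrightarrow> holo_on (\<lambda>x. x) U"
  by (simp add: holo_on_iff_cdiff cdiff_ident)

section \<open>Parametrizations of manifolds\<close>

text \<open>Charts are handled through their inverses, injective maps from an open subset of the model
  space. The transition condition is local on the source, so that openness of the overlap is part
  of it.\<close>

definition transits ::
  "'m::complex_space set \<Rightarrow> ('m \<Rightarrow> 'a) \<Rightarrow> 'n::complex_space set \<Rightarrow> ('n \<Rightarrow> 'a) \<Rightarrow> bool" where
  "transits V \<sigma> V' \<sigma>' \<longleftrightarrow> (\<forall>v\<in>V. \<sigma> v \<in> \<sigma>' ` V' \<longrightarrow>
     (\<exists>N g. v \<in> N \<and> N \<subseteq> V \<and> holo_on g N \<and> g ` N \<subseteq> V' \<and> (\<forall>u\<in>N. \<sigma>' (g u) = \<sigma> u)))"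

lemma transitsI:
  assumes "\<And>v. v \<in> V \<Longrightarrow> \<sigma> v \<in> \<sigma>' ` V' \<Longrightarrow>
     (\<exists>N g. v \<in> N \<and> N \<subseteq> V \<and> holo_on g N \<and> g ` N \<subseteq> V' \<and> (\<forall>u\<in>N. \<sigma>' (g u) = \<sigma> u))"
  shows "transits V \<sigma> V' \<sigma>'"
  unfolding transits_def by (intro ballI impI) (rule assms)

lemma transitsE:
  assumes "transits V \<sigma> V' \<sigma>'" "v \<in> V" "\<sigma> v \<in> \<sigma>' ` V'"
  obtains N g where "v \<in> N" "N \<subseteq> V" "holo_on g N" "g ` N \<subseteq> V'" "\<And>u. u \<in> N \<Longrightarrow> \<sigma>' (g u) = \<sigma> u"
  using assms unfolding transits_def by metis

lemma transits_explicit: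
  assumes "holo_on g {v\<in>V. \<sigma> v \<in> \<sigma>' ` V'}"
    and "\<And>v. v \<in> V \<Longrightarrow> \<sigma> v \<in> \<sigma>' ` V' \<Longrightarrow> g v \<in> V' \<and> \<sigma>' (g v) = \<sigma> v"
  shows "transits V \<sigma> V' \<sigma>'"
proof (rule transitsI)
  fix v assume "v \<in> V" "\<sigma> v \<in> \<sigma>' ` V'"
  then have "v \<in> {v\<in>V. \<sigma> v \<in> \<sigma>' ` V'}" by blast
  moreover have "g ` {v\<in>V. \<sigma> v \<in> \<sigma>' ` V'} \<subseteq> V'" "\<forall>u\<in>{v\<in>V. \<sigma> v \<in> \<sigma>' ` V'}. \<sigma>' (g u) = \<sigma> u"
    using assms(2) by blast+
  ultimately show "\<exists>N g. v \<in> N \<and> N \<subseteq> V \<and> holo_on g N \<and> g ` N \<subseteq> V' \<and> (\<forall>u\<in>N. \<sigma>' (g u) = \<sigma> u)"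
    using assms(1) by (intro exI[of _ "{v\<in>V. \<sigma> v \<in> \<sigma>' ` V'}"] exI[of _ g] conjI) simp_all
qed

lemma transits_refl:
  assumes "open V" shows "transits V \<sigma> V \<sigma>"
  by (rule transitsI, rule exI[of _ V], rule exI[of _ "\<lambda>x. x"]) (simp add: holo_on_id[OF assms])

text \<open>Stated at a single point: the middle chart may cover only part of the overlap of the
  outer two, so \<open>\<sigma> v\<close> has to lie in its image as well.\<close>

lemma transits_trans:
  assumes 1: "transits V \<sigma> V' \<sigma>'" and 2: "transits V' \<sigma>' V'' \<sigma>''"
    and v: "v \<in> V" "\<sigma> v \<in> \<sigma>' ` V'" "\<sigma> v \<in> \<sigma>'' ` V''"
  shows "\<exists>N g. v \<in> N \<and> N \<subseteq> V \<and> holo_on g N \<and> g ` N \<subseteq> V'' \<and> (\<forall>u\<in>N. \<sigma>'' (g u) = \<sigma> u)"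
proof -
  obtain N g where g: "v \<in> N" "N \<subseteq> V" "holo_on g N" "g ` N \<subseteq> V'" "\<And>u. u \<in> N \<Longrightarrow> \<sigma>' (g u) = \<sigma> u"
    using transitsE[OF 1 v(1,2)] by metis
  have "g v \<in> V'" "\<sigma>' (g v) \<in> \<sigma>'' ` V''" using g v by auto
  then obtain N' g' where g': "g v \<in> N'" "N' \<subseteq> V'" "holo_on g' N'" "g' ` N' \<subseteq> V''"
    "\<And>u. u \<in> N' \<Longrightarrow> \<sigma>'' (g' u) = \<sigma>' u"
    using transitsE[OF 2] by metis
  show ?thesis
  proof (intro exI conjI)
    show "holo_on (\<lambda>x. g' (g x)) {x\<in>N. g x \<in> N'}" by (rule holo_on_compose[OF g(3) g'(3)])
  qed (use g g' in auto)
qed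

lemma transits_subset:
  assumes "transits V \<sigma> V' \<sigma>'" "open A" "A \<subseteq> V"
  shows "transits A \<sigma> V' \<sigma>'"
proof (rule transitsI)
  fix v assume v: "v \<in> A" "\<sigma> v \<in> \<sigma>' ` V'"
  then have "v \<in> V" using assms by auto
  obtain N g where g: "v \<in> N" "N \<subseteq> V" "holo_on g N" "g ` N \<subseteq> V'" "\<And>u. u \<in> N \<Longrightarrow> \<sigma>' (g u) = \<sigma> u"
    using transitsE[OF assms(1) \<open>v \<in> V\<close> v(2)] by metis
  have "holo_on g (N \<inter> A)"
    by (rule holo_on_subset[OF g(3)]) (use holo_on_open[OF g(3)] assms in auto)
  then show "\<exists>N g. v \<in> N \<and> N \<subseteq> A \<and> holo_on g N \<and> g ` N \<subseteq> V' \<and> (\<forall>u\<in>N. \<sigma>' (g u) = \<sigma> u)"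
    by (intro exI[of _ "N \<inter> A"] exI[of _ g]) (use g v assms in auto)
qed

text \<open>Injectivity of \<open>\<sigma>'\<close> forces \<open>g v\<close> to be the parameter in
  A of the same point; N then shrinks to the preimage of A under g.\<close>

lemma transits_subset_target:
  assumes "transits V \<sigma> V' \<sigma>'" "open A" "A \<subseteq> V'" "inj_on \<sigma>' V'"
  shows "transits V \<sigma> A \<sigma>'"
proof (rule transitsI)
  fix v assume v: "v \<in> V" "\<sigma> v \<in> \<sigma>' ` A"
  then have v': "\<sigma> v \<in> \<sigma>' ` V'" using assms by auto
  obtain N g where g: "v \<in> N" "N \<subseteq> V" "holo_on g N" "g ` N \<subseteq> V'" "\<And>u. u \<in> N \<Longrightarrow> \<sigma>' (g u) = \<sigma> u"
    using transitsE[OF assms(1) v(1) v'] by metis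
  obtain a where a: "a \<in> A" "\<sigma> v = \<sigma>' a" using v by auto
  have "g v = a" by (rule inj_onD[OF assms(4)]) (use a v g assms(3) in auto)
  then have "g v \<in> A" using a by simp
  show "\<exists>N g. v \<in> N \<and> N \<subseteq> V \<and> holo_on g N \<and> g ` N \<subseteq> A \<and> (\<forall>u\<in>N. \<sigma>' (g u) = \<sigma> u)"
    by (rule exI[of _ "{x\<in>N. g x \<in> A}"], rule exI[of _ g])
      (use g v \<open>g v \<in> A\<close> assms(2) in \<open>auto intro!: holo_on_subset[of g N] holo_on_preimage\<close>)
qed

text \<open>Renaming the points injectively leaves the coordinates alone. The charts of the surface
  become those of a fibre in this way, with \<open>cls\<close> as renaming.\<close>

lemma transits_comp:
  assumes "transits V \<sigma> V' \<sigma>'" "inj_on F A" "\<sigma> ` V \<subseteq> A" "\<sigma>' ` V' \<subseteq> A"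
  shows "transits V (F \<circ> \<sigma>) V' (F \<circ> \<sigma>')"
proof (rule transitsI)
  fix v assume v: "v \<in> V" "(F \<circ> \<sigma>) v \<in> (F \<circ> \<sigma>') ` V'"
  then have v': "\<sigma> v \<in> \<sigma>' ` V'" using assms by (auto dest!: inj_onD[OF assms(2)])
  obtain N g where g: "v \<in> N" "N \<subseteq> V" "holo_on g N" "g ` N \<subseteq> V'" "\<And>u. u \<in> N \<Longrightarrow> \<sigma>' (g u) = \<sigma> u"
    using transitsE[OF assms(1) v(1) v'] by metis
  then show "\<exists>N g. v \<in> N \<and> N \<subseteq> V \<and> holo_on g N \<and> g ` N \<subseteq> V' \<and> (\<forall>u\<in>N. (F \<circ> \<sigma>') (g u) = (F \<circ> \<sigma>) u)"
    by (intro exI[of _ N] exI[of _ g]) auto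
qed

lemma transits_cong:
  assumes "transits V \<sigma> V' \<sigma>'" "\<And>v. v \<in> V \<Longrightarrow> \<sigma> v = \<tau> v" "\<And>v. v \<in> V' \<Longrightarrow> \<sigma>' v = \<tau>' v"
  shows "transits V \<tau> V' \<tau>'"
proof (rule transitsI)
  fix v assume v: "v \<in> V" "\<tau> v \<in> \<tau>' ` V'"
  then have v': "\<sigma> v \<in> \<sigma>' ` V'" using assms by auto
  obtain N g where g: "v \<in> N" "N \<subseteq> V" "holo_on g N" "g ` N \<subseteq> V'" "\<And>u. u \<in> N \<Longrightarrow> \<sigma>' (g u) = \<sigma> u"
    using transitsE[OF assms(1) v(1) v'] by metis
  then show "\<exists>N g. v \<in> N \<and> N \<subseteq> V \<and> holo_on g N \<and> g ` N \<subseteq> V' \<and> (\<forall>u\<in>N. \<tau>' (g u) = \<tau> u)"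
    using assms by (intro exI[of _ N] exI[of _ g]) (auto simp: subset_iff image_subset_iff)
qed

text \<open>The bridge between the atlas condition of \<open>complex_manifold\<close> and
  parametrizations. From right to left, the local map g has to be the coordinate change, because
  \<psi> undoes \<open>inv_into V \<psi>\<close>.\<close>

lemma transits_iff_holo_on:
  assumes "inj_on \<phi> U" "open (\<phi> ` U)" "inj_on \<psi> V"
  shows "holo_on (\<psi> \<circ> inv_into U \<phi>) (\<phi> ` (U \<inter> V)) \<longleftrightarrow>
         transits (\<phi> ` U) (inv_into U \<phi>) (\<psi> ` V) (inv_into V \<psi>)" (is "?L \<longleftrightarrow> ?R")
proof -
  have eq: "{v\<in>\<phi> ` U. inv_into U \<phi> v \<in> inv_into V \<psi> ` \<psi> ` V} = \<phi> ` (U \<inter> V)"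
    using assms by (auto simp: image_image)
  show ?thesis
  proof
    assume L: ?L
    show ?R
      by (rule transits_explicit[where g = "\<psi> \<circ> inv_into U \<phi>"], unfold eq)
        (use L assms in \<open>auto simp: image_image\<close>)
  next
    assume R: ?R
    show ?L
    proof (rule holo_on_local)
      fix x assume x: "x \<in> \<phi> ` (U \<inter> V)"
      then have "x \<in> \<phi> ` U" "inv_into U \<phi> x \<in> inv_into V \<psi> ` \<psi> ` V"
        using eq by blast+
      then obtain N g where g: "x \<in> N" "N \<subseteq> \<phi> ` U" "holo_on g N" "g ` N \<subseteq> \<psi> ` V"
        "\<And>u. u \<in> N \<Longrightarrow> inv_into V \<psi> (g u) = inv_into U \<phi> u"
        using transitsE[OF R] by metis
      have "(\<psi> \<circ> inv_into U \<phi>) u = g u" if "u \<in> N" for u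
        using g(5)[OF that] g(4) that assms(3) f_inv_into_f[of "g u" \<psi> V] by (metis comp_apply image_subset_iff)
      moreover have "N \<subseteq> \<phi> ` (U \<inter> V)"
      proof
        fix u assume u: "u \<in> N"
        then have "inv_into U \<phi> u \<in> V" using g(4,5)
          by (metis image_subset_iff inv_into_into)
        then show "u \<in> \<phi> ` (U \<inter> V)" using u g(2) assms(1) by auto
      qed
      ultimately show "\<exists>N g. x \<in> N \<and> N \<subseteq> \<phi> ` (U \<inter> V) \<and> holo_on g N \<and>
          (\<forall>u\<in>N. (\<psi> \<circ> inv_into U \<phi>) u = g u)"
        using g by blast
    qed
  qed
qed

text \<open>The part of \<open>complex_manifold\<close> on which the calculus of charts rests. The
  topological axioms come later, since the charts are used to prove them.\<close>

definition premanifold :: "('a, 'm::complex_space) cmfd \<Rightarrow> bool" where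
  "premanifold M \<longleftrightarrow>
     (\<forall>(U, \<phi>)\<in>atlas M. U \<subseteq> pts M \<and> inj_on \<phi> U \<and> open (\<phi> ` U)) \<and>
     (\<Union>(U, \<phi>)\<in>atlas M. U) = pts M \<and>
     (\<forall>(U, \<phi>)\<in>atlas M. \<forall>(V, \<psi>)\<in>atlas M.
        transits (\<phi> ` U) (inv_into U \<phi>) (\<psi> ` V) (inv_into V \<psi>))"

lemma complex_manifold_iff:
  "complex_manifold M \<longleftrightarrow>
     premanifold M \<and> Hausdorff_space (mtop M) \<and> second_countable (mtop M)"
proof -
  have "(\<forall>(U, \<phi>)\<in>atlas M. \<forall>(V, \<psi>)\<in>atlas M. holo_on (\<psi> \<circ> inv_into U \<phi>) (\<phi> ` (U \<inter> V))) \<longleftrightarrow>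
    (\<forall>(U, \<phi>)\<in>atlas M. \<forall>(V, \<psi>)\<in>atlas M.
        transits (\<phi> ` U) (inv_into U \<phi>) (\<psi> ` V) (inv_into V \<psi>))"
    if *: "\<forall>(U, \<phi>)\<in>atlas M. U \<subseteq> pts M \<and> inj_on \<phi> U \<and> open (\<phi> ` U)"
    by (rule ball_cong[OF refl], clarify, rule ball_cong[OF refl], clarify,
        rule transits_iff_holo_on) (use * in auto)
  then show ?thesis unfolding complex_manifold_def premanifold_def by blast
qed

lemma premanifoldD:
  assumes "premanifold M" "(U, \<phi>) \<in> atlas M"
  shows "U \<subseteq> pts M" "inj_on \<phi> U" "open (\<phi> ` U)"
  using assms by (auto simp: premanifold_def)

lemma premanifold_transits:
  assumes "premanifold M" "(U, \<phi>) \<in> atlas M" "(V, \<psi>) \<in> atlas M"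
  shows "transits (\<phi> ` U) (inv_into U \<phi>) (\<psi> ` V) (inv_into V \<psi>)"
  using assms unfolding premanifold_def by fast

lemma premanifold_cover:
  assumes "premanifold M" "p \<in> pts M"
  obtains U \<phi> where "(U, \<phi>) \<in> atlas M" "p \<in> U"
proof -
  have "p \<in> (\<Union>(U, \<phi>)\<in>atlas M. U)" using assms by (simp add: premanifold_def)
  then obtain U \<phi> where "(U, \<phi>) \<in> atlas M" "p \<in> U" by auto
  then show ?thesis by (rule that)
qed

text \<open>The inverse of a chart in the maximal atlas. Both directions of compatibility are
  required because \<open>transits\<close> is not symmetric.\<close>

definition chart :: "('a, 'm::complex_space) cmfd \<Rightarrow> 'm set \<Rightarrow> ('m \<Rightarrow> 'a) \<Rightarrow> bool" where
  "chart M V \<sigma> \<longleftrightarrow> open V \<and> inj_on \<sigma> V \<and> \<sigma> ` V \<subseteq> pts M \<and>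
     (\<forall>(U, \<phi>)\<in>atlas M. transits V \<sigma> (\<phi> ` U) (inv_into U \<phi>) \<and>
        transits (\<phi> ` U) (inv_into U \<phi>) V \<sigma>)"

lemma chartD:
  assumes "chart M V \<sigma>"
  shows "open V" "inj_on \<sigma> V" "\<sigma> ` V \<subseteq> pts M"
    and "(U, \<phi>) \<in> atlas M \<Longrightarrow> transits V \<sigma> (\<phi> ` U) (inv_into U \<phi>)"
    and "(U, \<phi>) \<in> atlas M \<Longrightarrow> transits (\<phi> ` U) (inv_into U \<phi>) V \<sigma>"
  using assms by (auto simp: chart_def)

lemma chart_atlas:
  assumes "premanifold M" "(U, \<phi>) \<in> atlas M"
  shows "chart M (\<phi> ` U) (inv_into U \<phi>)"
  using premanifoldD[OF assms] premanifold_transits[OF assms(1)] assms(2)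
  unfolding chart_def by (auto simp: inj_on_inv_into)

text \<open>Near each common point, an atlas chart around that point acts as the middle chart of
  \<open>transits_trans\<close>.\<close>

lemma chart_transits:
  assumes M: "premanifold M" and "chart M V \<sigma>" "chart M V' \<sigma>'"
  shows "transits V \<sigma> V' \<sigma>'"
proof (rule transitsI)
  fix v assume v: "v \<in> V" "\<sigma> v \<in> \<sigma>' ` V'"
  then have "\<sigma> v \<in> pts M" using chartD(3)[OF assms(2)] by auto
  then obtain U \<phi> where U: "(U, \<phi>) \<in> atlas M" "\<sigma> v \<in> U" using premanifold_cover[OF M] by metis
  then have "\<sigma> v \<in> inv_into U \<phi> ` \<phi> ` U" by (simp add: premanifoldD(2)[OF M U(1)])
  then show "\<exists>N g. v \<in> N \<and> N \<subseteq> V \<and> holo_on g N \<and> g ` N \<subseteq> V' \<and> (\<forall>u\<in>N. \<sigma>' (g u) = \<sigma> u)"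
    using transits_trans[OF chartD(4)[OF assms(2) U(1)] chartD(5)[OF assms(3) U(1)]] v by blast
qed

lemma chart_subset:
  assumes "chart M V \<sigma>" "open A" "A \<subseteq> V"
  shows "chart M A \<sigma>"
proof -
  note c = chartD[OF assms(1)]
  show ?thesis
    unfolding chart_def
    using transits_subset[OF c(4) assms(2,3)] transits_subset_target[OF c(5) assms(2,3) c(2)]
      inj_on_subset[OF c(2) assms(3)] subset_trans[OF image_mono[OF assms(3)] c(3)] assms(2)
    by auto
qed

lemma chart_cong:
  assumes "chart M V \<sigma>" "\<And>v. v \<in> V \<Longrightarrow> \<tau> v = \<sigma> v"
  shows "chart M V \<tau>"
proof -
  note c = chartD[OF assms(1)]
  have "inj_on \<tau> V" using c(2) assms(2) by (simp cong: inj_on_cong)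
  moreover have "\<tau> ` V \<subseteq> pts M" using c(3) assms(2) by auto
  moreover have "transits V \<tau> (\<phi> ` U) (inv_into U \<phi>)" "transits (\<phi> ` U) (inv_into U \<phi>) V \<tau>"
    if "(U, \<phi>) \<in> atlas M" for U \<phi>
    using transits_cong[OF c(4)[OF that]] transits_cong[OF c(5)[OF that]] assms(2) by metis+
  ultimately show ?thesis using c(1) unfolding chart_def by auto
qed

lemma transits_change:
  assumes g: "holo_on g V'" "g ` V' \<subseteq> V"
  shows "transits V' (\<lambda>v. \<sigma> (g v)) V \<sigma>"
  by (rule transitsI, rule exI[of _ V'], rule exI[of _ g]) (use g in auto)

text \<open>Reparametrization by a biholomorphic map g from V' onto a possibly smaller set A. The
  charts \<open>e2S\<close>, \<open>e3C\<close>, \<open>e4S\<close>, \<open>e2B'\<close>,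
  \<open>e3B'\<close> and \<open>e4B'\<close>, which are not direct outputs of a blow-up, are
  obtained from this.\<close>

lemma chart_change:
  assumes "chart M V \<sigma>" and g: "holo_on g V'" "g ` V' \<subseteq> V"
    and h: "holo_on h A" "A \<subseteq> V" "h ` A \<subseteq> V'" "\<And>v. v \<in> A \<Longrightarrow> g (h v) = v" "\<And>v. v \<in> V' \<Longrightarrow> g v \<in> A \<and> h (g v) = v"
  shows "chart M V' (\<lambda>v. \<sigma> (g v))"
proof -
  note c = chartD[OF assms(1)]
  have inj: "inj_on (\<lambda>v. \<sigma> (g v)) V'"
    by (rule inj_onI) (metis c(2) g(2) h(5) image_subset_iff inj_onD)
  have t1: "transits V' (\<lambda>v. \<sigma> (g v)) V \<sigma>" by (rule transits_change[OF g])
  have t2: "transits V \<sigma> V' (\<lambda>v. \<sigma> (g v))"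
  proof (rule transitsI)
    fix v assume v: "v \<in> V" "\<sigma> v \<in> (\<lambda>v. \<sigma> (g v)) ` V'"
    then obtain u where u: "u \<in> V'" "\<sigma> v = \<sigma> (g u)" by auto
    then have "v = g u" using c(2) v(1) g(2) by (auto dest: inj_onD)
    then have "v \<in> A" using h(5) u by auto
    then show "\<exists>N k. v \<in> N \<and> N \<subseteq> V \<and> holo_on k N \<and> k ` N \<subseteq> V' \<and> (\<forall>u\<in>N. \<sigma> (g (k u)) = \<sigma> u)"
      using h by (intro exI[of _ A] exI[of _ h]) auto
  qed
  have sub: "(\<lambda>v. \<sigma> (g v)) v \<in> \<sigma> ` V" if "v \<in> V'" for v using that g(2) by auto
  have 1: "transits V' (\<lambda>v. \<sigma> (g v)) (\<phi> ` U) (inv_into U \<phi>)" if "(U, \<phi>) \<in> atlas M" for U \<phi>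
    by (rule transitsI, rule transits_trans[OF t1 c(4)[OF that]]) (use sub in auto)
  have 2: "transits (\<phi> ` U) (inv_into U \<phi>) V' (\<lambda>v. \<sigma> (g v))" if "(U, \<phi>) \<in> atlas M" for U \<phi>
    by (rule transitsI, rule transits_trans[OF c(5)[OF that] t2]) (use sub in auto)
  show ?thesis unfolding chart_def
    using 1 2 inj holo_on_open[OF g(1)] sub c(3) by auto
qed

text \<open>Apart from injectivity, being a chart is a local property of the domain. It serves
  \<open>emb 1\<close>, for which two charts of different origin have to be combined.\<close>

lemma chart_union:
  assumes M: "premanifold M" and inj: "inj_on \<sigma> V"
    and loc: "\<And>v. v \<in> V \<Longrightarrow> \<exists>A. v \<in> A \<and> A \<subseteq> V \<and> chart M A \<sigma>"
  shows "chart M V \<sigma>"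
proof -
  have "open V"
  proof (rule Topological_Spaces.openI)
    fix x assume "x \<in> V"
    then obtain A where "x \<in> A" "A \<subseteq> V" "chart M A \<sigma>" using loc by blast
    then show "\<exists>T. open T \<and> x \<in> T \<and> T \<subseteq> V" using chartD(1) by blast
  qed
  moreover have "\<sigma> ` V \<subseteq> pts M" using loc chartD(3) by blast
  moreover have "transits V \<sigma> (\<phi> ` U) (inv_into U \<phi>)" if U: "(U, \<phi>) \<in> atlas M" for U \<phi>
  proof (rule transitsI)
    fix v assume v: "v \<in> V" "\<sigma> v \<in> inv_into U \<phi> ` \<phi> ` U"
    obtain A where A: "v \<in> A" "A \<subseteq> V" "chart M A \<sigma>" using loc[OF v(1)] by blast
    show "\<exists>N g. v \<in> N \<and> N \<subseteq> V \<and> holo_on g N \<and> g ` N \<subseteq> \<phi> ` U \<and> (\<forall>u\<in>N. inv_into U \<phi> (g u) = \<sigma> u)"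
    proof -
      obtain N g where g: "v \<in> N" "N \<subseteq> A" "holo_on g N" "g ` N \<subseteq> \<phi> ` U"
        "\<And>u. u \<in> N \<Longrightarrow> inv_into U \<phi> (g u) = \<sigma> u"
        using transitsE[OF chartD(4)[OF A(3) U] A(1) v(2)] by metis
      then show ?thesis using A(2) by (intro exI[of _ N] exI[of _ g] conjI ballI) auto
    qed
  qed
  moreover have "transits (\<phi> ` U) (inv_into U \<phi>) V \<sigma>" if U: "(U, \<phi>) \<in> atlas M" for U \<phi>
  proof (rule transitsI)
    fix v assume v: "v \<in> \<phi> ` U" "inv_into U \<phi> v \<in> \<sigma> ` V"
    then obtain u where u: "u \<in> V" "inv_into U \<phi> v = \<sigma> u" by auto
    obtain A where A: "u \<in> A" "A \<subseteq> V" "chart M A \<sigma>" using loc[OF u(1)] by blast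
    show "\<exists>N g. v \<in> N \<and> N \<subseteq> \<phi> ` U \<and> holo_on g N \<and> g ` N \<subseteq> V \<and> (\<forall>x\<in>N. \<sigma> (g x) = inv_into U \<phi> x)"
    proof -
      have "inv_into U \<phi> v \<in> \<sigma> ` A" using u A by simp
      then obtain N g where g: "v \<in> N" "N \<subseteq> \<phi> ` U" "holo_on g N" "g ` N \<subseteq> A"
        "\<And>x. x \<in> N \<Longrightarrow> \<sigma> (g x) = inv_into U \<phi> x"
        using transitsE[OF chartD(5)[OF A(3) U] v(1)] by metis
      then show ?thesis using A(2) by (intro exI[of _ N] exI[of _ g] conjI ballI) auto
    qed
  qed
  ultimately show ?thesis using inj unfolding chart_def by auto
qed

section \<open>The topology of a manifold\<close>

text \<open>\<open>mtop\<close> is the bare \<open>topology\<close> of a predicate, so the predicate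
  must first be shown to define a topology. Intersections are the delicate point: images commute
  with them by injectivity of the coordinate maps.\<close>

lemma openin_mtop:
  assumes "premanifold M"
  shows "openin (mtop M) W \<longleftrightarrow> W \<subseteq> pts M \<and> (\<forall>(U, \<phi>)\<in>atlas M. open (\<phi> ` (W \<inter> U)))"
proof -
  have "istopology (\<lambda>W. W \<subseteq> pts M \<and> (\<forall>(U, \<phi>)\<in>atlas M. open (\<phi> ` (W \<inter> U))))"
    unfolding istopology_def
  proof (intro conjI allI impI)
    fix S T assume S: "S \<subseteq> pts M \<and> (\<forall>(U, \<phi>)\<in>atlas M. open (\<phi> ` (S \<inter> U)))"
      and T: "T \<subseteq> pts M \<and> (\<forall>(U, \<phi>)\<in>atlas M. open (\<phi> ` (T \<inter> U)))"
    have "open (\<phi> ` (S \<inter> T \<inter> U))" if U: "(U, \<phi>) \<in> atlas M" for U \<phi>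
    proof -
      have "\<phi> ` (S \<inter> T \<inter> U) = \<phi> ` (S \<inter> U) \<inter> \<phi> ` (T \<inter> U)"
        using premanifoldD(2)[OF assms U] by (auto simp: inj_on_def)
      then show ?thesis using S T U by auto
    qed
    then show "\<forall>(U, \<phi>)\<in>atlas M. open (\<phi> ` (S \<inter> T \<inter> U))" by auto
    show "S \<inter> T \<subseteq> pts M" using S by auto
  next
    fix K assume K: "\<forall>S\<in>K. S \<subseteq> pts M \<and> (\<forall>(U, \<phi>)\<in>atlas M. open (\<phi> ` (S \<inter> U)))"
    then show "\<Union>K \<subseteq> pts M" by auto
    have "open (\<phi> ` (\<Union>K \<inter> U))" if U: "(U, \<phi>) \<in> atlas M" for U \<phi>
    proof -
      have "\<phi> ` (\<Union>K \<inter> U) = (\<Union>S\<in>K. \<phi> ` (S \<inter> U))" by auto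
      then show ?thesis using K U by (metis (mono_tags, lifting) case_prodD open_UN)
    qed
    then show "\<forall>(U, \<phi>)\<in>atlas M. open (\<phi> ` (\<Union>K \<inter> U))" by auto
  qed
  then show ?thesis by (simp add: mtop_def topology_inverse')
qed

lemma topspace_mtop:
  assumes "premanifold M"
  shows "topspace (mtop M) = pts M"
proof
  show "topspace (mtop M) \<subseteq> pts M"
    using openin_mtop[OF assms] openin_topspace by blast
  have "open (\<phi> ` (pts M \<inter> U))" if "(U, \<phi>) \<in> atlas M" for U \<phi>
    using premanifoldD[OF assms that] by (simp add: Int_absorb1)
  then have "openin (mtop M) (pts M)" by (auto simp: openin_mtop[OF assms])
  then show "pts M \<subseteq> topspace (mtop M)" by (rule openin_subset)
qed

lemma openin_chart_image:
  assumes M: "premanifold M" and c: "chart M V \<sigma>" and A: "open A" "A \<subseteq> V"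
  shows "openin (mtop M) (\<sigma> ` A)"
proof -
  note c' = chart_subset[OF c A]
  have "open (\<phi> ` (\<sigma> ` A \<inter> U))" if U: "(U, \<phi>) \<in> atlas M" for U \<phi>
  proof (rule Topological_Spaces.openI)
    fix x assume "x \<in> \<phi> ` (\<sigma> ` A \<inter> U)"
    then obtain q where q: "x = \<phi> q" "q \<in> \<sigma> ` A" "q \<in> U" by auto
    then have "inv_into U \<phi> x \<in> \<sigma> ` A" using premanifoldD[OF M U] by simp
    then obtain N g where g: "x \<in> N" "N \<subseteq> \<phi> ` U" "holo_on g N" "g ` N \<subseteq> A"
      "\<And>u. u \<in> N \<Longrightarrow> \<sigma> (g u) = inv_into U \<phi> u"
      using transitsE[OF chartD(5)[OF c' U]] q by (metis imageI)
    have "N \<subseteq> \<phi> ` (\<sigma> ` A \<inter> U)"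
    proof
      fix u assume u: "u \<in> N"
      then have "inv_into U \<phi> u \<in> \<sigma> ` A" "inv_into U \<phi> u \<in> U" "\<phi> (inv_into U \<phi> u) = u"
        using g(4) g(5)[OF u, symmetric] u f_inv_into_f[OF subsetD[OF g(2) u]] inv_into_into[OF subsetD[OF g(2) u]]
        by auto
      then show "u \<in> \<phi> ` (\<sigma> ` A \<inter> U)" by force
    qed
    then show "\<exists>T. open T \<and> x \<in> T \<and> T \<subseteq> \<phi> ` (\<sigma> ` A \<inter> U)"
      using g(1) holo_on_open[OF g(3)] by (intro exI[of _ N]) simp
  qed
  then show ?thesis using chartD(3)[OF c'] by (auto simp: openin_mtop[OF M])
qed

lemma open_chart_preimage:
  assumes M: "premanifold M" and c: "chart M V \<sigma>" and W: "openin (mtop M) W"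
  shows "open {v\<in>V. \<sigma> v \<in> W}"
proof (rule Topological_Spaces.openI)
  fix v assume v: "v \<in> {v\<in>V. \<sigma> v \<in> W}"
  then have "\<sigma> v \<in> pts M" using chartD(3)[OF c] by auto
  then obtain U \<phi> where U: "(U, \<phi>) \<in> atlas M" "\<sigma> v \<in> U" using premanifold_cover[OF M] by metis
  then have "\<sigma> v \<in> inv_into U \<phi> ` \<phi> ` U" by (simp add: premanifoldD(2)[OF M U(1)])
  then obtain N g where g: "v \<in> N" "N \<subseteq> V" "holo_on g N" "g ` N \<subseteq> \<phi> ` U"
      "\<And>u. u \<in> N \<Longrightarrow> inv_into U \<phi> (g u) = \<sigma> u"
    using transitsE[OF chartD(4)[OF c U(1)]] v by blast
  have o: "open (\<phi> ` (W \<inter> U))" using W U openin_mtop[OF M] by auto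
  have gv: "g v \<in> \<phi> ` (W \<inter> U)"
  proof -
    have "inv_into U \<phi> (g v) = \<sigma> v" "g v \<in> \<phi> ` U" using g by auto
    then have "g v = \<phi> (\<sigma> v)" using f_inv_into_f[of "g v" \<phi> U] by simp
    then show ?thesis using v U(2) by blast
  qed
  have sub: "\<sigma> u \<in> W" if u: "u \<in> N" "g u \<in> \<phi> ` (W \<inter> U)" for u
  proof -
    obtain w where w: "g u = \<phi> w" "w \<in> W" "w \<in> U" using u(2) by blast
    then show ?thesis using g(5)[OF u(1)] premanifoldD[OF M U(1)] by auto
  qed
  define X where "X = {x\<in>N. g x \<in> \<phi> ` (W \<inter> U)}"
  have "open X" unfolding X_def by (rule holo_on_preimage[OF g(3) o])
  moreover have "v \<in> X" unfolding X_def using g(1) gv by simp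
  moreover have "X \<subseteq> {v\<in>V. \<sigma> v \<in> W}" unfolding X_def using sub g(2) by auto
  ultimately show "\<exists>T. open T \<and> v \<in> T \<and> T \<subseteq> {v\<in>V. \<sigma> v \<in> W}" by blast
qed

lemma openin_if_charts:
  assumes M: "premanifold M" and "\<And>p. p \<in> W \<Longrightarrow> \<exists>V \<sigma>. chart M V \<sigma> \<and> p \<in> \<sigma> ` V \<and> \<sigma> ` V \<subseteq> W"
  shows "openin (mtop M) W"
proof (subst openin_subopen, rule ballI)
  fix p assume "p \<in> W"
  then obtain V \<sigma> where "chart M V \<sigma>" "p \<in> \<sigma> ` V" "\<sigma> ` V \<subseteq> W" using assms(2) by blast
  then show "\<exists>T. openin (mtop M) T \<and> p \<in> T \<and> T \<subseteq> W"
    using openin_chart_image[OF M _ chartD(1) order_refl] by (intro exI[of _ "\<sigma> ` V"]) simp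
qed

text \<open>A countable basis of the model space, transported by countably many charts, is a basis
  of the manifold.\<close>

lemma second_countable_mtop:
  assumes M: "premanifold M" and "countable (atlas M)"
  shows "second_countable (mtop M)"
proof -
  obtain B :: "'b set set" where B: "countable B" "topological_basis B" using ex_countable_basis by blast
  let ?B = "(\<lambda>((U, \<phi>), b). inv_into U \<phi> ` (\<phi> ` U \<inter> b)) ` (atlas M \<times> B)"
  have "countable ?B" using B assms(2) by auto
  moreover have "openin (mtop M) W" if W: "W \<in> ?B" for W
  proof -
    obtain U \<phi> b where U: "(U, \<phi>) \<in> atlas M" "b \<in> B" "W = inv_into U \<phi> ` (\<phi> ` U \<inter> b)" using W by auto
    then have "open (\<phi> ` U \<inter> b)" using premanifoldD(3)[OF M U(1)] topological_basis_open[OF B(2) U(2)] by auto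
    then show ?thesis unfolding U(3) by (rule openin_chart_image[OF M chart_atlas[OF M U(1)]]) simp
  qed
  moreover have "\<exists>V\<in>?B. x \<in> V \<and> V \<subseteq> W" if W: "openin (mtop M) W" "x \<in> W" for W x
  proof -
    have "x \<in> pts M" using W openin_mtop[OF M] by auto
    then obtain U \<phi> where U: "(U, \<phi>) \<in> atlas M" "x \<in> U" using premanifold_cover[OF M] by metis
    have "open {v\<in>\<phi> ` U. inv_into U \<phi> v \<in> W}"
      by (rule open_chart_preimage[OF M chart_atlas[OF M U(1)] W(1)])
    moreover have "\<phi> x \<in> {v\<in>\<phi> ` U. inv_into U \<phi> v \<in> W}" using U W premanifoldD[OF M U(1)] by auto
    ultimately obtain b where b: "b \<in> B" "\<phi> x \<in> b" "b \<subseteq> {v\<in>\<phi> ` U. inv_into U \<phi> v \<in> W}"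
      by (rule topological_basisE[OF B(2)])
    have x: "x = inv_into U \<phi> (\<phi> x)" using U premanifoldD[OF M U(1)] by simp
    have "x \<in> inv_into U \<phi> ` (\<phi> ` U \<inter> b)"
      by (rule image_eqI[where x = "\<phi> x"], rule x) (use U b in simp)
    moreover have "inv_into U \<phi> ` (\<phi> ` U \<inter> b) \<subseteq> W" using b(3) by blast
    moreover have "inv_into U \<phi> ` (\<phi> ` U \<inter> b) \<in> ?B"
      using U(1) b(1) by (intro image_eqI[of _ _ "((U, \<phi>), b)"]) auto
    ultimately show ?thesis by (intro bexI[of _ "inv_into U \<phi> ` (\<phi> ` U \<inter> b)"] conjI)
  qed
  ultimately show ?thesis unfolding second_countable_def by (intro exI[of _ ?B]) blast
qed

lemma Hausdorff_mtop_iff: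
  assumes "premanifold M"
  shows "Hausdorff_space (mtop M) \<longleftrightarrow> (\<forall>p\<in>pts M. \<forall>q\<in>pts M. p \<noteq> q \<longrightarrow>
     (\<exists>A B. openin (mtop M) A \<and> openin (mtop M) B \<and> p \<in> A \<and> q \<in> B \<and> A \<inter> B = {}))"
  unfolding Hausdorff_space_def topspace_mtop[OF assms] disjnt_def by blast

text \<open>This leaves for each Hausdorff proof only the pairs of points that have no chart in
  common.\<close>

lemma separated_in_chart:
  assumes M: "premanifold M" and c: "chart M V \<sigma>" and "p \<in> \<sigma> ` V" "q \<in> \<sigma> ` V" "p \<noteq> q"
  shows "\<exists>A B. openin (mtop M) A \<and> openin (mtop M) B \<and> p \<in> A \<and> q \<in> B \<and> A \<inter> B = {}"
proof -
  obtain u v where uv: "u \<in> V" "v \<in> V" "p = \<sigma> u" "q = \<sigma> v" "u \<noteq> v" using assms by auto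
  obtain A B where AB: "open A" "open B" "u \<in> A" "v \<in> B" "A \<inter> B = {}" using hausdorff[OF uv(5)] by blast
  have "\<sigma> ` (A \<inter> V) \<inter> \<sigma> ` (B \<inter> V) = {}" using AB(5) chartD(2)[OF c] by (auto simp: inj_on_def)
  then show ?thesis using AB uv chartD(1)[OF c]
    by (intro exI[of _ "\<sigma> ` (A \<inter> V)"] exI[of _ "\<sigma> ` (B \<inter> V)"]) (auto intro!: openin_chart_image[OF M c])
qed

section \<open>Holomorphic maps between manifolds\<close>

text \<open>\<open>holomorphic_map\<close> speaks about charts of the two atlases, whereas the maps
  below are simple in other charts. The transitions k and l on the two sides of g make up the
  difference.\<close>

lemma holomorphic_mapI:
  fixes M :: "('a, 'm::complex_space) cmfd" and N :: "('b, 'n::complex_space) cmfd"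
  assumes M: "premanifold M" and N: "premanifold N" and im: "F ` pts M \<subseteq> pts N"
    and loc: "\<And>p. p \<in> pts M \<Longrightarrow> \<exists>V \<sigma> V' \<sigma>' v g. chart M V \<sigma> \<and> chart N V' \<sigma>' \<and> v \<in> V \<and> \<sigma> v = p \<and>
      holo_on g V \<and> g ` V \<subseteq> V' \<and> (\<forall>u\<in>V. F (\<sigma> u) = \<sigma>' (g u))"
  shows "holomorphic_map M N F"
  unfolding holomorphic_map_def
proof (intro conjI ballI im)
  fix p assume p: "p \<in> pts M"
  obtain V \<sigma> V' \<sigma>' v g where c: "chart M V \<sigma>" "chart N V' \<sigma>'" "v \<in> V" "\<sigma> v = p"
      and g: "holo_on g V" "g ` V \<subseteq> V'" "\<forall>u\<in>V. F (\<sigma> u) = \<sigma>' (g u)"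
    using loc[OF p] by metis
  obtain U \<phi> where U: "(U, \<phi>) \<in> atlas M" "p \<in> U" by (rule premanifold_cover[OF M p])
  have "F p \<in> pts N" using im p by auto
  then obtain U' \<psi> where U': "(U', \<psi>) \<in> atlas N" "F p \<in> U'" by (rule premanifold_cover[OF N])
  note uM = premanifoldD[OF M U(1)] and uN = premanifoldD[OF N U'(1)]
  have inv_p: "inv_into U \<phi> (\<phi> p) = p" using U uM by simp
  have "\<phi> p \<in> \<phi> ` U" "inv_into U \<phi> (\<phi> p) \<in> \<sigma> ` V" using inv_p U c by auto
  then obtain N1 k where k: "\<phi> p \<in> N1" "N1 \<subseteq> \<phi> ` U" "holo_on k N1" "k ` N1 \<subseteq> V"
      "\<And>u. u \<in> N1 \<Longrightarrow> \<sigma> (k u) = inv_into U \<phi> u"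
    using transitsE[OF chartD(5)[OF c(1) U(1)]] by metis
  have kp: "k (\<phi> p) \<in> V" "\<sigma> (k (\<phi> p)) = p" using k inv_p by auto
  have gk: "g (k (\<phi> p)) \<in> V'" "\<sigma>' (g (k (\<phi> p))) = F p" using kp g by auto
  have "F p \<in> inv_into U' \<psi> ` \<psi> ` U'" using U' uN by simp
  then obtain N2 l where l: "g (k (\<phi> p)) \<in> N2" "N2 \<subseteq> V'" "holo_on l N2" "l ` N2 \<subseteq> \<psi> ` U'"
      "\<And>u. u \<in> N2 \<Longrightarrow> inv_into U' \<psi> (l u) = \<sigma>' u"
    using transitsE[OF chartD(4)[OF c(2) U'(1)] gk(1)] gk(2) by metis
  have "holo_on (\<lambda>x. g (k x)) {x\<in>N1. k x \<in> V}" by (rule holo_on_compose[OF k(3) g(1)])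
  moreover have "{x\<in>N1. k x \<in> V} = N1" using k by auto
  ultimately have gk_holo: "holo_on (\<lambda>x. g (k x)) N1" by simp
  define W where "W = {x\<in>N1. g (k x) \<in> N2}"
  have *: "inv_into U' \<psi> (l (g (k x))) = F (inv_into U \<phi> x)" "l (g (k x)) \<in> \<psi> ` U'" if "x \<in> W" for x
    using that k(4,5) g(3) l(4,5) unfolding W_def by (simp_all add: image_subset_iff) (metis)
  have F_in: "F (inv_into U \<phi> x) \<in> U'" if "x \<in> W" for x
    using *[OF that] by (metis inv_into_into)
  have eq: "(\<psi> \<circ> F \<circ> inv_into U \<phi>) x = l (g (k x))" if "x \<in> W" for x
    using *[OF that] f_inv_into_f[of "l (g (k x))" \<psi> U'] by simp
  have "holo_on (\<psi> \<circ> F \<circ> inv_into U \<phi>) W"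
    by (rule holo_on_cong[OF _ eq]) (simp_all add: W_def holo_on_compose[OF gk_holo l(3)])
  moreover have "W \<subseteq> \<phi> ` U" "\<phi> p \<in> W" using k l unfolding W_def by auto
  ultimately show "\<exists>(U, \<phi>)\<in>atlas M. \<exists>(V, \<psi>)\<in>atlas N. \<exists>W. W \<subseteq> \<phi> ` U \<and>
        p \<in> U \<and> \<phi> p \<in> W \<and> F ` inv_into U \<phi> ` W \<subseteq> V \<and> holo_on (\<psi> \<circ> F \<circ> inv_into U \<phi>) W"
    using U F_in
    by (intro bexI[OF _ U(1)] bexI[OF _ U'(1)] case_prodI exI[of _ W]) auto
qed

text \<open>A bijection that carries charts to charts is the identity in coordinates, and so is its
  inverse.\<close>

lemma biholomorphicI:
  fixes M :: "('a, 'm::complex_space) cmfd" and N :: "('b, 'm::complex_space) cmfd"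
  assumes M: "premanifold M" and N: "premanifold N" and bij: "bij_betw F (pts M) (pts N)"
    and loc: "\<And>p. p \<in> pts M \<Longrightarrow> \<exists>V \<sigma>. chart M V \<sigma> \<and> p \<in> \<sigma> ` V \<and> chart N V (F \<circ> \<sigma>)"
  shows "biholomorphic M N F"
  unfolding biholomorphic_def
proof (intro conjI bij)
  show "holomorphic_map M N F"
  proof (rule holomorphic_mapI[OF M N])
    fix p assume "p \<in> pts M"
    then obtain V \<sigma> v where c: "chart M V \<sigma>" "v \<in> V" "\<sigma> v = p" "chart N V (F \<circ> \<sigma>)" using loc by blast
    then show "\<exists>V \<sigma> V' \<sigma>' v g. chart M V \<sigma> \<and> chart N V' \<sigma>' \<and> v \<in> V \<and> \<sigma> v = p \<and>
      holo_on g V \<and> g ` V \<subseteq> V' \<and> (\<forall>u\<in>V. F (\<sigma> u) = \<sigma>' (g u))"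
      using holo_on_id[OF chartD(1)[OF c(1)]]
      by (intro exI[of _ V] exI[of _ \<sigma>] exI[of _ "F \<circ> \<sigma>"] exI[of _ v] exI[of _ "\<lambda>x. x"]) simp
  qed (use bij in \<open>auto simp: bij_betw_def\<close>)
  show "holomorphic_map N M (inv_into (pts M) F)"
  proof (rule holomorphic_mapI[OF N M])
    fix q assume q: "q \<in> pts N"
    define p where "p = inv_into (pts M) F q"
    have p: "p \<in> pts M" "F p = q" unfolding p_def
      using bij q by (auto simp: bij_betw_def inv_into_into f_inv_into_f)
    obtain V \<sigma> v where c: "chart M V \<sigma>" "v \<in> V" "\<sigma> v = p" "chart N V (F \<circ> \<sigma>)" using loc[OF p(1)] by blast
    have "inv_into (pts M) F ((F \<circ> \<sigma>) u) = \<sigma> u" if "u \<in> V" for u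
      using bij chartD(3)[OF c(1)] that by (auto simp: bij_betw_def image_subset_iff)
    then show "\<exists>V \<sigma> V' \<sigma>' v g. chart N V \<sigma> \<and> chart M V' \<sigma>' \<and> v \<in> V \<and> \<sigma> v = q \<and>
      holo_on g V \<and> g ` V \<subseteq> V' \<and> (\<forall>u\<in>V. inv_into (pts M) F (\<sigma> u) = \<sigma>' (g u))"
      using c p holo_on_id[OF chartD(1)[OF c(1)]]
      by (intro exI[of _ V] exI[of _ "F \<circ> \<sigma>"] exI[of _ \<sigma>] exI[of _ v] exI[of _ "\<lambda>x. x"]) simp
  qed (use bij in \<open>auto simp: bij_betw_def inv_into_into\<close>)
qed

text \<open>Works with the literal atlases, as is convenient for \<open>P1\<close>,
  \<open>P2\<close>, \<open>Bl0\<close> and \<open>curve_mfd\<close>. If the coordinates of p and of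
  its image agree on W, both local expressions are the identity there.\<close>

lemma biholomorphic_atlasI:
  fixes M :: "('a, 'm::complex_space) cmfd" and N :: "('b, 'm::complex_space) cmfd"
  assumes bij: "bij_betw F (pts M) (pts N)"
    and loc: "\<And>p. p \<in> pts M \<Longrightarrow> \<exists>U \<phi> U' \<psi> W. (U, \<phi>) \<in> atlas M \<and> (U', \<psi>) \<in> atlas N \<and> p \<in> U \<and>
      U \<subseteq> pts M \<and> inj_on \<phi> U \<and> inj_on \<psi> U' \<and> open W \<and> \<phi> p \<in> W \<and> W \<subseteq> \<phi> ` U \<and>
      (\<forall>q\<in>U. \<phi> q \<in> W \<longrightarrow> F q \<in> U' \<and> \<psi> (F q) = \<phi> q)"
  shows "biholomorphic M N F"
  unfolding biholomorphic_def
proof (intro conjI bij)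
  show "holomorphic_map M N F"
    unfolding holomorphic_map_def
  proof (intro conjI ballI)
    show "F ` pts M \<subseteq> pts N" using bij by (auto simp: bij_betw_def)
    fix p assume p: "p \<in> pts M"
    obtain U \<phi> U' \<psi> W where h: "(U, \<phi>) \<in> atlas M" "(U', \<psi>) \<in> atlas N" "p \<in> U" "inj_on \<phi> U"
      "open W" "\<phi> p \<in> W" "W \<subseteq> \<phi> ` U" "\<And>q. q \<in> U \<Longrightarrow> \<phi> q \<in> W \<Longrightarrow> F q \<in> U' \<and> \<psi> (F q) = \<phi> q"
      using loc[OF p] by metis
    have i: "inv_into U \<phi> x \<in> U" "\<phi> (inv_into U \<phi> x) = x" if "x \<in> W" for x
      using that h(7) by (auto simp: inv_into_into f_inv_into_f)
    have "holo_on (\<psi> \<circ> F \<circ> inv_into U \<phi>) W"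
      by (rule holo_on_cong[OF holo_on_id[OF h(5)]]) (use h(8) i in auto)
    moreover have "F ` inv_into U \<phi> ` W \<subseteq> U'" using h(8) i by auto
    ultimately show "\<exists>(U, \<phi>)\<in>atlas M. \<exists>(V, \<psi>)\<in>atlas N. \<exists>W. W \<subseteq> \<phi> ` U \<and>
        p \<in> U \<and> \<phi> p \<in> W \<and> F ` inv_into U \<phi> ` W \<subseteq> V \<and> holo_on (\<psi> \<circ> F \<circ> inv_into U \<phi>) W"
      using h(3,6,7) by (intro bexI[OF _ h(1)] bexI[OF _ h(2)] case_prodI exI[of _ W]) auto
  qed
  show "holomorphic_map N M (inv_into (pts M) F)"
    unfolding holomorphic_map_def
  proof (intro conjI ballI)
    show "inv_into (pts M) F ` pts N \<subseteq> pts M" using bij by (auto simp: bij_betw_def inv_into_into)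
    fix q assume q: "q \<in> pts N"
    define p where "p = inv_into (pts M) F q"
    have p: "p \<in> pts M" "F p = q" unfolding p_def
      using bij q by (auto simp: bij_betw_def inv_into_into f_inv_into_f)
    obtain U \<phi> U' \<psi> W where h: "(U, \<phi>) \<in> atlas M" "(U', \<psi>) \<in> atlas N" "p \<in> U" "U \<subseteq> pts M" "inj_on \<phi> U"
      "inj_on \<psi> U'"
      "open W" "\<phi> p \<in> W" "W \<subseteq> \<phi> ` U" "\<And>q. q \<in> U \<Longrightarrow> \<phi> q \<in> W \<Longrightarrow> F q \<in> U' \<and> \<psi> (F q) = \<phi> q"
      using loc[OF p(1)] by metis
    have i: "inv_into U \<phi> x \<in> U" "\<phi> (inv_into U \<phi> x) = x" if "x \<in> W" for x
      using that h(9) by (auto simp: inv_into_into f_inv_into_f)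
    have j: "F (inv_into U \<phi> x) \<in> U'" "\<psi> (F (inv_into U \<phi> x)) = x" if "x \<in> W" for x
      using h(10)[OF i(1)[OF that]] i[OF that] that by auto
    have k: "inv_into U' \<psi> x = F (inv_into U \<phi> x)" if "x \<in> W" for x
      using j[OF that] h(6) by (metis inv_into_f_eq)
    have m: "inv_into (pts M) F (inv_into U' \<psi> x) = inv_into U \<phi> x" if "x \<in> W" for x
      unfolding k[OF that] using bij i(1)[OF that] h(4) by (auto simp: bij_betw_def)
    have "holo_on (\<phi> \<circ> inv_into (pts M) F \<circ> inv_into U' \<psi>) W"
      by (rule holo_on_cong[OF holo_on_id[OF h(7)]]) (simp add: m i)
    moreover have "inv_into (pts M) F ` inv_into U' \<psi> ` W \<subseteq> U" using m i by auto
    moreover have "W \<subseteq> \<psi> ` U'" using j by force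
    moreover have "q \<in> U'" "\<psi> q \<in> W" using h(10)[OF h(3) h(8)] h(8) p(2) by auto
    ultimately show "\<exists>(U, \<phi>)\<in>atlas N. \<exists>(V, \<psi>)\<in>atlas M. \<exists>W. W \<subseteq> \<phi> ` U \<and> q \<in> U \<and> \<phi> q \<in> W \<and>
        inv_into (pts M) F ` inv_into U \<phi> ` W \<subseteq> V \<and> holo_on (\<psi> \<circ> inv_into (pts M) F \<circ> inv_into U \<phi>) W"
      by (intro bexI[OF _ h(2)] bexI[OF _ h(1)] case_prodI exI[of _ W]) auto
  qed
qed

section \<open>Open submanifolds and coordinate charts\<close>

lemma pts_restrict [simp]: "pts (restrict_mfd M W) = pts M \<inter> W"
  by (simp add: restrict_mfd_def)

lemma atlas_restrict: "(U', \<phi>) \<in> atlas (restrict_mfd M W) \<longleftrightarrow> (\<exists>U. (U, \<phi>) \<in> atlas M \<and> U' = U \<inter> W)"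
  by (auto simp: restrict_mfd_def)

lemma inv_into_subset: "inj_on f B \<Longrightarrow> A \<subseteq> B \<Longrightarrow> x \<in> f ` A \<Longrightarrow> inv_into A f x = inv_into B f x"
  by (auto simp: inj_on_subset subsetD)

text \<open>Restricting an atlas chart replaces \<open>inv_into U \<phi>\<close> by
  \<open>inv_into A \<phi>\<close>. The two functions agree only on the image of A, which explains
  the detour through \<open>transits_cong\<close>.\<close>

lemma transits_restrict:
  assumes "transits V \<sigma> (\<phi> ` U) (inv_into U \<phi>)" "inj_on \<phi> U" "A \<subseteq> U" "open (\<phi> ` A)"
  shows "transits V \<sigma> (\<phi> ` A) (inv_into A \<phi>)"
  by (rule transits_cong[OF transits_subset_target[OF assms(1,4)]])
    (use assms inv_into_subset[of \<phi> U A] in \<open>auto simp: inj_on_inv_into\<close>)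

lemma transits_restrict':
  assumes "transits (\<phi> ` U) (inv_into U \<phi>) V \<sigma>" "inj_on \<phi> U" "A \<subseteq> U" "open (\<phi> ` A)"
  shows "transits (\<phi> ` A) (inv_into A \<phi>) V \<sigma>"
  by (rule transits_cong[OF transits_subset[OF assms(1,4)]])
    (use assms inv_into_subset[of \<phi> U A] in auto)

lemma premanifold_restrict:
  assumes M: "premanifold M" and W: "openin (mtop M) (pts M \<inter> W)"
  shows "premanifold (restrict_mfd M W)"
proof -
  have o: "open (\<phi> ` (U \<inter> W))" if "(U, \<phi>) \<in> atlas M" for U \<phi>
  proof -
    have "pts M \<inter> W \<inter> U = U \<inter> W" using premanifoldD(1)[OF M that] by auto
    then show ?thesis using W that openin_mtop[OF M] by auto
  qed
  have "transits (\<phi> ` (U \<inter> W)) (inv_into (U \<inter> W) \<phi>) (\<psi> ` (V \<inter> W)) (inv_into (V \<inter> W) \<psi>)"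
    if "(U, \<phi>) \<in> atlas M" "(V, \<psi>) \<in> atlas M" for U \<phi> V \<psi>
    by (rule transits_restrict[OF transits_restrict'[OF premanifold_transits[OF M that]]])
      (use premanifoldD[OF M that(1)] premanifoldD[OF M that(2)] o that in auto)
  moreover have "U \<inter> W \<subseteq> pts M \<inter> W \<and> inj_on \<phi> (U \<inter> W) \<and> open (\<phi> ` (U \<inter> W))"
    if "(U, \<phi>) \<in> atlas M" for U \<phi>
    using premanifoldD[OF M that] o[OF that] by (auto intro: inj_on_subset)
  moreover have "(\<Union>(U, \<phi>)\<in>atlas (restrict_mfd M W). U) = pts M \<inter> W"
    using M unfolding premanifold_def restrict_mfd_def by auto
  ultimately show ?thesis
    unfolding premanifold_def by (auto simp: atlas_restrict)
qed

lemma chart_restrict: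
  assumes M: "premanifold M" and W: "openin (mtop M) (pts M \<inter> W)" and c: "chart M V \<sigma>" "\<sigma> ` V \<subseteq> W"
  shows "chart (restrict_mfd M W) V \<sigma>"
proof -
  have "transits V \<sigma> (\<phi> ` (U \<inter> W)) (inv_into (U \<inter> W) \<phi>)" "transits (\<phi> ` (U \<inter> W)) (inv_into (U \<inter> W) \<phi>) V \<sigma>"
    if U: "(U, \<phi>) \<in> atlas M" for U \<phi>
  proof -
    have "pts M \<inter> W \<inter> U = U \<inter> W" using premanifoldD(1)[OF M U] by auto
    then have "open (\<phi> ` (U \<inter> W))" using W U openin_mtop[OF M] by auto
    then show "transits V \<sigma> (\<phi> ` (U \<inter> W)) (inv_into (U \<inter> W) \<phi>)" "transits (\<phi> ` (U \<inter> W)) (inv_into (U \<inter> W) \<phi>) V \<sigma>"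
      using transits_restrict[OF chartD(4)[OF c(1) U] premanifoldD(2)[OF M U]]
        transits_restrict'[OF chartD(5)[OF c(1) U] premanifoldD(2)[OF M U]] by auto
  qed
  then show ?thesis using c(2) chartD(1-3)[OF c(1)] unfolding chart_def by (auto simp: atlas_restrict)
qed

lemma premanifold_open_mfd: "open V \<Longrightarrow> premanifold (open_mfd V)"
  by (auto simp: premanifold_def open_mfd_def transits_refl)

lemma chart_open_mfd: "open V \<Longrightarrow> chart (open_mfd V) V (\<lambda>x. x)"
  using chart_atlas[of "open_mfd V" V "\<lambda>x. x"] premanifold_open_mfd[of V]
  by (auto simp: open_mfd_def intro!: chart_cong[of _ _ "inv_into V (\<lambda>x. x)"])

lemma coord_chartI:
  assumes M: "premanifold M" and c: "chart M V \<sigma>" and \<kappa>: "\<And>v. v \<in> V \<Longrightarrow> \<kappa> (\<sigma> v) = v"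
  shows "coord_chart M (\<sigma> ` V) \<kappa>"
proof -
  have o: "openin (mtop M) (\<sigma> ` V)" by (rule openin_chart_image[OF M c chartD(1)[OF c] order_refl])
  have i: "\<kappa> ` \<sigma> ` V = V" using \<kappa> by (auto simp: image_image)
  have p: "pts M \<inter> \<sigma> ` V = \<sigma> ` V" using chartD(3)[OF c] by auto
  have "biholomorphic (restrict_mfd M (\<sigma> ` V)) (open_mfd V) \<kappa>"
  proof (rule biholomorphicI)
    show "premanifold (restrict_mfd M (\<sigma> ` V))" by (rule premanifold_restrict[OF M]) (simp add: p o)
    show "premanifold (open_mfd V)" by (rule premanifold_open_mfd[OF chartD(1)[OF c]])
    show "bij_betw \<kappa> (pts (restrict_mfd M (\<sigma> ` V))) (pts (open_mfd V))"
      using \<kappa> by (auto simp: p open_mfd_def bij_betw_def i inj_on_def)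
    fix q assume "q \<in> pts (restrict_mfd M (\<sigma> ` V))"
    then have "q \<in> \<sigma> ` V" by (simp add: p)
    moreover have "chart (restrict_mfd M (\<sigma> ` V)) V \<sigma>"
      by (rule chart_restrict[OF M _ c]) (simp_all add: p o)
    moreover have "chart (open_mfd V) V (\<kappa> \<circ> \<sigma>)"
      by (rule chart_cong[OF chart_open_mfd[OF chartD(1)[OF c]]]) (simp add: \<kappa>)
    ultimately show "\<exists>W \<tau>. chart (restrict_mfd M (\<sigma> ` V)) W \<tau> \<and> q \<in> \<tau> ` W \<and> chart (open_mfd V) W (\<kappa> \<circ> \<tau>)"
      by (intro exI[of _ V] exI[of _ \<sigma>] conjI)
  qed
  then show ?thesis unfolding coord_chart_def i using o chartD(1)[OF c] by simp
qed

section \<open>Blowing up a point of a surface\<close>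

lemma mem_line: "v \<in> line (a, b) \<longleftrightarrow> (\<exists>c. v = (c * a, c * (b::complex)))" for a :: complex
  by (auto simp: line_def cscale_prod_def cscale_complex_def)

lemma line_self: "(a, b) \<in> line (a, b)" for a b :: complex
  unfolding mem_line by (intro exI[of _ 1]) simp

lemma one_mem_line [simp]: "(1 :: complex, w) \<in> line (1, z) \<longleftrightarrow> w = z" for w z :: complex
  using line_self[of 1 z] mem_line[of "(1, w)" 1 z] by auto

lemma mem_line_one [simp]: "(w, 1 :: complex) \<in> line (z, 1) \<longleftrightarrow> w = z" for w z :: complex
  using line_self[of z 1] mem_line[of "(w, 1)" z 1] by auto

lemma line_one_eq [simp]: "line (1 :: complex, w) = line (1, z) \<longleftrightarrow> w = z" for w z :: complex
  using one_mem_line[of w z] line_self[of 1 w] by metis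

lemma line_eq_one [simp]: "line (w, 1 :: complex) = line (z, 1) \<longleftrightarrow> w = z" for w z :: complex
  using mem_line_one[of w z] line_self[of w 1] by metis

lemma line_scale: "c \<noteq> 0 \<Longrightarrow> line (c * a, c * b) = line (a, b)" for a b c :: complex
proof (intro set_eqI)
  fix v :: "complex \<times> complex" assume c: "c \<noteq> 0"
  show "v \<in> line (c * a, c * b) \<longleftrightarrow> v \<in> line (a, b)"
    unfolding mem_line
  proof
    assume "\<exists>d. v = (d * (c * a), d * (c * b))"
    then obtain d where "v = (d * (c * a), d * (c * b))" by auto
    then show "\<exists>e. v = (e * a, e * b)" by (intro exI[of _ "d * c"]) simp
  next
    assume "\<exists>e. v = (e * a, e * b)"
    then obtain e where "v = (e * a, e * b)" by auto
    then show "\<exists>d. v = (d * (c * a), d * (c * b))" using c by (intro exI[of _ "e / c"]) simp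
  qed
qed

lemma line_one_eq_line_one [simp]: "line (1, w) = line (z, 1) \<longleftrightarrow> w * z = 1" for w z :: complex
proof
  assume "line (1, w) = line (z, 1)"
  then have "(z, 1) \<in> line (1, w)" using line_self[of z 1] by metis
  then show "w * z = 1" by (auto simp: mem_line mult.commute)
next
  assume *: "w * z = 1"
  then have "z \<noteq> 0" by auto
  from line_scale[OF this, of 1 w] * show "line (1, w) = line (z, 1)" by (simp add: mult.commute)
qed

lemma line_eq_line_one [simp]: "line (z, 1) = line (1, w) \<longleftrightarrow> w * z = 1" for w z :: complex
  using line_one_eq_line_one[of w z] by (metis mult.commute)

lemma pts_P1: "pts P1 = range (\<lambda>z. line (1, z)) \<union> range (\<lambda>z. line (z, 1))"
proof -
  have "line v \<in> range (\<lambda>z. line (1, z)) \<union> range (\<lambda>z. line (z, 1))" if "v \<noteq> 0" for v :: "complex \<times> complex"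
  proof (cases v)
    case (Pair a b)
    show ?thesis
    proof (cases "a = 0")
      case True
      then have "b \<noteq> 0" using that Pair by (simp add: zero_prod_def)
      then have "line v = line (0, 1)" using line_scale[of b 0 1] True Pair by simp
      then show ?thesis by auto
    next
      case False
      then have "line v = line (1, b / a)" using line_scale[of a 1 "b / a"] Pair by simp
      then show ?thesis by auto
    qed
  qed
  moreover have "(1 :: complex, z) \<noteq> 0" "(z, 1 :: complex) \<noteq> 0" for z :: complex by (auto simp: zero_prod_def)
  ultimately show ?thesis unfolding P1_def by fastforce
qed

lemma line_mem_P1: "line (1, z) \<in> pts P1" "line (z, 1) \<in> pts P1"
  by (auto simp: pts_P1)

text \<open>The exceptional point with direction \<open>l\<close> is \<open>E l\<close>; the parametrization \<open>\<sigma>\<close> of a neighbourhood of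
  the blown-up point \<open>\<sigma> 0\<close> lifts to the two affine charts of the blow-up.\<close>

definition lift_A :: "(complex \<times> complex \<Rightarrow> 'a) \<Rightarrow> ((complex \<times> complex) set \<Rightarrow> 'a) \<Rightarrow> complex \<times> complex \<Rightarrow> 'a" where
  "lift_A \<sigma> E = (\<lambda>(a, b). if a = 0 then E (line (1, b)) else \<sigma> (a, a * b))"

definition lift_B :: "(complex \<times> complex \<Rightarrow> 'a) \<Rightarrow> ((complex \<times> complex) set \<Rightarrow> 'a) \<Rightarrow> complex \<times> complex \<Rightarrow> 'a" where
  "lift_B \<sigma> E = (\<lambda>(a, b). if a = 0 then E (line (b, 1)) else \<sigma> (a * b, a))"

definition dom_A :: "(complex \<times> complex) set \<Rightarrow> (complex \<times> complex) set" where
  "dom_A V = {(a, b). (a, a * b) \<in> V}"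

definition dom_B :: "(complex \<times> complex) set \<Rightarrow> (complex \<times> complex) set" where
  "dom_B V = {(a, b). (a * b, a) \<in> V}"

text \<open>The centre is replaced by new points of the same type, and all other points keep their
  names. Hence a parametrization that avoids the centre describes the same points before and after
  the blow-up, with no map in between.\<close>

definition blow_up :: "('a, complex \<times> complex) cmfd \<Rightarrow> (complex \<times> complex) set \<Rightarrow> (complex \<times> complex \<Rightarrow> 'a) \<Rightarrow>
    ((complex \<times> complex) set \<Rightarrow> 'a) \<Rightarrow> ('a, complex \<times> complex) cmfd" where
  "blow_up S V \<sigma> E =
     \<lparr>pts = (pts S - {\<sigma> 0}) \<union> E ` pts P1,
      atlas = (\<lambda>(U, \<phi>). (U - {\<sigma> 0}, \<phi>)) ` atlas S \<union>
        {(lift_A \<sigma> E ` dom_A V, inv_into (dom_A V) (lift_A \<sigma> E)),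
         (lift_B \<sigma> E ` dom_B V, inv_into (dom_B V) (lift_B \<sigma> E))}\<rparr>"

definition blow_down :: "(complex \<times> complex \<Rightarrow> 'a) \<Rightarrow> ((complex \<times> complex) set \<Rightarrow> 'a) \<Rightarrow> 'a \<Rightarrow> 'a" where
  "blow_down \<sigma> E q = (if q \<in> E ` pts P1 then \<sigma> 0 else q)"

lemma Pair_zero: "(0 :: complex \<times> complex) = (0, 0)" by (simp add: zero_prod_def)

lemma open_dom_A: "open V \<Longrightarrow> open (dom_A V)"
  unfolding dom_A_def case_prod_beta
  by (rule open_vimage[where f = "\<lambda>p. (fst p, fst p * snd p)", unfolded vimage_def])
    (auto intro!: continuous_intros)

lemma open_dom_B: "open V \<Longrightarrow> open (dom_B V)"
  unfolding dom_B_def case_prod_beta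
  by (rule open_vimage[where f = "\<lambda>p. (fst p * snd p, fst p)", unfolded vimage_def])
    (auto intro!: continuous_intros)

text \<open>A countable atlas is carried along because it visibly remains countable under
  \<open>blow_up\<close>, and second countability follows from it.\<close>

locale blowing_up =
  fixes S :: "('a, complex \<times> complex) cmfd" and V \<sigma> and E :: "(complex \<times> complex) set \<Rightarrow> 'a"
  assumes S: "complex_manifold S" and countable_atlas: "countable (atlas S)"
    and ch: "chart S V \<sigma>" and zero: "0 \<in> V"
    and inj_E: "inj_on E (pts P1)" and fresh: "E ` pts P1 \<inter> pts S = {}"
begin

abbreviation "\<sigma>A \<equiv> lift_A \<sigma> E"
abbreviation "\<sigma>B \<equiv> lift_B \<sigma> E"
abbreviation "VA \<equiv> dom_A V"
abbreviation "VB \<equiv> dom_B V"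
abbreviation "S' \<equiv> blow_up S V \<sigma> E"
abbreviation "\<beta> \<equiv> blow_down \<sigma> E"
abbreviation "p \<equiv> \<sigma> 0"

lemma pre: "premanifold S" using S by (simp add: complex_manifold_iff)

lemma \<sigma>_eq: "u \<in> V \<Longrightarrow> v \<in> V \<Longrightarrow> \<sigma> u = \<sigma> v \<longleftrightarrow> u = v"
  using chartD(2)[OF ch] by (auto dest: inj_onD)

lemma \<sigma>_pts: "u \<in> V \<Longrightarrow> \<sigma> u \<in> pts S"
  using chartD(3)[OF ch] by auto

lemma E_eq: "l \<in> pts P1 \<Longrightarrow> m \<in> pts P1 \<Longrightarrow> E l = E m \<longleftrightarrow> l = m"
  using inj_E by (auto dest: inj_onD)

lemma E_notin: "l \<in> pts P1 \<Longrightarrow> E l \<notin> pts S"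
  using fresh by auto

lemma p_pts: "p \<in> pts S" by (rule \<sigma>_pts[OF zero])

lemma E_neq: "l \<in> pts P1 \<Longrightarrow> q \<in> pts S \<Longrightarrow> E l \<noteq> q" "l \<in> pts P1 \<Longrightarrow> q \<in> pts S \<Longrightarrow> q \<noteq> E l"
  using E_notin by auto

section \<open>The two lifted parametrizations and their transitions\<close>

lemma inj_A: "inj_on \<sigma>A VA"
  by (rule inj_onI)
    (auto simp: lift_A_def dom_A_def E_eq E_neq line_mem_P1 \<sigma>_pts \<sigma>_eq split: if_splits)

lemma inj_B: "inj_on \<sigma>B VB"
  by (rule inj_onI)
    (auto simp: lift_B_def dom_B_def E_eq E_neq line_mem_P1 \<sigma>_pts \<sigma>_eq split: if_splits)

lemma \<sigma>A_pts: "v \<in> VA \<Longrightarrow> \<sigma>A v \<in> pts S'"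
  using zero imageI[OF line_mem_P1(1), of E]
  by (cases "fst v = 0") (auto simp: lift_A_def dom_A_def blow_up_def case_prod_beta \<sigma>_pts \<sigma>_eq Pair_zero)

lemma \<sigma>B_pts: "v \<in> VB \<Longrightarrow> \<sigma>B v \<in> pts S'"
  using zero imageI[OF line_mem_P1(2), of E]
  by (cases "fst v = 0") (auto simp: lift_B_def dom_B_def blow_up_def case_prod_beta \<sigma>_pts \<sigma>_eq Pair_zero)

text \<open>Off the exceptional curve the lift A runs through the part of V with nonzero first
  coordinate, the lift B through the part with nonzero second coordinate. These two pieces are the
  middle charts through which the lifts are compared with all old charts.\<close>

lemma chart_V1: "chart S {v\<in>V. fst v \<noteq> 0} \<sigma>" and chart_V2: "chart S {v\<in>V. snd v \<noteq> 0} \<sigma>"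
proof -
  have "{v\<in>V. fst v \<noteq> 0} = V \<inter> {v. fst v \<noteq> 0}" "{v\<in>V. snd v \<noteq> 0} = V \<inter> {v. snd v \<noteq> 0}" by auto
  then have "open {v\<in>V. fst v \<noteq> 0}" "open {v\<in>V. snd v \<noteq> 0}"
    using chartD(1)[OF ch] by (auto intro!: open_Int open_Collect_neq continuous_intros)
  then show "chart S {v\<in>V. fst v \<noteq> 0} \<sigma>" "chart S {v\<in>V. snd v \<noteq> 0} \<sigma>"
    by (auto intro: chart_subset[OF ch])
qed

lemma transits_V1_A: "transits {v\<in>V. fst v \<noteq> 0} \<sigma> VA \<sigma>A"
proof (rule transitsI, rule exI, rule exI, intro conjI)
  show "holo_on (\<lambda>v. (fst v, snd v / fst v)) {v\<in>V. fst v \<noteq> 0}"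
    using chartD(1)[OF chart_V1] by (auto simp: holo_on_iff_cdiff intro!: cdiff_intros)
qed (auto simp: lift_A_def dom_A_def)

lemma transits_V2_B: "transits {v\<in>V. snd v \<noteq> 0} \<sigma> VB \<sigma>B"
proof (rule transitsI, rule exI, rule exI, intro conjI)
  show "holo_on (\<lambda>v. (snd v, fst v / snd v)) {v\<in>V. snd v \<noteq> 0}"
    using chartD(1)[OF chart_V2] by (auto simp: holo_on_iff_cdiff intro!: cdiff_intros)
qed (auto simp: lift_B_def dom_B_def)

lemma open_VA: "open VA" and open_VB: "open VB"
  using chartD(1)[OF ch] by (auto intro: open_dom_A open_dom_B)

lemma open_neq0: "open {v\<in>VA. fst v \<noteq> 0}" "open {v\<in>VB. fst v \<noteq> 0}"
   "open {v\<in>VA. snd v \<noteq> 0}" "open {v\<in>VB. snd v \<noteq> 0}"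
proof -
  have "{v\<in>W. fst v \<noteq> 0} = W \<inter> {v. fst v \<noteq> 0}" "{v\<in>W. snd v \<noteq> 0} = W \<inter> {v. snd v \<noteq> 0}"
    for W :: "(complex \<times> complex) set" by auto
  then show "open {v\<in>VA. fst v \<noteq> 0}" "open {v\<in>VB. fst v \<noteq> 0}"
   "open {v\<in>VA. snd v \<noteq> 0}" "open {v\<in>VB. snd v \<noteq> 0}"
    using open_VA open_VB by (auto intro!: open_Int open_Collect_neq continuous_intros)
qed

lemma \<sigma>A_notin: "v \<in> VA \<Longrightarrow> \<sigma>A v \<in> pts S \<longleftrightarrow> fst v \<noteq> 0"
  and \<sigma>B_notin: "v \<in> VB \<Longrightarrow> \<sigma>B v \<in> pts S \<longleftrightarrow> fst v \<noteq> 0"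
  by (auto simp: lift_A_def lift_B_def dom_A_def dom_B_def E_notin line_mem_P1 \<sigma>_pts)

lemma transits_A_V1: "transits VA \<sigma>A {v\<in>V. fst v \<noteq> 0} \<sigma>"
proof (rule transitsI, rule exI, rule exI, intro conjI)
  fix v assume v: "v \<in> VA" "\<sigma>A v \<in> \<sigma> ` {v\<in>V. fst v \<noteq> 0}"
  show "holo_on (\<lambda>v. (fst v, fst v * snd v)) {v\<in>VA. fst v \<noteq> 0}"
    using open_neq0 by (auto simp: holo_on_iff_cdiff intro!: cdiff_intros)
  have "\<sigma>A v \<in> pts S" using v(2) \<sigma>_pts by auto
  then show "v \<in> {v\<in>VA. fst v \<noteq> 0}" using v(1) \<sigma>A_notin by auto
qed (auto simp: lift_A_def dom_A_def)

lemma transits_B_V2: "transits VB \<sigma>B {v\<in>V. snd v \<noteq> 0} \<sigma>"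
proof (rule transitsI, rule exI, rule exI, intro conjI)
  fix v assume v: "v \<in> VB" "\<sigma>B v \<in> \<sigma> ` {v\<in>V. snd v \<noteq> 0}"
  show "holo_on (\<lambda>v. (fst v * snd v, fst v)) {v\<in>VB. fst v \<noteq> 0}"
    using open_neq0 by (auto simp: holo_on_iff_cdiff intro!: cdiff_intros)
  have "\<sigma>B v \<in> pts S" using v(2) \<sigma>_pts by auto
  then show "v \<in> {v\<in>VB. fst v \<noteq> 0}" using v(1) \<sigma>B_notin by auto
qed (auto simp: lift_B_def dom_B_def)

lemma \<sigma>A_image: "q \<in> pts S \<Longrightarrow> q \<in> \<sigma>A ` VA \<Longrightarrow> q \<in> \<sigma> ` {v\<in>V. fst v \<noteq> 0}"
proof -
  assume q: "q \<in> pts S" "q \<in> \<sigma>A ` VA"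
  then obtain v where v: "v \<in> VA" "q = \<sigma>A v" by auto
  then have "fst v \<noteq> 0" using \<sigma>A_notin q by auto
  then have "q = \<sigma> (fst v, fst v * snd v)" using v by (simp add: lift_A_def case_prod_beta)
  moreover have "(fst v, fst v * snd v) \<in> {v\<in>V. fst v \<noteq> 0}"
    using v \<open>fst v \<noteq> 0\<close> by (auto simp: dom_A_def)
  ultimately show ?thesis by blast
qed

lemma \<sigma>B_image: "q \<in> pts S \<Longrightarrow> q \<in> \<sigma>B ` VB \<Longrightarrow> q \<in> \<sigma> ` {v\<in>V. snd v \<noteq> 0}"
proof -
  assume q: "q \<in> pts S" "q \<in> \<sigma>B ` VB"
  then obtain v where v: "v \<in> VB" "q = \<sigma>B v" by auto
  then have "fst v \<noteq> 0" using \<sigma>B_notin q by auto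
  then have "q = \<sigma> (fst v * snd v, fst v)" using v by (simp add: lift_B_def case_prod_beta)
  moreover have "(fst v * snd v, fst v) \<in> {v\<in>V. snd v \<noteq> 0}"
    using v \<open>fst v \<noteq> 0\<close> by (auto simp: dom_B_def)
  ultimately show ?thesis by blast
qed

lemma transits_chart_A: "chart S W \<tau> \<Longrightarrow> transits W \<tau> VA \<sigma>A"
  using chartD(3) \<sigma>A_image
  by (intro transitsI transits_trans[OF chart_transits[OF pre _ chart_V1] transits_V1_A]) blast+

lemma transits_chart_B: "chart S W \<tau> \<Longrightarrow> transits W \<tau> VB \<sigma>B"
  using chartD(3) \<sigma>B_image
  by (intro transitsI transits_trans[OF chart_transits[OF pre _ chart_V2] transits_V2_B]) blast+

lemma transits_A_chart: "chart S W \<tau> \<Longrightarrow> transits VA \<sigma>A W \<tau>"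
  using chartD(3) \<sigma>A_image
  by (intro transitsI transits_trans[OF transits_A_V1 chart_transits[OF pre chart_V1]]) blast+

lemma transits_B_chart: "chart S W \<tau> \<Longrightarrow> transits VB \<sigma>B W \<tau>"
  using chartD(3) \<sigma>B_image
  by (intro transitsI transits_trans[OF transits_B_V2 chart_transits[OF pre chart_V2]]) blast+

lemma \<sigma>A_in_B: "v \<in> VA \<Longrightarrow> \<sigma>A v \<in> \<sigma>B ` VB \<Longrightarrow> snd v \<noteq> 0"
  by (auto simp: lift_A_def lift_B_def dom_A_def dom_B_def E_eq E_neq line_mem_P1 \<sigma>_pts \<sigma>_eq split: if_splits)

lemma \<sigma>B_in_A: "v \<in> VB \<Longrightarrow> \<sigma>B v \<in> \<sigma>A ` VA \<Longrightarrow> snd v \<noteq> 0"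
  by (auto simp: lift_A_def lift_B_def dom_A_def dom_B_def E_eq E_neq line_mem_P1 \<sigma>_pts \<sigma>_eq split: if_splits)

lemma E_line_inverse: "z \<noteq> 0 \<Longrightarrow> E (line (1, 1 / z)) = E (line (z, 1))"
    "z \<noteq> 0 \<Longrightarrow> E (line (1 / z, 1)) = E (line (1, z))"
  by (simp_all add: E_eq line_mem_P1)

text \<open>Off the exceptional curve (a, a b) = (c d, c) means c = a b and d = 1/b. On it the same
  formula expresses [1 : b] = [1/b : 1].\<close>

lemma transits_A_B: "transits VA \<sigma>A VB \<sigma>B"
proof (rule transitsI, rule exI, rule exI, intro conjI)
  fix v assume v: "v \<in> VA" "\<sigma>A v \<in> \<sigma>B ` VB"
  show "holo_on (\<lambda>v. (fst v * snd v, 1 / snd v)) {v\<in>VA. snd v \<noteq> 0}"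
    using open_neq0 by (auto simp: holo_on_iff_cdiff intro!: cdiff_intros)
  show "v \<in> {v\<in>VA. snd v \<noteq> 0}" using \<sigma>A_in_B v by auto
qed (auto simp: lift_A_def lift_B_def dom_A_def dom_B_def E_line_inverse)

lemma transits_B_A: "transits VB \<sigma>B VA \<sigma>A"
proof (rule transitsI, rule exI, rule exI, intro conjI)
  fix v assume v: "v \<in> VB" "\<sigma>B v \<in> \<sigma>A ` VA"
  show "holo_on (\<lambda>v. (fst v * snd v, 1 / snd v)) {v\<in>VB. snd v \<noteq> 0}"
    using open_neq0 by (auto simp: holo_on_iff_cdiff intro!: cdiff_intros)
  show "v \<in> {v\<in>VB. snd v \<noteq> 0}" using \<sigma>B_in_A v by auto
qed (auto simp: lift_A_def lift_B_def dom_A_def dom_B_def E_line_inverse)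

section \<open>The atlas of the blow-up\<close>

lemma chart_old:
  assumes "(U, \<phi>) \<in> atlas S"
  shows "chart S (\<phi> ` (U - {p})) (inv_into (U - {p}) \<phi>)" "inj_on \<phi> (U - {p})" "open (\<phi> ` (U - {p}))"
proof -
  note u = premanifoldD[OF pre assms]
  show "inj_on \<phi> (U - {p})" using u(2) by (rule inj_on_subset) auto
  have "\<phi> ` (U - {p}) = \<phi> ` U - \<phi> ` (U \<inter> {p})" using u(2) by (auto simp: inj_on_def)
  moreover have "finite (\<phi> ` (U \<inter> {p}))" by simp
  ultimately show o: "open (\<phi> ` (U - {p}))" using u(3) by (metis open_Diff finite_imp_closed)
  show "chart S (\<phi> ` (U - {p})) (inv_into (U - {p}) \<phi>)"
    by (rule chart_cong[OF chart_subset[OF chart_atlas[OF pre assms] o]])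
      (auto intro!: inv_into_subset[OF u(2)])
qed

lemma atlas_S': "atlas S' = (\<lambda>(U, \<phi>). (U - {p}, \<phi>)) ` atlas S \<union>
        {(\<sigma>A ` VA, inv_into VA \<sigma>A), (\<sigma>B ` VB, inv_into VB \<sigma>B)}"
  by (simp add: blow_up_def)

lemma pts_S': "pts S' = (pts S - {p}) \<union> E ` pts P1"
  by (simp add: blow_up_def)

lemma inv_inv_into: "inj_on f A \<Longrightarrow> a \<in> A \<Longrightarrow> inv_into (f ` A) (inv_into A f) a = f a"
  by (rule inv_into_f_eq) (auto simp: inj_on_inv_into)

lemma param_A: "inv_into VA \<sigma>A ` \<sigma>A ` VA = VA" "v \<in> VA \<Longrightarrow> inv_into (\<sigma>A ` VA) (inv_into VA \<sigma>A) v = \<sigma>A v"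
  and param_B: "inv_into VB \<sigma>B ` \<sigma>B ` VB = VB" "v \<in> VB \<Longrightarrow> inv_into (\<sigma>B ` VB) (inv_into VB \<sigma>B) v = \<sigma>B v"
  using inj_A inj_B by (auto simp: inv_inv_into)

lemma E_mem_charts:
  assumes "l \<in> pts P1" shows "E l \<in> \<sigma>A ` VA \<or> E l \<in> \<sigma>B ` VB"
proof -
  have "E (line (1, z)) = \<sigma>A (0, z)" "(0, z) \<in> VA" "E (line (z, 1)) = \<sigma>B (0, z)" "(0, z) \<in> VB" for z
    using zero by (auto simp: lift_A_def dom_A_def lift_B_def dom_B_def Pair_zero)
  then show ?thesis using assms unfolding pts_P1 by auto
qed

lemma transits_AA: "transits VA \<sigma>A VA \<sigma>A" and transits_BB: "transits VB \<sigma>B VB \<sigma>B"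
  by (simp_all add: transits_refl open_VA open_VB)

lemma atlas_cases:
  assumes "(U, \<phi>) \<in> atlas S'"
  obtains W where "(W, \<phi>) \<in> atlas S" "U = W - {p}"
    | "U = \<sigma>A ` VA" "\<phi> = inv_into VA \<sigma>A" | "U = \<sigma>B ` VB" "\<phi> = inv_into VB \<sigma>B"
  using assms unfolding atlas_S' by auto

lemma transits_atlas_A:
  assumes "(U, \<phi>) \<in> atlas S'" shows "transits (\<phi> ` U) (inv_into U \<phi>) VA \<sigma>A \<and> transits VA \<sigma>A (\<phi> ` U) (inv_into U \<phi>)"
  using assms
proof (cases rule: atlas_cases)
  case (1 W)
  then show ?thesis using chart_old[OF 1(1)] transits_chart_A transits_A_chart by simp
next
  case 2
  show ?thesis unfolding 2 param_A(1) using transits_cong[OF transits_AA] param_A(2) by (metis (no_types, lifting))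
next
  case 3
  show ?thesis unfolding 3 param_B(1)
    using transits_cong[OF transits_A_B, of \<sigma>A] transits_cong[OF transits_B_A, of _ \<sigma>A] param_B(2)
    by (metis (no_types, lifting))
qed

lemma transits_atlas_B:
  assumes "(U, \<phi>) \<in> atlas S'" shows "transits (\<phi> ` U) (inv_into U \<phi>) VB \<sigma>B \<and> transits VB \<sigma>B (\<phi> ` U) (inv_into U \<phi>)"
  using assms
proof (cases rule: atlas_cases)
  case (1 W)
  then show ?thesis using chart_old[OF 1(1)] transits_chart_B transits_B_chart by simp
next
  case 2
  show ?thesis unfolding 2 param_A(1)
    using transits_cong[OF transits_B_A, of \<sigma>B] transits_cong[OF transits_A_B, of _ \<sigma>B] param_A(2)
    by (metis (no_types, lifting))
next
  case 3
  show ?thesis unfolding 3 param_B(1) using transits_cong[OF transits_BB] param_B(2) by (metis (no_types, lifting))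
qed

lemma chart_A: "chart S' VA \<sigma>A" and chart_B: "chart S' VB \<sigma>B"
  unfolding chart_def using open_VA open_VB inj_A inj_B \<sigma>A_pts \<sigma>B_pts transits_atlas_A transits_atlas_B by auto

lemma transits_atlas_chart:
  assumes "chart S W \<tau>" "(U, \<phi>) \<in> atlas S'"
  shows "transits W \<tau> (\<phi> ` U) (inv_into U \<phi>) \<and> transits (\<phi> ` U) (inv_into U \<phi>) W \<tau>"
  using assms(2)
proof (cases rule: atlas_cases)
  case (1 W')
  then show ?thesis using chart_transits[OF pre] assms(1) chart_old[OF 1(1)] by simp
next
  case 2
  show ?thesis unfolding 2 param_A(1)
    using transits_cong[OF transits_chart_A[OF assms(1)], of \<tau>] transits_cong[OF transits_A_chart[OF assms(1)], of _ \<tau>] param_A(2)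
    by (metis (no_types, lifting))
next
  case 3
  show ?thesis unfolding 3 param_B(1)
    using transits_cong[OF transits_chart_B[OF assms(1)], of \<tau>] transits_cong[OF transits_B_chart[OF assms(1)], of _ \<tau>] param_B(2)
    by (metis (no_types, lifting))
qed

text \<open>The device by which charts survive later blow-ups unchanged: it suffices that their
  image avoids the centre.\<close>

lemma chart_keep:
  assumes "chart S W \<tau>" "p \<notin> \<tau> ` W"
  shows "chart S' W \<tau>"
proof -
  have "\<tau> ` W \<subseteq> pts S'" unfolding pts_S' using chartD(3)[OF assms(1)] assms(2) by blast
  then show ?thesis unfolding chart_def using transits_atlas_chart[OF assms(1)] chartD(1,2)[OF assms(1)] by auto
qed

lemma premanifold_S': "premanifold S'"
  unfolding premanifold_def
proof (intro conjI)
  have "U \<subseteq> pts S' \<and> inj_on \<phi> U \<and> open (\<phi> ` U)" if "(U, \<phi>) \<in> atlas S'" for U \<phi>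
    using that
  proof (cases rule: atlas_cases)
    case (1 W)
    then show ?thesis using premanifoldD(1)[OF pre 1(1)] chart_old[OF 1(1)] pts_S' by auto
  next
    case 2
    show ?thesis unfolding 2 param_A(1) using \<sigma>A_pts open_VA by (auto simp: inj_on_inv_into)
  next
    case 3
    show ?thesis unfolding 3 param_B(1) using \<sigma>B_pts open_VB by (auto simp: inj_on_inv_into)
  qed
  then show "\<forall>(U, \<phi>)\<in>atlas S'. U \<subseteq> pts S' \<and> inj_on \<phi> U \<and> open (\<phi> ` U)" by auto
  have "q \<in> (\<Union>(U, \<phi>)\<in>atlas S'. U)" if "q \<in> pts S'" for q
  proof (cases "q \<in> pts S")
    case True
    then obtain U \<phi> where "(U, \<phi>) \<in> atlas S" "q \<in> U" by (rule premanifold_cover[OF pre])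
    moreover have "q \<noteq> p" using that pts_S' True E_neq p_pts by auto
    ultimately have "(U - {p}, \<phi>) \<in> atlas S'" "q \<in> U - {p}" unfolding atlas_S' by force+
    then show ?thesis by fast
  next
    case False
    then have "q \<in> \<sigma>A ` VA \<or> q \<in> \<sigma>B ` VB" using that pts_S' E_mem_charts by auto
    then show ?thesis unfolding atlas_S' by auto
  qed
  moreover have "(\<Union>(U, \<phi>)\<in>atlas S'. U) \<subseteq> pts S'"
    using \<open>\<forall>(U, \<phi>)\<in>atlas S'. U \<subseteq> pts S' \<and> inj_on \<phi> U \<and> open (\<phi> ` U)\<close> by auto
  ultimately show "(\<Union>(U, \<phi>)\<in>atlas S'. U) = pts S'" by blast
  have "transits (\<phi> ` U) (inv_into U \<phi>) (\<psi> ` W) (inv_into W \<psi>)"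
    if a: "(U, \<phi>) \<in> atlas S'" "(W, \<psi>) \<in> atlas S'" for U \<phi> W \<psi>
    using a(2)
  proof (cases rule: atlas_cases)
    case (1 W')
    then show ?thesis using transits_atlas_chart[OF chart_old(1)[OF 1(1)] a(1)] by simp
  next
    case 2
    show ?thesis unfolding 2 param_A(1)
      by (rule transits_cong[of _ "inv_into U \<phi>" _ \<sigma>A]) (use transits_atlas_A[OF a(1)] param_A in auto)
  next
    case 3
    show ?thesis unfolding 3 param_B(1)
      by (rule transits_cong[of _ "inv_into U \<phi>" _ \<sigma>B]) (use transits_atlas_B[OF a(1)] param_B in auto)
  qed
  then show "\<forall>(U, \<phi>)\<in>atlas S'. \<forall>(V, \<psi>)\<in>atlas S'.
        transits (\<phi> ` U) (inv_into U \<phi>) (\<psi> ` V) (inv_into V \<psi>)" by auto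
qed

section \<open>The blow-down map and the Hausdorff property\<close>

lemma \<beta>_old: "q \<in> pts S \<Longrightarrow> \<beta> q = q"
  using fresh by (auto simp: blow_down_def)

lemma \<beta>_E: "l \<in> pts P1 \<Longrightarrow> \<beta> (E l) = p"
  by (auto simp: blow_down_def)

lemma \<beta>_A: "v \<in> VA \<Longrightarrow> \<beta> (\<sigma>A v) = \<sigma> (fst v, fst v * snd v)"
  and \<beta>_B: "v \<in> VB \<Longrightarrow> \<beta> (\<sigma>B v) = \<sigma> (fst v * snd v, fst v)"
  by (auto simp: lift_A_def lift_B_def dom_A_def dom_B_def \<beta>_E line_mem_P1 \<beta>_old \<sigma>_pts Pair_zero)

lemma holo_A: "holo_on (\<lambda>v. (fst v, fst v * snd v)) VA" and holo_B: "holo_on (\<lambda>v. (fst v * snd v, fst v)) VB"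
  using open_VA open_VB by (auto simp: holo_on_iff_cdiff intro!: cdiff_intros)

lemma maps_A: "(\<lambda>v. (fst v, fst v * snd v)) ` VA \<subseteq> V" and maps_B: "(\<lambda>v. (fst v * snd v, fst v)) ` VB \<subseteq> V"
  by (auto simp: dom_A_def dom_B_def)

lemma chart_cases:
  assumes "q \<in> pts S'"
  obtains U \<phi> where "(U, \<phi>) \<in> atlas S" "q \<in> U" "q \<in> pts S" "q \<noteq> p"
  | v where "v \<in> VA" "q = \<sigma>A v" "\<beta> q = p" | v where "v \<in> VB" "q = \<sigma>B v" "\<beta> q = p"
proof (cases "q \<in> pts S")
  case True
  then obtain U \<phi> where "(U, \<phi>) \<in> atlas S" "q \<in> U" by (rule premanifold_cover[OF pre])
  moreover have "q \<noteq> p" using assms pts_S' True E_neq p_pts by auto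
  ultimately show ?thesis using that(1) True by blast
next
  case False
  then have "q \<in> \<sigma>A ` VA \<or> q \<in> \<sigma>B ` VB" "\<beta> q = p" using assms pts_S' E_mem_charts \<beta>_E by auto
  then show ?thesis using that(2,3) by blast
qed

lemma holomorphic_\<beta>: "holomorphic_map S' S \<beta>"
proof (rule holomorphic_mapI[OF premanifold_S' pre])
  show "\<beta> ` pts S' \<subseteq> pts S" using p_pts by (auto simp: blow_down_def pts_S')
  fix q assume q: "q \<in> pts S'"
  then show "\<exists>W \<tau> W' \<tau>' v g. chart S' W \<tau> \<and> chart S W' \<tau>' \<and> v \<in> W \<and> \<tau> v = q \<and>
      holo_on g W \<and> g ` W \<subseteq> W' \<and> (\<forall>u\<in>W. \<beta> (\<tau> u) = \<tau>' (g u))"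
  proof (cases rule: chart_cases)
    case (1 U \<phi>)
    have o: "p \<notin> inv_into (U - {p}) \<phi> ` \<phi> ` (U - {p})" using chart_old(2)[OF 1(1)] by simp
    note c = chart_keep[OF chart_old(1)[OF 1(1)] o]
    have "inv_into (U - {p}) \<phi> (\<phi> q) = q" using chart_old(2)[OF 1(1)] 1 by simp
    moreover have "\<beta> (inv_into (U - {p}) \<phi> u) = inv_into (U - {p}) \<phi> u" if "u \<in> \<phi> ` (U - {p})" for u
      using chartD(3)[OF chart_old(1)[OF 1(1)]] that \<beta>_old by blast
    ultimately show ?thesis
      using c chart_old(1)[OF 1(1)] holo_on_id[OF chartD(1)[OF c]] 1
      by (intro exI[of _ "\<phi> ` (U - {p})"] exI[of _ "inv_into (U - {p}) \<phi>"] exI[of _ "\<phi> q"] exI[of _ "\<lambda>x. x"]) auto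
  next
    case (2 v)
    then show ?thesis using chart_A ch holo_A maps_A \<beta>_A by blast
  next
    case (3 v)
    then show ?thesis using chart_B ch holo_B maps_B \<beta>_B by blast
  qed
qed

text \<open>Continuity of the blow-down map. In the lifted charts it is \<sigma> after a monomial
  map, elsewhere the identity; so open sets that separate points of S can be pulled back.\<close>

lemma openin_\<beta>:
  assumes O: "openin (mtop S) O'"
  shows "openin (mtop S') {q\<in>pts S'. \<beta> q \<in> O'}"
proof (rule openin_if_charts[OF premanifold_S'])
  have A: "chart S' {v\<in>VA. \<beta> (\<sigma>A v) \<in> O'} \<sigma>A" 
  proof (rule chart_subset[OF chart_A])
    have "open {v\<in>VA. (fst v, fst v * snd v) \<in> {w\<in>V. \<sigma> w \<in> O'}}"
      by (rule holo_on_preimage[OF holo_A open_chart_preimage[OF pre ch O]])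
    moreover have "{v\<in>VA. (fst v, fst v * snd v) \<in> {w\<in>V. \<sigma> w \<in> O'}} = {v\<in>VA. \<beta> (\<sigma>A v) \<in> O'}"
      using maps_A \<beta>_A by auto
    ultimately show "open {v\<in>VA. \<beta> (\<sigma>A v) \<in> O'}" by simp
  qed auto
  have B: "chart S' {v\<in>VB. \<beta> (\<sigma>B v) \<in> O'} \<sigma>B" 
  proof (rule chart_subset[OF chart_B])
    have "open {v\<in>VB. (fst v * snd v, fst v) \<in> {w\<in>V. \<sigma> w \<in> O'}}"
      by (rule holo_on_preimage[OF holo_B open_chart_preimage[OF pre ch O]])
    moreover have "{v\<in>VB. (fst v * snd v, fst v) \<in> {w\<in>V. \<sigma> w \<in> O'}} = {v\<in>VB. \<beta> (\<sigma>B v) \<in> O'}"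
      using maps_B \<beta>_B by auto
    ultimately show "open {v\<in>VB. \<beta> (\<sigma>B v) \<in> O'}" by simp
  qed auto
  fix q assume q: "q \<in> {q\<in>pts S'. \<beta> q \<in> O'}"
  then have "q \<in> pts S'" by simp
  then show "\<exists>W \<tau>. chart S' W \<tau> \<and> q \<in> \<tau> ` W \<and> \<tau> ` W \<subseteq> {q\<in>pts S'. \<beta> q \<in> O'}"
  proof (cases rule: chart_cases)
    case (1 U \<phi>)
    have o: "p \<notin> inv_into (U - {p}) \<phi> ` \<phi> ` (U - {p})" using chart_old(2)[OF 1(1)] by simp
    note c0 = chart_old(1)[OF 1(1)]
    define W where "W = {v\<in>\<phi> ` (U - {p}). inv_into (U - {p}) \<phi> v \<in> O'}"
    have c: "chart S' W (inv_into (U - {p}) \<phi>)"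
      unfolding W_def by (rule chart_subset[OF chart_keep[OF c0 o] open_chart_preimage[OF pre c0 O]]) auto
    have i: "inv_into (U - {p}) \<phi> (\<phi> q) = q" using chart_old(2)[OF 1(1)] 1 by simp
    have "\<phi> q \<in> W" unfolding W_def using 1 i q \<beta>_old by auto
    then have "q \<in> inv_into (U - {p}) \<phi> ` W" using i by (metis image_eqI)
    moreover have "inv_into (U - {p}) \<phi> v \<in> {q\<in>pts S'. \<beta> q \<in> O'}" if "v \<in> W" for v
    proof -
      have "inv_into (U - {p}) \<phi> v \<in> pts S" using chartD(3)[OF c0] that unfolding W_def by auto
      then show ?thesis using chartD(3)[OF c] that \<beta>_old unfolding W_def by auto
    qed
    ultimately show ?thesis using c by (intro exI[of _ W] exI[of _ "inv_into (U - {p}) \<phi>"]) auto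
  next
    case (2 v)
    then show ?thesis using A q \<sigma>A_pts by (intro exI[of _ "{v\<in>VA. \<beta> (\<sigma>A v) \<in> O'}"] exI[of _ \<sigma>A]) auto
  next
    case (3 v)
    then show ?thesis using B q \<sigma>B_pts by (intro exI[of _ "{v\<in>VB. \<beta> (\<sigma>B v) \<in> O'}"] exI[of _ \<sigma>B]) auto
  qed
qed

lemma Hausdorff_S': "Hausdorff_space (mtop S')"
  unfolding Hausdorff_mtop_iff[OF premanifold_S']
proof (intro ballI impI)
  fix q r assume qr: "q \<in> pts S'" "r \<in> pts S'" "q \<noteq> r"
  show "\<exists>A B. openin (mtop S') A \<and> openin (mtop S') B \<and> q \<in> A \<and> r \<in> B \<and> A \<inter> B = {}"
  proof (cases "\<beta> q = \<beta> r")
    case False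
    moreover have "\<beta> q \<in> pts S" "\<beta> r \<in> pts S" using qr p_pts by (auto simp: blow_down_def pts_S')
    moreover have "Hausdorff_space (mtop S)" using S by (simp add: complex_manifold_iff)
    ultimately obtain A B where AB: "openin (mtop S) A" "openin (mtop S) B" "\<beta> q \<in> A" "\<beta> r \<in> B" "A \<inter> B = {}"
      using Hausdorff_mtop_iff[OF pre] by meson
    show ?thesis
      using openin_\<beta>[OF AB(1)] openin_\<beta>[OF AB(2)] AB(3-5) qr
      by (intro exI[of _ "{q\<in>pts S'. \<beta> q \<in> A}"] exI[of _ "{q\<in>pts S'. \<beta> q \<in> B}"]) auto
  next
    case True
    have "q \<notin> pts S" "r \<notin> pts S"
      using qr True E_notin unfolding pts_S' by (auto simp: blow_down_def split: if_splits)
    then obtain l m where lm: "l \<in> pts P1" "m \<in> pts P1" "q = E l" "r = E m" using qr pts_S' by auto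
    have A0: "(0, z) \<in> VA" "E (line (1, z)) = \<sigma>A (0, z)" and B0: "(0, z) \<in> VB" "E (line (z, 1)) = \<sigma>B (0, z)" for z
      using zero by (auto simp: dom_A_def dom_B_def lift_A_def lift_B_def Pair_zero)
    have AA: ?thesis if "q \<in> \<sigma>A ` VA" "r \<in> \<sigma>A ` VA"
      by (rule separated_in_chart[OF premanifold_S' chart_A that qr(3)])
    have BB: ?thesis if "q \<in> \<sigma>B ` VB" "r \<in> \<sigma>B ` VB"
      by (rule separated_in_chart[OF premanifold_S' chart_B that qr(3)])
    have in_A: "E (line (1, z)) \<in> \<sigma>A ` VA" and in_B: "E (line (z, 1)) \<in> \<sigma>B ` VB" for z
      using A0 B0 by auto
    have in_A': "E (line (z, 1)) \<in> \<sigma>A ` VA" and in_B': "E (line (1, z)) \<in> \<sigma>B ` VB" if "z \<noteq> 0" for z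
    proof -
      show "E (line (z, 1)) \<in> \<sigma>A ` VA" "E (line (1, z)) \<in> \<sigma>B ` VB"
        unfolding E_line_inverse[OF that, symmetric] by (rule in_A in_B)+
    qed
    \<comment> \<open>Among the exceptional points only [1 : 0] and [0 : 1] have no common chart.
      The discs of radius 1 separate them, because the direction coordinates satisfy b d = 1 on the
      overlap of the lifted charts.\<close>
    define A where "A = \<sigma>A ` (VA \<inter> {v. norm (snd v) < 1})"
    define B where "B = \<sigma>B ` (VB \<inter> {v. norm (snd v) < 1})"
    have o: "openin (mtop S') A" "openin (mtop S') B" unfolding A_def B_def
      using open_VA open_VB
      by (auto intro!: openin_chart_image[OF premanifold_S' chart_A] openin_chart_image[OF premanifold_S' chart_B]
          open_Int open_Collect_less continuous_intros)
    have n: "norm b < 1 \<Longrightarrow> norm z < 1 \<Longrightarrow> b * z = 1 \<Longrightarrow> False" for b z :: complex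
      using mult_strict_mono'[of "norm b" 1 "norm z" 1] by (metis mult_1 norm_ge_zero norm_mult norm_one less_irrefl)
    have disj: "A \<inter> B = {}"
    proof (rule ccontr)
      assume "A \<inter> B \<noteq> {}"
      then obtain a b c d where h: "(a, b) \<in> VA" "(c, d) \<in> VB" "norm b < 1" "norm d < 1" "\<sigma>A (a, b) = \<sigma>B (c, d)"
        unfolding A_def B_def by auto
      then have "b * d = 1"
        by (auto simp: lift_A_def lift_B_def dom_A_def dom_B_def mult.commute E_eq E_neq line_mem_P1 \<sigma>_pts \<sigma>_eq split: if_splits)
      then show False using n h by blast
    qed
    have AB: "E (line (1, 0)) \<in> A" "E (line (0, 1)) \<in> B" unfolding A_def B_def A0 B0 using A0 B0 by auto
    consider (a) z w where "l = line (1, z)" "m = line (1, w)" | (b) z w where "l = line (z, 1)" "m = line (w, 1)"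
      | (c) z w where "l = line (1, z)" "m = line (w, 1)" | (d) z w where "l = line (z, 1)" "m = line (1, w)"
      using lm(1,2) unfolding pts_P1 by auto
    then show ?thesis
    proof cases
      case a then show ?thesis using AA in_A lm by auto
    next
      case b then show ?thesis using BB in_B lm by auto
    next
      case c
      show ?thesis
      proof (cases "z = 0 \<and> w = 0")
        case True then show ?thesis using o disj AB lm c by blast
      next
        case False then show ?thesis using c lm AA BB in_A in_B in_A' in_B' by auto
      qed
    next
      case d
      show ?thesis
      proof (cases "z = 0 \<and> w = 0")
        case True then show ?thesis using o disj AB lm d by (intro exI[of _ B] exI[of _ A]) auto
      next
        case False then show ?thesis using d lm AA BB in_A in_B in_A' in_B' by auto
      qed
    qed
  qed
qed

lemma countable_S': "countable (atlas S')"
  unfolding atlas_S' using countable_atlas by auto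

lemma complex_manifold_S': "complex_manifold S'"
  unfolding complex_manifold_iff
  using premanifold_S' Hausdorff_S' second_countable_mtop[OF premanifold_S' countable_S'] by simp


section \<open>The blow-down map away from the centre\<close>

lemma open_minus_p: "openin (mtop S) (pts S \<inter> - {p})"
proof -
  have "open (\<phi> ` ((pts S \<inter> - {p}) \<inter> U))" if "(U, \<phi>) \<in> atlas S" for U \<phi>
  proof -
    have "(pts S \<inter> - {p}) \<inter> U = U - {p}" using premanifoldD(1)[OF pre that] by auto
    then show ?thesis using chart_old(3)[OF that] by simp
  qed
  then show ?thesis by (auto simp: openin_mtop[OF pre])
qed

lemma pts_off_p: "pts S' \<inter> {q. \<beta> q \<noteq> p} = pts S \<inter> - {p}"
proof -
  have "q \<in> pts S' \<and> \<beta> q \<noteq> p \<longleftrightarrow> q \<in> pts S \<and> q \<noteq> p" for q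
  proof (cases "q \<in> E ` pts P1")
    case True then show ?thesis using E_notin \<beta>_E by auto
  next
    case False then show ?thesis by (auto simp: blow_down_def pts_S')
  qed
  then show ?thesis by auto
qed

lemma biholomorphic_off_p: "biholomorphic (restrict_mfd S' {q. \<beta> q \<noteq> p}) (restrict_mfd S (- {p})) \<beta>"
proof (rule biholomorphicI)
  have o: "openin (mtop S') (pts S' \<inter> {q. \<beta> q \<noteq> p})"
  proof -
    have "{q\<in>pts S'. \<beta> q \<in> pts S \<inter> - {p}} = pts S' \<inter> {q. \<beta> q \<noteq> p}"
      using p_pts by (auto simp: blow_down_def pts_S')
    then show ?thesis using openin_\<beta>[OF open_minus_p] by simp
  qed
  show "premanifold (restrict_mfd S' {q. \<beta> q \<noteq> p})" by (rule premanifold_restrict[OF premanifold_S' o])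
  show "premanifold (restrict_mfd S (- {p}))" by (rule premanifold_restrict[OF pre open_minus_p])
  show "bij_betw \<beta> (pts (restrict_mfd S' {q. \<beta> q \<noteq> p})) (pts (restrict_mfd S (- {p})))"
    unfolding pts_restrict pts_off_p using \<beta>_old by (auto simp: bij_betw_def inj_on_def)
  fix q assume "q \<in> pts (restrict_mfd S' {q. \<beta> q \<noteq> p})"
  then have q: "q \<in> pts S" "q \<noteq> p" unfolding pts_restrict pts_off_p by auto
  obtain U \<phi> where U: "(U, \<phi>) \<in> atlas S" "q \<in> U" by (rule premanifold_cover[OF pre q(1)])
  let ?\<tau> = "inv_into (U - {p}) \<phi>" and ?W = "\<phi> ` (U - {p})"
  have im: "?\<tau> ` ?W = U - {p}" using chart_old(2)[OF U(1)] by simp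
  then have n: "p \<notin> ?\<tau> ` ?W" by simp
  have id: "\<beta> (?\<tau> v) = ?\<tau> v" if "v \<in> ?W" for v
    using chartD(3)[OF chart_old(1)[OF U(1)]] that \<beta>_old by blast
  have "\<beta> (?\<tau> v) \<noteq> p" if "v \<in> ?W" for v using id[OF that] n that by (metis imageI)
  then have "?\<tau> ` ?W \<subseteq> {q. \<beta> q \<noteq> p}" by blast
  then have 1: "chart (restrict_mfd S' {q. \<beta> q \<noteq> p}) ?W ?\<tau>"
    by (rule chart_restrict[OF premanifold_S' o chart_keep[OF chart_old(1)[OF U(1)] n]])
  have "?\<tau> ` ?W \<subseteq> - {p}" using n by auto
  then have "chart (restrict_mfd S (- {p})) ?W ?\<tau>"
    by (rule chart_restrict[OF pre open_minus_p chart_old(1)[OF U(1)]])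
  then have "chart (restrict_mfd S (- {p})) ?W (\<beta> \<circ> ?\<tau>)"
    by (rule chart_cong) (simp add: id)
  then show "\<exists>W \<tau>. chart (restrict_mfd S' {q. \<beta> q \<noteq> p}) W \<tau> \<and> q \<in> \<tau> ` W \<and>
      chart (restrict_mfd S (- {p})) W (\<beta> \<circ> \<tau>)"
    using 1 im U(2) q(2) by (intro exI[of _ ?W] exI[of _ ?\<tau>]) auto
qed

section \<open>Comparison with the local model \<open>Bl0\<close>\<close>

definition coord :: "'a \<Rightarrow> complex \<times> complex" where "coord = inv_into V \<sigma>"

definition local_model :: "'a \<Rightarrow> (complex \<times> complex) \<times> (complex \<times> complex) set" where
  "local_model q = (if q \<in> E ` pts P1 then (0, inv_into (pts P1) E q) else (coord q, line (coord q)))"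

lemma coord_\<sigma>: "v \<in> V \<Longrightarrow> coord (\<sigma> v) = v"
  unfolding coord_def using chartD(2)[OF ch] by simp

lemma local_model_E: "l \<in> pts P1 \<Longrightarrow> local_model (E l) = (0, l)"
  using inj_E by (simp add: local_model_def)

lemma local_model_\<sigma>: "v \<in> V \<Longrightarrow> local_model (\<sigma> v) = (v, line v)"
  using \<sigma>_pts[of v] fresh coord_\<sigma>[of v] by (auto simp: local_model_def)

lemma local_model_A: "(a, b) \<in> VA \<Longrightarrow> local_model (\<sigma>A (a, b)) = ((a, a * b), line (1, b))"
  using line_scale[of a 1 b]
  by (auto simp: lift_A_def dom_A_def local_model_E local_model_\<sigma> line_mem_P1 Pair_zero)

lemma local_model_B: "(a, b) \<in> VB \<Longrightarrow> local_model (\<sigma>B (a, b)) = ((a * b, a), line (b, 1))"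
  using line_scale[of a b 1]
  by (auto simp: lift_B_def dom_B_def local_model_E local_model_\<sigma> line_mem_P1 Pair_zero)

lemma over_V: "pts S' \<inter> {q. \<beta> q \<in> \<sigma> ` V} = \<sigma>A ` VA \<union> \<sigma>B ` VB"
proof (intro subset_antisym subsetI)
  fix q assume q: "q \<in> pts S' \<inter> {q. \<beta> q \<in> \<sigma> ` V}"
  show "q \<in> \<sigma>A ` VA \<union> \<sigma>B ` VB"
  proof (cases "q \<in> E ` pts P1")
    case True then show ?thesis using E_mem_charts by auto
  next
    case False
    then have "q \<in> \<sigma> ` V" "q \<noteq> p" using q by (auto simp: blow_down_def pts_S')
    then obtain v where "v \<in> V" "q = \<sigma> v" "v \<noteq> 0" by blast
    then obtain a b where v: "(a, b) \<in> V" "q = \<sigma> (a, b)" "(a, b) \<noteq> 0" by (cases v) auto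
    show ?thesis
    proof (cases "a = 0")
      case True
      then have "q = \<sigma>B (b, 0)" "(b, 0) \<in> VB" using v by (auto simp: lift_B_def dom_B_def Pair_zero)
      then show ?thesis by auto
    next
      case False
      then have "q = \<sigma>A (a, b / a)" "(a, b / a) \<in> VA" using v by (auto simp: lift_A_def dom_A_def)
      then show ?thesis by auto
    qed
  qed
next
  fix q assume "q \<in> \<sigma>A ` VA \<union> \<sigma>B ` VB"
  then show "q \<in> pts S' \<inter> {q. \<beta> q \<in> \<sigma> ` V}"
    using \<sigma>A_pts \<sigma>B_pts \<beta>_A \<beta>_B maps_A maps_B by auto
qed

lemma line_eqI: "l \<in> pts P1 \<Longrightarrow> v \<in> l \<Longrightarrow> v \<noteq> 0 \<Longrightarrow> line v = l"
proof -
  assume l: "l \<in> pts P1" "v \<in> l" "v \<noteq> 0"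
  then obtain a b where ab: "l = line (a, b)" unfolding pts_P1 by auto
  then obtain c where "v = (c * a, c * b)" using l(2) mem_line by auto
  moreover from this have "c \<noteq> 0" using l(3) by (auto simp: Pair_zero)
  ultimately show "line v = l" using line_scale ab by simp
qed

lemma bij_local_model:
  "bij_betw local_model (pts S' \<inter> {q. \<beta> q \<in> \<sigma> ` V}) (pts Bl0 \<inter> {(v, l). v \<in> V})"
proof (rule bij_betwI[where g = "\<lambda>(v, l). if v = 0 then E l else \<sigma> v"])
  show "local_model \<in> pts S' \<inter> {q. \<beta> q \<in> \<sigma> ` V} \<rightarrow> pts Bl0 \<inter> {(v, l). v \<in> V}"
    unfolding over_V
    using line_mem_P1 line_self[of 1] line_self[of _ 1]
    by (auto simp: local_model_A local_model_B Bl0_def dom_A_def dom_B_def mem_line)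
  show "(\<lambda>(v, l). if v = 0 then E l else \<sigma> v) \<in> pts Bl0 \<inter> {(v, l). v \<in> V} \<rightarrow> pts S' \<inter> {q. \<beta> q \<in> \<sigma> ` V}"
  proof
    fix x assume "x \<in> pts Bl0 \<inter> {(v, l). v \<in> V}"
    then obtain v l where x: "x = (v, l)" "l \<in> pts P1" "v \<in> l" "v \<in> V" by (auto simp: Bl0_def)
    show "(case x of (v, l) \<Rightarrow> if v = 0 then E l else \<sigma> v) \<in> pts S' \<inter> {q. \<beta> q \<in> \<sigma> ` V}"
    proof (cases "v = 0")
      case True
      then show ?thesis using x zero \<beta>_E[OF x(2)] pts_S' by auto
    next
      case False
      then show ?thesis using x zero \<beta>_old[OF \<sigma>_pts[OF x(4)]] \<sigma>_pts \<sigma>_eq by (auto simp: pts_S')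
    qed
  qed
next
  fix q assume q: "q \<in> pts S' \<inter> {q. \<beta> q \<in> \<sigma> ` V}"
  show "(case local_model q of (v, l) \<Rightarrow> if v = 0 then E l else \<sigma> v) = q"
  proof (cases "q \<in> E ` pts P1")
    case True then show ?thesis using local_model_E by auto
  next
    case False
    then have "q \<in> \<sigma> ` V" "q \<noteq> p" using q by (auto simp: blow_down_def pts_S')
    then obtain v where "v \<in> V" "q = \<sigma> v" "v \<noteq> 0" by blast
    then show ?thesis using local_model_\<sigma> by simp
  qed
next
  fix x assume "x \<in> pts Bl0 \<inter> {(v, l). v \<in> V}"
  then obtain v l where x: "x = (v, l)" "l \<in> pts P1" "v \<in> l" "v \<in> V" by (auto simp: Bl0_def)
  then show "local_model (case x of (v, l) \<Rightarrow> if v = 0 then E l else \<sigma> v) = x"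
    using local_model_E local_model_\<sigma> line_eqI[OF x(2,3)] by auto
qed

lemma biholomorphic_local_model:
  "biholomorphic (restrict_mfd S' {q. \<beta> q \<in> \<sigma> ` V}) (restrict_mfd Bl0 {(v, l). v \<in> V}) local_model"
proof (rule biholomorphic_atlasI)
  show "bij_betw local_model (pts (restrict_mfd S' {q. \<beta> q \<in> \<sigma> ` V})) (pts (restrict_mfd Bl0 {(v, l). v \<in> V}))"
    unfolding pts_restrict by (rule bij_local_model)
  fix q assume "q \<in> pts (restrict_mfd S' {q. \<beta> q \<in> \<sigma> ` V})"
  then have "q \<in> \<sigma>A ` VA \<or> q \<in> \<sigma>B ` VB" unfolding pts_restrict over_V by simp
  then show "\<exists>U \<phi> U' \<psi> W. (U, \<phi>) \<in> atlas (restrict_mfd S' {q. \<beta> q \<in> \<sigma> ` V}) \<and>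
      (U', \<psi>) \<in> atlas (restrict_mfd Bl0 {(v, l). v \<in> V}) \<and> q \<in> U \<and>
      U \<subseteq> pts (restrict_mfd S' {q. \<beta> q \<in> \<sigma> ` V}) \<and> inj_on \<phi> U \<and> inj_on \<psi> U' \<and> open W \<and> \<phi> q \<in> W \<and> W \<subseteq> \<phi> ` U \<and>
      (\<forall>q\<in>U. \<phi> q \<in> W \<longrightarrow> local_model q \<in> U' \<and> \<psi> (local_model q) = \<phi> q)"
  proof
    assume q: "q \<in> \<sigma>A ` VA"
    let ?U' = "{(v, l). (\<exists>z. l = line (1 :: complex, z)) \<and> v \<in> l}" and ?\<psi> = "\<lambda>(v :: complex \<times> complex, l). (fst v, THE z. (1 :: complex, z) \<in> l)"
    have U: "(\<sigma>A ` VA, inv_into VA \<sigma>A) \<in> atlas (restrict_mfd S' {q. \<beta> q \<in> \<sigma> ` V})"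
      unfolding atlas_restrict atlas_S' using over_V by (intro exI[of _ "\<sigma>A ` VA"]) auto
    have U': "(?U' \<inter> {(v, l). v \<in> V}, ?\<psi>) \<in> atlas (restrict_mfd Bl0 {(v, l). v \<in> V})"
      unfolding atlas_restrict Bl0_def by auto
    have inj: "inj_on ?\<psi> (?U' \<inter> {(v, l). v \<in> V})"
      by (rule inj_onI) (auto simp: mem_line)
    have h: "local_model (\<sigma>A (a, b)) \<in> ?U' \<inter> {(v, l). v \<in> V} \<and> ?\<psi> (local_model (\<sigma>A (a, b))) = (a, b)"
      if "(a, b) \<in> VA" for a b
      using that line_self[of 1 b] by (auto simp: local_model_A dom_A_def mem_line)
    have h': "\<forall>q\<in>\<sigma>A ` VA. inv_into VA \<sigma>A q \<in> VA \<longrightarrow>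
        local_model q \<in> ?U' \<inter> {(v, l). v \<in> V} \<and> ?\<psi> (local_model q) = inv_into VA \<sigma>A q"
    proof (intro ballI impI)
      fix q assume "q \<in> \<sigma>A ` VA"
      then obtain a b where "(a, b) \<in> VA" "q = \<sigma>A (a, b)" by auto
      then show "local_model q \<in> ?U' \<inter> {(v, l). v \<in> V} \<and> ?\<psi> (local_model q) = inv_into VA \<sigma>A q"
        using h inj_A by simp
    qed
    show ?thesis
      by (rule exI[of _ "\<sigma>A ` VA"], rule exI[of _ "inv_into VA \<sigma>A"], rule exI[of _ "?U' \<inter> {(v, l). v \<in> V}"],
          rule exI[of _ ?\<psi>], rule exI[of _ VA], intro conjI U U' inj open_VA q h')
        (use over_V q inj_A in \<open>auto simp: inj_on_inv_into\<close>)
  next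
    assume q: "q \<in> \<sigma>B ` VB"
    let ?U' = "{(v, l). (\<exists>z. l = line (z, 1 :: complex)) \<and> v \<in> l}" and ?\<psi> = "\<lambda>(v :: complex \<times> complex, l). (snd v, THE z. (z, 1 :: complex) \<in> l)"
    have U: "(\<sigma>B ` VB, inv_into VB \<sigma>B) \<in> atlas (restrict_mfd S' {q. \<beta> q \<in> \<sigma> ` V})"
      unfolding atlas_restrict atlas_S' using over_V by (intro exI[of _ "\<sigma>B ` VB"]) auto
    have U': "(?U' \<inter> {(v, l). v \<in> V}, ?\<psi>) \<in> atlas (restrict_mfd Bl0 {(v, l). v \<in> V})"
      unfolding atlas_restrict Bl0_def by auto
    have inj: "inj_on ?\<psi> (?U' \<inter> {(v, l). v \<in> V})"
      by (rule inj_onI) (auto simp: mem_line)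
    have h: "local_model (\<sigma>B (a, b)) \<in> ?U' \<inter> {(v, l). v \<in> V} \<and> ?\<psi> (local_model (\<sigma>B (a, b))) = (a, b)"
      if "(a, b) \<in> VB" for a b
      using that line_self[of b 1] by (auto simp: local_model_B dom_B_def mem_line)
    have h': "\<forall>q\<in>\<sigma>B ` VB. inv_into VB \<sigma>B q \<in> VB \<longrightarrow>
        local_model q \<in> ?U' \<inter> {(v, l). v \<in> V} \<and> ?\<psi> (local_model q) = inv_into VB \<sigma>B q"
    proof (intro ballI impI)
      fix q assume "q \<in> \<sigma>B ` VB"
      then obtain a b where "(a, b) \<in> VB" "q = \<sigma>B (a, b)" by auto
      then show "local_model q \<in> ?U' \<inter> {(v, l). v \<in> V} \<and> ?\<psi> (local_model q) = inv_into VB \<sigma>B q"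
        using h inj_B by simp
    qed
    show ?thesis
      by (rule exI[of _ "\<sigma>B ` VB"], rule exI[of _ "inv_into VB \<sigma>B"], rule exI[of _ "?U' \<inter> {(v, l). v \<in> V}"],
          rule exI[of _ ?\<psi>], rule exI[of _ VB], intro conjI U U' inj open_VB q h')
        (use over_V q inj_B in \<open>auto simp: inj_on_inv_into\<close>)
  qed
qed

theorem is_blowup: "is_blowup S' S p \<beta>"
  unfolding is_blowup_def
proof (intro conjI complex_manifold_S' S p_pts holomorphic_\<beta> biholomorphic_off_p)
  have im: "coord ` \<sigma> ` V = V" using coord_\<sigma> by (auto simp: image_image)
  have "coord_chart S (\<sigma> ` V) coord" by (rule coord_chartI[OF pre ch coord_\<sigma>])
  moreover have "coord p = 0" by (rule coord_\<sigma>[OF zero])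
  moreover have "fst (local_model q) = coord (\<beta> q)" if "q \<in> pts S'" "\<beta> q \<in> \<sigma> ` V" for q
    using that coord_\<sigma>[OF zero] by (auto simp: local_model_def blow_down_def)
  ultimately show "\<exists>W \<kappa> h. coord_chart S W \<kappa> \<and> p \<in> W \<and> \<kappa> p = 0 \<and>
        biholomorphic (restrict_mfd S' {q. \<beta> q \<in> W}) (restrict_mfd Bl0 {(v, l). v \<in> \<kappa> ` W}) h \<and>
        (\<forall>q\<in>pts S'. \<beta> q \<in> W \<longrightarrow> fst (h q) = \<kappa> (\<beta> q))"
    using biholomorphic_local_model zero im
    by (intro exI[of _ "\<sigma> ` V"] exI[of _ coord] exI[of _ local_model]) auto
qed

end

section \<open>The tower of blow-ups over the projective plane\<close>

lemma transits_on:
  assumes "holo_on g N" "N \<subseteq> V" "g ` N \<subseteq> V'" "\<And>v. v \<in> V \<Longrightarrow> \<sigma> v \<in> \<sigma>' ` V' \<Longrightarrow> v \<in> N"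
    "\<And>v. v \<in> N \<Longrightarrow> \<sigma>' (g v) = \<sigma> v"
  shows "transits V \<sigma> V' \<sigma>'"
proof (rule transitsI)
  fix v assume "v \<in> V" "\<sigma> v \<in> \<sigma>' ` V'"
  then have "v \<in> N" by (rule assms(4))
  then show "\<exists>N g. v \<in> N \<and> N \<subseteq> V \<and> holo_on g N \<and> g ` N \<subseteq> V' \<and> (\<forall>u\<in>N. \<sigma>' (g u) = \<sigma> u)"
    using assms(1-3,5) by (intro exI[of _ N] exI[of _ g] conjI ballI)
qed

lemma chart_swap:
  assumes "chart M V \<sigma>"
  shows "chart M {v. (snd v, fst v) \<in> V} (\<lambda>v. \<sigma> (snd v, fst v))"
proof (rule chart_change[OF assms, where h = "\<lambda>v. (snd v, fst v)" and A = V])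
  have "open ((\<lambda>v. (snd v, fst v)) -` V)"
    by (rule open_vimage[OF chartD(1)[OF assms]]) (intro continuous_intros)
  then show "holo_on (\<lambda>v. (snd v, fst v)) {v. (snd v, fst v) \<in> V}"
    by (auto simp: holo_on_iff_cdiff vimage_def intro!: cdiff_intros)
  show "holo_on (\<lambda>v. (snd v, fst v)) V"
    using chartD(1)[OF assms] by (auto simp: holo_on_iff_cdiff intro!: cdiff_intros)
qed auto

type_synonym point = "(nat \<times> complex \<times> complex) set"

text \<open>Every point of the surfaces is a singleton \<open>{(n, a, b)}\<close>. The tag \<open>n\<close> is 0 for the affine plane,
  1 and 2 for the line at infinity, and 3, ..., 11 for the exceptional curves; on these \<open>pt n z\<close> has
  direction \<open>[1 : z]\<close> and \<open>pt_inf n\<close> has direction \<open>[0 : 1]\<close>.\<close>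

definition pt :: "nat \<Rightarrow> complex \<Rightarrow> point" where "pt n z = {(n, z, 0)}"
definition pt_inf :: "nat \<Rightarrow> point" where "pt_inf n = {(n, 0, 1)}"

definition exc :: "nat \<Rightarrow> (complex \<times> complex) set \<Rightarrow> point" where
  "exc n l = (if l = line (0, 1) then pt_inf n else pt n (THE z. (1, z) \<in> l))"

lemma pt_eq [simp]: "pt n z = pt m w \<longleftrightarrow> n = m \<and> z = w" "pt n z \<noteq> pt_inf m" "pt_inf m \<noteq> pt n z"
  "pt_inf n = pt_inf m \<longleftrightarrow> n = m"
  "pt n z = {(m, a, b)} \<longleftrightarrow> m = n \<and> a = z \<and> b = 0" "{(m, a, b)} = pt n z \<longleftrightarrow> m = n \<and> a = z \<and> b = 0"
  "pt_inf n = {(m, a, b)} \<longleftrightarrow> m = n \<and> a = 0 \<and> b = 1" "{(m, a, b)} = pt_inf n \<longleftrightarrow> m = n \<and> a = 0 \<and> b = 1"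
  by (auto simp: pt_def pt_inf_def)

lemma exc_line [simp]: "exc n (line (1, z)) = pt n z" "exc n (line (0, 1)) = pt_inf n"
  "exc n (line (z, 1)) = (if z = 0 then pt_inf n else pt n (1 / z))"
proof -
  show 1: "exc n (line (1, z)) = pt n z" for z by (simp add: exc_def)
  show 2: "exc n (line (0, 1)) = pt_inf n" by (simp add: exc_def)
  show "exc n (line (z, 1)) = (if z = 0 then pt_inf n else pt n (1 / z))"
  proof (cases "z = 0")
    case False
    then have "line (z, 1) = line (1, 1 / z)" by simp
    then show ?thesis using 1 False by metis
  qed (simp add: 2)
qed

lemma exc_image: "exc n ` pts P1 = range (pt n) \<union> {pt_inf n}"
proof -
  have "exc n ` pts P1 = range (\<lambda>z. exc n (line (1, z))) \<union> range (\<lambda>z. exc n (line (z, 1)))"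
    by (simp add: pts_P1 image_Un image_image)
  also have "\<dots> = range (pt n) \<union> {pt_inf n}"
    by (auto intro: rev_image_eqI[of 0])
  finally show ?thesis .
qed

lemma inj_exc: "inj_on (exc n) (pts P1)"
proof (rule inj_onI)
  fix l m assume l: "l \<in> pts P1" and m: "m \<in> pts P1" and e: "exc n l = exc n m"
  have *: "k = line (0, 1) \<or> (\<exists>z. k = line (1, z))" if k: "k \<in> pts P1" for k
  proof -
    from k consider z where "k = line (1, z)" | z where "k = line (z, 1)" unfolding pts_P1 by auto
    then show ?thesis
    proof cases
      case (2 z)
      then show ?thesis by (cases "z = 0") (simp, metis line_eq_line_one nonzero_divide_eq_eq)
    qed simp
  qed
  show "l = m" using *[OF l] *[OF m] e by auto
qed

text \<open>The invariant of the tower. Tags below n guarantee that the points of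
  \<open>exc n\<close> are new. The condition on \<pi> says that the affine plane is never touched,
  which is what the last condition on \<iota> in \<open>rational_surface_of_type\<close>
  requires.\<close>

definition stage :: "nat \<Rightarrow> (point, complex \<times> complex) cmfd \<Rightarrow> bool" where
  "stage n S \<longleftrightarrow> complex_manifold S \<and> countable (atlas S) \<and> (\<forall>c\<in>pts S. \<exists>m<n. \<exists>a b. c = {(m, a, b)}) \<and>
     (\<exists>\<pi>. iterated_blowup S \<pi> \<and> (\<forall>x y. \<pi> {(0, x, y)} = line (1, x, y)))"

lemma stage_blowing_up:
  assumes "stage n S" "chart S V \<sigma>" "0 \<in> V"
  shows "blowing_up S V \<sigma> (exc n)"
proof
  show "complex_manifold S" "countable (atlas S)" using assms(1) by (auto simp: stage_def)
  show "exc n ` pts P1 \<inter> pts S = {}"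
    using assms(1) unfolding exc_image stage_def by fastforce
qed (use assms inj_exc in auto)

lemma stage_blow_up:
  assumes st: "stage n S" and c: "chart S V \<sigma>" "0 \<in> V" and n: "n > 0"
  shows "stage (Suc n) (blow_up S V \<sigma> (exc n))"
  unfolding stage_def
proof (intro conjI)
  interpret blowing_up S V \<sigma> "exc n" by (rule stage_blowing_up[OF st c])
  show "complex_manifold S'" "countable (atlas S')" by (rule complex_manifold_S' countable_S')+
  show "\<forall>c\<in>pts S'. \<exists>m<Suc n. \<exists>a b. c = {(m, a, b)}"
  proof
    fix c assume "c \<in> pts S'"
    then consider "c \<in> pts S" | "c \<in> range (pt n) \<union> {pt_inf n}" unfolding pts_S' exc_image by blast
    then show "\<exists>m<Suc n. \<exists>a b. c = {(m, a, b)}"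
    proof cases
      case 1
      then obtain m a b where "m < n" "c = {(m, a, b)}" using st unfolding stage_def by blast
      then show ?thesis by (intro exI[of _ m]) auto
    next
      case 2 then show ?thesis by (intro exI[of _ n]) auto
    qed
  qed
  obtain \<pi> where \<pi>: "iterated_blowup S \<pi>" "\<forall>x y. \<pi> {(0, x, y)} = line (1, x, y)"
    using st unfolding stage_def by blast
  have "iterated_blowup S' (\<pi> \<circ> \<beta>)" by (rule iterated_blowup.blowup[OF \<pi>(1) is_blowup])
  moreover have "(\<pi> \<circ> \<beta>) {(0, x, y)} = line (1, x, y)" for x y
    using \<pi>(2) n by (auto simp: blow_down_def exc_image)
  ultimately show "\<exists>\<pi>. iterated_blowup S' \<pi> \<and> (\<forall>x y. \<pi> {(0, x, y)} = line (1, x, y))" by blast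
qed

lemma stage_chart_A: "stage n S \<Longrightarrow> chart S V \<sigma> \<Longrightarrow> 0 \<in> V \<Longrightarrow>
    chart (blow_up S V \<sigma> (exc n)) (dom_A V) (lift_A \<sigma> (exc n))"
  by (rule blowing_up.chart_A[OF stage_blowing_up])

lemma stage_chart_B: "stage n S \<Longrightarrow> chart S V \<sigma> \<Longrightarrow> 0 \<in> V \<Longrightarrow>
    chart (blow_up S V \<sigma> (exc n)) (dom_B V) (lift_B \<sigma> (exc n))"
  by (rule blowing_up.chart_B[OF stage_blowing_up])

lemma stage_chart_keep: "stage n S \<Longrightarrow> chart S V \<sigma> \<Longrightarrow> 0 \<in> V \<Longrightarrow> chart S W \<tau> \<Longrightarrow> \<sigma> 0 \<notin> \<tau> ` W \<Longrightarrow>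
    chart (blow_up S V \<sigma> (exc n)) W \<tau>"
  by (rule blowing_up.chart_keep[OF stage_blowing_up])

lemma stage_premanifold: "stage n S \<Longrightarrow> premanifold S"
  by (simp add: stage_def complex_manifold_iff)

subsection \<open>The projective plane\<close>

text \<open>The three affine charts of the plane of points \<open>[w : x : y]\<close> are \<open>[1 : a : b]\<close>, \<open>[a : 1 : b]\<close> and
  \<open>[a : b : 1]\<close>.\<close>

definition a0 :: "complex \<times> complex \<Rightarrow> point" where
  "a0 = (\<lambda>(a, b). {(0, a, b)})"
definition a1 :: "complex \<times> complex \<Rightarrow> point" where
  "a1 = (\<lambda>(a, b). if a = 0 then pt 1 b else {(0, 1 / a, b / a)})"
definition a2 :: "complex \<times> complex \<Rightarrow> point" where
  "a2 = (\<lambda>(a, b). if a = 0 then if b = 0 then pt 2 0 else pt 1 (1 / b) else {(0, b / a, 1 / a)})"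

definition plane :: "(point, complex \<times> complex) cmfd" where
  "plane = \<lparr>pts = range a0 \<union> range a1 \<union> range a2, atlas = {(range a0, inv a0), (range a1, inv a1), (range a2, inv a2)}\<rparr>"

lemma inj_a: "inj a0" "inj a1" "inj a2"
  by (auto simp: inj_def a0_def a1_def a2_def field_simps split: if_splits)

lemma open_neq: "open {v :: complex \<times> complex. fst v \<noteq> 0}" "open {v :: complex \<times> complex. snd v \<noteq> 0}"
  by (intro open_Collect_neq continuous_intros)+

lemma transits_a:
  "transits UNIV a0 UNIV a1" "transits UNIV a1 UNIV a0" "transits UNIV a0 UNIV a2"
  "transits UNIV a2 UNIV a0" "transits UNIV a1 UNIV a2" "transits UNIV a2 UNIV a1"
proof -
  have h: "holo_on (\<lambda>v. (1 / fst v, snd v / fst v)) {v :: complex \<times> complex. fst v \<noteq> 0}"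
    "holo_on (\<lambda>v. (snd v / fst v, 1 / fst v)) {v :: complex \<times> complex. fst v \<noteq> 0}"
    "holo_on (\<lambda>v. (1 / snd v, fst v / snd v)) {v :: complex \<times> complex. snd v \<noteq> 0}"
    "holo_on (\<lambda>v. (fst v / snd v, 1 / snd v)) {v :: complex \<times> complex. snd v \<noteq> 0}"
    unfolding holo_on_iff_cdiff by (intro conjI ballI open_neq cdiff_intros; simp)+
  show "transits UNIV a0 UNIV a1" "transits UNIV a1 UNIV a0"
    by (rule transits_on[OF h(1)]; force simp: a0_def a1_def split: if_splits)+
  show "transits UNIV a0 UNIV a2"
    by (rule transits_on[OF h(3)]) (auto simp: a0_def a2_def split: if_splits)
  show "transits UNIV a2 UNIV a0"
    by (rule transits_on[OF h(2)]) (auto simp: a0_def a2_def split: if_splits)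
  show "transits UNIV a1 UNIV a2"
    by (rule transits_on[OF h(4)]) (auto simp: a1_def a2_def split: if_splits)
  show "transits UNIV a2 UNIV a1"
    by (rule transits_on[OF h(4)]) (auto simp: a1_def a2_def split: if_splits)
qed

lemma param_inv: "inj \<sigma> \<Longrightarrow> inv \<sigma> ` range \<sigma> = UNIV" "inj \<sigma> \<Longrightarrow> inv_into (range \<sigma>) (inv \<sigma>) = \<sigma>"
  by (auto simp: image_image inv_into_f_f[of _ UNIV] intro!: inv_into_f_eq inj_on_inv_into)

lemma premanifold_plane: "premanifold plane"
  unfolding premanifold_def plane_def
  by (auto simp: param_inv inj_a inj_on_inv_into transits_refl transits_a)

lemma chart_a: "chart plane UNIV a0" "chart plane UNIV a1" "chart plane UNIV a2"
  using chart_atlas[OF premanifold_plane, of "range a0" "inv a0"] chart_atlas[OF premanifold_plane, of "range a1" "inv a1"]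
    chart_atlas[OF premanifold_plane, of "range a2" "inv a2"]
  by (simp_all add: plane_def param_inv inj_a)

lemma pts_plane: "pts plane = range a0 \<union> range (pt 1) \<union> {pt 2 0}"
proof (intro subset_antisym subsetI)
  fix c assume "c \<in> pts plane"
  then obtain a b where "c = a0 (a, b) \<or> c = a1 (a, b) \<or> c = a2 (a, b)"
    unfolding plane_def by auto
  then show "c \<in> range a0 \<union> range (pt 1) \<union> {pt 2 0}"
    by (cases "a = 0"; cases "b = 0") (auto simp: a0_def a1_def a2_def)
next
  have "pt 1 z = a1 (0, z)" "pt 2 0 = a2 (0, 0)" for z by (simp_all add: a1_def a2_def)
  then have "pt 1 z \<in> range a1" "pt 2 0 \<in> range a2" for z by simp_all
  moreover fix c assume "c \<in> range a0 \<union> range (pt 1) \<union> {pt 2 0}"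
  ultimately show "c \<in> pts plane" unfolding plane_def cmfd.simps by (elim UnE rangeE singletonE) simp_all
qed

lemma separated_sym:
  "(\<exists>A B. openin T A \<and> openin T B \<and> q \<in> A \<and> p \<in> B \<and> A \<inter> B = {}) \<Longrightarrow>
   (\<exists>A B. openin T A \<and> openin T B \<and> p \<in> A \<and> q \<in> B \<and> A \<inter> B = {})"
  by (metis Int_commute)

text \<open>Points without a common affine chart are told apart by a coordinate of one chart that is
  reciprocal to a coordinate of the other: x and 1/x, y and 1/y, or y/x and x/y. The sets where the
  respective coordinate has norm below 1 are disjoint.\<close>

lemma Hausdorff_plane: "Hausdorff_space (mtop plane)"
proof -
  let ?sep = "\<lambda>p q. \<exists>A B. openin (mtop plane) A \<and> openin (mtop plane) B \<and> p \<in> A \<and> q \<in> B \<and> A \<inter> B = {}"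
  note M = premanifold_plane
  have o: "open {v :: complex \<times> complex. norm (fst v) < 1}" "open {v :: complex \<times> complex. norm (snd v) < 1}"
    by (intro open_Collect_less continuous_intros)+
  have i: "openin (mtop plane) (\<sigma> ` {v. norm (fst v) < 1})" "openin (mtop plane) (\<sigma> ` {v. norm (snd v) < 1})"
    if "\<sigma> \<in> {a0, a1, a2}" for \<sigma>
    using that chart_a o by (auto intro!: openin_chart_image[OF M])
  have n: "norm (1 / z) < 1 \<Longrightarrow> norm z < 1 \<Longrightarrow> False" if "z \<noteq> 0" for z :: complex
    using that by (auto simp: norm_divide field_simps)
  have sI: "?sep p q" if "openin (mtop plane) A" "openin (mtop plane) B" "p \<in> A" "q \<in> B" "A \<inter> B = {}" for A B p q
    using that by (intro exI[of _ A] exI[of _ B] conjI)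
  have 00: "?sep p q" if "p \<in> range a0" "q \<in> range a0" "p \<noteq> q" for p q
    by (rule separated_in_chart[OF M chart_a(1) that])
  have 11: "?sep p q" if "p \<in> range a1" "q \<in> range a1" "p \<noteq> q" for p q
    by (rule separated_in_chart[OF M chart_a(2) that])
  have 22: "?sep p q" if "p \<in> range a2" "q \<in> range a2" "p \<noteq> q" for p q
    by (rule separated_in_chart[OF M chart_a(3) that])
  have r: "pt 1 z = a1 (0, z)" "pt 2 0 = a2 (0, 0)" "z \<noteq> 0 \<Longrightarrow> pt 1 z = a2 (0, 1 / z)"
    "x \<noteq> 0 \<Longrightarrow> a0 (x, y) = a1 (1 / x, y / x)" "y \<noteq> 0 \<Longrightarrow> a0 (x, y) = a2 (1 / y, x / y)" for x y z
    by (simp_all add: a0_def a1_def a2_def)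
  have 01: "?sep (a0 (x, y)) (pt 1 z)" for x y z
  proof (cases "x = 0")
    case True
    have "a0 ` {v. norm (fst v) < 1} \<inter> a1 ` {v. norm (fst v) < 1} = {}"
      using n by (auto simp: a0_def a1_def split: if_splits)
    moreover have "a0 (x, y) \<in> a0 ` {v. norm (fst v) < 1}" using True by auto
    moreover have "pt 1 z \<in> a1 ` {v. norm (fst v) < 1}" unfolding r(1) by auto
    ultimately show ?thesis by (intro sI[OF i(1)[of a0] i(1)[of a1]]) simp_all
  next
    case False
    then have "a0 (x, y) \<in> range a1" "pt 1 z \<in> range a1" using r by auto
    then show ?thesis by (rule 11) (simp add: a0_def)
  qed
  have 02: "?sep (a0 (x, y)) (pt 2 0)" for x y
  proof (cases "y = 0")
    case True
    have "a0 ` {v. norm (snd v) < 1} \<inter> a2 ` {v. norm (fst v) < 1} = {}"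
      using n by (auto simp: a0_def a2_def split: if_splits)
    moreover have "a0 (x, y) \<in> a0 ` {v. norm (snd v) < 1}" using True by auto
    moreover have "pt 2 0 \<in> a2 ` {v. norm (fst v) < 1}" unfolding r(2) by auto
    ultimately show ?thesis by (intro sI[OF i(2)[of a0] i(1)[of a2]]) simp_all
  next
    case False
    then have "a0 (x, y) \<in> range a2" "pt 2 0 \<in> range a2" using r by auto
    then show ?thesis by (rule 22) (simp add: a0_def)
  qed
  have 12: "?sep (pt 1 z) (pt 2 0)" for z
  proof (cases "z = 0")
    case True
    have bd: "b * d = 1" if "a1 (a, b) = a2 (c, d)" for a b c d
      using that by (cases "a = 0"; cases "c = 0"; cases "d = 0") (auto simp: a1_def a2_def field_simps)
    have "norm b < 1 \<Longrightarrow> norm d < 1 \<Longrightarrow> b * d \<noteq> 1" for b d :: complex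
      using mult_strict_mono'[of "norm b" 1 "norm d" 1]
      by (metis mult_1 norm_ge_zero norm_mult norm_one less_irrefl)
    then have "a1 ` {v. norm (snd v) < 1} \<inter> a2 ` {v. norm (snd v) < 1} = {}"
      using bd by (simp add: disjoint_iff image_iff) (metis prod.collapse)
    moreover have "pt 1 z \<in> a1 ` {v. norm (snd v) < 1}" unfolding r(1) True by auto
    moreover have "pt 2 0 \<in> a2 ` {v. norm (snd v) < 1}" unfolding r(2) by auto
    ultimately show ?thesis by (intro sI[OF i(2)[of a1] i(2)[of a2]]) simp_all
  next
    case False
    then have "pt 1 z \<in> range a2" "pt 2 0 \<in> range a2" using r by auto
    then show ?thesis by (rule 22) simp
  qed
  have s: "?sep p q \<Longrightarrow> ?sep q p" for p q by (rule separated_sym)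
  show ?thesis
    unfolding Hausdorff_mtop_iff[OF M]
  proof (intro ballI impI)
    fix p q assume pq: "p \<in> pts plane" "q \<in> pts plane" "p \<noteq> q"
    have r1: "pt 1 z \<in> range a1" for z using r(1) by auto
    show "?sep p q"
      using pq(1,2) unfolding pts_plane
      by (elim UnE rangeE singletonE)
        (use 00 01 02 11[OF r1 r1] 12 s pq(3) in auto)
  qed
qed

definition to_P2 :: "point \<Rightarrow> (complex \<times> complex \<times> complex) set" where
  "to_P2 c = (case the_elem c of (n, a, b) \<Rightarrow>
     if n = 0 then line (1, a, b) else if n = 1 then line (0, 1, a) else line (0, 0, 1))"

lemma mem_line3: "v \<in> line (a, b, c) \<longleftrightarrow> (\<exists>k. v = (k * a, k * b, k * c))" for a b c :: complex
  by (auto simp: line_def cscale_prod_def cscale_complex_def)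

lemma line3_scale:
  fixes a b c k :: complex
  assumes "k \<noteq> 0" shows "line (k * a, k * b, k * c) = line (a, b, c)"
proof -
  have "\<exists>j. (m * (k * a), m * (k * b), m * (k * c)) = (j * a, j * b, j * c)" for m
    by (intro exI[of _ "m * k"]) simp
  moreover have "\<exists>j. (m * a, m * b, m * c) = (j * (k * a), j * (k * b), j * (k * c))" for m
    using assms by (intro exI[of _ "m / k"]) simp
  ultimately show ?thesis by (auto simp: mem_line3 set_eq_iff)
qed

lemma line3_eq: "line (a, b, c) = line (a', b', c') \<Longrightarrow> \<exists>k. a = k * a' \<and> b = k * b' \<and> c = k * c'" for a b c a' b' c' :: complex
proof -
  assume "line (a, b, c) = line (a', b', c')"
  then have "(a, b, c) \<in> line (a', b', c')"
    using mem_line3[of "(a, b, c)" a b c] by (metis mult_1)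
  then show ?thesis by (auto simp: mem_line3)
qed

lemma to_P2_a: "to_P2 (a0 (a, b)) = line (1, a, b)" "to_P2 (a1 (a, b)) = line (a, 1, b)" "to_P2 (a2 (a, b)) = line (a, b, 1)"
proof -
  show "to_P2 (a0 (a, b)) = line (1, a, b)" by (simp add: to_P2_def a0_def)
  show "to_P2 (a1 (a, b)) = line (a, 1, b)"
  proof (cases "a = 0")
    case False
    then have "line (1 :: complex, 1 / a, b / a) = line (a, 1, b)" using line3_scale[of "1 / a" a 1 b] by simp
    then show ?thesis using False by (simp add: to_P2_def a1_def)
  qed (simp add: to_P2_def a1_def pt_def)
  show "to_P2 (a2 (a, b)) = line (a, b, 1)"
  proof (cases "a = 0")
    case True
    show ?thesis
    proof (cases "b = 0")
      case False
      then have "line (0 :: complex, 1 :: complex, 1 / b) = line (0, b, 1)" using line3_scale[of "1 / b" 0 b 1] by simp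
      then show ?thesis using True False by (simp add: to_P2_def a2_def pt_def)
    qed (simp add: True to_P2_def a2_def pt_def)
  next
    case False
    then have "line (1 :: complex, b / a, 1 / a) = line (a, b, 1)" using line3_scale[of "1 / a" a b 1] by simp
    then show ?thesis using False by (simp add: to_P2_def a2_def)
  qed
qed

lemma line3_self: "(a, b, c) \<in> line (a, b, c)" for a b c :: complex
  unfolding mem_line3 by (intro exI[of _ 1]) simp

lemma line3_mem: "(1 :: complex, a, b) \<in> line (1, a', b') \<longleftrightarrow> a = a' \<and> b = b'"
    "(a, 1 :: complex, b) \<in> line (a', 1, b') \<longleftrightarrow> a = a' \<and> b = b'"
    "(a, b, 1 :: complex) \<in> line (a', b', 1) \<longleftrightarrow> a = a' \<and> b = b'" for a b a' b' :: complex
  using mem_line3[of "(1, a, b)" 1 a' b'] mem_line3[of "(a, 1, b)" a' 1 b'] mem_line3[of "(a, b, 1)" a' b' 1]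
    line3_self[of 1 a b] line3_self[of a 1 b] line3_self[of a b 1] by auto

lemma to_P2_pts: "to_P2 ` pts plane = pts P2"
proof (intro subset_antisym subsetI)
  fix l assume "l \<in> to_P2 ` pts plane"
  then obtain v where "l = to_P2 (a0 v) \<or> l = to_P2 (a1 v) \<or> l = to_P2 (a2 v)" unfolding plane_def by auto
  then obtain a b where "l = line (1, a, b) \<or> l = line (a, 1, b) \<or> l = line (a, b, 1)"
    by (cases v) (auto simp: to_P2_a)
  then obtain w where "l = line w" "w \<noteq> 0" by (auto simp: zero_prod_def)
  then show "l \<in> pts P2" unfolding P2_def cmfd.simps by blast
next
  fix l assume "l \<in> pts P2"
  then obtain a b c where l: "l = line (a, b, c)" "(a, b, c) \<noteq> 0" by (auto simp: P2_def)
  then have "a \<noteq> 0 \<or> b \<noteq> 0 \<or> c \<noteq> 0" by (auto simp: zero_prod_def)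
  then have "l = to_P2 (a0 (b / a, c / a)) \<or> l = to_P2 (a1 (a / b, c / b)) \<or> l = to_P2 (a2 (a / c, b / c))"
    unfolding to_P2_a l
    using line3_scale[of a 1 "b / a" "c / a"] line3_scale[of b "a / b" 1 "c / b"] line3_scale[of c "a / c" "b / c" 1]
    by auto
  then show "l \<in> to_P2 ` pts plane" unfolding plane_def by auto
qed

lemma inj_to_P2: "inj_on to_P2 (pts plane)"
proof (rule inj_onI)
  fix p q assume "p \<in> pts plane" "q \<in> pts plane" "to_P2 p = to_P2 q"
  then show "p = q"
    unfolding pts_plane
    by (auto simp: a0_def to_P2_def pt_def dest!: line3_eq)
qed

lemma matching_chart:
  fixes M :: "('a, 'm::complex_space) cmfd" and N :: "('b, 'm) cmfd"
  assumes "inj \<sigma>" "q \<in> range \<sigma>" "(range \<sigma>, inv \<sigma>) \<in> atlas M" "range \<sigma> \<subseteq> pts M" "(U', \<psi>) \<in> atlas N" "inj_on \<psi> U'"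
    "\<And>v. F (\<sigma> v) \<in> U'" "\<And>v. \<psi> (F (\<sigma> v)) = v"
  shows "\<exists>U \<phi> U' \<psi> W. (U, \<phi>) \<in> atlas M \<and> (U', \<psi>) \<in> atlas N \<and> q \<in> U \<and>
      U \<subseteq> pts M \<and> inj_on \<phi> U \<and> inj_on \<psi> U' \<and> open W \<and> \<phi> q \<in> W \<and> W \<subseteq> \<phi> ` U \<and>
      (\<forall>q\<in>U. \<phi> q \<in> W \<longrightarrow> F q \<in> U' \<and> \<psi> (F q) = \<phi> q)"
  by (rule exI[of _ "range \<sigma>"], rule exI[of _ "inv \<sigma>"], rule exI[of _ U'], rule exI[of _ \<psi>], rule exI[of _ UNIV])
    (use assms in \<open>auto simp: param_inv inj_on_inv_into\<close>)

lemma the_pair: "(THE (a, b). a = x \<and> b = y) = (x, y)"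
  by (rule the_equality) auto

lemma biholomorphic_plane: "biholomorphic plane P2 to_P2"
proof (rule biholomorphic_atlasI)
  show "bij_betw to_P2 (pts plane) (pts P2)" using inj_to_P2 to_P2_pts by (simp add: bij_betw_def)
  fix q assume "q \<in> pts plane"
  then have "q \<in> range a0 \<or> q \<in> range a1 \<or> q \<in> range a2" by (auto simp: plane_def)
  then show "\<exists>U \<phi> U' \<psi> W. (U, \<phi>) \<in> atlas plane \<and> (U', \<psi>) \<in> atlas P2 \<and> q \<in> U \<and>
      U \<subseteq> pts plane \<and> inj_on \<phi> U \<and> inj_on \<psi> U' \<and> open W \<and> \<phi> q \<in> W \<and> W \<subseteq> \<phi> ` U \<and>
      (\<forall>q\<in>U. \<phi> q \<in> W \<longrightarrow> to_P2 q \<in> U' \<and> \<psi> (to_P2 q) = \<phi> q)"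
  proof (elim disjE)
    assume q: "q \<in> range a0"
    show ?thesis
      by (rule matching_chart[OF inj_a(1) q, of plane "{line (1, a, b) |a b. True}" "\<lambda>l. THE (a, b). (1, a, b) \<in> l"])
        (auto simp: plane_def P2_def to_P2_a line3_mem the_pair intro!: inj_onI, blast)
  next
    assume q: "q \<in> range a1"
    show ?thesis
      by (rule matching_chart[OF inj_a(2) q, of plane "{line (a, 1, b) |a b. True}" "\<lambda>l. THE (a, b). (a, 1, b) \<in> l"])
        (auto simp: plane_def P2_def to_P2_a line3_mem the_pair intro!: inj_onI, blast)
  next
    assume q: "q \<in> range a2"
    show ?thesis
      by (rule matching_chart[OF inj_a(3) q, of plane "{line (a, b, 1) |a b. True}" "\<lambda>l. THE (a, b). (a, b, 1) \<in> l"])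
        (auto simp: plane_def P2_def to_P2_a line3_mem the_pair intro!: inj_onI, blast)
  qed
qed

lemma stage_plane: "stage 3 plane"
proof -
  have c: "countable (atlas plane)" by (simp add: plane_def)
  have m: "complex_manifold plane"
    unfolding complex_manifold_iff
    using premanifold_plane Hausdorff_plane second_countable_mtop[OF premanifold_plane c] by simp
  have "\<forall>c\<in>pts plane. \<exists>m<3. \<exists>a b. c = {(m, a, b)}"
    unfolding pts_plane by (auto simp: a0_def)
  moreover have "\<exists>\<pi>. iterated_blowup plane \<pi> \<and> (\<forall>x y. \<pi> {(0, x, y)} = line (1, x, y))"
    using iterated_blowup.plane[OF m biholomorphic_plane] to_P2_a(1) by (auto simp: a0_def)
  ultimately show ?thesis using c m by (simp add: stage_def)
qed

subsection \<open>The nine blow-ups\<close>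

text \<open>In terms of \<open>v = 1/y\<close>, \<open>\<xi> = x/y\<^sup>2\<close>, \<open>q = y/x\<close>, \<open>r = 1/4 - \<xi>\<close> and \<open>m = r/v\<^sup>2 - 1\<close> the charts below have
  the coordinates
  \<open>f1A: (v, x)\<close>, \<open>f1B: (x v, 1/x)\<close>, \<open>f2A: (v, x/v)\<close>, \<open>f2B: (x, v/x)\<close>, \<open>f3A: (v, x/v\<^sup>2)\<close>, \<open>f3B: (x/v, v\<^sup>2/x)\<close>,
  \<open>e1A: (1/x, y)\<close>, \<open>e1B: (q, v)\<close>, \<open>e2A: (q, \<xi>)\<close>, \<open>e2B: (v, 1/\<xi>)\<close>, \<open>e3A: (q, (\<xi> - 1/4)/q)\<close>,
  \<open>e3B: (\<xi> - 1/4, q/(\<xi> - 1/4))\<close>, \<open>e3C: (v, r/v)\<close>, \<open>e4A: (v, r/v\<^sup>2)\<close>, \<open>e4B: (r/v, v\<^sup>2/r)\<close>,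
  \<open>e5A: (v, m/v)\<close>, \<open>e5B: (m, v/m)\<close>, \<open>e6A: (v, m/v\<^sup>2)\<close>, \<open>e6B: (m/v, v\<^sup>2/m)\<close>.
  Three blow-ups lie over \<open>[0 : 0 : 1]\<close>; the other six lie over \<open>[0 : 1 : 0]\<close>, the third of them at
  the point \<open>\<xi> = 1/4\<close> and the fifth at the point \<open>r/v\<^sup>2 = 1\<close> of the preceding exceptional curve.\<close>

definition f1A :: "complex \<times> complex \<Rightarrow> point" where
  "f1A = (\<lambda>(a, b). if a = 0 then pt 3 b else {(0, b, 1 / a)})"
definition f1B :: "complex \<times> complex \<Rightarrow> point" where
  "f1B = (\<lambda>(a, b). if a = 0 then if b = 0 then pt_inf 3 else pt 3 (1 / b)
     else if b = 0 then pt 1 (1 / a) else {(0, 1 / b, 1 / (a * b))})"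
definition f2A :: "complex \<times> complex \<Rightarrow> point" where
  "f2A = (\<lambda>(a, b). if a = 0 then pt 4 b else {(0, a * b, 1 / a)})"
definition f2B :: "complex \<times> complex \<Rightarrow> point" where
  "f2B = (\<lambda>(a, b). if a = 0 then if b = 0 then pt_inf 4 else pt 4 (1 / b)
     else if b = 0 then pt 3 a else {(0, a, 1 / (a * b))})"
definition f3A :: "complex \<times> complex \<Rightarrow> point" where
  "f3A = (\<lambda>(a, b). if a = 0 then pt 5 b else {(0, a * (a * b), 1 / a)})"
definition f3B :: "complex \<times> complex \<Rightarrow> point" where
  "f3B = (\<lambda>(a, b). if a = 0 then if b = 0 then pt_inf 5 else pt 5 (1 / b)
     else if b = 0 then pt 4 a else {(0, a * b * a, 1 / (a * b))})"
definition e1A :: "complex \<times> complex \<Rightarrow> point" where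
  "e1A = (\<lambda>(a, b). if a = 0 then pt 6 b else {(0, 1 / a, b)})"
definition e1B :: "complex \<times> complex \<Rightarrow> point" where
  "e1B = (\<lambda>(a, b). if a = 0 then if b = 0 then pt_inf 6 else pt 6 (1 / b)
     else if b = 0 then pt 1 a else {(0, 1 / (a * b), 1 / b)})"
definition e2A :: "complex \<times> complex \<Rightarrow> point" where
  "e2A = (\<lambda>(a, b). if a = 0 then pt 7 b
     else if b = 0 then pt 1 a else {(0, 1 / (a * (a * b)), 1 / (a * b))})"
definition e2B :: "complex \<times> complex \<Rightarrow> point" where
  "e2B = (\<lambda>(a, b). if a = 0 then if b = 0 then pt_inf 7 else pt 7 (1 / b)
     else if b = 0 then pt 6 (1 / a) else {(0, 1 / (a * b * a), 1 / a)})"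
text \<open>\<open>blow_up\<close> always takes the origin of a parametrization as centre, so the
  centre xi = 1/4 has to be moved there first. \<open>e4S\<close> does the same for r/v^2 =
  1.\<close>

definition e2S :: "complex \<times> complex \<Rightarrow> point" where
  "e2S = (\<lambda>(a, b). e2A (a, b + 1/4))"
definition e3A :: "complex \<times> complex \<Rightarrow> point" where
  "e3A = (\<lambda>(a, b). if a = 0 then pt 8 b
     else if a * b + 1/4 = 0 then pt 1 a else {(0, 1 / (a * (a * (a * b + 1/4))), 1 / (a * (a * b + 1/4)))})"
definition e3B :: "complex \<times> complex \<Rightarrow> point" where
  "e3B = (\<lambda>(a, b). if a = 0 then if b = 0 then pt_inf 8 else pt 8 (1 / b)
     else if b = 0 then pt 7 (a + 1/4)
     else if a + 1/4 = 0 then pt 1 (a * b) else {(0, 1 / (a * b * (a * b * (a + 1/4))), 1 / (a * b * (a + 1/4)))})"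
definition dom_e3C :: "(complex \<times> complex) set" where
  "dom_e3C = {(a, b). a * b \<noteq> 1/4}"
definition e3C :: "complex \<times> complex \<Rightarrow> point" where
  "e3C = (\<lambda>(a, b). if a = 0 then pt 8 (- b / 4) else {(0, (1/4 - a * b) / a\<^sup>2, 1 / a)})"
definition e4A :: "complex \<times> complex \<Rightarrow> point" where
  "e4A = (\<lambda>(a, b). if a = 0 then pt 9 b else {(0, (1/4 - a * (a * b)) / a\<^sup>2, 1 / a)})"
definition e4B :: "complex \<times> complex \<Rightarrow> point" where
  "e4B = (\<lambda>(a, b). if a = 0 then if b = 0 then pt_inf 9 else pt 9 (1 / b)
     else if b = 0 then pt 8 (- a / 4) else {(0, (1/4 - a * b * a) / (a * b)\<^sup>2, 1 / (a * b))})"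
definition dom_e4S :: "(complex \<times> complex) set" where
  "dom_e4S = {(a, b). a * (a * (b + 1)) \<noteq> 1/4}"
definition e4S :: "complex \<times> complex \<Rightarrow> point" where
  "e4S = (\<lambda>(a, b). e4A (a, b + 1))"
definition e5A :: "complex \<times> complex \<Rightarrow> point" where
  "e5A = (\<lambda>(a, b). if a = 0 then pt 10 b else {(0, (1/4 - a * (a * (a * b + 1))) / a\<^sup>2, 1 / a)})"
definition e5B :: "complex \<times> complex \<Rightarrow> point" where
  "e5B = (\<lambda>(a, b). if a = 0 then if b = 0 then pt_inf 10 else pt 10 (1 / b)
     else if b = 0 then pt 9 (a + 1) else {(0, (1/4 - a * b * (a * b * (a + 1))) / (a * b)\<^sup>2, 1 / (a * b))})"
definition e6A :: "complex \<times> complex \<Rightarrow> point" where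
  "e6A = (\<lambda>(a, b). if a = 0 then pt 11 b else {(0, (1/4 - a * (a * (a * (a * b) + 1))) / a\<^sup>2, 1 / a)})"
definition e6B :: "complex \<times> complex \<Rightarrow> point" where
  "e6B = (\<lambda>(a, b). if a = 0 then if b = 0 then pt_inf 11 else pt 11 (1 / b)
     else if b = 0 then pt 10 a else {(0, (1/4 - a * b * (a * b * (a * b * a + 1))) / (a * b)\<^sup>2, 1 / (a * b))})"

text \<open>The explicit charts are what the lifts produce. Their nested products, such as a (a b),
  keep the shape in which the substitutions (a, a b) and (a b, a) create them.\<close>

lemma lift_simps:
  "lift_A a2 (exc 3) = f1A" "lift_B a2 (exc 3) = f1B"
  "lift_A f1A (exc 4) = f2A" "lift_B f1A (exc 4) = f2B"
  "lift_A f2A (exc 5) = f3A" "lift_B f2A (exc 5) = f3B"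
  "lift_A a1 (exc 6) = e1A" "lift_B a1 (exc 6) = e1B"
  "lift_A e1B (exc 7) = e2A" "lift_B e1B (exc 7) = e2B"
  "lift_A e2S (exc 8) = e3A" "lift_B e2S (exc 8) = e3B"
  "lift_A e3C (exc 9) = e4A" "lift_B e3C (exc 9) = e4B"
  "lift_A e4S (exc 10) = e5A" "lift_B e4S (exc 10) = e5B"
  "lift_A e5A (exc 11) = e6A" "lift_B e5A (exc 11) = e6B"
  by (auto simp: fun_eq_iff lift_A_def lift_B_def a1_def a2_def f1A_def f1B_def f2A_def f2B_def f3A_def f3B_def
      e1A_def e1B_def e2A_def e2B_def e2S_def e3A_def e3B_def e3C_def e4A_def e4B_def e4S_def e5A_def e5B_def
      e6A_def e6B_def)

definition "dom_e5A = dom_A dom_e4S"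

definition "S1 = blow_up plane UNIV a2 (exc 3)"
definition "S2 = blow_up S1 UNIV f1A (exc 4)"
definition "S3 = blow_up S2 UNIV f2A (exc 5)"
definition "S4 = blow_up S3 UNIV a1 (exc 6)"
definition "S5 = blow_up S4 UNIV e1B (exc 7)"
definition "S6 = blow_up S5 UNIV e2S (exc 8)"
definition "S7 = blow_up S6 dom_e3C e3C (exc 9)"
definition "S8 = blow_up S7 dom_e4S e4S (exc 10)"
definition "S9 = blow_up S8 dom_e5A e5A (exc 11)"

lemma dom_UNIV [simp]: "dom_A UNIV = UNIV" "dom_B UNIV = UNIV"
  by (auto simp: dom_A_def dom_B_def)

lemma stage_step:
  assumes "stage n S" "chart S V \<sigma>" "0 \<in> V" "n > 0" "S' = blow_up S V \<sigma> (exc n)"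
  shows "stage (Suc n) S'" "chart S' (dom_A V) (lift_A \<sigma> (exc n))" "chart S' (dom_B V) (lift_B \<sigma> (exc n))"
    and "\<And>W \<tau>. chart S W \<tau> \<Longrightarrow> \<sigma> 0 \<notin> \<tau> ` W \<Longrightarrow> chart S' W \<tau>"
  using stage_blow_up[OF assms(1-4)] stage_chart_A[OF assms(1-3)] stage_chart_B[OF assms(1-3)]
    stage_chart_keep[OF assms(1-3)] assms(5) by auto

text \<open>These nine points vanish from the surface one after the other; a chart lasts to the end
  iff it avoids the centres still to come.\<close>

lemma base_points: "a2 0 = pt 2 0" "f1A 0 = pt 3 0" "f2A 0 = pt 4 0" "a1 0 = pt 1 0" "e1B 0 = pt_inf 6"
    "e2S 0 = pt 7 (1/4)" "e3C 0 = pt 8 0" "e4S 0 = pt 9 1" "e5A 0 = pt 10 0"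
  by (simp_all add: Pair_zero a1_def a2_def f1A_def f2A_def e1B_def e2S_def e2A_def e3C_def e4S_def e4A_def e5A_def)

lemma S1: "stage 4 S1" "chart S1 UNIV f1A" "chart S1 UNIV f1B"
    "chart plane W \<tau> \<Longrightarrow> pt 2 0 \<notin> \<tau> ` W \<Longrightarrow> chart S1 W \<tau>"
  using stage_step[OF stage_plane chart_a(3) _ _ S1_def] by (auto simp: lift_simps base_points)

lemma S2: "stage 5 S2" "chart S2 UNIV f2A" "chart S2 UNIV f2B"
    "chart S1 W \<tau> \<Longrightarrow> pt 3 0 \<notin> \<tau> ` W \<Longrightarrow> chart S2 W \<tau>"
  using stage_step[OF S1(1,2) _ _ S2_def] by (auto simp: lift_simps base_points)

lemma S3: "stage 6 S3" "chart S3 UNIV f3A" "chart S3 UNIV f3B"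
    "chart S2 W \<tau> \<Longrightarrow> pt 4 0 \<notin> \<tau> ` W \<Longrightarrow> chart S3 W \<tau>"
  using stage_step[OF S2(1,2) _ _ S3_def] by (auto simp: lift_simps base_points)

text \<open>The first three centres lie over [0:0:1], so the chart around [0:1:0] is still intact
  when the second chain of blow-ups starts.\<close>

lemma chart_S3_a1: "chart S3 UNIV a1"
proof (intro S1(4) S2(4) S3(4) chart_a)
  show "pt 2 0 \<notin> range a1" "pt 3 0 \<notin> range a1" "pt 4 0 \<notin> range a1"
    by (auto simp: a1_def split: if_splits)
qed

lemma S4: "stage 7 S4" "chart S4 UNIV e1A" "chart S4 UNIV e1B"
    "chart S3 W \<tau> \<Longrightarrow> pt 1 0 \<notin> \<tau> ` W \<Longrightarrow> chart S4 W \<tau>"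
  using stage_step[OF S3(1) chart_S3_a1 _ _ S4_def] by (auto simp: lift_simps base_points)

lemma S5: "stage 8 S5" "chart S5 UNIV e2A" "chart S5 UNIV e2B"
    "chart S4 W \<tau> \<Longrightarrow> pt_inf 6 \<notin> \<tau> ` W \<Longrightarrow> chart S5 W \<tau>"
  using stage_step[OF S4(1,3) _ _ S5_def] by (auto simp: lift_simps base_points)

lemma chart_S5_e2S: "chart S5 UNIV e2S"
proof -
  have "chart S5 UNIV (\<lambda>v. e2A (fst v, snd v + 1/4))"
    by (rule chart_change[OF S5(2), where h = "\<lambda>v. (fst v, snd v - 1/4)" and A = UNIV])
      (auto simp: holo_on_iff_cdiff intro!: cdiff_intros)
  then show ?thesis by (simp add: e2S_def case_prod_beta')
qed

lemma S6: "stage 9 S6" "chart S6 UNIV e3A" "chart S6 UNIV e3B"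
    "chart S5 W \<tau> \<Longrightarrow> pt 7 (1/4) \<notin> \<tau> ` W \<Longrightarrow> chart S6 W \<tau>"
  using stage_step[OF S5(1) chart_S5_e2S _ _ S6_def] by (auto simp: lift_simps base_points)

lemma open_dom_e3C: "open dom_e3C"
  unfolding dom_e3C_def case_prod_beta' by (intro open_Collect_neq continuous_intros)

text \<open>Replaces (q, (xi - 1/4)/q) by (v, r/v), using v = q xi and r = 1/4 - xi; this is
  invertible where xi is nonzero. Keeping v as first coordinate makes the remaining blow-ups end in
  (v, m/v^2) = (y1, x1). At q = 0 one has xi = 1/4, whence the value -b/4 in
  \<open>e3C\<close>.\<close>

lemma chart_S6_e3C: "chart S6 dom_e3C e3C"
proof -
  let ?g = "\<lambda>v. (fst v / (1/4 - fst v * snd v), - snd v * (1/4 - fst v * snd v)) :: complex \<times> complex"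
  let ?h = "\<lambda>v. (fst v * (fst v * snd v + 1/4), - snd v / (fst v * snd v + 1/4)) :: complex \<times> complex"
  let ?A = "{v :: complex \<times> complex. fst v * snd v + 1/4 \<noteq> 0}"
  \<comment> \<open>The product of the two coordinates is r in \<open>e3C\<close> and -r in
    \<open>e3A\<close>. Its change of sign translates the condition xi \<noteq> 0 between the two
    domains.\<close>
  have gp: "fst (?g v) * snd (?g v) = - (fst v * snd v)" if "v \<in> dom_e3C" for v
    using that by (auto simp: dom_e3C_def)
  have hp: "fst (?h v) * snd (?h v) = - (fst v * snd v)" if "v \<in> ?A" for v
    using that by auto
  have "chart S6 dom_e3C (\<lambda>v. e3A (?g v))"
  proof (rule chart_change[OF S6(2), where h = ?h and A = ?A])
    show "holo_on ?g dom_e3C"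
      using open_dom_e3C by (auto simp: holo_on_iff_cdiff dom_e3C_def intro!: cdiff_intros)
    show "holo_on ?h ?A"
      by (auto simp: holo_on_iff_cdiff intro!: cdiff_intros open_Collect_neq continuous_intros)
    show "?h ` ?A \<subseteq> dom_e3C"
    proof
      fix w assume "w \<in> ?h ` ?A"
      then obtain v where v: "v \<in> ?A" "w = ?h v" by blast
      have "fst w * snd w = - (fst v * snd v)" unfolding v(2) by (rule hp[OF v(1)])
      then have "fst w * snd w \<noteq> 1/4" using v(1) by (metis (mono_tags, lifting) add.right_inverse mem_Collect_eq)
      then show "w \<in> dom_e3C" by (simp add: dom_e3C_def case_prod_beta')
    qed
    fix v assume v: "v \<in> ?A"
    then show "?g (?h v) = v" by (auto simp: prod_eq_iff add.commute)
  next
    fix v assume v: "v \<in> dom_e3C"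
    then show "?g v \<in> ?A \<and> ?h (?g v) = v" by (auto simp: dom_e3C_def prod_eq_iff)
  qed (rule subset_UNIV)+
  moreover have "e3C v = e3A (?g v)" if v: "v \<in> dom_e3C" for v
  proof -
    obtain a b where ab: "v = (a, b)" by (cases v)
    then have n: "1/4 - a * b \<noteq> 0" using v by (auto simp: dom_e3C_def)
    define c where "c = 1/4 - a * b"
    have c: "c \<noteq> 0" "a / c * (- b * c) + 1/4 = c" using n by (auto simp: c_def)
    show ?thesis
    proof (cases "a = 0")
      case True then show ?thesis by (simp add: ab e3A_def e3C_def)
    next
      case False then show ?thesis
        using c unfolding ab e3A_def e3C_def by (simp add: c_def[symmetric] power2_eq_square)
    qed
  qed
  ultimately show ?thesis by (rule chart_cong)
qed

lemma zero_in_dom: "0 \<in> dom_e3C" "0 \<in> dom_e4S" "0 \<in> dom_e5A"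
  by (simp_all add: dom_e3C_def dom_e4S_def dom_e5A_def dom_A_def Pair_zero)

lemma S7: "stage 10 S7" "chart S7 (dom_A dom_e3C) e4A" "chart S7 (dom_B dom_e3C) e4B"
    "chart S6 W \<tau> \<Longrightarrow> pt 8 0 \<notin> \<tau> ` W \<Longrightarrow> chart S7 W \<tau>"
  using stage_step[OF S6(1) chart_S6_e3C _ _ S7_def] by (auto simp: lift_simps base_points zero_in_dom)

lemma chart_S7_e4S: "chart S7 dom_e4S e4S"
proof -
  have o: "open dom_e4S"
    unfolding dom_e4S_def case_prod_beta' by (intro open_Collect_neq continuous_intros)
  have "chart S7 dom_e4S (\<lambda>v. e4A (fst v, snd v + 1))"
    by (rule chart_change[OF S7(2), where h = "\<lambda>v. (fst v, snd v - 1)" and A = "dom_A dom_e3C"])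
      (use o open_dom_A[OF open_dom_e3C] in
        \<open>auto simp: holo_on_iff_cdiff dom_A_def dom_e3C_def dom_e4S_def intro!: cdiff_intros\<close>)
  then show ?thesis by (simp add: e4S_def case_prod_beta')
qed

lemma S8: "stage 11 S8" "chart S8 dom_e5A e5A" "chart S8 (dom_B dom_e4S) e5B"
    "chart S7 W \<tau> \<Longrightarrow> pt 9 1 \<notin> \<tau> ` W \<Longrightarrow> chart S8 W \<tau>"
  using stage_step[OF S7(1) chart_S7_e4S _ _ S8_def]
  by (auto simp: lift_simps base_points zero_in_dom dom_e5A_def)

lemma S9: "stage 12 S9" "chart S9 (dom_A dom_e5A) e6A" "chart S9 (dom_B dom_e5A) e6B"
    "chart S8 W \<tau> \<Longrightarrow> pt 10 0 \<notin> \<tau> ` W \<Longrightarrow> chart S9 W \<tau>"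
  using stage_step[OF S8(1,2) _ _ S9_def]
  by (auto simp: lift_simps base_points zero_in_dom)

section \<open>Charts that survive up to the last surface\<close>

lemma keep3:
  assumes "chart S3 W \<tau>" "{pt 1 0, pt_inf 6, pt 7 (1/4), pt 8 0, pt 9 1, pt 10 0} \<inter> \<tau> ` W = {}"
  shows "chart S9 W \<tau>"
  using assms(2) by (intro S9(4) S8(4) S7(4) S6(4) S5(4) S4(4) assms(1)) auto

lemma keep5:
  assumes "chart S5 W \<tau>" "{pt 7 (1/4), pt 8 0, pt 9 1, pt 10 0} \<inter> \<tau> ` W = {}"
  shows "chart S9 W \<tau>"
  using assms(2) by (intro S9(4) S8(4) S7(4) S6(4) assms(1)) auto

lemma premanifold_S9: "premanifold S9" by (rule stage_premanifold[OF S9(1)])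

lemma chart_a0: "chart S9 UNIV a0"
  by (intro keep3 S3(4) S2(4) S1(4) chart_a) (auto simp: a0_def)

lemma chart_f1B: "chart S9 UNIV f1B"
  by (intro keep3 S3(4) S2(4) S1(3)) (auto simp: f1B_def split: if_splits)

lemma chart_f2B: "chart S9 UNIV f2B"
  by (intro keep3 S3(4) S2(3)) (auto simp: f2B_def split: if_splits)

lemma chart_f3: "chart S9 UNIV f3A" "chart S9 UNIV f3B"
  by (intro keep3 S3(2); auto simp: f3A_def split: if_splits)
    (intro keep3 S3(3); auto simp: f3B_def split: if_splits)

lemma chart_e1A: "chart S9 UNIV e1A"
  by (intro keep5 S5(4) S4(2)) (auto simp: e1A_def split: if_splits)

text \<open>The centre xi = 1/4 on this exceptional curve was blown up afterwards; the whole line xi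
  = 1/4 of the chart is cut away. In \<open>e2B\<close> the same line is 1/xi = 4.\<close>

lemma chart_e2A: "chart S9 {v. snd v \<noteq> 1/4} e2A"
  by (intro keep5 chart_subset[OF S5(2)] open_Collect_neq continuous_intros)
    (auto simp: e2A_def split: if_splits)

lemma chart_e2B: "chart S9 {v. snd v \<noteq> 4} e2B"
  by (intro keep5 chart_subset[OF S5(3)] open_Collect_neq continuous_intros)
    (auto simp: e2B_def field_simps split: if_splits)

lemma chart_e3B: "chart S9 UNIV e3B"
  by (intro S9(4) S8(4) S7(4) S6(3)) (auto simp: e3B_def split: if_splits)

text \<open>b = 1 contains the later centre \<open>pt 9 1\<close>. The second condition is r
  \<noteq> 1/4, that is xi \<noteq> 0, inherited from \<open>dom_e3C\<close>.\<close>

lemma chart_e4B: "chart S9 {v. snd v \<noteq> 1 \<and> fst v * snd v * fst v \<noteq> 1/4} e4B"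
proof -
  have "open {v :: complex \<times> complex. snd v \<noteq> 1 \<and> fst v * snd v * fst v \<noteq> 1/4}"
    by (intro open_Collect_conj open_Collect_neq continuous_intros)
  then have "chart S7 {v. snd v \<noteq> 1 \<and> fst v * snd v * fst v \<noteq> 1/4} e4B"
    by (rule chart_subset[OF S7(3)]) (auto simp: dom_B_def dom_e3C_def)
  then show ?thesis
    by (intro S9(4) S8(4)) (auto simp: e4B_def split: if_splits)
qed

lemma chart_e5B: "chart S9 (dom_B dom_e4S) e5B"
  by (intro S9(4) S8(3)) (auto simp: e5B_def split: if_splits)

lemma dom_eqs: "dom_B dom_e4S = {v. fst v * snd v * (fst v * snd v * (fst v + 1)) \<noteq> 1/4}"
  "dom_A dom_e5A = {v. fst v * (fst v * (fst v * (fst v * snd v) + 1)) \<noteq> 1/4}"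
  "dom_B dom_e5A = {v. fst v * snd v * (fst v * snd v * (fst v * snd v * fst v + 1)) \<noteq> 1/4}"
  by (auto simp: dom_A_def dom_B_def dom_e4S_def dom_e5A_def)

lemma pts_blow_up:
  assumes "pts S = A - D" "S' = blow_up S V \<sigma> (exc n)" "\<sigma> 0 = c" "insert c D \<inter> (range (pt n) \<union> {pt_inf n}) = {}"
  shows "pts S' = (A \<union> (range (pt n) \<union> {pt_inf n})) - insert c D"
proof -
  have "pts S' = (A - D) - {c} \<union> (range (pt n) \<union> {pt_inf n})"
    using assms(1-3) by (simp add: blow_up_def exc_image)
  then show ?thesis using assms(4) by blast
qed

text \<open>All points ever created minus the nine centres. The difference keeps this simple form
  because a new exceptional curve never contains a centre already removed; this is the disjointness
  premise of \<open>pts_blow_up\<close>.\<close>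

lemma pts_S9_eq:
  "pts S9 = (pts plane \<union> (\<Union>n\<in>{3..11}. range (pt n) \<union> {pt_inf n})) -
     {pt 10 0, pt 9 1, pt 8 0, pt 7 (1/4), pt_inf 6, pt 1 0, pt 4 0, pt 3 0, pt 2 0}"
proof -
  note 1 = pts_blow_up[OF Diff_empty[symmetric] S1_def base_points(1)]
  note 2 = pts_blow_up[OF 1 S2_def base_points(2)]
  note 3 = pts_blow_up[OF 2 S3_def base_points(3)]
  note 4 = pts_blow_up[OF 3 S4_def base_points(4)]
  note 5 = pts_blow_up[OF 4 S5_def base_points(5)]
  note 6 = pts_blow_up[OF 5 S6_def base_points(6)]
  note 7 = pts_blow_up[OF 6 S7_def base_points(7)]
  note 8 = pts_blow_up[OF 7 S8_def base_points(8)]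
  note 9 = pts_blow_up[OF 8 S9_def base_points(9)]
  have i: "{3..11} = {3, 4, 5, 6, 7, 8, 9, 10, 11 :: nat}" by auto
  have "pts S9 = pts plane \<union> (range (pt 3) \<union> {pt_inf 3}) \<union> (range (pt 4) \<union> {pt_inf 4}) \<union> (range (pt 5) \<union> {pt_inf 5})
    \<union> (range (pt 6) \<union> {pt_inf 6}) \<union> (range (pt 7) \<union> {pt_inf 7}) \<union> (range (pt 8) \<union> {pt_inf 8})
    \<union> (range (pt 9) \<union> {pt_inf 9}) \<union> (range (pt 10) \<union> {pt_inf 10}) \<union> (range (pt 11) \<union> {pt_inf 11})
    - {pt 10 0, pt 9 1, pt 8 0, pt 7 (1/4), pt_inf 6, pt 1 0, pt 4 0, pt 3 0, pt 2 0}"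
    by (rule 9) auto
  then show ?thesis unfolding i by (simp only: UN_insert UN_empty Un_assoc Un_empty_right)
qed

section \<open>Rational curves of self-intersection -2\<close>

lemma inv_inv_into': "inj_on f A \<Longrightarrow> a \<in> A \<Longrightarrow> inv_into (f ` A) (inv_into A f) a = f a"
  by (rule inv_into_f_eq) (auto simp: inj_on_inv_into)

lemma adapted_chartI:
  assumes M: "premanifold S" and c: "chart S V \<sigma>" and C: "\<And>v. v \<in> V \<Longrightarrow> \<sigma> v \<in> C \<longleftrightarrow> snd v = 0"
    and \<kappa>: "\<And>v. v \<in> V \<Longrightarrow> \<kappa> (\<sigma> v) = v"
  shows "adapted_chart S C (\<sigma> ` V) \<kappa>"
proof -
  have "\<kappa> ` (C \<inter> \<sigma> ` V) = {q \<in> \<kappa> ` \<sigma> ` V. snd q = 0}"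
  proof (intro subset_antisym subsetI)
    fix x assume "x \<in> \<kappa> ` (C \<inter> \<sigma> ` V)"
    then obtain v where v: "v \<in> V" "\<sigma> v \<in> C" "x = \<kappa> (\<sigma> v)" by auto
    then have "x \<in> \<kappa> ` \<sigma> ` V" by blast
    then show "x \<in> {q \<in> \<kappa> ` \<sigma> ` V. snd q = 0}" using v C \<kappa> by auto
  next
    fix x assume "x \<in> {q \<in> \<kappa> ` \<sigma> ` V. snd q = 0}"
    then obtain v where "v \<in> V" "snd v = 0" "x = \<kappa> (\<sigma> v)" using \<kappa> by auto
    then show "x \<in> \<kappa> ` (C \<inter> \<sigma> ` V)" using C by auto
  qed
  then show ?thesis unfolding adapted_chart_def using coord_chartI[OF M c \<kappa>] by simp
qed

lemma continuous_map_chart: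
  assumes M: "premanifold S" and c: "chart S V \<sigma>"
  shows "continuous_map (top_of_set V) (mtop S) \<sigma>"
  unfolding continuous_map_def
proof (intro conjI allI impI)
  show "\<sigma> \<in> topspace (top_of_set V) \<rightarrow> topspace (mtop S)"
    using chartD(3)[OF c] by (auto simp: topspace_mtop[OF M])
  fix U assume "openin (mtop S) U"
  then have "open {v\<in>V. \<sigma> v \<in> U}" by (rule open_chart_preimage[OF M c])
  then show "openin (top_of_set V) {x \<in> topspace (top_of_set V). \<sigma> x \<in> U}"
    using chartD(1)[OF c] by (simp add: openin_open_eq subset_iff)
qed

lemma zorder_const: "c \<noteq> 0 \<Longrightarrow> zorder (\<lambda>_. c) z = 0"
  by (rule zorder_eq_0I) (auto intro: analytic_intros)

lemma zorder_inverse_square: "zorder (\<lambda>z. inverse (z\<^sup>2)) 0 = - 2"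
  by (rule zorder_eqI[of UNIV _ "\<lambda>_. 1"])
    (auto simp: power_int_minus power2_eq_square power_int_def field_simps)

text \<open>The two charts describe a neighbourhood of the zero section in the line bundle of degree
  -2 over the projective line. The chart \<sigma> contains the whole affine line w = 0, and \<tau>
  need only reach its point at infinity.\<close>

locale neg2_curve =
  fixes S :: "('a, complex \<times> complex) cmfd" and C :: "'a set" and V \<sigma> V' \<tau>
  assumes S: "complex_manifold S" and c1: "chart S V \<sigma>" and c2: "chart S V' \<tau>"
    and V: "\<And>z. (z, 0) \<in> V" and V': "(0, 0) \<in> V'"
    and C1: "\<And>z w. (z, w) \<in> V \<Longrightarrow> \<sigma> (z, w) \<in> C \<longleftrightarrow> w = 0"
    and C2: "\<And>z w. (z, w) \<in> V' \<Longrightarrow> \<tau> (z, w) \<in> C \<longleftrightarrow> w = 0"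
    and C_sub: "\<And>q. q \<in> C \<Longrightarrow> q = \<tau> (0, 0) \<or> (\<exists>z. q = \<sigma> (z, 0))"
    and inf: "\<tau> (0, 0) \<notin> \<sigma> ` V"
    and rel: "\<And>z w. (z, w) \<in> V \<Longrightarrow> (1 / z, z\<^sup>2 * w) \<in> V' \<Longrightarrow> z \<noteq> 0 \<Longrightarrow> \<sigma> (z, w) = \<tau> (1 / z, z\<^sup>2 * w)"
begin

lemma pre: "premanifold S" using S by (simp add: complex_manifold_iff)

definition "\<kappa>1 = inv_into V \<sigma>"
definition "\<kappa>2 = inv_into V' \<tau>"

lemma \<kappa>1: "v \<in> V \<Longrightarrow> \<kappa>1 (\<sigma> v) = v" "v \<in> V \<Longrightarrow> inv_into (\<sigma> ` V) \<kappa>1 v = \<sigma> v"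
  using chartD(2)[OF c1] by (simp_all add: \<kappa>1_def inv_inv_into')

lemma \<kappa>2: "v \<in> V' \<Longrightarrow> \<kappa>2 (\<tau> v) = v" "v \<in> V' \<Longrightarrow> inv_into (\<tau> ` V') \<kappa>2 v = \<tau> v"
  using chartD(2)[OF c2] by (simp_all add: \<kappa>2_def inv_inv_into')

lemma adapted: "adapted_chart S C (\<sigma> ` V) \<kappa>1" "adapted_chart S C (\<tau> ` V') \<kappa>2"
proof -
  show "adapted_chart S C (\<sigma> ` V) \<kappa>1"
    by (rule adapted_chartI[OF pre c1 _ \<kappa>1(1)]) (auto simp: C1)
  show "adapted_chart S C (\<tau> ` V') \<kappa>2"
    by (rule adapted_chartI[OF pre c2 _ \<kappa>2(1)]) (auto simp: C2)
qed

lemma C_\<sigma>: "\<sigma> (z, 0) \<in> C" and C_\<tau>: "(z, 0) \<in> V' \<Longrightarrow> \<tau> (z, 0) \<in> C"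
  using C1[OF V] C2 by auto

lemma \<sigma>_inj: "\<sigma> (z, 0) = \<sigma> (w, 0) \<longleftrightarrow> z = w"
  using inj_onD[OF chartD(2)[OF c1] _ V V] by auto

lemma \<tau>_inj: "(z, 0) \<in> V' \<Longrightarrow> (w, 0) \<in> V' \<Longrightarrow> \<tau> (z, 0) = \<tau> (w, 0) \<longleftrightarrow> z = w"
  using inj_onD[OF chartD(2)[OF c2]] by auto

lemma \<tau>_eq: "(z, 0) \<in> V' \<Longrightarrow> z \<noteq> 0 \<Longrightarrow> \<tau> (z, 0) = \<sigma> (1 / z, 0)"
  using rel[OF V, of "1 / z"] by simp

lemma open_slice: "open {z. (z, 0) \<in> V'}"
proof -
  have "open ((\<lambda>z. (z, 0)) -` V')" by (rule open_vimage[OF chartD(1)[OF c2]]) (intro continuous_intros)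
  then show ?thesis by (simp add: vimage_def)
qed

text \<open>C is the union of two compact pieces, the disc of radius 1/e in the first chart and that
  of radius e in the second. Compact subsets of a Hausdorff space are closed.\<close>

lemma closed_C: "closedin (mtop S) C"
proof -
  have "0 \<in> {z. (z, 0) \<in> V'}" using V' by simp
  then obtain e where e: "e > 0" "cball 0 e \<subseteq> {z. (z, 0) \<in> V'}"
    using open_slice open_contains_cball by blast
  let ?K1 = "cball (0 :: complex) (1 / e) \<times> {0 :: complex}" and ?K2 = "cball (0 :: complex) e \<times> {0 :: complex}"
  have "compact ?K1" "compact ?K2" by (simp_all add: compact_Times)
  moreover have "?K1 \<subseteq> V" "?K2 \<subseteq> V'" using V e by auto
  ultimately have "compactin (top_of_set V) ?K1" "compactin (top_of_set V') ?K2"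
    by (auto simp: compactin_subtopology)
  then have "compactin (mtop S) (\<sigma> ` ?K1)" "compactin (mtop S) (\<tau> ` ?K2)"
    using continuous_map_chart[OF pre c1] continuous_map_chart[OF pre c2] by (auto intro: image_compactin)
  moreover have "Hausdorff_space (mtop S)" using S by (simp add: complex_manifold_iff)
  ultimately have "closedin (mtop S) (\<sigma> ` ?K1 \<union> \<tau> ` ?K2)"
    by (auto intro: compactin_imp_closedin)
  moreover have "\<sigma> ` ?K1 \<union> \<tau> ` ?K2 = C"
  proof (intro subset_antisym subsetI)
    fix q assume "q \<in> \<sigma> ` ?K1 \<union> \<tau> ` ?K2"
    then show "q \<in> C" using C_\<sigma> C_\<tau> e by auto
  next
    fix q assume "q \<in> C"
    then consider "q = \<tau> (0, 0)" | z where "q = \<sigma> (z, 0)" using C_sub by blast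
    then show "q \<in> \<sigma> ` ?K1 \<union> \<tau> ` ?K2"
    proof cases
      case 1 then show ?thesis using e by auto
    next
      case (2 z)
      show ?thesis
      proof (cases "norm z \<le> 1 / e")
        case True then show ?thesis using 2 by auto
      next
        case False
        then have "norm z > 1 / e" by simp
        moreover have "1 / e > 0" using e by simp
        ultimately have "norm z > 0" by linarith
        then have z: "z \<noteq> 0" "norm (1 / z) \<le> e"
          using e \<open>norm z > 1 / e\<close> by (auto simp: norm_divide field_simps)
        then have "1 / z \<in> cball 0 e" by simp
        moreover from this have "q = \<tau> (1 / z, 0)" using \<tau>_eq[of "1 / z"] z(1) e 2 by auto
        ultimately show ?thesis by auto
      qed
    qed
  qed
  ultimately show ?thesis by simp
qed

lemma C_cover: "q \<in> C \<Longrightarrow> q \<in> \<sigma> ` V \<or> q \<in> \<tau> ` V'"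
  using C_sub[of q] V V' by blast

lemma smooth: "smooth_curve S C"
  unfolding smooth_curve_def using closed_C C_cover adapted by blast

definition "\<gamma> (l :: (complex \<times> complex) set) = (if l = line (0, 1) then \<tau> (0, 0) else \<sigma> (THE z. (1, z) \<in> l, 0))"

lemma \<gamma>_simps: "\<gamma> (line (1, z)) = \<sigma> (z, 0)" "\<gamma> (line (0, 1)) = \<tau> (0, 0)"
  by (simp_all add: \<gamma>_def)

lemma \<gamma>_inf: "(z, 0) \<in> V' \<Longrightarrow> \<gamma> (line (z, 1)) = \<tau> (z, 0)"
proof (cases "z = 0")
  case False
  assume z: "(z, 0) \<in> V'"
  have "line (z, 1) = line (1, 1 / z)" using False by simp
  then show ?thesis using \<tau>_eq[OF z False] \<gamma>_simps(1) by metis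
qed (simp add: \<gamma>_simps)

lemma P1_cases:
  assumes "l \<in> pts P1" obtains z where "l = line (1, z)" | "l = line (0, 1)"
proof -
  from assms consider z where "l = line (1, z)" | z where "l = line (z, 1)" unfolding pts_P1 by auto
  then show ?thesis
  proof cases
    case (2 z)
    then show ?thesis
    proof (cases "z = 0")
      case False
      then have "line (z, 1) = line (1, 1 / z)" by simp
      then show ?thesis using that(1) 2 by metis
    qed (use that(2) 2 in simp)
  qed (rule that(1))
qed

lemma bij_\<gamma>: "bij_betw \<gamma> (pts P1) C"
  unfolding bij_betw_def
proof
  have n: "\<sigma> (z, 0) \<noteq> \<tau> (0, 0)" for z using inf V by (metis imageI)
  show "inj_on \<gamma> (pts P1)"
  proof (rule inj_onI)
    fix l m assume l: "l \<in> pts P1" "m \<in> pts P1" "\<gamma> l = \<gamma> m"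
    show "l = m"
      using l(1) by (cases rule: P1_cases; use l(2) in \<open>cases rule: P1_cases\<close>)
        (use l(3) n in \<open>auto simp: \<gamma>_simps \<sigma>_inj dest: sym\<close>)
  qed
  show "\<gamma> ` pts P1 = C"
  proof (intro subset_antisym subsetI)
    fix q assume "q \<in> \<gamma> ` pts P1"
    then obtain l where "l \<in> pts P1" "q = \<gamma> l" by auto
    then show "q \<in> C" using C_\<sigma> C_\<tau> V' by (cases rule: P1_cases) (auto simp: \<gamma>_simps)
  next
    fix q assume "q \<in> C"
    then consider "q = \<gamma> (line (0, 1))" | z where "q = \<gamma> (line (1, z))" using C_sub by (metis \<gamma>_simps)
    then show "q \<in> \<gamma> ` pts P1" using line_mem_P1 by cases auto
  qed
qed

lemma inj_fst_\<kappa>: "inj_on (fst \<circ> \<kappa>1) (C \<inter> \<sigma> ` V)" "inj_on (fst \<circ> \<kappa>2) (C \<inter> \<tau> ` V')"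
  by (rule inj_onI, auto simp: \<kappa>1 C1, rule inj_onI, auto simp: \<kappa>2 C2)

text \<open>Of all charts in the atlas of \<open>curve_mfd\<close> only the two given ones occur;
  their coordinates z and 1/z are those of the projective line.\<close>

lemma rational: "smooth_rational_curve S C"
  unfolding smooth_rational_curve_def
proof (intro conjI smooth exI)
  show "biholomorphic P1 (curve_mfd S C) \<gamma>"
  proof (rule biholomorphic_atlasI)
    show "bij_betw \<gamma> (pts P1) (pts (curve_mfd S C))" using bij_\<gamma> by (simp add: curve_mfd_def)
    fix p assume "p \<in> pts P1"
    then show "\<exists>U \<phi> U' \<psi> W. (U, \<phi>) \<in> atlas P1 \<and> (U', \<psi>) \<in> atlas (curve_mfd S C) \<and> p \<in> U \<and>
      U \<subseteq> pts P1 \<and> inj_on \<phi> U \<and> inj_on \<psi> U' \<and> open W \<and> \<phi> p \<in> W \<and> W \<subseteq> \<phi> ` U \<and>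
      (\<forall>q\<in>U. \<phi> q \<in> W \<longrightarrow> \<gamma> q \<in> U' \<and> \<psi> (\<gamma> q) = \<phi> q)"
    proof (cases rule: P1_cases)
      case (1 z)
      let ?U = "{line (1 :: complex, z :: complex) |z. True}" and ?\<phi> = "\<lambda>l. THE z. (1 :: complex, z :: complex) \<in> l"
      have "(?U, ?\<phi>) \<in> atlas P1" by (simp add: P1_def)
      moreover have "(C \<inter> \<sigma> ` V, fst \<circ> \<kappa>1) \<in> atlas (curve_mfd S C)"
        unfolding curve_mfd_def using adapted(1) by auto
      moreover have "?U \<subseteq> pts P1" using line_mem_P1 by auto
      moreover have "inj_on ?\<phi> ?U" by (rule inj_onI) auto
      moreover have "UNIV \<subseteq> ?\<phi> ` ?U"
      proof
        fix z :: complex show "z \<in> ?\<phi> ` ?U" by (rule image_eqI[of _ _ "line (1, z)"]) auto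
      qed
      moreover have "\<forall>q\<in>?U. ?\<phi> q \<in> UNIV \<longrightarrow> \<gamma> q \<in> C \<inter> \<sigma> ` V \<and> (fst \<circ> \<kappa>1) (\<gamma> q) = ?\<phi> q"
        using C_\<sigma> V by (auto simp: \<gamma>_simps \<kappa>1)
      moreover have "p \<in> ?U" using 1 by blast
      ultimately show ?thesis using inj_fst_\<kappa>(1)
        by (intro exI[of _ ?U] exI[of _ ?\<phi>] exI[of _ "C \<inter> \<sigma> ` V"] exI[of _ "fst \<circ> \<kappa>1"] exI[of _ UNIV] conjI open_UNIV UNIV_I)
    next
      case 2
      let ?U = "{line (z :: complex, 1 :: complex) |z. True}" and ?\<phi> = "\<lambda>l. THE z. (z :: complex, 1 :: complex) \<in> l"
      let ?W = "{z. (z, 0) \<in> V'}"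
      have "(?U, ?\<phi>) \<in> atlas P1" by (simp add: P1_def)
      moreover have "(C \<inter> \<tau> ` V', fst \<circ> \<kappa>2) \<in> atlas (curve_mfd S C)"
        unfolding curve_mfd_def using adapted(2) by auto
      moreover have "?U \<subseteq> pts P1" using line_mem_P1 by auto
      moreover have "inj_on ?\<phi> ?U" by (rule inj_onI) auto
      moreover have "?W \<subseteq> ?\<phi> ` ?U"
      proof
        fix z assume "z \<in> ?W" show "z \<in> ?\<phi> ` ?U" by (rule image_eqI[of _ _ "line (z, 1)"]) auto
      qed
      moreover have "\<forall>q\<in>?U. ?\<phi> q \<in> ?W \<longrightarrow> \<gamma> q \<in> C \<inter> \<tau> ` V' \<and> (fst \<circ> \<kappa>2) (\<gamma> q) = ?\<phi> q"
        using C_\<tau> by (auto simp: \<gamma>_inf \<kappa>2)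
      moreover have "p \<in> ?U" "?\<phi> p \<in> ?W" using 2 V' by auto
      ultimately show ?thesis using inj_fst_\<kappa>(2) open_slice
        by (intro exI[of _ ?U] exI[of _ ?\<phi>] exI[of _ "C \<inter> \<tau> ` V'"] exI[of _ "fst \<circ> \<kappa>2"] exI[of _ ?W] conjI)
    qed
  qed
qed

lemma eventually_slice: "open W \<Longrightarrow> f 0 \<in> W \<Longrightarrow> continuous_on UNIV f \<Longrightarrow> \<forall>\<^sub>F w in nhds 0. f w \<in> W"
  for W :: "(complex \<times> complex) set" and f :: "complex \<Rightarrow> complex \<times> complex"
  using open_vimage[of W f] by (auto simp: eventually_nhds vimage_def)

lemma eventually_V: "\<forall>\<^sub>F w in nhds 0. (z, c * w) \<in> V" if "(z, 0) \<in> V"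
  by (rule eventually_slice[OF chartD(1)[OF c1]]) (use that in \<open>auto intro!: continuous_intros\<close>)

lemma eventually_V': "\<forall>\<^sub>F w in nhds 0. (z, c * w) \<in> V'" if "(z, 0) \<in> V'"
  by (rule eventually_slice[OF chartD(1)[OF c2]]) (use that in \<open>auto intro!: continuous_intros\<close>)

lemma deriv_cmult: "deriv (\<lambda>w. c * w) (0 :: complex) = c"
  by (rule DERIV_imp_deriv) (auto intro!: derivative_eq_intros)

text \<open>The section of the normal bundle is the one with component 1 in the frame of \<open>\<sigma>\<close>. As
  \<open>w' = z\<^sup>2 w\<close>, its component in the frame of \<open>\<tau>\<close> is \<open>z\<^sup>2 = z'\<^sup>-\<^sup>2\<close>, with a double pole at \<open>z' = 0\<close>.\<close>

lemma self_int: "self_intersection S C (-2)"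
proof -
  let ?W1 = "\<sigma> ` V" and ?W2 = "\<tau> ` V'"
  define s where "s = (\<lambda>(W :: 'a set, \<kappa> :: 'a \<Rightarrow> complex \<times> complex) p. if W = ?W1 then 1 else inverse ((fst (\<kappa>2 p))\<^sup>2))"
  define ord where "ord = (\<lambda>p. if p = \<tau> (0, 0) then -2 else 0 :: int)"
  \<comment> \<open>The section s distinguishes the two charts by their domains, so these must
    differ; the point at infinity lies in only one of them.\<close>
  have W12: "?W2 \<noteq> ?W1" using inf V' by blast
  have s1: "s (?W1, \<kappa>1) = (\<lambda>_. 1)" and s2: "s (?W2, \<kappa>2) = (\<lambda>p. inverse ((fst (\<kappa>2 p))\<^sup>2))"
    using W12 by (simp_all add: s_def fun_eq_iff)
  have p1: "\<exists>z. p = \<sigma> (z, 0)" if "p \<in> C \<inter> ?W1" for p using that C1 by auto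
  have p2: "\<exists>z. p = \<tau> (z, 0) \<and> (z, 0) \<in> V'" if "p \<in> C \<inter> ?W2" for p using that C2 by auto
  have n: "\<sigma> (z, 0) \<noteq> \<tau> (0, 0)" for z using inf V by (metis imageI)
  have a: "let z0 = fst (\<kappa>1 p); g = (\<lambda>z. s (?W1, \<kappa>1) (inv_into ?W1 \<kappa>1 (z, 0)))
           in g meromorphic_on {z0} \<and> (\<forall>\<^sub>F z in at z0. g z \<noteq> 0) \<and> ord p = zorder g z0" if p: "p \<in> C \<inter> ?W1" for p
    using p1[OF p] n by (auto simp: s1 ord_def zorder_const)
  have b: "let z0 = fst (\<kappa>2 p); g = (\<lambda>z. s (?W2, \<kappa>2) (inv_into ?W2 \<kappa>2 (z, 0)))
           in g meromorphic_on {z0} \<and> (\<forall>\<^sub>F z in at z0. g z \<noteq> 0) \<and> ord p = zorder g z0" if p: "p \<in> C \<inter> ?W2" for p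
  proof -
    obtain z0 where z0: "p = \<tau> (z0, 0)" "(z0, 0) \<in> V'" using p2[OF p] by auto
    let ?g = "\<lambda>z. s (?W2, \<kappa>2) (inv_into ?W2 \<kappa>2 (z, 0))"
    have "\<forall>\<^sub>F z in nhds z0. (z, 0) \<in> V'" using open_slice z0(2) by (auto simp: eventually_nhds)
    then have ev: "\<forall>\<^sub>F z in at z0. ?g z = inverse (z\<^sup>2)"
      by (auto simp: eventually_at_filter s2 \<kappa>2 elim!: eventually_mono)
    have m: "(\<lambda>z. inverse (z\<^sup>2)) meromorphic_on {z0}" by (intro meromorphic_intros)
    have 1: "?g meromorphic_on {z0}"
      using m ev meromorphic_on_cong[of "{z0}" ?g "\<lambda>z. inverse (z\<^sup>2)" "{z0}"] by simp
    have "\<forall>\<^sub>F z in at z0. z \<noteq> 0"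
    proof (cases "z0 = 0")
      case True then show ?thesis by (simp add: eventually_at_filter)
    next
      case False
      then have "\<forall>\<^sub>F z in nhds z0. z \<noteq> 0" by (rule t1_space_nhds)
      then show ?thesis by (simp add: eventually_at_filter eventually_mono)
    qed
    then have 2: "\<forall>\<^sub>F z in at z0. ?g z \<noteq> 0" using ev by eventually_elim simp
    have "zorder ?g z0 = zorder (\<lambda>z. inverse (z\<^sup>2)) z0" by (rule zorder_cong[OF ev refl])
    also have "\<dots> = ord p"
    proof (cases "z0 = 0")
      case True then show ?thesis using z0 by (simp add: ord_def zorder_inverse_square)
    next
      case False
      have "p \<noteq> \<tau> (0, 0)" using z0 \<tau>_inj V' False by simp
      moreover have "zorder (\<lambda>z. inverse (z\<^sup>2)) z0 = 0"
        by (rule zorder_eq_0I) (use False in \<open>auto intro!: analytic_intros\<close>)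
      ultimately show ?thesis by (simp add: ord_def)
    qed
    finally show ?thesis using 1 2 z0 by (simp add: \<kappa>2)
  qed
  have d11: "s (?W1, \<kappa>1) p = deriv (\<lambda>w'. snd (\<kappa>1 (inv_into ?W1 \<kappa>1 (fst (\<kappa>1 p), w')))) 0 * s (?W1, \<kappa>1) p"
    if p: "p \<in> C \<inter> ?W1" for p
  proof -
    obtain z where z: "p = \<sigma> (z, 0)" using p1[OF p] by auto
    have "\<forall>\<^sub>F w in nhds 0. snd (\<kappa>1 (inv_into ?W1 \<kappa>1 (fst (\<kappa>1 p), w))) = 1 * w"
      using eventually_V[OF V[of z], of 1] by eventually_elim (use V in \<open>simp add: z \<kappa>1\<close>)
    from deriv_cong_ev[OF this refl] show ?thesis by (simp add: s1 deriv_cmult del: mult_1)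
  qed
  have d22: "s (?W2, \<kappa>2) p = deriv (\<lambda>w'. snd (\<kappa>2 (inv_into ?W2 \<kappa>2 (fst (\<kappa>2 p), w')))) 0 * s (?W2, \<kappa>2) p"
    if p: "p \<in> C \<inter> ?W2" for p
  proof -
    obtain z where z: "p = \<tau> (z, 0)" "(z, 0) \<in> V'" using p2[OF p] by auto
    have "\<forall>\<^sub>F w in nhds 0. snd (\<kappa>2 (inv_into ?W2 \<kappa>2 (fst (\<kappa>2 p), w))) = 1 * w"
      using eventually_V'[OF z(2), of 1] by eventually_elim (use z in \<open>simp add: \<kappa>2\<close>)
    from deriv_cong_ev[OF this refl] have "deriv (\<lambda>w'. snd (\<kappa>2 (inv_into ?W2 \<kappa>2 (fst (\<kappa>2 p), w')))) 0 = 1"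
      by (simp add: deriv_cmult del: mult_1)
    then show ?thesis by simp
  qed
  have both: "\<exists>z. z \<noteq> 0 \<and> p = \<sigma> (z, 0) \<and> p = \<tau> (1 / z, 0) \<and> (1 / z, 0) \<in> V'" if p: "p \<in> C \<inter> ?W1 \<inter> ?W2" for p
  proof -
    obtain z' where z': "p = \<tau> (z', 0)" "(z', 0) \<in> V'" using p2 p by auto
    then have "z' \<noteq> 0" using p inf by auto
    then show ?thesis using z' \<tau>_eq[OF z'(2)] by (intro exI[of _ "1 / z'"]) auto
  qed
  have d12: "s (?W1, \<kappa>1) p = deriv (\<lambda>w'. snd (\<kappa>1 (inv_into ?W2 \<kappa>2 (fst (\<kappa>2 p), w')))) 0 * s (?W2, \<kappa>2) p"
    if p: "p \<in> C \<inter> ?W1 \<inter> ?W2" for p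
  proof -
    obtain z where z: "z \<noteq> 0" "p = \<sigma> (z, 0)" "p = \<tau> (1 / z, 0)" "(1 / z, 0) \<in> V'" using both[OF p] by blast
    have k: "\<kappa>2 p = (1 / z, 0)" using z(3,4) \<kappa>2 by simp
    have "\<forall>\<^sub>F w in nhds 0. snd (\<kappa>1 (inv_into ?W2 \<kappa>2 (fst (\<kappa>2 p), w))) = inverse (z\<^sup>2) * w"
      using eventually_V'[OF z(4), of 1] eventually_V[OF V[of z], of "inverse (z\<^sup>2)"]
    proof eventually_elim
      case (elim w)
      moreover have "z\<^sup>2 * (inverse (z\<^sup>2) * w) = w" using z(1) by simp
      ultimately have "\<sigma> (z, inverse (z\<^sup>2) * w) = \<tau> (1 / z, w)"
        using rel[of z "inverse (z\<^sup>2) * w"] z(1) by (simp only: mult_1 simp_thms)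
      then show ?case using elim \<kappa>1(1)[OF elim(2)] \<kappa>2(2)[of "(1 / z, w)"] by (simp add: k)
    qed
    from deriv_cong_ev[OF this refl]
    have "deriv (\<lambda>w. snd (\<kappa>1 (inv_into ?W2 \<kappa>2 (fst (\<kappa>2 p), w)))) 0 = inverse (z\<^sup>2)" by (simp only: deriv_cmult)
    then show ?thesis using z(1) by (simp add: s1 s2 k power_divide)
  qed
  have d21: "s (?W2, \<kappa>2) p = deriv (\<lambda>w'. snd (\<kappa>2 (inv_into ?W1 \<kappa>1 (fst (\<kappa>1 p), w')))) 0 * s (?W1, \<kappa>1) p"
    if p: "p \<in> C \<inter> ?W1 \<inter> ?W2" for p
  proof -
    obtain z where z: "z \<noteq> 0" "p = \<sigma> (z, 0)" "p = \<tau> (1 / z, 0)" "(1 / z, 0) \<in> V'" using both[OF p] by blast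
    have k: "\<kappa>2 p = (1 / z, 0)" "\<kappa>1 p = (z, 0)" using \<kappa>2(1)[OF z(4)] \<kappa>1(1)[OF V[of z]] z(2,3) by metis+
    have "\<forall>\<^sub>F w in nhds 0. snd (\<kappa>2 (inv_into ?W1 \<kappa>1 (fst (\<kappa>1 p), w))) = z\<^sup>2 * w"
      using eventually_V'[OF z(4), of "z\<^sup>2"] eventually_V[OF V[of z], of 1]
    proof eventually_elim
      case (elim w)
      then have "\<sigma> (z, w) = \<tau> (1 / z, z\<^sup>2 * w)" using rel[of z w] z(1) by simp
      then show ?case using elim \<kappa>1(2)[of "(z, w)"] \<kappa>2(1)[OF elim(1)] by (simp add: k)
    qed
    from deriv_cong_ev[OF this refl]
    have "deriv (\<lambda>w. snd (\<kappa>2 (inv_into ?W1 \<kappa>1 (fst (\<kappa>1 p), w)))) 0 = z\<^sup>2" by (simp only: deriv_cmult)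
    then show ?thesis using z(1) by (simp add: s1 s2 k power_divide)
  qed
  have o: "{p \<in> C. ord p \<noteq> 0} = {\<tau> (0, 0)}" using C_\<tau>[OF V'] by (auto simp: ord_def)
  show ?thesis
    unfolding self_intersection_def
  proof (rule exI[of _ "{(?W1, \<kappa>1), (?W2, \<kappa>2)}"], rule exI[of _ s], rule exI[of _ ord], intro conjI)
    show "\<forall>(W, \<kappa>)\<in>{(?W1, \<kappa>1), (?W2, \<kappa>2)}. adapted_chart S C W \<kappa>" using adapted by simp
    show "C \<subseteq> (\<Union>(W, \<kappa>)\<in>{(?W1, \<kappa>1), (?W2, \<kappa>2)}. W)" using C_cover by auto
    show "\<forall>(W, \<kappa>)\<in>{(?W1, \<kappa>1), (?W2, \<kappa>2)}. \<forall>p\<in>C \<inter> W.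
           let z0 = fst (\<kappa> p); g = (\<lambda>z. s (W, \<kappa>) (inv_into W \<kappa> (z, 0)))
           in g meromorphic_on {z0} \<and> (\<forall>\<^sub>F z in at z0. g z \<noteq> 0) \<and> ord p = zorder g z0"
      using a b by blast
    show "\<forall>(W, \<kappa>)\<in>{(?W1, \<kappa>1), (?W2, \<kappa>2)}. \<forall>(W', \<kappa>')\<in>{(?W1, \<kappa>1), (?W2, \<kappa>2)}. \<forall>p\<in>C \<inter> W \<inter> W'.
           s (W, \<kappa>) p = deriv (\<lambda>w'. snd (\<kappa> (inv_into W' \<kappa>' (fst (\<kappa>' p), w')))) 0 * s (W', \<kappa>') p"
    proof -
      have *: "\<forall>(W, \<kappa>)\<in>{A, B}. \<forall>(W', \<kappa>')\<in>{A, B}. Q W \<kappa> W' \<kappa>'"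
        if "case A of (W, \<kappa>) \<Rightarrow> case A of (W', \<kappa>') \<Rightarrow> Q W \<kappa> W' \<kappa>'" "case A of (W, \<kappa>) \<Rightarrow> case B of (W', \<kappa>') \<Rightarrow> Q W \<kappa> W' \<kappa>'"
          "case B of (W, \<kappa>) \<Rightarrow> case A of (W', \<kappa>') \<Rightarrow> Q W \<kappa> W' \<kappa>'" "case B of (W, \<kappa>) \<Rightarrow> case B of (W', \<kappa>') \<Rightarrow> Q W \<kappa> W' \<kappa>'"
        for A B and Q :: "'a set \<Rightarrow> ('a \<Rightarrow> complex \<times> complex) \<Rightarrow> 'a set \<Rightarrow> ('a \<Rightarrow> complex \<times> complex) \<Rightarrow> bool"
        using that by auto
      show ?thesis
      proof (rule *; unfold prod.case; intro ballI)
        fix p assume "p \<in> C \<inter> ?W1 \<inter> ?W1"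
        then show "s (?W1, \<kappa>1) p = deriv (\<lambda>w'. snd (\<kappa>1 (inv_into ?W1 \<kappa>1 (fst (\<kappa>1 p), w')))) 0 * s (?W1, \<kappa>1) p"
          by (intro d11) simp
      next
        fix p assume "p \<in> C \<inter> ?W1 \<inter> ?W2"
        then show "s (?W1, \<kappa>1) p = deriv (\<lambda>w'. snd (\<kappa>1 (inv_into ?W2 \<kappa>2 (fst (\<kappa>2 p), w')))) 0 * s (?W2, \<kappa>2) p"
          by (rule d12)
      next
        fix p assume "p \<in> C \<inter> ?W2 \<inter> ?W1"
        then show "s (?W2, \<kappa>2) p = deriv (\<lambda>w'. snd (\<kappa>2 (inv_into ?W1 \<kappa>1 (fst (\<kappa>1 p), w')))) 0 * s (?W1, \<kappa>1) p"
          by (intro d21) simp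
      next
        fix p assume "p \<in> C \<inter> ?W2 \<inter> ?W2"
        then show "s (?W2, \<kappa>2) p = deriv (\<lambda>w'. snd (\<kappa>2 (inv_into ?W2 \<kappa>2 (fst (\<kappa>2 p), w')))) 0 * s (?W2, \<kappa>2) p"
          by (intro d22) simp
      qed
    qed
    show "finite {p \<in> C. ord p \<noteq> 0}" unfolding o by simp
    show "- 2 = (\<Sum>p | p \<in> C \<and> ord p \<noteq> 0. ord p)" unfolding o by (simp add: ord_def)
  qed
qed

end

lemma zorder_ident: "zorder (\<lambda>z. z) 0 = 1"
  by (rule zorder_eqI[of UNIV _ "\<lambda>_. 1"]) auto

text \<open>If the two curves are the coordinate axes, exchanging the coordinates gives a chart
  adapted to D. The local equation of D restricted to C is then the coordinate z itself, which
  vanishes to order 1.\<close>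

lemma local_intersection_crossing:
  assumes M: "premanifold S" and c: "chart S V \<sigma>" and 0: "(0, 0) \<in> V"
    and C: "\<And>v. v \<in> V \<Longrightarrow> \<sigma> v \<in> C \<longleftrightarrow> snd v = 0" and D: "\<And>v. v \<in> V \<Longrightarrow> \<sigma> v \<in> D \<longleftrightarrow> fst v = 0"
  shows "local_intersection S C D (\<sigma> (0, 0)) 1"
proof -
  define \<kappa> where "\<kappa> = inv_into V \<sigma>"
  have \<kappa>: "\<kappa> (\<sigma> v) = v" "inv_into (\<sigma> ` V) \<kappa> v = \<sigma> v" if "v \<in> V" for v
    using chartD(2)[OF c] that by (simp_all add: \<kappa>_def inv_inv_into')
  define \<kappa>' where "\<kappa>' = (\<lambda>p. (snd (\<kappa> p), fst (\<kappa> p)))"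
  let ?V' = "{v. (snd v, fst v) \<in> V}"
  have W': "(\<lambda>v. \<sigma> (snd v, fst v)) ` ?V' = \<sigma> ` V"
  proof (intro subset_antisym subsetI)
    fix q assume "q \<in> \<sigma> ` V"
    then obtain a b where "q = \<sigma> (a, b)" "(a, b) \<in> V" by auto
    then show "q \<in> (\<lambda>v. \<sigma> (snd v, fst v)) ` ?V'" by (intro image_eqI[of _ _ "(b, a)"]) auto
  qed auto
  have 1: "adapted_chart S C (\<sigma> ` V) \<kappa>" by (rule adapted_chartI[OF M c C \<kappa>(1)])
  have 2: "adapted_chart S D (\<sigma> ` V) \<kappa>'"
    using adapted_chartI[OF M chart_swap[OF c], of D \<kappa>'] D \<kappa> by (simp add: W' \<kappa>'_def)
  have "open ((\<lambda>z. (z, 0)) -` V)" by (rule open_vimage[OF chartD(1)[OF c]]) (intro continuous_intros)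
  then have "\<forall>\<^sub>F z in nhds 0. (z, 0) \<in> V" using 0 by (auto simp: eventually_nhds vimage_def)
  then have "\<forall>\<^sub>F z in at 0. snd (\<kappa>' (inv_into (\<sigma> ` V) \<kappa> (z, 0))) = z"
    by (auto simp: eventually_at_filter \<kappa> \<kappa>'_def elim!: eventually_mono)
  then have "zorder (\<lambda>z. snd (\<kappa>' (inv_into (\<sigma> ` V) \<kappa> (z, 0)))) (fst (\<kappa> (\<sigma> (0, 0)))) = 1"
    using zorder_cong[of _ "\<lambda>z. z" 0 0] zorder_ident \<kappa>(1)[OF 0] by simp
  then show ?thesis unfolding local_intersection_def using 1 2 0 by (metis imageI)
qed

lemma intersection_crossing:
  assumes M: "premanifold S" and c: "chart S V \<sigma>" and 0: "(0, 0) \<in> V"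
    and C: "\<And>a b. (a, b) \<in> V \<Longrightarrow> \<sigma> (a, b) \<in> C \<longleftrightarrow> b = 0" and D: "\<And>a b. (a, b) \<in> V \<Longrightarrow> \<sigma> (a, b) \<in> D \<longleftrightarrow> a = 0"
    and CD: "C \<inter> D = {\<sigma> (0, 0)}"
  shows "intersection_number S C D 1" "intersection_number S D C 1"
proof -
  have "local_intersection S C D (\<sigma> (0, 0)) 1"
    by (rule local_intersection_crossing[OF M c 0]) (use C D in auto)
  then show "intersection_number S C D 1" unfolding intersection_number_def CD by (intro conjI exI[of _ "\<lambda>_. 1"]) auto
  have "local_intersection S D C ((\<lambda>v. \<sigma> (snd v, fst v)) (0, 0)) 1"
    by (rule local_intersection_crossing[OF M chart_swap[OF c]]) (use 0 C D in auto)
  then show "intersection_number S D C 1"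
    unfolding intersection_number_def Int_commute[of D C] CD by (intro conjI exI[of _ "\<lambda>_. 1"]) auto
qed

lemma intersection_disjoint: "C \<inter> D = {} \<Longrightarrow> intersection_number S C D 0"
  by (simp add: intersection_number_def)

section \<open>The eight curves at the boundary\<close>

text \<open>The curves are numbered as the vertices of \<open>E7_affine\<close>: the second and the first exceptional
  curve over \<open>[0 : 0 : 1]\<close>, the line at infinity, the second, ..., fifth exceptional curve over
  \<open>[0 : 1 : 0]\<close>, and finally the first one over \<open>[0 : 1 : 0]\<close>.\<close>

definition curve :: "nat \<Rightarrow> point set" where
  "curve i =
    (if i = 0 then pt 4 ` (- {0}) \<union> {pt_inf 4, pt_inf 5}
     else if i = 1 then pt 3 ` (- {0}) \<union> {pt_inf 3, pt_inf 4}
     else if i = 2 then pt 1 ` (- {0}) \<union> {pt 7 0, pt_inf 3}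
     else if i = 3 then pt 7 ` (- {1/4}) \<union> {pt_inf 7, pt_inf 8}
     else if i = 4 then pt 8 ` (- {0}) \<union> {pt_inf 8, pt_inf 9}
     else if i = 5 then pt 9 ` (- {1}) \<union> {pt_inf 9, pt_inf 10}
     else if i = 6 then pt 10 ` (- {0}) \<union> {pt_inf 10, pt_inf 11}
     else range (pt 6) \<union> {pt_inf 7})"

lemma mem_pt [simp]: "pt n z \<in> pt m ` A \<longleftrightarrow> n = m \<and> z \<in> A" "pt_inf n \<notin> pt m ` A"
    "{(0, a, b)} \<in> pt m ` A \<longleftrightarrow> m = 0 \<and> a \<in> A \<and> b = 0"
  by (auto simp: image_iff)

lemma complex_manifold_S9: "complex_manifold S9" using S9(1) by (simp add: stage_def)

text \<open>In the chart of its blow-up an exceptional curve is a = 0. When a point of it is blown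
  up, the strict transform has direction [0 : 1] there, so \<open>pt_inf 5\<close> takes the place
  of the centre \<open>pt 4 0\<close>; the other curves follow the same rule. The coordinates are
  (z, w) = (x/v, v^2/x), with 1/z = v/x and z^2 w = x.\<close>

lemma neg2_curve_0: "neg2_curve S9 (curve 0) UNIV f3B UNIV (\<lambda>v. f2B (snd v, fst v))"
proof (unfold_locales, rule complex_manifold_S9, rule chart_f3)
  show "chart S9 UNIV (\<lambda>v. f2B (snd v, fst v))" using chart_swap[OF chart_f2B] by simp
  show "q = f2B (snd (0, 0), fst (0, 0)) \<or> (\<exists>z. q = f3B (z, 0))" if "q \<in> curve 0" for q
  proof -
    have "pt_inf 4 = f2B (0, 0)" "pt_inf 5 = f3B (0, 0)" "z \<noteq> 0 \<Longrightarrow> pt 4 z = f3B (z, 0)" for z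
      by (auto simp: f2B_def f3B_def)
    then show ?thesis using that unfolding curve_def by auto
  qed
qed (auto simp: curve_def f2B_def f3B_def power2_eq_square split: if_splits)

text \<open>(z, w) = (x, v/x) gives 1/z = 1/x and z^2 w = x v.\<close>

lemma neg2_curve_1: "neg2_curve S9 (curve 1) UNIV f2B UNIV (\<lambda>v. f1B (snd v, fst v))"
proof (unfold_locales, rule complex_manifold_S9, rule chart_f2B)
  show "chart S9 UNIV (\<lambda>v. f1B (snd v, fst v))" using chart_swap[OF chart_f1B] by simp
  show "q = f1B (snd (0, 0), fst (0, 0)) \<or> (\<exists>z. q = f2B (z, 0))" if "q \<in> curve 1" for q
  proof -
    have "pt_inf 3 = f1B (0, 0)" "pt_inf 4 = f2B (0, 0)" "z \<noteq> 0 \<Longrightarrow> pt 3 z = f2B (z, 0)" for z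
      by (auto simp: f1B_def f2B_def)
    then show ?thesis using that unfolding curve_def by auto
  qed
qed (auto simp: curve_def f1B_def f2B_def power2_eq_square split: if_splits)

text \<open>The line at infinity: (z, w) = (q, xi) gives 1/z = x v and z^2 w = 1/x. In
  \<open>e1B\<close> this line is b = 0, so it meets the next exceptional curve in direction
  [1 : 0], at \<open>pt 7 0\<close>.\<close>

lemma neg2_curve_2: "neg2_curve S9 (curve 2) {v. snd v \<noteq> 1/4} e2A UNIV f1B"
proof (unfold_locales, rule complex_manifold_S9, rule chart_e2A, rule chart_f1B)
  show "q = f1B (0, 0) \<or> (\<exists>z. q = e2A (z, 0))" if "q \<in> curve 2" for q
  proof -
    have "pt_inf 3 = f1B (0, 0)" "pt 7 0 = e2A (0, 0)" "z \<noteq> 0 \<Longrightarrow> pt 1 z = e2A (z, 0)" for z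
      by (auto simp: f1B_def e2A_def)
    then show ?thesis using that unfolding curve_def by auto
  qed
qed (auto simp: curve_def f1B_def e2A_def power2_eq_square split: if_splits)

text \<open>For (z, w) = (xi - 1/4, q/(xi - 1/4)) the required coordinates are a = 1/z and b = z^2 w
  = q (xi - 1/4). Solving for v = q xi and 1/xi gives the arguments of \<open>e2B\<close>; a = -4
  corresponds to xi = 0.\<close>

definition e2B' :: "complex \<times> complex \<Rightarrow> point" where
  "e2B' = (\<lambda>(a, b). e2B (b * (4 + a) / 4, 4 * a / (4 + a)))"

lemma chart_e2B': "chart S9 {v. fst v \<noteq> -4} e2B'"
proof -
  have n: "4 + a = 0 \<longleftrightarrow> a = -4" "4 - a = 0 \<longleftrightarrow> a = 4" for a :: complex
    using eq_neg_iff_add_eq_0[of a 4] by (simp_all add: add.commute)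
  have "chart S9 {v. fst v \<noteq> -4} (\<lambda>v. e2B (snd v * (4 + fst v) / 4, 4 * fst v / (4 + fst v)))"
  proof (rule chart_change[OF chart_e2B, where h = "\<lambda>v. (4 * snd v / (4 - snd v), fst v * (4 - snd v) / 4)" and A = "{v. snd v \<noteq> 4}"])
    show "holo_on (\<lambda>v. (snd v * (4 + fst v) / 4, 4 * fst v / (4 + fst v))) {v :: complex \<times> complex. fst v \<noteq> -4}"
      by (auto simp: holo_on_iff_cdiff n intro!: cdiff_intros open_Collect_neq continuous_intros)
    show "holo_on (\<lambda>v. (4 * snd v / (4 - snd v), fst v * (4 - snd v) / 4)) {v :: complex \<times> complex. snd v \<noteq> 4}"
      by (auto simp: holo_on_iff_cdiff n intro!: cdiff_intros open_Collect_neq continuous_intros)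
    have 4: "4 * a / (4 + a) \<noteq> 4" if "a \<noteq> -4" for a :: complex using that n[of a] by (auto simp: field_simps)
    have 5: "4 * a / (4 - a) \<noteq> -4" if "a \<noteq> 4" for a :: complex using that n[of a] by (auto simp: field_simps)
    have 6: "4 + 4 * a / (4 - a) = 16 / (4 - a)" if "a \<noteq> 4" for a :: complex using that n[of a] by (auto simp: field_simps)
    have 7: "4 - 4 * a / (4 + a) = 16 / (4 + a)" if "a \<noteq> -4" for a :: complex using that n[of a] by (auto simp: field_simps)
    show "(\<lambda>v. (snd v * (4 + fst v) / 4, 4 * fst v / (4 + fst v))) ` {v :: complex \<times> complex. fst v \<noteq> -4} \<subseteq> {v. snd v \<noteq> 4}"
      using 4 by auto
    show "(\<lambda>v. (4 * snd v / (4 - snd v), fst v * (4 - snd v) / 4)) ` {v :: complex \<times> complex. snd v \<noteq> 4} \<subseteq> {v. fst v \<noteq> -4}"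
      using 5 by auto
    show "(snd (4 * snd v / (4 - snd v), fst v * (4 - snd v) / 4) * (4 + fst (4 * snd v / (4 - snd v), fst v * (4 - snd v) / 4)) / 4,
        4 * fst (4 * snd v / (4 - snd v), fst v * (4 - snd v) / 4) / (4 + fst (4 * snd v / (4 - snd v), fst v * (4 - snd v) / 4))) = v"
      if "v \<in> {v. snd v \<noteq> 4}" for v :: "complex \<times> complex"
      using that 6[of "snd v"] n(2)[of "snd v"] by (simp add: prod_eq_iff)
    show "(snd v * (4 + fst v) / 4, 4 * fst v / (4 + fst v)) \<in> {v. snd v \<noteq> 4} \<and>
      (4 * snd (snd v * (4 + fst v) / 4, 4 * fst v / (4 + fst v)) / (4 - snd (snd v * (4 + fst v) / 4, 4 * fst v / (4 + fst v))),
        fst (snd v * (4 + fst v) / 4, 4 * fst v / (4 + fst v)) * (4 - snd (snd v * (4 + fst v) / 4, 4 * fst v / (4 + fst v))) / 4) = v"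
      if "v \<in> {v. fst v \<noteq> -4}" for v :: "complex \<times> complex"
      using that 7[of "fst v"] 4[of "fst v"] n(1)[of "fst v"] by (simp add: prod_eq_iff)
  qed auto
  then show ?thesis by (simp add: e2B'_def case_prod_beta')
qed

lemma neg2_curve_3: "neg2_curve S9 (curve 3) UNIV e3B {v. fst v \<noteq> -4} e2B'"
proof (unfold_locales, rule complex_manifold_S9, rule chart_e3B, rule chart_e2B')
  have n: "4 + a = 0 \<longleftrightarrow> a = -4" for a :: complex
    using eq_neg_iff_add_eq_0[of a 4] by (simp add: add.commute)
  show "q = e2B' (0, 0) \<or> (\<exists>z. q = e3B (z, 0))" if "q \<in> curve 3" for q
  proof -
    have "pt_inf 7 = e2B' (0, 0)" "pt_inf 8 = e3B (0, 0)" "z \<noteq> 1/4 \<Longrightarrow> pt 7 z = e3B (z - 1/4, 0)" for z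
      by (auto simp: e2B'_def e2B_def e3B_def)
    then show ?thesis using that unfolding curve_def by auto
  qed
  show "e2B' (z, w) \<in> curve 3 \<longleftrightarrow> w = 0" if "(z, w) \<in> {v. fst v \<noteq> -4}" for z w
  proof -
    \<comment> \<open>The definition unfolds to the expanded product; in factored form its other
      factor is nonzero on the domain, so only w can vanish.\<close>
    have "w * z + w * 4 = w * (4 + z)" by (simp add: algebra_simps)
    then have "w * z + w * 4 = 0 \<longleftrightarrow> w = 0" using that n[of z] by auto
    then show ?thesis
      using that n[of z] by (auto simp: e2B'_def e2B_def curve_def field_simps split: if_splits)
  qed
  show "e3B (z, w) = e2B' (1 / z, z\<^sup>2 * w)" if "(1 / z, z\<^sup>2 * w) \<in> {v. fst v \<noteq> -4}" "z \<noteq> 0" for z w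
  proof -
    have d: "4 + 1 / z = (4 * z + 1) / z" "4 * z + 1 \<noteq> 0" "z + 1/4 = (4 * z + 1) / 4"
      using that n[of "1 / z"] by (auto simp: field_simps add_eq_0_iff)
    have e: "z\<^sup>2 * w * ((4 * z + 1) / z) / 4 = z * w * ((4 * z + 1) / 4)" "4 * (1 / z) / ((4 * z + 1) / z) = 4 / (4 * z + 1)"
      "z * w * ((4 * z + 1) / 4) * (4 / (4 * z + 1)) = z * w"
      using d(2) that(2) by (simp_all add: power2_eq_square)
    show ?thesis
      using d(2) that(2) unfolding e3B_def e2B'_def e2B_def prod.case d(1,3) e by (cases "w = 0") simp_all
  qed
qed (auto simp: curve_def e3B_def e2B'_def e2B_def split: if_splits)

text \<open>For (z, w) = (r/v, v^2/r) the second chart must have a = v/r and b = r. With q = v/xi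
  and xi = 1/4 - b, the coordinates (xi - 1/4, q/(xi - 1/4)) of \<open>e3B\<close> become the stated
  arguments.\<close>

definition e3B' :: "complex \<times> complex \<Rightarrow> point" where
  "e3B' = (\<lambda>(a, b). e3B (- b, - a / (1/4 - b)))"

lemma chart_e3B': "chart S9 {v. snd v \<noteq> 1/4} e3B'"
proof -
  have m: "a = - (1/4)" if "- (a * 4) = 1" for a :: complex
    using that eq_divide_imp[of 4 a "-1"] by (metis divide_minus_left minus_minus zero_neq_numeral)
  have "chart S9 {v. snd v \<noteq> 1/4} (\<lambda>v. e3B (- snd v, - fst v / (1/4 - snd v)))"
    by (rule chart_change[OF chart_e3B, where h = "\<lambda>v. (- snd v * (1/4 + fst v), - fst v)" and A = "{v. fst v \<noteq> - (1/4)}"])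
      (auto simp: holo_on_iff_cdiff add_eq_0_iff prod_eq_iff dest: m intro!: cdiff_intros open_Collect_neq continuous_intros)
  then show ?thesis by (simp add: e3B'_def case_prod_beta')
qed

lemma neg2_curve_4: "neg2_curve S9 (curve 4) {v. snd v \<noteq> 1 \<and> fst v * snd v * fst v \<noteq> 1/4} e4B {v. snd v \<noteq> 1/4} e3B'"
proof (unfold_locales, rule complex_manifold_S9, rule chart_e4B, rule chart_e3B')
  show "q = e3B' (0, 0) \<or> (\<exists>z. q = e4B (z, 0))" if "q \<in> curve 4" for q
  proof -
    have "pt_inf 8 = e3B' (0, 0)" "pt_inf 9 = e4B (0, 0)" "z \<noteq> 0 \<Longrightarrow> pt 8 z = e4B (- 4 * z, 0)" for z
      by (auto simp: e3B'_def e3B_def e4B_def)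
    then show ?thesis using that unfolding curve_def by auto
  qed
  show "e4B (z, w) = e3B' (1 / z, z\<^sup>2 * w)" if "(1 / z, z\<^sup>2 * w) \<in> {v. snd v \<noteq> 1/4}" "z \<noteq> 0" for z w
  proof -
    define c where "c = 1/4 - z\<^sup>2 * w"
    have c: "c \<noteq> 0" "1/4 - z * w * z = c" "- (z\<^sup>2 * w) + 1/4 = c"
      using that by (auto simp: c_def power2_eq_square)
    show ?thesis
      using c(1) that(2) unfolding e4B_def e3B'_def e3B_def prod.case c_def[symmetric] c(2,3)
      by (cases "w = 0") (simp_all add: c_def field_simps power2_eq_square)
  qed
qed (auto simp: curve_def e4B_def e3B'_def e3B_def split: if_splits)

text \<open>For (z, w) = (m, v/m) the second chart must have a = 1/m and b = m v. Then r/v = v (m +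
  1) = b (1 + a) and v^2/r = 1/(m + 1) = a/(1 + a).\<close>

definition e4B' :: "complex \<times> complex \<Rightarrow> point" where
  "e4B' = (\<lambda>(a, b). e4B (b * (1 + a), a / (1 + a)))"

lemma chart_e4B': "chart S9 {v. fst v \<noteq> -1 \<and> snd v * fst v * (snd v * (1 + fst v)) \<noteq> 1/4} e4B'"
proof -
  let ?V = "{v :: complex \<times> complex. snd v \<noteq> 1 \<and> fst v * snd v * fst v \<noteq> 1/4}"
  let ?V' = "{v :: complex \<times> complex. fst v \<noteq> -1 \<and> snd v * fst v * (snd v * (1 + fst v)) \<noteq> 1/4}"
  let ?g = "\<lambda>v. (snd v * (1 + fst v), fst v / (1 + fst v)) :: complex \<times> complex"
  let ?h = "\<lambda>v. (snd v / (1 - snd v), fst v * (1 - snd v)) :: complex \<times> complex"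
  have n: "1 + a = 0 \<longleftrightarrow> a = -1" for a :: complex
    using eq_neg_iff_add_eq_0[of a 1] by (simp add: add.commute)
  have o: "open ?V" "open ?V'" by (intro open_Collect_conj open_Collect_neq continuous_intros)+
  have 4: "a / (1 + a) \<noteq> 1" "1 - a / (1 + a) = 1 / (1 + a)" if "a \<noteq> -1" for a :: complex
    using that n[of a] by (auto simp: field_simps)
  have 5: "a / (1 - a) \<noteq> -1" "1 + a / (1 - a) = 1 / (1 - a)" if "a \<noteq> 1" for a :: complex
    using that by (auto simp: field_simps)
  have g: "?g v \<in> ?V \<and> ?h (?g v) = v" if "v \<in> ?V'" for v
    using that 4[of "fst v"] n[of "fst v"] by (simp add: prod_eq_iff mult.assoc mult.left_commute)
  have h: "?h v \<in> ?V' \<and> ?g (?h v) = v" if "v \<in> ?V" for v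
  proof -
    have b: "snd v \<noteq> 1" "1 - snd v \<noteq> 0" using that by auto
    have "fst v * (1 - snd v) * (snd v / (1 - snd v)) = fst v * snd v"
      "fst v * (1 - snd v) * (1 + snd v / (1 - snd v)) = fst v" "snd v / (1 - snd v) / (1 + snd v / (1 - snd v)) = snd v"
      using b unfolding 5(2)[OF b(1)] by simp_all
    then show ?thesis using that 5(1)[OF b(1)] by (simp only: prod_eq_iff mem_Collect_eq fst_conv snd_conv simp_thms)
  qed
  have "chart S9 ?V' (\<lambda>v. e4B (?g v))"
  proof (rule chart_change[OF chart_e4B, where h = ?h and A = ?V])
    show "holo_on ?g ?V'" unfolding holo_on_iff_cdiff by (intro conjI ballI o cdiff_intros) (simp add: n)
    show "holo_on ?h ?V" unfolding holo_on_iff_cdiff by (intro conjI ballI o cdiff_intros) simp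
    show "?g ` ?V' \<subseteq> ?V" by (rule image_subsetI) (use g in blast)
    show "?h ` ?V \<subseteq> ?V'" by (rule image_subsetI) (use h in blast)
    show "?g (?h v) = v" if "v \<in> ?V" for v using h[OF that] by (rule conjunct2)
    show "?g v \<in> ?V \<and> ?h (?g v) = v" if "v \<in> ?V'" for v by (rule g[OF that])
  qed (rule subset_refl)
  then show ?thesis by (simp add: e4B'_def case_prod_beta')
qed

lemma neg2_curve_5: "neg2_curve S9 (curve 5) (dom_B dom_e4S) e5B
    {v. fst v \<noteq> -1 \<and> snd v * fst v * (snd v * (1 + fst v)) \<noteq> 1/4} e4B'"
proof (unfold_locales, rule complex_manifold_S9, rule chart_e5B, rule chart_e4B')
  have n: "1 + a = 0 \<longleftrightarrow> a = -1" for a :: complex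
    using eq_neg_iff_add_eq_0[of a 1] by (simp add: add.commute)
  show "q = e4B' (0, 0) \<or> (\<exists>z. q = e5B (z, 0))" if "q \<in> curve 5" for q
  proof -
    have "pt_inf 9 = e4B' (0, 0)" "pt_inf 10 = e5B (0, 0)" "z \<noteq> 1 \<Longrightarrow> pt 9 z = e5B (z - 1, 0)" for z
      by (auto simp: e4B'_def e4B_def e5B_def)
    then show ?thesis using that unfolding curve_def by auto
  qed
  show "e4B' (z, w) \<in> curve 5 \<longleftrightarrow> w = 0"
    if "(z, w) \<in> {v. fst v \<noteq> -1 \<and> snd v * fst v * (snd v * (1 + fst v)) \<noteq> 1/4}" for z w
  proof -
    have "w + w * z = w * (1 + z)" by (simp add: algebra_simps)
    then have "w + w * z = 0 \<longleftrightarrow> w = 0" using that n[of z] by auto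
    then show ?thesis
      using that n[of z] by (auto simp: e4B'_def e4B_def curve_def field_simps split: if_splits)
  qed
  show "e5B (z, w) = e4B' (1 / z, z\<^sup>2 * w)"
    if "(1 / z, z\<^sup>2 * w) \<in> {v. fst v \<noteq> -1 \<and> snd v * fst v * (snd v * (1 + fst v)) \<noteq> 1/4}" "z \<noteq> 0" for z w
  proof -
    have d: "1 + 1 / z = (z + 1) / z" "z + 1 \<noteq> 0" "1 / z / ((z + 1) / z) = 1 / (z + 1)" "z\<^sup>2 * w * ((z + 1) / z) = z * w * (z + 1)"
      using that n[of "1 / z"] by (auto simp: field_simps add_eq_0_iff power2_eq_square)
    show ?thesis
      using d(2) that(2) unfolding e5B_def e4B'_def e4B_def prod.case d(1,3,4)
      by (cases "w = 0") simp_all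
  qed
qed (auto simp: curve_def e5B_def e4B'_def e4B_def dom_eqs split: if_splits)

text \<open>(z, w) = (m/v, v^2/m) gives 1/z = v/m and z^2 w = m, the coordinates of
  \<open>e5B\<close> in reverse order.\<close>

lemma neg2_curve_6: "neg2_curve S9 (curve 6) (dom_B dom_e5A) e6B {v. (snd v, fst v) \<in> dom_B dom_e4S} (\<lambda>v. e5B (snd v, fst v))"
proof (unfold_locales, rule complex_manifold_S9, rule S9, rule chart_swap[OF chart_e5B])
  show "q = e5B (snd (0, 0), fst (0, 0)) \<or> (\<exists>z. q = e6B (z, 0))" if "q \<in> curve 6" for q
  proof -
    have "pt_inf 10 = e5B (0, 0)" "pt_inf 11 = e6B (0, 0)" "z \<noteq> 0 \<Longrightarrow> pt 10 z = e6B (z, 0)" for z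
      by (auto simp: e5B_def e6B_def)
    then show ?thesis using that unfolding curve_def by auto
  qed
  show "e6B (z, w) = e5B (snd (1 / z, z\<^sup>2 * w), fst (1 / z, z\<^sup>2 * w))" if "z \<noteq> 0" for z w
  proof -
    have d: "z\<^sup>2 * w * (1 / z) = z * w" "z * w * z = z\<^sup>2 * w" using that by (auto simp: power2_eq_square)
    show ?thesis using that unfolding e6B_def e5B_def prod.case fst_conv snd_conv d by simp
  qed
qed (auto simp: curve_def e5B_def e6B_def dom_eqs split: if_splits)

text \<open>(z, w) = (y, 1/x) gives 1/z = v and z^2 w = 1/xi. This is the first exceptional curve
  over [0:1:0], which meets only the second one.\<close>

lemma neg2_curve_7: "neg2_curve S9 (curve 7) UNIV (\<lambda>v. e1A (snd v, fst v)) {v. snd v \<noteq> 4} e2B"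
proof (unfold_locales, rule complex_manifold_S9)
  show "chart S9 UNIV (\<lambda>v. e1A (snd v, fst v))" using chart_swap[OF chart_e1A] by simp
  show "chart S9 {v. snd v \<noteq> 4} e2B" by (rule chart_e2B)
  show "q = e2B (0, 0) \<or> (\<exists>z. q = e1A (snd (z, 0), fst (z, 0)))" if "q \<in> curve 7" for q
  proof -
    have "pt_inf 7 = e2B (0, 0)" "pt 6 z = e1A (0, z)" for z
      by (auto simp: e1A_def e2B_def)
    then show ?thesis using that unfolding curve_def by auto
  qed
qed (auto simp: curve_def e1A_def e2B_def power2_eq_square split: if_splits)

lemma curves_neg2:
  assumes "i \<in> {0..7}"
  shows "smooth_rational_curve S9 (curve i)" "self_intersection S9 (curve i) (-2)"
proof -
  note R = neg2_curve.rational and I = neg2_curve.self_int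
  have "i \<in> {0, 1, 2, 3, 4, 5, 6, 7}" using assms by auto
  then show "smooth_rational_curve S9 (curve i)"
    using R[OF neg2_curve_0] R[OF neg2_curve_1] R[OF neg2_curve_2] R[OF neg2_curve_3] R[OF neg2_curve_4]
      R[OF neg2_curve_5] R[OF neg2_curve_6] R[OF neg2_curve_7] by auto
  from \<open>i \<in> {0, 1, 2, 3, 4, 5, 6, 7}\<close> show "self_intersection S9 (curve i) (-2)"
    using I[OF neg2_curve_0] I[OF neg2_curve_1] I[OF neg2_curve_2] I[OF neg2_curve_3] I[OF neg2_curve_4]
      I[OF neg2_curve_5] I[OF neg2_curve_6] I[OF neg2_curve_7] by auto
qed

text \<open>For each edge of the diagram there is one chart whose axes b = 0 and a = 0 are the two
  curves, so that they cross transversally at its origin.\<close>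

lemma crossing_01: "intersection_number S9 (curve 1) (curve 0) 1" "intersection_number S9 (curve 0) (curve 1) 1"
  by (rule intersection_crossing(1)[OF premanifold_S9 chart_f2B]; force simp: curve_def f2B_def split: if_splits)
    (rule intersection_crossing(2)[OF premanifold_S9 chart_f2B]; force simp: curve_def f2B_def split: if_splits)

lemma crossing_12: "intersection_number S9 (curve 2) (curve 1) 1" "intersection_number S9 (curve 1) (curve 2) 1"
  by (rule intersection_crossing(1)[OF premanifold_S9 chart_f1B]; force simp: curve_def f1B_def split: if_splits)
    (rule intersection_crossing(2)[OF premanifold_S9 chart_f1B]; force simp: curve_def f1B_def split: if_splits)

lemma crossing_23: "intersection_number S9 (curve 2) (curve 3) 1" "intersection_number S9 (curve 3) (curve 2) 1"
  by (rule intersection_crossing(1)[OF premanifold_S9 chart_e2A]; force simp: curve_def e2A_def split: if_splits)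
    (rule intersection_crossing(2)[OF premanifold_S9 chart_e2A]; force simp: curve_def e2A_def split: if_splits)

lemma crossing_34: "intersection_number S9 (curve 3) (curve 4) 1" "intersection_number S9 (curve 4) (curve 3) 1"
  by (rule intersection_crossing(1)[OF premanifold_S9 chart_e3B]; force simp: curve_def e3B_def split: if_splits)
    (rule intersection_crossing(2)[OF premanifold_S9 chart_e3B]; force simp: curve_def e3B_def split: if_splits)

lemma crossing_45: "intersection_number S9 (curve 4) (curve 5) 1" "intersection_number S9 (curve 5) (curve 4) 1"
  by (rule intersection_crossing(1)[OF premanifold_S9 chart_e4B]; force simp: curve_def e4B_def split: if_splits)
    (rule intersection_crossing(2)[OF premanifold_S9 chart_e4B]; force simp: curve_def e4B_def split: if_splits)

lemma crossing_56: "intersection_number S9 (curve 5) (curve 6) 1" "intersection_number S9 (curve 6) (curve 5) 1"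
  by (rule intersection_crossing(1)[OF premanifold_S9 chart_e5B]; force simp: curve_def e5B_def dom_eqs split: if_splits)
    (rule intersection_crossing(2)[OF premanifold_S9 chart_e5B]; force simp: curve_def e5B_def dom_eqs split: if_splits)

lemma crossing_73: "intersection_number S9 (curve 7) (curve 3) 1" "intersection_number S9 (curve 3) (curve 7) 1"
  by (rule intersection_crossing(1)[OF premanifold_S9 chart_e2B]; force simp: curve_def e2B_def field_simps split: if_splits)
    (rule intersection_crossing(2)[OF premanifold_S9 chart_e2B]; force simp: curve_def e2B_def field_simps split: if_splits)

definition adjacent :: "(nat \<times> nat) set" where
  "adjacent = {(0, 1), (1, 2), (2, 3), (3, 4), (4, 5), (5, 6), (3, 7)}"

lemma E7_edge: "snd E7_affine i j = (if (i, j) \<in> adjacent \<or> (j, i) \<in> adjacent then 1 else 0)"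
  unfolding E7_affine_def adjacent_def by (auto simp: doubleton_eq_iff)

lemma curves_disjoint:
  assumes "i \<in> {0..7}" "j \<in> {0..7}" "i \<noteq> j" "(i, j) \<notin> adjacent" "(j, i) \<notin> adjacent"
  shows "curve i \<inter> curve j = {}"
proof -
  have *: "k \<in> {0, 1, 2, 3, 4, 5, 6, 7}" if "k \<in> {0..7}" for k :: nat using that by auto
  show ?thesis
    using *[OF assms(1)] *[OF assms(2)] assms(3-5)
    by (elim insertE emptyE; simp add: adjacent_def; simp add: curve_def disjoint_iff; auto)
qed

lemma curves_intersection:
  assumes "i \<in> {0..7}" "j \<in> {0..7}" "i \<noteq> j"
  shows "intersection_number S9 (curve i) (curve j) (int (snd E7_affine i j))"
proof (cases "(i, j) \<in> adjacent \<or> (j, i) \<in> adjacent")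
  case True
  then show ?thesis
    using crossing_01 crossing_12 crossing_23 crossing_34 crossing_45 crossing_56 crossing_73
    unfolding E7_edge by (auto simp: adjacent_def)
next
  case False
  then show ?thesis using intersection_disjoint[OF curves_disjoint[OF assms]] unfolding E7_edge by simp
qed

lemma mem_boundary:
  "pt n z \<in> (\<Union>i\<in>{0..7}. curve i) \<longleftrightarrow>
     n \<in> {1, 3, 4, 8, 10} \<and> z \<noteq> 0 \<or> n = 6 \<or> n = 7 \<and> z \<noteq> 1/4 \<or> n = 9 \<and> z \<noteq> 1"
  "pt_inf n \<in> (\<Union>i\<in>{0..7}. curve i) \<longleftrightarrow> n \<in> {3, 4, 5, 7, 8, 9, 10, 11}"
  "{(0, a, b)} \<notin> (\<Union>i\<in>{0..7}. curve i)"
proof -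
  have i: "{0..7} = {0, 1, 2, 3, 4, 5, 6, 7 :: nat}" by auto
  have u: "(\<Union>i\<in>{0..7}. curve i) = curve 0 \<union> curve 1 \<union> curve 2 \<union> curve 3 \<union> curve 4 \<union> curve 5 \<union> curve 6 \<union> curve 7"
    unfolding i by (simp only: UN_insert UN_empty Un_empty_right Un_assoc)
  show "pt n z \<in> (\<Union>i\<in>{0..7}. curve i) \<longleftrightarrow>
     n \<in> {1, 3, 4, 8, 10} \<and> z \<noteq> 0 \<or> n = 6 \<or> n = 7 \<and> z \<noteq> 1/4 \<or> n = 9 \<and> z \<noteq> 1"
    unfolding u by (simp add: curve_def) auto
  show "pt_inf n \<in> (\<Union>i\<in>{0..7}. curve i) \<longleftrightarrow> n \<in> {3, 4, 5, 7, 8, 9, 10, 11}"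
    unfolding u by (simp add: curve_def) auto
  show "{(0, a, b)} \<notin> (\<Union>i\<in>{0..7}. curve i)"
    unfolding u by (simp add: curve_def)
qed

text \<open>Besides the affine plane only the last exceptional curve of each chain remains, with
  tags 5 and 11. Their points \<open>pt_inf 5\<close> and \<open>pt_inf 11\<close> lie on the
  preceding curves and so belong to the boundary.\<close>

lemma pts_off_curves:
  "pts S9 - (\<Union>i\<in>{0..7}. curve i) = range a0 \<union> range (pt 5) \<union> range (pt 11)"
proof (intro subset_antisym subsetI)
  fix c assume "c \<in> pts S9 - (\<Union>i\<in>{0..7}. curve i)"
  then have c: "c \<in> pts S9" "c \<notin> (\<Union>i\<in>{0..7}. curve i)" by blast+
  have "c \<in> range a0 \<union> range (pt 1) \<union> {pt 2 0} \<or> c \<in> (\<Union>n\<in>{3..11}. range (pt n) \<union> {pt_inf n})"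
    using c(1) unfolding pts_S9_eq pts_plane by (elim DiffE UnE) simp_all
  then show "c \<in> range a0 \<union> range (pt 5) \<union> range (pt 11)"
  proof
    assume "c \<in> range a0 \<union> range (pt 1) \<union> {pt 2 0}"
    moreover have "c \<notin> range (pt 1)"
    proof
      assume "c \<in> range (pt 1)"
      then obtain z where z: "c = pt 1 z" by auto
      show False using c unfolding z mem_boundary pts_S9_eq by simp
    qed
    moreover have "c \<noteq> pt 2 0" using c(1) by (auto simp: pts_S9_eq)
    ultimately show ?thesis by simp
  next
    assume "c \<in> (\<Union>n\<in>{3..11}. range (pt n) \<union> {pt_inf n})"
    then obtain n where n: "n \<in> {3..11}" "c \<in> range (pt n) \<union> {pt_inf n}" by (rule UN_E)
    then have n': "n \<in> {3, 4, 5, 6, 7, 8, 9, 10, 11}" by auto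
    from n(2) show ?thesis
    proof (elim UnE rangeE singletonE)
      fix z assume z: "c = pt n z"
      have "\<not> (n \<in> {3, 4, 8, 10} \<and> z = 0)" "\<not> (n = 7 \<and> z = 1/4)" "\<not> (n = 9 \<and> z = 1)"
        using c(1) unfolding z pts_S9_eq by auto
      moreover have "\<not> (n \<in> {1, 3, 4, 8, 10} \<and> z \<noteq> 0 \<or> n = 6 \<or> n = 7 \<and> z \<noteq> 1/4 \<or> n = 9 \<and> z \<noteq> 1)"
        using c(2) unfolding z mem_boundary .
      ultimately have "n = 5 \<or> n = 11" using n' by auto
      then show ?thesis using z by auto
    next
      assume z: "c = pt_inf n"
      have "n \<noteq> 6" using c(1) unfolding z pts_S9_eq by simp
      moreover have "n \<notin> {3, 4, 5, 7, 8, 9, 10, 11}" using c(2) unfolding z mem_boundary .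
      ultimately show ?thesis using n' by simp
    qed
  qed
next
  fix c assume "c \<in> range a0 \<union> range (pt 5) \<union> range (pt 11)"
  then consider a b where "c = {(0, a, b)}" | z where "c = pt 5 z" | z where "c = pt 11 z"
    by (auto simp: a0_def)
  then show "c \<in> pts S9 - (\<Union>i\<in>{0..7}. curve i)"
  proof cases
    case (1 a b)
    have "c \<in> range a0" using 1 by (auto simp: a0_def)
    then show ?thesis unfolding Diff_iff using mem_boundary(3)[of a b] by (simp add: 1 pts_S9_eq pts_plane)
  next
    case (2 z)
    have "c \<in> (\<Union>n\<in>{3..11}. range (pt n) \<union> {pt_inf n})" unfolding 2 by (rule UN_I[of 5]) auto
    then show ?thesis unfolding Diff_iff using mem_boundary(1)[of 5 z] by (simp add: 2 pts_S9_eq)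
  next
    case (3 z)
    have "c \<in> (\<Union>n\<in>{3..11}. range (pt n) \<union> {pt_inf n})" unfolding 3 by (rule UN_I[of 11]) auto
    then show ?thesis unfolding Diff_iff using mem_boundary(1)[of 11 z] by (simp add: 3 pts_S9_eq)
  qed
qed

section \<open>The fibre as an open part of the surface\<close>

text \<open>The copy \<open>j\<close> of \<open>\<complex>\<^sup>2\<close> is embedded into the surface: two points of copies at the same time are
  glued iff they have the same image.\<close>

definition to_plane :: "nat \<Rightarrow> complex \<times> complex \<Rightarrow> complex \<times> complex" where
  "to_plane j = (\<lambda>(x, y). if j = 0 then (x, y) else if j = 1 then (1 / (4 * y\<^sup>2) - 1 - x * y\<^sup>2, 1 / y)
     else (- x * y\<^sup>2, 1 / y))"

definition emb :: "nat \<Rightarrow> complex \<times> complex \<Rightarrow> point" where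
  "emb j q = (if j = 0 \<or> snd q \<noteq> 0 then a0 (to_plane j q) else if j = 1 then pt 11 (fst q) else pt 5 (- fst q))"

lemma emb_0: "emb 0 = a0"
  by (auto simp: emb_def to_plane_def fun_eq_iff)

lemma inj_emb: "inj (emb j)"
proof (rule injI)
  fix p q assume "emb j p = emb j q"
  then show "p = q"
    by (cases p; cases q) (auto simp: emb_def to_plane_def a0_def split: if_splits)
qed

text \<open>In coordinates, \<open>emb 2\<close> is \<open>f3A\<close> with (v, x/v^2) = (y2, -x2),
  whence the minus sign in \<open>emb\<close>, and \<open>emb 1\<close> is \<open>e6A\<close> with
  (v, m/v^2) = (y1, x1).\<close>

lemma chart_emb: assumes "j \<in> {0, 1, 2}" shows "chart S9 UNIV (emb j)"
proof -
  have 0: "chart S9 UNIV (emb 0)" unfolding emb_0 by (rule chart_a0)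
  have "chart S9 UNIV (\<lambda>v. f3A (snd v, - fst v))"
    by (rule chart_change[OF chart_f3(1), where h = "\<lambda>v. (- snd v, fst v)" and A = UNIV])
      (auto simp: holo_on_iff_cdiff intro!: cdiff_intros)
  moreover have "emb 2 v = f3A (snd v, - fst v)" for v
    by (auto simp: emb_def to_plane_def a0_def f3A_def power2_eq_square case_prod_beta)
  ultimately have 2: "chart S9 UNIV (emb 2)" by (rule chart_cong)
  have 1: "chart S9 UNIV (emb 1)"
  proof (rule chart_union[OF premanifold_S9 inj_emb])
    fix v :: "complex \<times> complex"
    show "\<exists>A. v \<in> A \<and> A \<subseteq> UNIV \<and> chart S9 A (emb 1)"
    proof (cases "snd v = 0")
      case True
      \<comment> \<open>The domain of \<open>e6A\<close> excludes xi = 0, so it covers a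
        neighbourhood of the line y1 = 0 but not the whole copy. The rest comes from the affine
        chart \<open>a0\<close>.\<close>
      have "chart S9 {v. (snd v, fst v) \<in> dom_A dom_e5A} (\<lambda>v. e6A (snd v, fst v))"
        by (rule chart_swap[OF S9(2)])
      moreover have "emb 1 w = e6A (snd w, fst w)" for w
      proof (cases "snd w = 0")
        case False
        then have "(1/4 - snd w * (snd w * (snd w * (snd w * fst w) + 1))) / (snd w)\<^sup>2 = 1 / (4 * (snd w)\<^sup>2) - 1 - fst w * (snd w)\<^sup>2"
          by (simp add: field_simps power2_eq_square)
        then show ?thesis using False by (simp add: emb_def to_plane_def a0_def e6A_def case_prod_beta)
      qed (simp add: emb_def e6A_def)
      ultimately have "chart S9 {v. (snd v, fst v) \<in> dom_A dom_e5A} (emb 1)" by (rule chart_cong)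
      moreover have "v \<in> {v. (snd v, fst v) \<in> dom_A dom_e5A}" using True by (simp add: dom_eqs)
      ultimately show ?thesis
        by (intro exI[of _ "{v. (snd v, fst v) \<in> dom_A dom_e5A}"] conjI subset_UNIV)
    next
      case False
      let ?A = "{v :: complex \<times> complex. snd v \<noteq> 0}"
      have "chart S9 ?A (\<lambda>v. a0 (1 / (4 * (snd v)\<^sup>2) - 1 - fst v * (snd v)\<^sup>2, 1 / snd v))"
      proof (rule chart_change[OF chart_a0, where h = "\<lambda>v. (- (fst v - (snd v)\<^sup>2 / 4 + 1) * (snd v)\<^sup>2, 1 / snd v)" and A = ?A])
        show "holo_on (\<lambda>v. (1 / (4 * (snd v)\<^sup>2) - 1 - fst v * (snd v)\<^sup>2, 1 / snd v)) ?A"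
          "holo_on (\<lambda>v. (- (fst v - (snd v)\<^sup>2 / 4 + 1) * (snd v)\<^sup>2, 1 / snd v)) ?A"
          unfolding holo_on_iff_cdiff by (intro conjI ballI open_neq cdiff_intros; simp)+
      qed (auto simp: prod_eq_iff field_simps)
      moreover have "emb 1 w = a0 (1 / (4 * (snd w)\<^sup>2) - 1 - fst w * (snd w)\<^sup>2, 1 / snd w)" if "w \<in> ?A" for w
        using that by (simp add: emb_def to_plane_def case_prod_beta)
      ultimately have "chart S9 ?A (emb 1)" by (rule chart_cong)
      moreover have "v \<in> ?A" using False by simp
      ultimately show ?thesis by (intro exI[of _ ?A] conjI subset_UNIV)
    qed
  qed
  show ?thesis using assms 0 1 2 by auto
qed

lemma range_emb: "(\<Union>j\<in>{0, 1, 2}. range (emb j)) = pts S9 - (\<Union>i\<in>{0..7}. curve i)"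
  unfolding pts_off_curves
proof (intro subset_antisym subsetI)
  fix c assume "c \<in> (\<Union>j\<in>{0, 1, 2}. range (emb j))"
  then show "c \<in> range a0 \<union> range (pt 5) \<union> range (pt 11)" by (auto simp: emb_def)
next
  fix c assume c: "c \<in> range a0 \<union> range (pt 5) \<union> range (pt 11)"
  have "pt 5 z = emb 2 (- z, 0)" "pt 11 z = emb 1 (z, 0)" for z by (simp_all add: emb_def)
  then show "c \<in> (\<Union>j\<in>{0, 1, 2}. range (emb j))" using c by (auto simp: emb_0)
qed

section \<open>Rational functions of two variables\<close>

text \<open>As \<open>eval2\<close> prescribes, the outer variable of the polynomial is y and the
  inner one is x.\<close>

definition polyX :: "complex poly poly" where "polyX = [:[:0, 1:]:]"
definition polyY :: "complex poly poly" where "polyY = [:0, 1:]"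
definition polyC :: "complex \<Rightarrow> complex poly poly" where "polyC c = [:[:c:]:]"

lemma eval2_simps [simp]:
  "eval2 polyX (x, y) = x" "eval2 polyY (x, y) = y" "eval2 (polyC c) (x, y) = c"
  "eval2 1 (x, y) = 1"
  "eval2 (P + Q) (x, y) = eval2 P (x, y) + eval2 Q (x, y)"
  "eval2 (P - Q) (x, y) = eval2 P (x, y) - eval2 Q (x, y)"
  "eval2 (P * Q) (x, y) = eval2 P (x, y) * eval2 Q (x, y)"
  "eval2 (P ^ n) (x, y) = eval2 P (x, y) ^ n"
  "eval2 (- P) (x, y) = - eval2 P (x, y)"
  by (simp_all add: eval2_def polyX_def polyY_def polyC_def)

text \<open>Continuity in the second variable suffices, because limits are taken along lines on
  which the first coordinate is fixed.\<close>

lemma isCont_eval2: "isCont (\<lambda>w. eval2 P (a, w)) b"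
proof (induction P)
  case 0 show ?case by (simp add: eval2_def)
next
  case (pCons c P)
  have "(\<lambda>w. eval2 (pCons c P) (a, w)) = (\<lambda>w. poly c a + w * eval2 P (a, w))"
    by (simp add: eval2_def)
  then show ?case using pCons by (simp add: continuous_intros)
qed

lemma polyY_neq_0: "polyY \<noteq> 0" by (simp add: polyY_def)

text \<open>Explicit fractions for the passage from copy j to copy k. Between copies 1 and 2 it
  reads x2 = x1 + 1/y^2 - 1/(4 y^4) with common y, so on y = 0 it has a genuine pole.\<close>

definition ratmap_of :: "nat \<Rightarrow> nat \<Rightarrow> ratmap" where
  "ratmap_of j k =
    (if j = k then ((polyX, 1), (polyY, 1))
     else if j = 0 then (if k = 1 then ((- (polyX - polyC (1/4) * polyY ^ 2 + 1) * polyY ^ 2, 1), (1, polyY))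
                         else ((- polyX * polyY ^ 2, 1), (1, polyY)))
     else if k = 0 then (if j = 1 then ((polyC (1/4) - polyY ^ 2 - polyX * polyY ^ 4, polyY ^ 2), (1, polyY))
                         else ((- polyX * polyY ^ 2, 1), (1, polyY)))
     else if j = 1 then ((polyX * polyY ^ 4 + polyY ^ 2 - polyC (1/4), polyY ^ 4), (polyY, 1))
     else ((polyX * polyY ^ 4 - polyY ^ 2 + polyC (1/4), polyY ^ 4), (polyY, 1)))"

lemma trafo_dom_iff: "(x, y) \<in> trafo_dom j t \<longleftrightarrow> j = 0 \<or> y \<noteq> 0"
  by (simp add: trafo_dom_def)

lemma ratmap_trafo:
  assumes "j \<in> {0, 1, 2}" "k \<in> {0, 1, 2}" "p \<in> trafo_dom j t" "p \<in> trafo_dom k t"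
  shows "trafo j t p \<in> rat_dom (ratmap_of j k)" "rat_eval (ratmap_of j k) (trafo j t p) = trafo k t p"
proof -
  obtain x y where p: "p = (x, y)" by (cases p)
  have y: "j = 0 \<or> y \<noteq> 0" "k = 0 \<or> y \<noteq> 0" using assms(3,4) unfolding p trafo_dom_iff by auto
  show "trafo j t p \<in> rat_dom (ratmap_of j k)"
    using assms(1,2) y unfolding p by (auto simp: trafo_def ratmap_of_def rat_dom_def)
  consider "j = k" | "j = 0" "k = 1" | "j = 0" "k = 2" | "j = 1" "k = 0" | "j = 2" "k = 0" | "j = 1" "k = 2" | "j = 2" "k = 1"
    using assms(1,2) by auto
  then show "rat_eval (ratmap_of j k) (trafo j t p) = trafo k t p"
  proof cases
    case 1 then show ?thesis unfolding p by (simp add: trafo_def ratmap_of_def rat_eval_def)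
  next
    case 2 then show ?thesis unfolding p by (simp add: trafo_def ratmap_of_def rat_eval_def)
  next
    case 3 then show ?thesis unfolding p by (simp add: trafo_def ratmap_of_def rat_eval_def)
  next
    case 4
    then have "y \<noteq> 0" using y by simp
    then have "(1/4 - (1 / y)\<^sup>2 - (- (x - y\<^sup>2 / 4 + 1) * y\<^sup>2) * (1 / y) ^ 4) / (1 / y)\<^sup>2 = x"
      by (simp add: field_simps power2_eq_square power4_eq_xxxx)
    then show ?thesis unfolding p using 4 by (simp add: trafo_def ratmap_of_def rat_eval_def)
  next
    case 5
    then have "y \<noteq> 0" using y by simp
    then show ?thesis unfolding p using 5 by (simp add: trafo_def ratmap_of_def rat_eval_def power_divide)
  next
    case 6
    then have "y \<noteq> 0" using y by simp
    then have "((- (x - y\<^sup>2 / 4 + 1) * y\<^sup>2) * (1 / y) ^ 4 + (1 / y)\<^sup>2 - 1/4) / (1 / y) ^ 4 = - x * y\<^sup>2"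
      by (simp add: field_simps power2_eq_square power4_eq_xxxx)
    then show ?thesis unfolding p using 6 by (simp add: trafo_def ratmap_of_def rat_eval_def)
  next
    case 7
    then have "y \<noteq> 0" using y by simp
    then have "((- x * y\<^sup>2) * (1 / y) ^ 4 - (1 / y)\<^sup>2 + 1/4) / (1 / y) ^ 4 = - (x - y\<^sup>2 / 4 + 1) * y\<^sup>2"
      by (simp add: field_simps power2_eq_square power4_eq_xxxx)
    then show ?thesis unfolding p using 7 by (simp add: trafo_def ratmap_of_def rat_eval_def)
  qed
qed

lemma trafo_back: "p \<in> trafo_dom j t \<Longrightarrow> trafo j t (to_plane j p) = p" "p \<in> trafo_dom j t \<Longrightarrow> to_plane j p \<in> trafo_dom j t"
  and back_trafo: "p \<in> trafo_dom j t \<Longrightarrow> to_plane j (trafo j t p) = p" "p \<in> trafo_dom j t \<Longrightarrow> trafo j t p \<in> trafo_dom j t"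
proof -
  obtain x y where p: "p = (x, y)" by (cases p)
  assume "p \<in> trafo_dom j t"
  then have y: "j = 0 \<or> y \<noteq> 0" unfolding p trafo_dom_iff .
  have eq3: "- (- x * y\<^sup>2) * (1 / y)\<^sup>2 = x" if "y \<noteq> 0" using that by (simp add: power_divide)
  have eq1: "- (1 / (4 * y\<^sup>2) - 1 - x * y\<^sup>2 - (1 / y)\<^sup>2 / 4 + 1) * (1 / y)\<^sup>2 = x" if "y \<noteq> 0"
    using that by (simp add: field_simps power2_eq_square)
  have eq2: "1 / (4 * (1 / y)\<^sup>2) - 1 - (- (x - y\<^sup>2 / 4 + 1) * y\<^sup>2) * (1 / y)\<^sup>2 = x" if "y \<noteq> 0"
    using that by (simp add: field_simps power2_eq_square)
  consider "j = 0" | "j = 1" "y \<noteq> 0" | "j \<noteq> 0" "j \<noteq> 1" "y \<noteq> 0" using y by metis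
  then show "trafo j t (to_plane j p) = p"
  proof cases
    case 1 then show ?thesis unfolding p by (simp add: trafo_def to_plane_def)
  next
    case 2
    show ?thesis unfolding p 2(1) trafo_def to_plane_def prod.case
      by (simp only: one_neq_zero if_False if_True prod.case simp_thms eq1[OF 2(2)]) simp
  next
    case 3
    show ?thesis unfolding p trafo_def to_plane_def prod.case
      by (simp only: 3(1,2) if_False prod.case eq3[OF 3(3)]) simp
  qed
  consider "j = 0" | "j = 1" "y \<noteq> 0" | "j \<noteq> 0" "j \<noteq> 1" "y \<noteq> 0" using y by metis
  then show "to_plane j (trafo j t p) = p"
  proof cases
    case 1 then show ?thesis unfolding p by (simp add: trafo_def to_plane_def)
  next
    case 2
    show ?thesis unfolding p 2(1) trafo_def to_plane_def prod.case
      by (simp only: one_neq_zero if_False if_True prod.case simp_thms eq2[OF 2(2)]) simp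
  next
    case 3
    show ?thesis unfolding p trafo_def to_plane_def prod.case
      by (simp only: 3(1,2) if_False prod.case eq3[OF 3(3)]) simp
  qed
  show "to_plane j p \<in> trafo_dom j t" "trafo j t p \<in> trafo_dom j t"
    using y unfolding p trafo_def to_plane_def by (auto simp: trafo_dom_def)
qed

lemma a0_notin: "a0 p \<notin> range (pt 5) \<union> range (pt 11)"
  by (cases p) (auto simp: a0_def)

lemma emb_trafo: "p \<in> trafo_dom j t \<Longrightarrow> emb j (trafo j t p) = a0 p"
  using back_trafo[of p j t] by (cases "trafo j t p") (auto simp: emb_def trafo_dom_def)

lemma emb_back: "p \<in> trafo_dom j t \<Longrightarrow> emb j p = a0 (to_plane j p)"
  by (cases p) (auto simp: emb_def trafo_dom_def)

lemma emb_notin: "p \<notin> trafo_dom j t \<Longrightarrow> emb j p \<in> range (pt 5) \<union> range (pt 11)"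
  by (cases p) (auto simp: emb_def trafo_dom_def split: if_splits)

lemma ratmap_id: "p \<in> rat_dom (ratmap_of j j)" "rat_eval (ratmap_of j j) p = p"
  by (cases p; simp add: ratmap_of_def rat_eval_def rat_dom_def)+

text \<open>If the common image lies in the affine plane, both parameters come from the same point
  of copy 0 and the explicit fractions do the job. Otherwise it lies on one of the two added lines,
  which have different tags, so the copies and the parameters coincide.\<close>

lemma biregular_if_emb_eq:
  assumes j: "j \<in> {0, 1, 2}" and k: "k \<in> {0, 1, 2}" and e: "emb j q = emb k q'"
  shows "biregular_at (trafo_dom j t) (trafo j t) (trafo_dom k t) (trafo k t) q q'"
proof (cases "q \<in> trafo_dom j t")
  case True
  have q': "q' \<in> trafo_dom k t"
    using emb_notin[of q' k t] emb_back[OF True] e a0_notin[of "to_plane j q"] by metis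
  define p where "p = to_plane j q"
  have "to_plane k q' = p" using emb_back[OF True] emb_back[OF q'] e inj_a(1) by (auto simp: p_def inj_eq)
  then have p: "p \<in> trafo_dom j t" "p \<in> trafo_dom k t" "q = trafo j t p" "q' = trafo k t p"
    using trafo_back[OF True] trafo_back[OF q'] by (auto simp: p_def)
  show ?thesis
    unfolding biregular_at_def
    by (rule exI[of _ "ratmap_of j k"], rule exI[of _ "ratmap_of k j"])
      (use ratmap_trafo[OF j k] ratmap_trafo[OF k j] p in auto)
next
  case False
  then have "j \<noteq> 0" "snd q = 0" by (auto simp: trafo_dom_def split: if_splits)
  moreover from this have "emb j q = (if j = 1 then pt 11 (fst q) else pt 5 (- fst q))" by (simp add: emb_def)
  moreover have "a0 p \<noteq> pt 5 z" "a0 p \<noteq> pt 11 z" for p z using a0_notin[of p] by auto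
  moreover note e
  ultimately have "emb k q' = (if j = 1 then pt 11 (fst q) else pt 5 (- fst q))"
    "\<And>p z. a0 p \<noteq> pt 5 z" "\<And>p z. a0 p \<noteq> pt 11 z" "snd q = 0" "j \<noteq> 0" by simp_all
  then have eq: "k = j \<and> snd q' = snd q \<and> fst q' = fst q"
    using j k unfolding emb_def by (simp split: if_splits)
  then have "k = j" "q = q'" by (simp_all add: prod_eq_iff)
  then show ?thesis
    unfolding biregular_at_def
    by (intro exI[of _ "ratmap_of j j"]) (simp add: ratmap_id)
qed

text \<open>\<open>biregular_at\<close> admits any fractions whatsoever, so no particular formula
  can be inspected. What every representative has in common is its limit at q along the line of
  fixed first coordinate.\<close>

lemma emb_eq_if_biregular:
  assumes j: "j \<in> {0, 1, 2}" and k: "k \<in> {0, 1, 2}"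
    and b: "biregular_at (trafo_dom j t) (trafo j t) (trafo_dom k t) (trafo k t) q q'"
  shows "emb j q = emb k q'"
proof -
  obtain F where F: "\<forall>p\<in>trafo_dom j t \<inter> trafo_dom k t. trafo j t p \<in> rat_dom F \<longrightarrow> rat_eval F (trafo j t p) = trafo k t p"
    "q \<in> rat_dom F" "rat_eval F q = q'" using b unfolding biregular_at_def by auto
  obtain a b where q: "q = (a, b)" by (cases q)
  obtain F1 F2 F3 F4 where F': "F = ((F1, F2), (F3, F4))" by (metis surj_pair)
  have n: "eval2 F2 (a, b) \<noteq> 0" "eval2 F4 (a, b) \<noteq> 0" using F(2) by (auto simp: q F' rat_dom_def)
  \<comment> \<open>F is continuous at q, and for w \<noteq> 0 near b it agrees with the explicit
    transition; hence the transition itself must tend to q' along this line.\<close>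
  have lim: "((\<lambda>w. rat_eval F (a, w)) \<longlongrightarrow> q') (at b)"
    unfolding F(3)[symmetric] q rat_eval_def F' fst_conv snd_conv
    by (intro tendsto_intros isContD[OF isCont_eval2] n)
  have "\<forall>\<^sub>F w in at b. eval2 F2 (a, w) \<noteq> 0" "\<forall>\<^sub>F w in at b. eval2 F4 (a, w) \<noteq> 0"
    using n by (auto intro!: tendsto_imp_eventually_ne isContD[OF isCont_eval2])
  then have ev1: "\<forall>\<^sub>F w in at b. (a, w) \<in> rat_dom F" by eventually_elim (simp add: rat_dom_def F')
  have ev0: "\<forall>\<^sub>F w in at b. w \<noteq> 0"
  proof (cases "b = 0")
    case True then show ?thesis by (simp add: eventually_at_filter)
  next
    case False
    then show ?thesis by (intro tendsto_imp_eventually_ne[OF tendsto_ident_at])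
  qed
  have tr: "trafo k t (to_plane j (a, w)) = rat_eval F (a, w)" if "w \<noteq> 0" "(a, w) \<in> rat_dom F" for w
  proof -
    have w: "(a, w) \<in> trafo_dom j t" using that by (simp add: trafo_dom_def)
    have "to_plane j (a, w) \<in> trafo_dom j t \<inter> trafo_dom k t"
      using trafo_back(2)[OF w] that by (auto simp: to_plane_def trafo_dom_def)
    from F(1)[rule_format, OF this] show ?thesis using trafo_back(1)[OF w] that(2) by simp
  qed
  have lim': "((\<lambda>w. trafo k t (to_plane j (a, w))) \<longlongrightarrow> q') (at b)"
    by (rule Lim_transform_eventually[OF lim]) (use ev0 ev1 in \<open>eventually_elim, simp add: tr\<close>)
  show ?thesis
  proof (cases "b = 0")
    case False
    have bq: "(a, b) \<in> trafo_dom j t" "to_plane j (a, b) \<in> trafo_dom k t"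
      using False by (auto simp: to_plane_def trafo_dom_def)
    have "(a, b) \<in> rat_dom F" using F(2) q by simp
    then have "q' = trafo k t (to_plane j (a, b))" using tr[OF False] F(3) q by simp
    then show ?thesis using emb_trafo[OF bq(2)] emb_back[OF bq(1)] q by simp
  next
    case True
    \<comment> \<open>Two obstructions at y = 0: between copy 0 and another copy the second
      coordinate 1/w diverges; between copies 1 and 2 the first coordinate grows like a nonzero
      multiple of 1/w^4.\<close>
    have no: False if "((\<lambda>w :: complex. 1 / w) \<longlongrightarrow> L) (at 0)" for L
    proof -
      have 1: "((\<lambda>w :: complex. w * (1 / w)) \<longlongrightarrow> 0 * L) (at 0)" by (intro tendsto_mult tendsto_ident_at that)
      have 2: "((\<lambda>w :: complex. w * (1 / w)) \<longlongrightarrow> 1) (at 0)"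
        by (rule Lim_transform_eventually[OF tendsto_const]) (simp add: eventually_at_filter)
      show False using tendsto_unique[OF at_neq_bot 1 2] by simp
    qed
    have no': False if f: "((\<lambda>w :: complex. f w) \<longlongrightarrow> L) (at 0)" and e: "\<And>w. w \<noteq> 0 \<Longrightarrow> w ^ 4 * f w = c * w ^ 4 + d * w\<^sup>2 + e" "e \<noteq> 0" for f L c d e
    proof -
      have 1: "((\<lambda>w. w ^ 4 * f w) \<longlongrightarrow> 0 ^ 4 * L) (at 0)" by (intro tendsto_intros f)
      have "((\<lambda>w. c * w ^ 4 + d * w\<^sup>2 + e) \<longlongrightarrow> c * 0 ^ 4 + d * 0\<^sup>2 + e) (at 0)" by (intro tendsto_intros)
      moreover have "\<forall>\<^sub>F w in at 0. c * w ^ 4 + d * w\<^sup>2 + e = w ^ 4 * f w"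
        unfolding eventually_at_filter by (rule always_eventually) (metis e(1))
      ultimately have 2: "((\<lambda>w. w ^ 4 * f w) \<longlongrightarrow> c * 0 ^ 4 + d * 0\<^sup>2 + e) (at 0)" by (rule Lim_transform_eventually)
      show False using tendsto_unique[OF at_neq_bot 1 2] e(2) by simp
    qed
    note l1 = tendsto_fst[OF lim'[unfolded True]] and l2 = tendsto_snd[OF lim'[unfolded True]]
    consider "j = k" | "j \<noteq> k" "j = 0 \<or> k = 0" | "j = 1" "k = 2" | "j = 2" "k = 1" using j k by auto
    then show ?thesis
    proof cases
      case 1
      have "\<forall>\<^sub>F w in at 0. trafo k t (to_plane j (a, w)) = (a, w)"
        unfolding eventually_at_filter 1 by (rule always_eventually) (auto intro!: trafo_back(1) simp: trafo_dom_def)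
      then have 3: "((\<lambda>w. (a, w)) \<longlongrightarrow> q') (at 0)"
        by (rule Lim_transform_eventually[OF lim'[unfolded True]])
      have 4: "((\<lambda>w. (a, w)) \<longlongrightarrow> (a, 0)) (at (0 :: complex))" by (intro tendsto_intros)
      have "q' = (a, 0)" by (rule tendsto_unique[OF at_neq_bot 3 4])
      then show ?thesis using 1 q True by simp
    next
      case 2
      then have "(\<lambda>w. snd (trafo k t (to_plane j (a, w)))) = (\<lambda>w. 1 / w)"
        using j k by (auto simp: trafo_def to_plane_def fun_eq_iff)
      with l2 have "((\<lambda>w :: complex. 1 / w) \<longlongrightarrow> snd q') (at 0)" by simp
      then have False by (rule no)
      then show ?thesis ..
    next
      case 3
      have "w ^ 4 * fst (trafo k t (to_plane j (a, w))) = a * w ^ 4 + 1 * w\<^sup>2 + - (1/4)" if "w \<noteq> 0" for w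
        using that 3 by (simp add: trafo_def to_plane_def field_simps power2_eq_square power4_eq_xxxx)
      from no'[OF l1 this] show ?thesis by simp
    next
      case 4
      have "w ^ 4 * fst (trafo k t (to_plane j (a, w))) = a * w ^ 4 + (-1) * w\<^sup>2 + 1/4" if "w \<noteq> 0" for w
        using that 4 by (simp add: trafo_def to_plane_def field_simps power2_eq_square power4_eq_xxxx)
      from no'[OF l1 this] show ?thesis by simp
    qed
  qed
qed

definition "glueing = glue_rel {0, 1, 2} trafo_dom trafo"
definition "total_space = glued {0, 1, 2} trafo_dom trafo"

text \<open>The heart of the gluing: it is equality of images in the surface together with equality
  of times. That it is an equivalence relation is then immediate, and manifold structure and
  separation can be transferred from \<open>S9\<close>.\<close>

lemma glueing_iff: "((j, x, y, t), (k, x', y', t')) \<in> glueing \<longleftrightarrow>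
    j \<in> {0, 1, 2} \<and> k \<in> {0, 1, 2} \<and> t' = t \<and> emb j (x, y) = emb k (x', y')"
proof -
  have "((j, x, y, t), (k, x', y', t')) \<in> glueing \<longleftrightarrow> j \<in> {0, 1, 2} \<and> k \<in> {0, 1, 2} \<and> t' = t \<and>
      biregular_at (trafo_dom j t) (trafo j t) (trafo_dom k t) (trafo k t) (x, y) (x', y')"
    unfolding glueing_def glue_rel_def by blast
  then show ?thesis
    using emb_eq_if_biregular[of j k t "(x, y)" "(x', y')"] biregular_if_emb_eq[of j k "(x, y)" "(x', y')" t] by blast
qed

lemma equiv_glueing: "equiv ({0, 1, 2} \<times> UNIV) glueing"
proof (rule equivI)
  show "glueing \<subseteq> ({0, 1, 2} \<times> UNIV) \<times> ({0, 1, 2} \<times> UNIV)" by (auto simp: glueing_def glue_rel_def)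
  show "refl_on ({0, 1, 2} \<times> UNIV) glueing" by (rule refl_onI) (auto simp: glueing_iff)
  show "sym glueing" by (rule symI) (auto simp: glueing_iff)
  show "trans glueing" by (rule transI) (auto simp: glueing_iff)
qed

section \<open>The total space of the gluing\<close>

text \<open>The glued point at time \<open>t\<close> that corresponds to the point \<open>s\<close> of the surface.\<close>

definition cls :: "point \<Rightarrow> complex \<Rightarrow> copy_point set" where
  "cls s t = {(k, x, y, t') |k x y t'. k \<in> {0, 1, 2} \<and> t' = t \<and> emb k (x, y) = s}"

definition embs :: "point set" where "embs = (\<Union>j\<in>{0, 1, 2}. range (emb j))"

definition par :: "nat \<Rightarrow> complex \<times> complex \<times> complex \<Rightarrow> copy_point set" where
  "par j v = cls (emb j (fst v, fst (snd v))) (snd (snd v))"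

lemma mem_cls: "(k, x, y, t') \<in> cls s t \<longleftrightarrow> k \<in> {0, 1, 2} \<and> t' = t \<and> emb k (x, y) = s"
  unfolding cls_def by blast

lemma embsE: assumes "s \<in> embs" obtains j x y where "j \<in> {0, 1, 2}" "s = emb j (x, y)"
proof -
  from assms obtain j q where "j \<in> {0, 1, 2}" "s = emb j q" unfolding embs_def by blast
  then show ?thesis using that[of j "fst q" "snd q"] by simp
qed

lemma embs_I: "j \<in> {0, 1, 2} \<Longrightarrow> emb j q \<in> embs"
  unfolding embs_def by blast

lemma cls_eq: "s \<in> embs \<Longrightarrow> cls s t = cls s' t' \<longleftrightarrow> s = s' \<and> t = t'"
proof -
  assume "s \<in> embs"
  then obtain j x y where j: "j \<in> {0, 1, 2}" "s = emb j (x, y)" by (rule embsE)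
  then have "(j, x, y, t) \<in> cls s t" using mem_cls by blast
  then show ?thesis using mem_cls[of j x y t s' t'] j by metis
qed

lemma par_eq: "j \<in> {0, 1, 2} \<Longrightarrow> par j v = par k w \<longleftrightarrow>
    emb j (fst v, fst (snd v)) = emb k (fst w, fst (snd w)) \<and> snd (snd v) = snd (snd w)"
  unfolding par_def by (rule cls_eq[OF embs_I])

lemma glueing_class: "j \<in> {0, 1, 2} \<Longrightarrow> glueing `` {(j, v)} = par j v"
proof -
  assume j: "j \<in> {0, 1, 2}"
  obtain x y t where v: "v = (x, y, t)" by (cases v)
  show ?thesis
  proof (intro set_eqI iffI)
    fix c assume "c \<in> glueing `` {(j, v)}"
    then show "c \<in> par j v" unfolding v par_def by (cases c) (auto simp only: Image_singleton_iff glueing_iff mem_cls fst_conv snd_conv)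
  next
    fix c assume "c \<in> par j v"
    then show "c \<in> glueing `` {(j, v)}" using j unfolding v par_def
      by (cases c) (auto simp only: Image_singleton_iff glueing_iff mem_cls fst_conv snd_conv)
  qed
qed

lemma pts_total_space: "pts total_space = {cls s t |s t. s \<in> embs}"
proof -
  have "pts total_space = {par j v |j v. j \<in> {0, 1, 2}}"
    unfolding total_space_def glued_def cmfd.simps glueing_def[symmetric] quotient_def
    using glueing_class by blast
  also have "\<dots> = {cls s t |s t. s \<in> embs}"
  proof (intro set_eqI iffI)
    fix c assume "c \<in> {par j v |j v. j \<in> {0, 1, 2}}"
    then show "c \<in> {cls s t |s t. s \<in> embs}" unfolding par_def using embs_I by blast
  next
    fix c assume "c \<in> {cls s t |s t. s \<in> embs}"
    then obtain s t where s: "c = cls s t" "s \<in> embs" by blast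
    obtain j x y where j: "j \<in> {0, 1, 2}" "s = emb j (x, y)" using s(2) by (rule embsE)
    have "c = par j (x, y, t)" by (simp add: s j par_def)
    then show "c \<in> {par j v |j v. j \<in> {0, 1, 2}}" using j by blast
  qed
  finally show ?thesis .
qed

definition coords :: "nat \<Rightarrow> copy_point set \<Rightarrow> complex \<times> complex \<times> complex" where
  "coords j = (\<lambda>c. THE p. (j, p) \<in> c)"

lemma coords_par: "j \<in> {0, 1, 2} \<Longrightarrow> coords j (par j v) = v"
proof -
  assume j: "j \<in> {0, 1, 2}"
  obtain x y t where v: "v = (x, y, t)" by (cases v)
  show ?thesis unfolding coords_def
  proof (rule the_equality)
    show "(j, v) \<in> par j v" unfolding v par_def using j mem_cls by simp
    fix p assume "(j, p) \<in> par j v"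
    then show "p = v" unfolding v par_def by (cases p) (simp only: mem_cls fst_conv snd_conv inj_eq[OF inj_emb] prod.inject)
  qed
qed

lemma atlas_total_space: "atlas total_space = (\<lambda>j. (range (par j), coords j)) ` {0, 1, 2}"
proof -
  have "{glueing `` {(j, p)} |p. True} = range (par j)" if "j \<in> {0, 1, 2}" for j
    using glueing_class[OF that] by auto
  then have "atlas total_space = {(range (par j), coords j) |j. j \<in> {0, 1, 2}}"
    unfolding total_space_def glued_def cmfd.simps glueing_def[symmetric] coords_def[symmetric] by blast
  then show ?thesis by blast
qed

lemma coords_image: "j \<in> {0, 1, 2} \<Longrightarrow> coords j ` range (par j) = UNIV" "j \<in> {0, 1, 2} \<Longrightarrow> inj_on (coords j) (range (par j))"
  "j \<in> {0, 1, 2} \<Longrightarrow> inv_into (range (par j)) (coords j) = par j"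
proof -
  assume j: "j \<in> {0, 1, 2}"
  show "coords j ` range (par j) = UNIV" using coords_par[OF j] by (simp add: image_image)
  show i: "inj_on (coords j) (range (par j))" using coords_par[OF j] by (auto simp: inj_on_def)
  show "inv_into (range (par j)) (coords j) = par j"
    by (rule ext, rule inv_into_f_eq[OF i]) (auto simp: coords_par[OF j])
qed

lemma par_pts: "j \<in> {0, 1, 2} \<Longrightarrow> par j v \<in> pts total_space"
  unfolding pts_total_space par_def using embs_I by blast

lemma holo_on_prod:
  fixes g :: "complex \<times> complex \<Rightarrow> complex \<times> complex"
  assumes "holo_on g N"
  shows "holo_on (\<lambda>v. (fst (g (fst v, fst (snd v))), snd (g (fst v, fst (snd v))), snd (snd v)))
    {v :: complex \<times> complex \<times> complex. (fst v, fst (snd v)) \<in> N}"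
proof -
  have "open ((\<lambda>v :: complex \<times> complex \<times> complex. (fst v, fst (snd v))) -` N)"
    by (rule open_vimage[OF holo_on_open[OF assms]]) (intro continuous_intros)
  moreover have "cdiff (\<lambda>v :: complex \<times> complex \<times> complex. g (fst v, fst (snd v))) v" if "(fst v, fst (snd v)) \<in> N" for v
    by (rule cdiff_compose) (use assms that in \<open>auto simp: holo_on_iff_cdiff intro!: cdiff_intros\<close>)
  ultimately show ?thesis
    unfolding holo_on_iff_cdiff vimage_def
    by (intro conjI ballI cdiff_Pair cdiff_fst cdiff_snd cdiff_ident) (simp_all only: mem_Collect_eq)
qed

text \<open>\<open>emb\<close> does not involve the time, so a transition of the total space is a
  transition of the surface times the identity on t.\<close>

lemma transits_par:
  assumes "j \<in> {0, 1, 2}" "k \<in> {0, 1, 2}"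
  shows "transits UNIV (par j) UNIV (par k)"
proof (rule transitsI)
  fix v :: "complex \<times> complex \<times> complex" assume "par j v \<in> range (par k)"
  then obtain w where "par j v = par k w" by blast
  then have "emb j (fst v, fst (snd v)) = emb k (fst w, fst (snd w))" using par_eq[OF assms(1)] by metis
  then have "emb j (fst v, fst (snd v)) \<in> range (emb k)" by (rule range_eqI)
  then obtain N g where g: "(fst v, fst (snd v)) \<in> N" "holo_on g N" "\<And>u. u \<in> N \<Longrightarrow> emb k (g u) = emb j u"
    using transitsE[OF chart_transits[OF premanifold_S9 chart_emb[OF assms(1)] chart_emb[OF assms(2)]] UNIV_I] by metis
  let ?g = "\<lambda>v. (fst (g (fst v, fst (snd v))), snd (g (fst v, fst (snd v))), snd (snd v))"
  let ?N = "{v :: complex \<times> complex \<times> complex. (fst v, fst (snd v)) \<in> N}"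
  have "par k (?g u) = par j u" if "u \<in> ?N" for u
    using that g(3) by (simp add: par_def)
  then show "\<exists>N g. v \<in> N \<and> N \<subseteq> UNIV \<and> holo_on g N \<and> g ` N \<subseteq> UNIV \<and> (\<forall>u\<in>N. par k (g u) = par j u)"
    using g(1) holo_on_prod[OF g(2)] by (intro exI[of _ ?N] exI[of _ ?g] conjI ballI subset_UNIV) simp_all
qed

lemma premanifold_total_space: "premanifold total_space"
  unfolding premanifold_def
proof (intro conjI)
  have "range (par j) \<subseteq> pts total_space \<and> inj_on (coords j) (range (par j)) \<and> open (coords j ` range (par j))"
    if "j \<in> {0, 1, 2}" for j using that par_pts coords_image by auto
  then show "\<forall>(U, \<phi>)\<in>atlas total_space. U \<subseteq> pts total_space \<and> inj_on \<phi> U \<and> open (\<phi> ` U)"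
    unfolding atlas_total_space by blast
  show "(\<Union>(U, \<phi>)\<in>atlas total_space. U) = pts total_space"
  proof -
    have "(\<Union>(U, \<phi>)\<in>atlas total_space. U) = (\<Union>j\<in>{0, 1, 2}. range (par j))" unfolding atlas_total_space by auto
    also have "\<dots> = pts total_space"
    proof (intro subset_antisym subsetI)
      fix c assume "c \<in> pts total_space"
      then obtain s t where s: "c = cls s t" "s \<in> embs" unfolding pts_total_space by blast
      obtain j x y where j: "j \<in> {0, 1, 2}" "s = emb j (x, y)" using s(2) by (rule embsE)
      have "c = par j (x, y, t)" by (simp add: s j par_def)
      then show "c \<in> (\<Union>j\<in>{0, 1, 2}. range (par j))" using j by blast
    next
      fix c assume "c \<in> (\<Union>j\<in>{0, 1, 2}. range (par j))"
      then show "c \<in> pts total_space" using par_pts by blast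
    qed
    finally show ?thesis .
  qed
  have "transits (coords j ` range (par j)) (inv_into (range (par j)) (coords j)) (coords k ` range (par k)) (inv_into (range (par k)) (coords k))"
    if "j \<in> {0, 1, 2}" "k \<in> {0, 1, 2}" for j k
    unfolding coords_image(1,3)[OF that(1)] coords_image(1,3)[OF that(2)] by (rule transits_par[OF that])
  then show "\<forall>(U, \<phi>)\<in>atlas total_space. \<forall>(V, \<psi>)\<in>atlas total_space.
        transits (\<phi> ` U) (inv_into U \<phi>) (\<psi> ` V) (inv_into V \<psi>)"
    unfolding atlas_total_space by blast
qed

lemma chart_par: assumes "j \<in> {0, 1, 2}" shows "chart total_space UNIV (par j)"
proof -
  have "(range (par j), coords j) \<in> atlas total_space" using assms unfolding atlas_total_space by blast
  from chart_atlas[OF premanifold_total_space this] show ?thesis unfolding coords_image(1,3)[OF assms] .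
qed

lemma openin_total_space:
  assumes "W \<subseteq> pts total_space" "\<And>j. j \<in> {0, 1, 2} \<Longrightarrow> open {v. par j v \<in> W}"
  shows "openin (mtop total_space) W"
proof -
  have "coords j ` (W \<inter> range (par j)) = {v. par j v \<in> W}" if "j \<in> {0, 1, 2}" for j
  proof (intro subset_antisym subsetI)
    fix v assume "v \<in> {v. par j v \<in> W}"
    then show "v \<in> coords j ` (W \<inter> range (par j))"
      using coords_par[OF that, of v] by (intro image_eqI[of _ _ "par j v"]) auto
  qed (auto simp: coords_par[OF that])
  then have "open (coords j ` (W \<inter> range (par j)))" if "j \<in> {0, 1, 2}" for j using that assms(2) by metis
  then show ?thesis unfolding openin_mtop[OF premanifold_total_space] atlas_total_space using assms(1) by blast
qed

text \<open>The total space sits in the product of \<open>S9\<close> with the t-line. Two points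
  differ in time or in the surface, and the preimages of separating open sets of that factor
  separate them.\<close>

lemma Hausdorff_total_space: "Hausdorff_space (mtop total_space)"
  unfolding Hausdorff_mtop_iff[OF premanifold_total_space]
proof (intro ballI impI)
  fix c c' assume "c \<in> pts total_space" "c' \<in> pts total_space" and ne: "c \<noteq> c'"
  then obtain s t s' t' where c: "c = cls s t" "s \<in> embs" "c' = cls s' t'" "s' \<in> embs"
    unfolding pts_total_space by blast
  let ?W = "\<lambda>A B. {cls s t |s t. s \<in> embs \<inter> A \<and> t \<in> B}"
  have mem: "par j v \<in> ?W A B \<longleftrightarrow> emb j (fst v, fst (snd v)) \<in> A \<and> snd (snd v) \<in> B" if j: "j \<in> {0, 1, 2}" for j v A B
  proof
    assume "par j v \<in> ?W A B"
    then obtain s t where s: "par j v = cls s t" "s \<in> embs" "s \<in> A" "t \<in> B" by blast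
    then have "emb j (fst v, fst (snd v)) = s" "snd (snd v) = t" unfolding par_def using cls_eq embs_I[OF j] by metis+
    then show "emb j (fst v, fst (snd v)) \<in> A \<and> snd (snd v) \<in> B" using s by simp
  next
    assume "emb j (fst v, fst (snd v)) \<in> A \<and> snd (snd v) \<in> B"
    then show "par j v \<in> ?W A B" unfolding par_def using embs_I[OF j] by blast
  qed
  have o: "openin (mtop total_space) (?W A B)" if A: "openin (mtop S9) A" and B: "open B" for A B
  proof (rule openin_total_space)
    show "?W A B \<subseteq> pts total_space" unfolding pts_total_space by blast
    fix j :: nat assume j: "j \<in> {0, 1, 2}"
    have "open {u \<in> UNIV. emb j u \<in> A}" by (rule open_chart_preimage[OF premanifold_S9 chart_emb[OF j] A])
    then have "open ((\<lambda>v :: complex \<times> complex \<times> complex. (fst v, fst (snd v))) -` {u. emb j u \<in> A})"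
      by (intro open_vimage continuous_intros) simp
    moreover have "open ((\<lambda>v :: complex \<times> complex \<times> complex. snd (snd v)) -` B)"
      by (intro open_vimage continuous_intros B)
    ultimately have "open ((\<lambda>v :: complex \<times> complex \<times> complex. (fst v, fst (snd v))) -` {u. emb j u \<in> A} \<inter> (\<lambda>v. snd (snd v)) -` B)"
      by (rule open_Int)
    moreover have "(\<lambda>v :: complex \<times> complex \<times> complex. (fst v, fst (snd v))) -` {u. emb j u \<in> A} \<inter> (\<lambda>v. snd (snd v)) -` B =
        {v. par j v \<in> ?W A B}" unfolding mem[OF j] by auto
    ultimately show "open {v. par j v \<in> ?W A B}" by simp
  qed
  have H: "Hausdorff_space (mtop S9)" using complex_manifold_S9 by (simp add: complex_manifold_iff)
  have sub: "embs \<subseteq> pts S9" unfolding embs_def range_emb by blast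
  have "openin (mtop S9) (pts S9)" using openin_topspace[of "mtop S9"] unfolding topspace_mtop[OF premanifold_S9] .
  note oS = this
  show "\<exists>A B. openin (mtop total_space) A \<and> openin (mtop total_space) B \<and> c \<in> A \<and> c' \<in> B \<and> A \<inter> B = {}"
  proof (cases "t = t'")
    case False
    then obtain A B where AB: "open A" "open B" "t \<in> A" "t' \<in> B" "A \<inter> B = {}" using hausdorff by metis
    have d: "?W (pts S9) A \<inter> ?W (pts S9) B = {}"
    proof (rule ccontr)
      assume "?W (pts S9) A \<inter> ?W (pts S9) B \<noteq> {}"
      then obtain s1 t1 s2 t2 where e: "cls s1 t1 = cls s2 t2" "s1 \<in> embs" "t1 \<in> A" "t2 \<in> B" by blast
      from e(1) have "t1 = t2" unfolding cls_eq[OF e(2)] by simp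
      then show False using AB(5) e(3,4) by blast
    qed
    have "c \<in> ?W (pts S9) A" "c' \<in> ?W (pts S9) B" using AB(3,4) c sub by blast+
    with o[OF oS AB(1)] o[OF oS AB(2)] d show ?thesis
      by (intro exI[of _ "?W (pts S9) A"] exI[of _ "?W (pts S9) B"] conjI)
  next
    case True
    then have "s \<noteq> s'" using ne c by auto
    moreover have "s \<in> pts S9" "s' \<in> pts S9" using sub c(2,4) by blast+
    ultimately have "\<exists>A B. openin (mtop S9) A \<and> openin (mtop S9) B \<and> s \<in> A \<and> s' \<in> B \<and> A \<inter> B = {}"
      using H[unfolded Hausdorff_mtop_iff[OF premanifold_S9]] by simp
    then obtain A B where AB: "openin (mtop S9) A" "openin (mtop S9) B" "s \<in> A" "s' \<in> B" "A \<inter> B = {}"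
      by (elim exE conjE)
    have d: "?W A UNIV \<inter> ?W B UNIV = {}"
    proof (rule ccontr)
      assume "?W A UNIV \<inter> ?W B UNIV \<noteq> {}"
      then obtain s1 t1 s2 t2 where e: "cls s1 t1 = cls s2 t2" "s1 \<in> embs" "s1 \<in> A" "s2 \<in> B" by blast
      from e(1) have "s1 = s2" unfolding cls_eq[OF e(2)] by simp
      then show False using AB(5) e(3,4) by blast
    qed
    have "c \<in> ?W A UNIV" "c' \<in> ?W B UNIV" using AB(3,4) c by blast+
    with o[OF AB(1) open_UNIV] o[OF AB(2) open_UNIV] d show ?thesis
      by (intro exI[of _ "?W A UNIV"] exI[of _ "?W B UNIV"] conjI)
  qed
qed

lemma complex_manifold_total_space: "complex_manifold total_space"
proof -
  have "countable (atlas total_space)" unfolding atlas_total_space by simp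
  from second_countable_mtop[OF premanifold_total_space this] show ?thesis
    unfolding complex_manifold_iff using premanifold_total_space Hausdorff_total_space by simp
qed

lemma time_of_cls: "s \<in> embs \<Longrightarrow> time_of (cls s t) = t"
proof -
  assume "s \<in> embs"
  then obtain j x y where j: "j \<in> {0, 1, 2}" "s = emb j (x, y)" by (rule embsE)
  then have "(j, x, y, t) \<in> cls s t" using mem_cls by blast
  then have "\<exists>j x y. (j, x, y, t) \<in> cls s t" by blast
  then show ?thesis unfolding time_of_def by (rule the_equality) (elim exE, simp only: mem_cls)
qed

lemma time_of_par: "j \<in> {0, 1, 2} \<Longrightarrow> time_of (par j v) = snd (snd v)"
  unfolding par_def by (rule time_of_cls[OF embs_I])

lemma total_space_cases:
  assumes "c \<in> pts total_space" obtains j x y t where "j \<in> {0, 1, 2}" "c = par j (x, y, t)"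
proof -
  obtain s t where s: "c = cls s t" "s \<in> embs" using assms unfolding pts_total_space by blast
  obtain j x y where j: "j \<in> {0, 1, 2}" "s = emb j (x, y)" using s(2) by (rule embsE)
  show ?thesis by (rule that[OF j(1)]) (simp add: s j par_def)
qed

lemma holomorphic_time_of: "holomorphic_map total_space (open_mfd UNIV) time_of"
proof (rule holomorphic_mapI[OF premanifold_total_space premanifold_open_mfd[OF open_UNIV]])
  fix c assume "c \<in> pts total_space"
  then obtain j x y t where j: "j \<in> {0, 1, 2}" "c = par j (x, y, t)" by (rule total_space_cases)
  have "holo_on (\<lambda>v. snd (snd v)) (UNIV :: (complex \<times> complex \<times> complex) set)"
    unfolding holo_on_iff_cdiff by (intro conjI ballI open_UNIV cdiff_intros)
  then show "\<exists>V \<sigma> V' \<sigma>' v g. chart total_space V \<sigma> \<and> chart (open_mfd UNIV) V' \<sigma>' \<and> v \<in> V \<and> \<sigma> v = c \<and>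
      holo_on g V \<and> g ` V \<subseteq> V' \<and> (\<forall>u\<in>V. time_of (\<sigma> u) = \<sigma>' (g u))"
    using chart_par[OF j(1)] chart_open_mfd[OF open_UNIV] j(2) time_of_par[OF j(1)]
    by (intro exI[of _ UNIV] exI[of _ "par j"] exI[of _ "\<lambda>x. x"] exI[of _ "(x, y, t)"] exI[of _ "\<lambda>v. snd (snd v)"] conjI ballI) auto
qed (simp add: open_mfd_def)

section \<open>The fibres\<close>

definition fib :: "complex \<Rightarrow> nat \<Rightarrow> complex \<times> complex \<Rightarrow> copy_point set" where
  "fib t j q = cls (emb j q) t"

lemma fib_par: "fib t j q = par j (fst q, snd q, t)"
  by (simp add: fib_def par_def)

lemma pts_fibre: "pts (fibre total_space t) = (\<lambda>s. cls s t) ` embs"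
proof (intro subset_antisym subsetI)
  fix c assume "c \<in> pts (fibre total_space t)"
  then have c: "c \<in> pts total_space" "time_of c = t" by (simp_all add: fibre_def)
  then obtain s t' where s: "c = cls s t'" "s \<in> embs" unfolding pts_total_space by blast
  then have "t' = t" using time_of_cls c(2) by metis
  then show "c \<in> (\<lambda>s. cls s t) ` embs" using s by (intro image_eqI) simp_all
next
  fix c assume "c \<in> (\<lambda>s. cls s t) ` embs"
  then obtain s where s: "c = cls s t" "s \<in> embs" by (rule imageE)
  then have "c \<in> pts total_space" unfolding pts_total_space by blast
  then show "c \<in> pts (fibre total_space t)" using s time_of_cls by (simp add: fibre_def)
qed

definition coords2 :: "nat \<Rightarrow> copy_point set \<Rightarrow> complex \<times> complex" where
  "coords2 j = (\<lambda>c. case coords j c of (x, y, _) \<Rightarrow> (x, y))"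

lemma coords2_fib: "j \<in> {0, 1, 2} \<Longrightarrow> coords2 j (fib t j q) = q"
  unfolding coords2_def fib_par by (simp add: coords_par)

lemma range_fib: "j \<in> {0, 1, 2} \<Longrightarrow> {c \<in> range (par j). time_of c = t} = range (fib t j)"
proof (intro subset_antisym subsetI)
  assume j: "j \<in> {0, 1, 2}"
  fix c assume "c \<in> {c \<in> range (par j). time_of c = t}"
  then obtain v where "c = par j v" "snd (snd v) = t" using time_of_par[OF j] by auto
  then have "c = fib t j (fst v, fst (snd v))" by (auto simp: fib_par)
  then show "c \<in> range (fib t j)" by blast
next
  assume j: "j \<in> {0, 1, 2}"
  fix c assume "c \<in> range (fib t j)"
  then obtain q where "c = fib t j q" by blast
  then show "c \<in> {c \<in> range (par j). time_of c = t}" using time_of_par[OF j] by (simp add: fib_par)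
qed

lemma atlas_fibre: "atlas (fibre total_space t) = (\<lambda>j. (range (fib t j), coords2 j)) ` {0, 1, 2}"
proof -
  have "atlas (fibre total_space t) = (\<lambda>j. ({c \<in> range (par j). time_of c = t}, coords2 j)) ` {0, 1, 2}"
    unfolding fibre_def cmfd.simps atlas_total_space coords2_def image_image prod.case ..
  also have "\<dots> = (\<lambda>j. (range (fib t j), coords2 j)) ` {0, 1, 2}"
    by (rule image_cong[OF refl]) (simp only: range_fib)
  finally show ?thesis .
qed

lemma coords2_image: "j \<in> {0, 1, 2} \<Longrightarrow> coords2 j ` range (fib t j) = UNIV" "j \<in> {0, 1, 2} \<Longrightarrow> inj_on (coords2 j) (range (fib t j))"
  "j \<in> {0, 1, 2} \<Longrightarrow> inv_into (range (fib t j)) (coords2 j) = fib t j"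
proof -
  assume j: "j \<in> {0, 1, 2}"
  show "coords2 j ` range (fib t j) = UNIV" using coords2_fib[OF j] by (simp add: image_image)
  show i: "inj_on (coords2 j) (range (fib t j))" using coords2_fib[OF j] by (auto simp: inj_on_def)
  show "inv_into (range (fib t j)) (coords2 j) = fib t j"
    by (rule ext, rule inv_into_f_eq[OF i]) (auto simp: coords2_fib[OF j])
qed

lemma inj_cls: "inj_on (\<lambda>s. cls s t) embs"
  by (rule inj_onI) (simp only: cls_eq)

lemma premanifold_fibre: "premanifold (fibre total_space t)"
  unfolding premanifold_def
proof (intro conjI)
  have sub: "range (fib t j) \<subseteq> pts (fibre total_space t)" if "j \<in> {0, 1, 2}" for j
    unfolding pts_fibre fib_def using embs_I[OF that] by blast
  have "range (fib t j) \<subseteq> pts (fibre total_space t) \<and> inj_on (coords2 j) (range (fib t j)) \<and> open (coords2 j ` range (fib t j))"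
    if "j \<in> {0, 1, 2}" for j using that sub coords2_image by auto
  then show "\<forall>(U, \<phi>)\<in>atlas (fibre total_space t). U \<subseteq> pts (fibre total_space t) \<and> inj_on \<phi> U \<and> open (\<phi> ` U)"
    unfolding atlas_fibre by blast
  show "(\<Union>(U, \<phi>)\<in>atlas (fibre total_space t). U) = pts (fibre total_space t)"
  proof -
    have "(\<Union>(U, \<phi>)\<in>atlas (fibre total_space t). U) = (\<Union>j\<in>{0, 1, 2}. range (fib t j))" unfolding atlas_fibre by auto
    also have "\<dots> = pts (fibre total_space t)"
      unfolding pts_fibre embs_def fib_def by blast
    finally show ?thesis .
  qed
  have "transits (coords2 j ` range (fib t j)) (inv_into (range (fib t j)) (coords2 j)) (coords2 k ` range (fib t k)) (inv_into (range (fib t k)) (coords2 k))"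
    if "j \<in> {0, 1, 2}" "k \<in> {0, 1, 2}" for j k
  proof -
    have "transits UNIV ((\<lambda>s. cls s t) \<circ> emb j) UNIV ((\<lambda>s. cls s t) \<circ> emb k)"
      by (rule transits_comp[OF chart_transits[OF premanifold_S9 chart_emb[OF that(1)] chart_emb[OF that(2)]] inj_cls])
        (intro image_subsetI embs_I that)+
    moreover have "(\<lambda>s. cls s t) \<circ> emb i = fib t i" for i by (simp add: fun_eq_iff fib_def)
    ultimately show ?thesis unfolding coords2_image(1,3)[OF that(1)] coords2_image(1,3)[OF that(2)] by simp
  qed
  then show "\<forall>(U, \<phi>)\<in>atlas (fibre total_space t). \<forall>(V, \<psi>)\<in>atlas (fibre total_space t).
        transits (\<phi> ` U) (inv_into U \<phi>) (\<psi> ` V) (inv_into V \<psi>)"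
    unfolding atlas_fibre by blast
qed

lemma chart_fib: assumes "j \<in> {0, 1, 2}" shows "chart (fibre total_space t) UNIV (fib t j)"
proof -
  have "(range (fib t j), coords2 j) \<in> atlas (fibre total_space t)" using assms unfolding atlas_fibre by blast
  from chart_atlas[OF premanifold_fibre this] show ?thesis unfolding coords2_image(1,3)[OF assms] .
qed

text \<open>All representatives of a glued point have the same image under \<open>emb\<close>; this
  makes the description unique, see \<open>iota_cls\<close>.\<close>

definition iota :: "copy_point set \<Rightarrow> point" where
  "iota c = (THE s. \<exists>j x y t. (j, x, y, t) \<in> c \<and> s = emb j (x, y))"

lemma iota_cls: "s \<in> embs \<Longrightarrow> iota (cls s t) = s"
proof -
  assume "s \<in> embs"
  then obtain j x y where j: "j \<in> {0, 1, 2}" "s = emb j (x, y)" by (rule embsE)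
  then have "(j, x, y, t) \<in> cls s t" using mem_cls by blast
  then have "\<exists>j x y t'. (j, x, y, t') \<in> cls s t \<and> s = emb j (x, y)" using j(2) by blast
  then show ?thesis unfolding iota_def by (rule the_equality) (elim exE conjE, simp only: mem_cls)
qed

text \<open>\<open>iota\<close> carries the chart \<open>fib t j\<close> of the fibre to the chart
  \<open>emb j\<close> of the surface, so it is the identity in coordinates.\<close>

lemma biholomorphic_iota:
  "biholomorphic (fibre total_space t) (restrict_mfd S9 (- (\<Union>i\<in>{0..7}. curve i))) iota"
proof -
  let ?W = "- (\<Union>i\<in>{0..7}. curve i)"
  have embs: "pts S9 \<inter> ?W = embs" unfolding embs_def range_emb by blast
  have o: "openin (mtop S9) (pts S9 \<inter> ?W)" unfolding embs
  proof (rule openin_if_charts[OF premanifold_S9])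
    fix p assume "p \<in> embs"
    then obtain j where j: "j \<in> {0, 1, 2}" "p \<in> range (emb j)" unfolding embs_def by blast
    then show "\<exists>V \<sigma>. chart S9 V \<sigma> \<and> p \<in> \<sigma> ` V \<and> \<sigma> ` V \<subseteq> embs"
      using chart_emb[OF j(1)] by (intro exI[of _ UNIV] exI[of _ "emb j"] conjI image_subsetI embs_I)
  qed
  have subW: "embs \<subseteq> ?W" unfolding embs[symmetric] by (rule Int_lower2)
  show ?thesis
  proof (rule biholomorphicI[OF premanifold_fibre premanifold_restrict[OF premanifold_S9 o]])
    have "iota ` (\<lambda>s. cls s t) ` embs = embs" using iota_cls by (simp add: image_image)
    moreover have "inj_on iota ((\<lambda>s. cls s t) ` embs)" using iota_cls by (auto simp: inj_on_def)
    ultimately show "bij_betw iota (pts (fibre total_space t)) (pts (restrict_mfd S9 ?W))"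
      unfolding pts_restrict embs pts_fibre bij_betw_def by simp
    fix c assume "c \<in> pts (fibre total_space t)"
    then obtain s where s: "c = cls s t" "s \<in> embs" unfolding pts_fibre by blast
    then obtain j where j: "j \<in> {0, 1, 2}" "s \<in> range (emb j)" unfolding embs_def by blast
    have "chart (restrict_mfd S9 ?W) UNIV (emb j)"
      by (rule chart_restrict[OF premanifold_S9 o chart_emb[OF j(1)]])
        (intro image_subsetI subsetD[OF subW] embs_I j(1))
    then have "chart (restrict_mfd S9 ?W) UNIV (iota \<circ> fib t j)"
      by (rule chart_cong) (simp add: fib_def iota_cls[OF embs_I[OF j(1)]])
    moreover have "c \<in> range (fib t j)" using s(1) j(2) by (auto simp: fib_def)
    ultimately show "\<exists>V \<sigma>. chart (fibre total_space t) V \<sigma> \<and> c \<in> \<sigma> ` V \<and> chart (restrict_mfd S9 ?W) V (iota \<circ> \<sigma>)"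
      using chart_fib[OF j(1)] by (intro exI[of _ UNIV] exI[of _ "fib t j"] conjI)
  qed
qed

lemma inj_curve: "inj_on curve {0..7}"
proof (rule inj_onI, rule ccontr)
  fix i j :: nat assume i: "i \<in> {0..7}" and j: "j \<in> {0..7}" and e: "curve i = curve j" and ne: "i \<noteq> j"
  \<comment> \<open>A witness on curve i that lies on no other curve: the point with parameter 2 on
    its main branch. The value 2 avoids the removed parameters 0, 1/4 and 1.\<close>
  define w where "w = (\<lambda>i :: nat. pt (if i = 0 then 4 else if i = 1 then 3 else if i = 2 then 1 else if i = 3 then 7
     else if i = 4 then 8 else if i = 5 then 9 else if i = 6 then 10 else 6) 2)"
  have ij: "i \<in> {0, 1, 2, 3, 4, 5, 6, 7}" "j \<in> {0, 1, 2, 3, 4, 5, 6, 7}" using i j by auto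
  have "w i \<in> curve i" using ij(1) by (elim insertE emptyE) (simp_all add: w_def curve_def)
  moreover have "w i \<notin> curve j"
    using ij ne by (elim insertE emptyE) (simp_all add: w_def curve_def)
  ultimately show False using e by simp
qed

text \<open>The transformations do not depend on t, so one and the same surface compactifies every
  fibre.\<close>

theorem surface_S9: "rational_surface_of_type E7_affine total_space t S9"
proof -
  obtain \<pi> where \<pi>: "iterated_blowup S9 \<pi>" "\<And>x y. \<pi> {(0, x, y)} = line (1, x, y)"
    using S9(1) unfolding stage_def by blast
  have I: "fst E7_affine = {0..7}" by (simp add: E7_affine_def)
  have "\<pi> (iota c) = line (1, x, y)" if "c \<in> pts (fibre total_space t)" "(0, x, y, t) \<in> c" for c x y
  proof -
    obtain s where s: "c = cls s t" "s \<in> embs" using \<open>c \<in> pts (fibre total_space t)\<close> unfolding pts_fibre by blast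
    then have "s = {(0, x, y)}" using that(2) mem_cls[of 0 x y t s t] by (simp add: emb_0 a0_def)
    then show ?thesis using \<pi>(2) iota_cls[OF s(2)] s(1) by simp
  qed
  note l = this
  show ?thesis
    unfolding rational_surface_of_type_def I
  proof (rule exI[of _ \<pi>], rule exI[of _ iota], rule exI[of _ curve], intro conjI ballI impI allI)
    show "iterated_blowup S9 \<pi>" by (rule \<pi>(1))
    show "biholomorphic (fibre total_space t) (restrict_mfd S9 (- (\<Union>i\<in>{0..7}. curve i))) iota"
      by (rule biholomorphic_iota)
    show "\<pi> (iota c) = line (1, x, y)" if "c \<in> pts (fibre total_space t)" "(0, x, y, t) \<in> c" for c x y
      by (rule l[OF that])
    show "inj_on curve {0..7}" by (rule inj_curve)
    show "smooth_rational_curve S9 (curve i)" "self_intersection S9 (curve i) (-2)" if "i \<in> {0..7}" for i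
      by (rule curves_neg2[OF that])+
    show "intersection_number S9 (curve i) (curve j) (int (snd E7_affine i j))"
      if "i \<in> {0..7}" "j \<in> {0..7}" "i \<noteq> j" for i j
      by (rule curves_intersection[OF that])
  qed
qed

section \<open>The coordinate transformations\<close>

lemma trafo_0: "trafo 0 t p = p" "trafo_dom 0 t = UNIV"
  by (cases p; simp add: trafo_def trafo_dom_def)+

lemma eval2_dom: "eval2 (if j = 0 then 1 else polyY) p \<noteq> 0 \<longleftrightarrow> p \<in> trafo_dom j t"
  by (cases p) (simp add: trafo_dom_def)

lemma birational_trafo:
  assumes j: "j \<in> {0, 1, 2}"
  shows "birational_on (trafo_dom j t) (trafo j t)"
  unfolding birational_on_def
proof (intro conjI)
  let ?h = "if j = 0 then 1 else polyY"
  have h: "?h \<noteq> 0" using polyY_neq_0 by simp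
  have 0: "(0 :: nat) \<in> {0, 1, 2}" by simp
  have p0: "p \<in> trafo_dom 0 t" for p by (simp add: trafo_0)
  show "\<exists>h. h \<noteq> 0 \<and> trafo_dom j t = {p. eval2 h p \<noteq> 0}"
    by (rule exI[of _ ?h], intro conjI h set_eqI) (simp only: mem_Collect_eq eval2_dom[of j _ t])
  show "\<exists>F. trafo_dom j t \<subseteq> rat_dom F \<and> (\<forall>p\<in>trafo_dom j t. trafo j t p = rat_eval F p)"
    using ratmap_trafo[OF 0 j p0] by (intro exI[of _ "ratmap_of 0 j"]) (auto simp: trafo_0)
  show "\<exists>G h k. h \<noteq> 0 \<and> k \<noteq> 0 \<and>
        (\<forall>p\<in>trafo_dom j t. eval2 h p \<noteq> 0 \<longrightarrow> trafo j t p \<in> rat_dom G \<and> rat_eval G (trafo j t p) = p) \<and>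
        (\<forall>q. eval2 k q \<noteq> 0 \<longrightarrow> q \<in> rat_dom G \<and> rat_eval G q \<in> trafo_dom j t \<and> trafo j t (rat_eval G q) = q)"
  \<comment> \<open>The map inverts on its whole domain, hence h = 1. Its image is cut out by the
    same condition y \<noteq> 0 as its domain for j \<noteq> 0, and is the whole plane for j = 0,
    hence the choice of k.\<close>
  proof (rule exI[of _ "ratmap_of j 0"], rule exI[of _ 1], rule exI[of _ ?h], intro conjI h ballI allI impI)
    fix p assume p: "p \<in> trafo_dom j t"
    show "trafo j t p \<in> rat_dom (ratmap_of j 0)" "rat_eval (ratmap_of j 0) (trafo j t p) = p"
      using ratmap_trafo[OF j 0 p p0] by (simp_all add: trafo_0)
  next
    fix q assume "eval2 ?h q \<noteq> 0"
    then have q: "q \<in> trafo_dom j t" by (simp only: eval2_dom[of j q t])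
    have *: "q \<in> rat_dom (ratmap_of j 0)" "rat_eval (ratmap_of j 0) q = to_plane j q"
      using ratmap_trafo[OF j 0 trafo_back(2)[OF q] p0] trafo_back(1)[OF q] by (simp_all add: trafo_0)
    show "q \<in> rat_dom (ratmap_of j 0)" "rat_eval (ratmap_of j 0) q \<in> trafo_dom j t"
      "trafo j t (rat_eval (ratmap_of j 0) q) = q"
      using * trafo_back[OF q] by simp_all
  qed simp
qed

lemmas hcd_Pair = has_complex_derivative_Pair and hcd_minus = has_complex_derivative_minus
  and hcd_mult = has_complex_derivative_mult and hcd_diff = has_complex_derivative_diff
  and hcd_add = has_complex_derivative_add and hcd_inverse = has_complex_derivative_inverse
  and hcd_fst = has_complex_derivative_fst and hcd_snd = has_complex_derivative_snd
  and hcd_const = has_complex_derivative_const and hcd_ident = has_complex_derivative_ident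

text \<open>Squares and quotients are written as products and \<open>inverse\<close>, the shape in
  which the derivative rules compose.\<close>

lemma trafo_1: "trafo 1 t (x, y) = (- ((x - (y * y) * (1/4) + 1) * (y * y)), inverse y)"
  and trafo_2: "trafo 2 t (x, y) = (- (x * (y * y)), inverse y)"
  by (simp_all add: trafo_def power2_eq_square inverse_eq_divide algebra_simps)

lemma symplectic_trafo:
  assumes j: "j \<in> {0, 1, 2}"
  shows "symplectic_on (trafo_dom j t) (trafo j t)"
  unfolding symplectic_on_def Let_def
proof
  fix p :: "complex \<times> complex" assume p: "p \<in> trafo_dom j t"
  consider "j = 0" | "j = 1" "snd p \<noteq> 0" | "j = 2" "snd p \<noteq> 0"
    using j p by (cases p) (auto simp: trafo_dom_def split: if_splits)
  then show "\<exists>L. has_complex_derivative (trafo j t) L p \<and>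
      (\<forall>u v. fst (L u) * snd (L v) - snd (L u) * fst (L v) = fst u * snd v - snd u * fst v)"
  proof cases
    case 1
    have "has_complex_derivative (trafo j t) (\<lambda>v. v) p"
      by (rule has_complex_derivative_transform[OF hcd_ident open_UNIV UNIV_I]) (simp add: 1 trafo_0)
    then show ?thesis by (intro exI[of _ "\<lambda>v. v"] conjI) auto
  next
    case 2
    note X = hcd_fst[OF hcd_ident[of p]] and Y = hcd_snd[OF hcd_ident[of p]]
    note D = hcd_Pair[OF hcd_minus[OF hcd_mult[OF hcd_add[OF hcd_diff[OF X hcd_mult[OF hcd_mult[OF Y Y] hcd_const[of "1/4"]]]
              hcd_const[of 1]] hcd_mult[OF Y Y]]] hcd_inverse[OF Y 2(2)]]
    have e: "trafo j t v = (- ((fst v - (snd v * snd v) * (1/4) + 1) * (snd v * snd v)), inverse (snd v))" for v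
      using trafo_1[of t "fst v" "snd v"] 2(1) by simp
    show ?thesis
      by (rule exI, rule conjI, rule has_complex_derivative_transform[OF D open_UNIV UNIV_I], rule e)
        (use 2(2) in \<open>auto simp: field_simps\<close>)
  next
    case 3
    note X = hcd_fst[OF hcd_ident[of p]] and Y = hcd_snd[OF hcd_ident[of p]]
    note D = hcd_Pair[OF hcd_minus[OF hcd_mult[OF X hcd_mult[OF Y Y]]] hcd_inverse[OF Y 3(2)]]
    have e: "trafo j t v = (- (fst v * (snd v * snd v)), inverse (snd v))" for v
      using trafo_2[of t "fst v" "snd v"] 3(1) by simp
    show ?thesis
      by (rule exI, rule conjI, rule has_complex_derivative_transform[OF D open_UNIV UNIV_I], rule e)
        (use 3(2) in \<open>auto simp: field_simps\<close>)
  qed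
qed

section \<open>The system in the three charts\<close>

text \<open>For j = 1 use u' = - y u, y' = y^2/2 + 4 u - 2 and x1 = - u y^2. The sign change (x, y)
  -> (-x, -y) exchanges the systems of copies 1 and 2, reflecting the symmetry (x, y) -> (-u, -y) of
  the original one. On y = 0 the second component is -1/2 or 1/2, so solutions cross the added lines
  transversally.\<close>

definition rhs_in :: "nat \<Rightarrow> complex \<Rightarrow> complex \<times> complex \<Rightarrow> complex \<times> complex" where
  "rhs_in j = (if j = 0 then rhs
     else if j = 1 then (\<lambda>t (x, y). (- 4 * x * y - 8 * x ^ 2 * y ^ 3, - 1/2 + 2 * y ^ 2 + 4 * x * y ^ 4))
     else (\<lambda>t (x, y). (4 * x * y - 8 * x ^ 2 * y ^ 3, 1/2 - 2 * y ^ 2 + 4 * x * y ^ 4)))"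

lemma sum_upto_4: "(\<Sum>i\<le>4. f i) = f 0 + f 1 + f 2 + f 3 + f 4" for f :: "nat \<Rightarrow> complex"
  by (simp add: numeral_eq_Suc)

text \<open>The coefficients are constant in t, and 4 bounds every exponent that occurs, the largest
  being y^4.\<close>

lemma poly_holo_coeffsI:
  assumes "\<And>t x y. g t (x, y) = (\<Sum>i\<le>4. \<Sum>k\<le>4. c i k * x ^ i * y ^ k)"
  shows "poly_holo_coeffs g"
  unfolding poly_holo_coeffs_def
  using assms by (intro exI[of _ 4] exI[of _ "\<lambda>i k _. c i k"]) auto

lemma poly_holo_rhs_in:
  "poly_holo_coeffs (\<lambda>t p. fst (rhs_in j t p))" "poly_holo_coeffs (\<lambda>t p. snd (rhs_in j t p))"
proof -
  consider "j = 0" | "j = 1" | "j \<noteq> 0" "j \<noteq> 1" by metis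
  then show "poly_holo_coeffs (\<lambda>t p. fst (rhs_in j t p))"
  proof cases
    case 1
    show ?thesis
      by (rule poly_holo_coeffsI[where c = "\<lambda>i k. if i = 1 \<and> k = 1 then 1 else 0"], simp only: sum_upto_4)
        (simp add: 1 rhs_in_def rhs_def)
  next
    case 2
    show ?thesis
      by (rule poly_holo_coeffsI[where c = "\<lambda>i k. if i = 1 \<and> k = 1 then -4 else if i = 2 \<and> k = 3 then -8 else 0"], simp only: sum_upto_4)
        (simp add: 2 rhs_in_def)
  next
    case 3
    show ?thesis
      by (rule poly_holo_coeffsI[where c = "\<lambda>i k. if i = 1 \<and> k = 1 then 4 else if i = 2 \<and> k = 3 then -8 else 0"], simp only: sum_upto_4)
        (use 3 in \<open>simp add: rhs_in_def\<close>)
  qed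
  consider "j = 0" | "j = 1" | "j \<noteq> 0" "j \<noteq> 1" by metis
  then show "poly_holo_coeffs (\<lambda>t p. snd (rhs_in j t p))"
  proof cases
    case 1
    show ?thesis
      by (rule poly_holo_coeffsI[where c = "\<lambda>i k. if i = 0 \<and> k = 2 then -1/2 else if i = 1 \<and> k = 0 then 4 else if i = 0 \<and> k = 0 then 2 else 0"], simp only: sum_upto_4)
        (simp add: 1 rhs_in_def rhs_def)
  next
    case 2
    show ?thesis
      by (rule poly_holo_coeffsI[where c = "\<lambda>i k. if i = 0 \<and> k = 2 then 2 else if i = 1 \<and> k = 4 then 4 else if i = 0 \<and> k = 0 then -1/2 else 0"], simp only: sum_upto_4)
        (simp add: 2 rhs_in_def)
  next
    case 3
    show ?thesis
      by (rule poly_holo_coeffsI[where c = "\<lambda>i k. if i = 0 \<and> k = 2 then -2 else if i = 1 \<and> k = 4 then 4 else if i = 0 \<and> k = 0 then 1/2 else 0"], simp only: sum_upto_4)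
        (use 3 in \<open>simp add: rhs_in_def\<close>)
  qed
qed

lemma rewritten_rhs:
  assumes j: "j \<in> {0, 1, 2}"
  shows "rewritten_system rhs (trafo_dom j) (trafo j) (rhs_in j)"
  unfolding rewritten_system_def
proof (intro allI ballI)
  fix t and p :: "complex \<times> complex" assume p: "p \<in> trafo_dom j t"
  obtain a b where ab: "p = (a, b)" by (cases p)
  consider "j = 0" | "j = 1" "b \<noteq> 0" | "j = 2" "b \<noteq> 0"
    using j p unfolding ab by (auto simp: trafo_dom_def split: if_splits)
  then show "\<exists>L. has_complex_derivative (\<lambda>(s, q). trafo j s q) L (t, p) \<and> L (1, rhs t p) = rhs_in j t (trafo j t p)"
  proof cases
    case 1
    have "has_complex_derivative (\<lambda>(s, q). trafo j s q) snd (t, p)"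
      by (rule has_complex_derivative_transform[OF hcd_snd[OF hcd_ident] open_UNIV UNIV_I]) (auto simp: 1 trafo_0)
    then show ?thesis by (intro exI[of _ snd]) (simp add: 1 trafo_0 rhs_in_def)
  next
    case 2
    note X = hcd_fst[OF hcd_snd[OF hcd_ident[of "(t, p)"]]] and Y = hcd_snd[OF hcd_snd[OF hcd_ident[of "(t, p)"]]]
    have n: "snd (snd (t, p)) \<noteq> 0" using 2 ab by simp
    note D = hcd_Pair[OF hcd_minus[OF hcd_mult[OF hcd_add[OF hcd_diff[OF X hcd_mult[OF hcd_mult[OF Y Y] hcd_const[of "1/4"]]]
              hcd_const[of 1]] hcd_mult[OF Y Y]]] hcd_inverse[OF Y n]]
    have e: "(case v of (s, q) \<Rightarrow> trafo j s q) =
        (- ((fst (snd v) - (snd (snd v) * snd (snd v)) * (1/4) + 1) * (snd (snd v) * snd (snd v))), inverse (snd (snd v)))" for v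
      using trafo_1[of "fst v" "fst (snd v)" "snd (snd v)"] 2(1) by (simp add: case_prod_beta)
    show ?thesis
      by (rule exI, rule conjI, rule has_complex_derivative_transform[OF D open_UNIV UNIV_I], rule e)
        (use 2 in \<open>simp add: ab rhs_def rhs_in_def trafo_def field_simps power2_eq_square power3_eq_cube power4_eq_xxxx\<close>)
  next
    case 3
    note X = hcd_fst[OF hcd_snd[OF hcd_ident[of "(t, p)"]]] and Y = hcd_snd[OF hcd_snd[OF hcd_ident[of "(t, p)"]]]
    have n: "snd (snd (t, p)) \<noteq> 0" using 3 ab by simp
    note D = hcd_Pair[OF hcd_minus[OF hcd_mult[OF X hcd_mult[OF Y Y]]] hcd_inverse[OF Y n]]
    have e: "(case v of (s, q) \<Rightarrow> trafo j s q) =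
        (- (fst (snd v) * (snd (snd v) * snd (snd v))), inverse (snd (snd v)))" for v
      using trafo_2[of "fst v" "fst (snd v)" "snd (snd v)"] 3(1) by (simp add: case_prod_beta)
    show ?thesis
      by (rule exI, rule conjI, rule has_complex_derivative_transform[OF D open_UNIV UNIV_I], rule e)
        (use 3 in \<open>simp add: ab rhs_def rhs_in_def trafo_def field_simps power2_eq_square power3_eq_cube power4_eq_xxxx\<close>)
  qed
qed

section \<open>Extension of meromorphic solutions\<close>

lemma removable:
  assumes r: "r > 0" and f: "\<And>t. t \<in> ball t0 r - {t0} \<Longrightarrow> \<exists>D. (f has_field_derivative D) (at t)"
    and l: "(f \<longlongrightarrow> l) (at t0)"
  shows "(\<lambda>t. if t = t0 then l else f t) holomorphic_on ball t0 r" (is "?g holomorphic_on _")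
proof (rule no_isolated_singularity'[where K = "{t0}"])
  have "(?g \<longlongrightarrow> l) (at t0)"
    by (rule Lim_transform_eventually[OF l]) (simp add: eventually_at_filter)
  then show "(?g \<longlongrightarrow> ?g z) (at z within ball t0 r)" if "z \<in> {t0}" for z
    using that by (auto intro: Lim_at_imp_Lim_at_within)
  have "f field_differentiable at t within (ball t0 r - {t0})" if "t \<in> ball t0 r - {t0}" for t
    using f[OF that] by (auto simp: field_differentiable_def intro: has_field_derivative_at_within)
  then have "f holomorphic_on (ball t0 r - {t0})" by (rule holomorphic_onI)
  then show "?g holomorphic_on (ball t0 r - {t0})" by (rule holomorphic_transform) auto
qed auto

lemma cdiff_if_holomorphic:
  assumes "f holomorphic_on B" "open B" "t \<in> B" shows "cdiff f t"
proof -
  obtain D where "(f has_field_derivative D) (at t)"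
    using holomorphic_on_imp_differentiable_at[OF assms] by (auto simp: field_differentiable_def)
  then have "has_complex_derivative f ((*) D) t"
    by (simp add: has_complex_derivative_def has_field_derivative_def cscale_complex_def)
  then show ?thesis unfolding cdiff_def by blast
qed

text \<open>Extending a solution into the total space amounts to finding one copy in which both
  coordinates extend holomorphically over t0.\<close>

lemma extension_in_chart:
  assumes j: "j \<in> {0, 1, 2}" and r: "r > 0" and X: "X holomorphic_on ball t0 r" and Y: "Y holomorphic_on ball t0 r"
    and e: "\<And>t. t \<in> ball t0 r - {t0} \<Longrightarrow> emb j (X t, Y t) = a0 (x t, y t)"
  shows "\<exists>r>0. \<exists>\<Phi>. holomorphic_map (open_mfd (ball t0 r)) total_space \<Phi> \<and>
           (\<forall>t\<in>ball t0 r - {t0}. (0, x t, y t, t) \<in> \<Phi> t)"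
proof -
  define \<Phi> where "\<Phi> = (\<lambda>t. par j (X t, Y t, t))"
  have "holomorphic_map (open_mfd (ball t0 r)) total_space \<Phi>"
  proof (rule holomorphic_mapI[OF premanifold_open_mfd[OF open_ball] premanifold_total_space])
    show "\<Phi> ` pts (open_mfd (ball t0 r)) \<subseteq> pts total_space"
      unfolding \<Phi>_def by (rule image_subsetI) (rule par_pts[OF j])
    fix t assume "t \<in> pts (open_mfd (ball t0 r))"
    then have t: "t \<in> ball t0 r" by (simp add: open_mfd_def)
    have "holo_on (\<lambda>t. (X t, Y t, t)) (ball t0 r)"
      unfolding holo_on_iff_cdiff
      by (intro conjI ballI open_ball cdiff_Pair cdiff_ident cdiff_if_holomorphic[OF X open_ball] cdiff_if_holomorphic[OF Y open_ball])
    then show "\<exists>V \<sigma> V' \<sigma>' v g. chart (open_mfd (ball t0 r)) V \<sigma> \<and> chart total_space V' \<sigma>' \<and> v \<in> V \<and> \<sigma> v = t \<and>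
      holo_on g V \<and> g ` V \<subseteq> V' \<and> (\<forall>u\<in>V. \<Phi> (\<sigma> u) = \<sigma>' (g u))"
      using chart_open_mfd[OF open_ball] chart_par[OF j] t
      by (intro exI[of _ "ball t0 r"] exI[of _ "\<lambda>x. x"] exI[of _ UNIV] exI[of _ "par j"] exI[of _ t] exI[of _ "\<lambda>t. (X t, Y t, t)"]
          conjI ballI subset_UNIV) (simp_all add: \<Phi>_def)
  qed
  moreover have "(0, x t, y t, t) \<in> \<Phi> t" if "t \<in> ball t0 r - {t0}" for t
    using e[OF that] by (simp add: \<Phi>_def par_def mem_cls emb_0)
  ultimately show ?thesis using r by blast
qed

text \<open>The system has the first integral \<open>x u\<close> with \<open>u = x - y\<^sup>2/4 + 1\<close>. If \<open>y\<close> has a pole, then either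
  \<open>x\<close> has a pole and \<open>u y\<^sup>2\<close> stays bounded, or \<open>x\<close> is bounded and \<open>x y\<^sup>2\<close> stays bounded.\<close>

lemma solution_extends:
  assumes "meromorphic_solution_near rhs t0 x y"
  shows "\<exists>r>0. \<exists>\<Phi>. holomorphic_map (open_mfd (ball t0 r)) total_space \<Phi> \<and>
           (\<forall>t\<in>ball t0 r - {t0}. (0, x t, y t, t) \<in> \<Phi> t)"
proof -
  let ?ode = "\<lambda>t. (x has_field_derivative x t * y t) (at t) \<and> (y has_field_derivative - ((y t)\<^sup>2 / 2) + 4 * x t + 2) (at t)"
  have ode: "\<forall>\<^sub>F t in at t0. ?ode t" and mer: "x meromorphic_on {t0}" "y meromorphic_on {t0}"
    using assms unfolding meromorphic_solution_near_def rhs_def by simp_all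
  have ball: "\<exists>r>0. \<forall>t\<in>ball t0 r - {t0}. P t" if P: "\<forall>\<^sub>F t in at t0. P t" for P
  proof -
    obtain d where d: "d > 0" "\<forall>t\<in>UNIV. t \<noteq> t0 \<and> dist t t0 < d \<longrightarrow> P t"
      using P unfolding eventually_at by (elim exE conjE)
    have "P t" if "t \<in> ball t0 d - {t0}" for t using d(2) that by (simp add: dist_commute)
    then show ?thesis using d(1) by (intro exI[of _ d] conjI ballI)
  qed
  \<comment> \<open>A meromorphic function has a limit or a pole; every case distinction below is of
    this kind.\<close>
  have ne: "(\<exists>l. (f \<longlongrightarrow> l) (at t0)) \<or> filterlim f at_infinity (at t0)" if "f meromorphic_on {t0}" for f :: "complex \<Rightarrow> complex"
    using that unfolding meromorphic_at_iff not_essential_def is_pole_def by blast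
  define u where "u = (\<lambda>t. x t - (y t)\<^sup>2 / 4 + 1)"
  \<comment> \<open>u' = x y - (y/2)(- y^2/2 + 4 x + 2) = - y (x - y^2/4 + 1).\<close>
  have Du: "(u has_field_derivative - y t * u t) (at t)" if "?ode t" for t
    unfolding u_def
    by (rule DERIV_cong[OF DERIV_add[OF DERIV_diff[OF that[THEN conjunct1]
          DERIV_cdivide[OF DERIV_power[OF that[THEN conjunct2], of 2], of 4]] DERIV_const[of 1]]])
      (simp add: field_simps power2_eq_square power3_eq_cube)
  obtain r0 where r0': "r0 > 0" "\<forall>t\<in>ball t0 r0 - {t0}. ?ode t" using ball[OF ode] by (elim exE conjE)
  note r0 = r0'(1) bspec[OF r0'(2)]
  \<comment> \<open>The logarithmic derivatives y and -y of x and u cancel, and the punctured disc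
    is connected.\<close>
  have "(\<lambda>t. x t * u t) constant_on (ball t0 r0 - {t0})"
  proof (rule DERIV_zero_connected_constant_on[where K = "{}"])
    show "connected (ball t0 r0 - {t0})" by (rule connected_punctured_ball) simp
    show "open (ball t0 r0 - {t0})" by (simp add: open_delete)
    have D: "((\<lambda>t. x t * u t) has_field_derivative 0) (at t)" if "t \<in> ball t0 r0 - {t0}" for t
      using DERIV_mult[OF conjunct1[OF r0(2)[OF that]] Du[OF r0(2)[OF that]]] by (simp add: algebra_simps)
    then show "\<forall>t\<in>ball t0 r0 - {t0} - {}. ((\<lambda>t. x t * u t) has_field_derivative 0) (at t)" by simp
    show "continuous_on (ball t0 r0 - {t0}) (\<lambda>t. x t * u t)"
      by (intro continuous_at_imp_continuous_on ballI DERIV_isCont[OF D])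
  qed simp
  then obtain c where "\<And>t. t \<in> ball t0 r0 - {t0} \<Longrightarrow> x t * u t = c" unfolding constant_on_def by blast
  then have c: "\<forall>\<^sub>F t in at t0. x t * u t = c"
    using r0(1) unfolding eventually_at by (intro exI[of _ r0]) (auto simp: dist_commute)
  have c_lim: "((\<lambda>t. x t * u t) \<longlongrightarrow> c) (at t0)"
    by (rule Lim_transform_eventually[OF tendsto_const]) (use c in \<open>simp add: eq_commute\<close>)
  have y2: "(y t)\<^sup>2 = 4 * (x t - u t + 1)" for t by (simp add: u_def)
  show ?thesis
  proof (cases "\<exists>l. (y \<longlongrightarrow> l) (at t0)")
    case True
    then obtain l where l: "(y \<longlongrightarrow> l) (at t0)" by blast
    \<comment> \<open>With y bounded, a pole of x would be a pole of u too, and then x u could not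
      be constant.\<close>
    have "\<not> filterlim x at_infinity (at t0)"
    proof
      assume x: "filterlim x at_infinity (at t0)"
      have "((\<lambda>t. 1 - (y t)\<^sup>2 / 4) \<longlongrightarrow> 1 - l\<^sup>2 / 4) (at t0)" by (intro tendsto_intros l) simp
      from tendsto_add_filterlim_at_infinity[OF this x] have "filterlim u at_infinity (at t0)"
        unfolding u_def by (simp add: algebra_simps)
      from filterlim_at_infinity_times[OF x this] show False
        using not_tendsto_and_filterlim_at_infinity[OF at_neq_bot c_lim] by blast
    qed
    then obtain m where m: "(x \<longlongrightarrow> m) (at t0)" using ne[OF mer(1)] by blast
    show ?thesis
    proof (rule extension_in_chart[of 0 r0])
      show "(\<lambda>t. if t = t0 then m else x t) holomorphic_on ball t0 r0"
        by (rule removable[OF r0(1) _ m]) (use r0(2) in blast)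
      show "(\<lambda>t. if t = t0 then l else y t) holomorphic_on ball t0 r0"
        by (rule removable[OF r0(1) _ l]) (use r0(2) in blast)
    qed (use r0(1) in \<open>simp_all add: emb_0\<close>)
  next
    case False
    then have yp: "filterlim y at_infinity (at t0)" using ne[OF mer(2)] by blast
    have iy: "((\<lambda>t. 1 / y t) \<longlongrightarrow> 0) (at t0)"
      using filterlim_compose[OF tendsto_inverse_0 yp] by (simp add: inverse_eq_divide)
    have "\<forall>\<^sub>F t in at t0. y t \<noteq> 0" by (rule filterlim_at_infinity_imp_eventually_ne[OF yp])
    with ode have "\<forall>\<^sub>F t in at t0. ?ode t \<and> y t \<noteq> 0" by eventually_elim simp
    from ball[OF this] obtain r where r': "r > 0" "\<forall>t\<in>ball t0 r - {t0}. ?ode t \<and> y t \<noteq> 0"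
      by (elim exE conjE)
    note r = r'(1) conjunct1[OF bspec[OF r'(2)]] conjunct2[OF bspec[OF r'(2)]]
    have Y: "(\<lambda>t. if t = t0 then 0 else 1 / y t) holomorphic_on ball t0 r"
    proof (rule removable[OF r(1) _ iy])
      fix t assume t: "t \<in> ball t0 r - {t0}"
      show "\<exists>D. ((\<lambda>t. 1 / y t) has_field_derivative D) (at t)"
        using DERIV_divide[OF DERIV_const conjunct2[OF r(2)[OF t]] r(3)[OF t]] by blast
    qed
    consider m where "(x \<longlongrightarrow> m) (at t0)" | "filterlim x at_infinity (at t0)" using ne[OF mer(1)] by blast
    then show ?thesis
    proof cases
      case (1 m)
      have "filterlim (\<lambda>t. (y t)\<^sup>2) at_infinity (at t0)"
        using filterlim_at_infinity_times[OF yp yp] by (simp add: power2_eq_square)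
      from tendsto_mult_filterlim_at_infinity[OF tendsto_const _ this, of "- 1 / 4"]
      have "filterlim (\<lambda>t. - 1 / 4 * (y t)\<^sup>2) at_infinity (at t0)" by simp
      from tendsto_add_filterlim_at_infinity[OF tendsto_add[OF 1 tendsto_const[of 1]] this]
      have up: "filterlim u at_infinity (at t0)" unfolding u_def by (simp add: algebra_simps)
      have iu: "((\<lambda>t. inverse (u t)) \<longlongrightarrow> 0) (at t0)" by (rule filterlim_compose[OF tendsto_inverse_0 up])
      have "\<forall>\<^sub>F t in at t0. u t \<noteq> 0" by (rule filterlim_at_infinity_imp_eventually_ne[OF up])
      \<comment> \<open>Here x = c/u and y^2 = 4 (x - u + 1), so x y^2 = 4 c (x/u - 1 + 1/u), where
        every term has a limit.\<close>
      with c have ev: "\<forall>\<^sub>F t in at t0. - (4 * c * (x t * inverse (u t) - 1 + inverse (u t))) = - x t * (y t)\<^sup>2"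
      proof eventually_elim
        case (elim t)
        then have "x t = c * inverse (u t)" by (simp add: field_simps)
        then have "x t * (4 * (x t - u t + 1)) = c * inverse (u t) * (4 * (x t - u t + 1))" by simp
        also have "\<dots> = 4 * c * (x t * inverse (u t) - 1 + inverse (u t))" using elim(2) by (simp add: field_simps)
        finally show ?case unfolding y2 by simp
      qed
      \<comment> \<open>The limit of x2 is 4 c, left in the shape that the limit rules
        produce.\<close>
      have "((\<lambda>t. - (4 * c * (x t * inverse (u t) - 1 + inverse (u t)))) \<longlongrightarrow> - (4 * c * (m * 0 - 1 + 0))) (at t0)"
        by (intro tendsto_intros 1 iu)
      then have lim: "((\<lambda>t. - x t * (y t)\<^sup>2) \<longlongrightarrow> - (4 * c * (m * 0 - 1 + 0))) (at t0)"
        by (rule Lim_transform_eventually[OF _ ev])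
      show ?thesis
      proof (rule extension_in_chart[of 2 r, OF _ r(1) removable[OF r(1) _ lim] Y])
        fix t assume t: "t \<in> ball t0 r - {t0}"
        have "emb 2 (trafo 2 t (x t, y t)) = a0 (x t, y t)" by (rule emb_trafo) (use r(3)[OF t] in \<open>simp add: trafo_dom_def\<close>)
        then show "emb 2 (if t = t0 then - (4 * c * (m * 0 - 1 + 0)) else - x t * (y t)\<^sup>2, if t = t0 then 0 else 1 / y t) = a0 (x t, y t)"
          using t by (simp add: trafo_def)
        show "\<exists>D. ((\<lambda>t. - x t * (y t)\<^sup>2) has_field_derivative D) (at t)"
          using DERIV_mult[OF DERIV_minus[OF conjunct1[OF r(2)[OF t]]] DERIV_power[OF conjunct2[OF r(2)[OF t]], of 2]] by blast
      qed simp
    next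
      case 2
      have ix: "((\<lambda>t. inverse (x t)) \<longlongrightarrow> 0) (at t0)" by (rule filterlim_compose[OF tendsto_inverse_0 2])
      have xn: "\<forall>\<^sub>F t in at t0. x t \<noteq> 0" by (rule filterlim_at_infinity_imp_eventually_ne[OF 2])
      with c have eu: "\<forall>\<^sub>F t in at t0. c * inverse (x t) = u t" by eventually_elim (auto simp: field_simps)
      have "((\<lambda>t. c * inverse (x t)) \<longlongrightarrow> c * 0) (at t0)" by (intro tendsto_intros ix)
      then have ul: "(u \<longlongrightarrow> c * 0) (at t0)" by (rule Lim_transform_eventually[OF _ eu])
      \<comment> \<open>The mirror case with u = c/x: u y^2 = 4 c (1 - u/x + 1/x), so x1 tends to -4
        c.\<close>
      from eu xn have ev: "\<forall>\<^sub>F t in at t0. - (4 * c * (1 - u t * inverse (x t) + inverse (x t))) = - (x t - (y t)\<^sup>2 / 4 + 1) * (y t)\<^sup>2"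
      proof eventually_elim
        case (elim t)
        have "u t * (4 * (x t - u t + 1)) = c * inverse (x t) * (4 * (x t - u t + 1))" using elim(1) by simp
        also have "\<dots> = 4 * c * (1 - u t * inverse (x t) + inverse (x t))" using elim(2) by (simp add: field_simps)
        finally have "u t * (y t)\<^sup>2 = 4 * c * (1 - u t * inverse (x t) + inverse (x t))" unfolding y2 .
        moreover have "- (x t - (y t)\<^sup>2 / 4 + 1) * (y t)\<^sup>2 = - (u t * (y t)\<^sup>2)"
          unfolding u_def by (rule mult_minus_left)
        ultimately show ?case by (simp only:)
      qed
      have "((\<lambda>t. - (4 * c * (1 - u t * inverse (x t) + inverse (x t)))) \<longlongrightarrow> - (4 * c * (1 - c * 0 * 0 + 0))) (at t0)"
        by (intro tendsto_intros ul ix)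
      then have lim: "((\<lambda>t. - (x t - (y t)\<^sup>2 / 4 + 1) * (y t)\<^sup>2) \<longlongrightarrow> - (4 * c * (1 - c * 0 * 0 + 0))) (at t0)"
        by (rule Lim_transform_eventually[OF _ ev])
      show ?thesis
      proof (rule extension_in_chart[of 1 r, OF _ r(1) removable[OF r(1) _ lim] Y])
        fix t assume t: "t \<in> ball t0 r - {t0}"
        have "emb 1 (trafo 1 t (x t, y t)) = a0 (x t, y t)" by (rule emb_trafo) (use r(3)[OF t] in \<open>simp add: trafo_dom_def\<close>)
        then show "emb 1 (if t = t0 then - (4 * c * (1 - c * 0 * 0 + 0)) else - (x t - (y t)\<^sup>2 / 4 + 1) * (y t)\<^sup>2,
            if t = t0 then 0 else 1 / y t) = a0 (x t, y t)"
          using t by (simp add: trafo_def)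
        show "\<exists>D. ((\<lambda>t. - (x t - (y t)\<^sup>2 / 4 + 1) * (y t)\<^sup>2) has_field_derivative D) (at t)"
          using DERIV_mult[OF DERIV_minus[OF Du[OF r(2)[OF t]]] DERIV_power[OF conjunct2[OF r(2)[OF t]], of 2]]
          unfolding u_def by blast
      qed simp
    qed
  qed
qed

lemma phase_space: "phase_space_by_gluing rhs {0, 1, 2} trafo_dom trafo"
  unfolding phase_space_by_gluing_def glueing_def[symmetric] total_space_def[symmetric]
proof (intro conjI allI ballI impI)
  show "\<exists>g. poly_holo_coeffs (\<lambda>t p. fst (g t p)) \<and> poly_holo_coeffs (\<lambda>t p. snd (g t p)) \<and>
        rewritten_system rhs (trafo_dom j) (trafo j) g" if "j \<in> {0, 1, 2}" for j
    using poly_holo_rhs_in rewritten_rhs[OF that] by (intro exI[of _ "rhs_in j"]) simp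
  show "equiv ({0, 1, 2} \<times> UNIV) glueing" by (rule equiv_glueing)
  show "complex_manifold total_space" by (rule complex_manifold_total_space)
  show "holomorphic_map total_space (open_mfd UNIV) time_of" by (rule holomorphic_time_of)
  show "\<exists>r>0. \<exists>\<Phi>. holomorphic_map (open_mfd (ball t0 r)) total_space \<Phi> \<and>
           (\<forall>t\<in>ball t0 r - {t0}. (0, x t, y t, t) \<in> \<Phi> t)" if "meromorphic_solution_near rhs t0 x y" for t0 x y
    by (rule solution_extends[OF that])
qed (simp_all add: trafo_0)

theorem theorem19p2:
  shows "(\<forall>j\<in>{0,1,2}. \<forall>t. birational_on (trafo_dom j t) (trafo j t) \<and>
                             symplectic_on (trafo_dom j t) (trafo j t)) \<and>
         phase_space_by_gluing rhs {0,1,2} trafo_dom trafo \<and>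
         (\<forall>t. \<exists>S :: ((nat \<times> complex \<times> complex) set, complex \<times> complex) cmfd.
            rational_surface_of_type E7_affine (glued {0,1,2} trafo_dom trafo) t S)"
proof (intro conjI ballI allI)
  fix j :: nat and t assume j: "j \<in> {0, 1, 2}"
  show "birational_on (trafo_dom j t) (trafo j t)" by (rule birational_trafo[OF j])
  show "symplectic_on (trafo_dom j t) (trafo j t)" by (rule symplectic_trafo[OF j])
next
  show "phase_space_by_gluing rhs {0,1,2} trafo_dom trafo" by (rule phase_space)
  show "\<exists>S :: ((nat \<times> complex \<times> complex) set, complex \<times> complex) cmfd.
      rational_surface_of_type E7_affine (glued {0,1,2} trafo_dom trafo) t S" for t
    using surface_S9[of t] unfolding total_space_def by blast
qed

end
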